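(* Let $r\ge2$, let $\|\cdot\|$ be a norm on $\mathbb{R}^m$, and consider the cost $c(x,p)=\|x-\int y\,p(dy)\|^r$, $x\in\mathbb{R}^m$, $p\in\mathcal{P}_1(\mathbb{R}^m)$. For $\mu\in\mathcal{P}_1(\mathbb{R}^m)$, the following are equivalent: (1) There exist $a_1,b_1>0$ such that for all $n\in\mathbb{N}^*$, $$\mu^n(A+t^{1/r}B_r^n)\ge1-b_1e^{-t/a_1},\qquad\forall t\ge0,$$ for any set $A\subset(\mathbb{R}^m)^n$ which is either convex or the complement of a convex set and such that $\mu^n(A)\ge1/2$. (2) There exist $a_2,b_2>0$ such that for all $n\in\mathbb{N}^*$, $$\mu^n(f>\mathrm{med}(f)+t)\le b_2e^{-t^r/a_2},\qquad\forall t\ge0,$$ for all $f:(\mathbb{R}^m)^n\to\mathbb{R}$ which is either convex or concave and $1$-Lipschitz with respect to the norm $\|x\|_r^n=\left(\sum_{i=1}^n\|x_i\|^r\right)^{1/r}$. (3) There exist $a_3,b_3>0$ such that for all $n\in\mathbb{N}^*$, all $s\in(0,1)$ and all $A\subset(\mathbb{R}^m)^n$, $$\mu^n\left((\mathbb{R}^m)^n\setminus A_t^n\right)^{1/(1-s)^{r-1}}\mu^n(A)^{1/s^{r-1}}\le b_3e^{-t/a_3},\qquad\forall t\ge0,$$ where $A_t^n=\{x\in(\mathbb{R}^m)^n:c_A^n(x)\le t\}=\overline{\mathrm{conv}}\,A+t^{1/r}B_r^n$. (4) There exists $a_4>0$ such that $\mu$ satisfies $\overline{\mathbf{T}}_r\left(\frac{a_4}{s^{r-1}},\frac{a_4}{(1-s)^{r-1}}\right)$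 for all $s\in(0,1)$. (5) There exists $a_5>0$ such that $\mu$ satisfies $\overline{\mathbf{T}}_r^+(a_5)$ and $\overline{\mathbf{T}}_r^-(a_5)$. Moreover: $(1)\Leftrightarrow(2)$ with $a_2=a_1$ and $b_2=b_1$; $(3)\Rightarrow(4)$ with $a_4=a_3$; $(4)\Rightarrow(3)$ with $a_3=a_4$ and $b_3=1$; $(4)\Leftrightarrow(5)$ with $a_4=a_5$; $(1)\Rightarrow(3)$ with $a_3=a_1$ and $b_3=b_1$; $(3)\Rightarrow(1)$ with $b_1=b_3^{(1-s)^{r-1}}2^{\frac{(1-s)^{r-1}}{s^{r-1}}}$ and $a_1=\frac{a_3}{(1-s)^{r-1}}$, for any $s\in(0,1)$.
   Context: $\mathcal{P}_1(\mathbb{R}^m)$ is the set of Borel probability measures on $\mathbb{R}^m$ with finite first moment (and similarly on $(\mathbb{R}^m)^n$). $B_r^n=\{x\in(\mathbb{R}^m)^n:\sum_{i=1}^n\|x_i\|^r\le1\}$. $\mu^n$ is the $n$-fold product measure, $\mathrm{med}(f)$ a median of $f$ under $\mu^n$, $\overline{\mathrm{conv}}\,A$ the closed convex hull; sets $A$ are Borel. For $x\in(\mathbb{R}^m)^n$ and $A\subset(\mathbb{R}^m)^n$, $c_A^n(x)=\inf\{\sum_{i=1}^nc(x_i,p_i):p\in\mathcal{P}_1((\mathbb{R}^m)^n),\,p(A)=1\}$, $p_i$ being the $i$-th marginal of $p$. $\overline{\mathcal{T}}_r(\nu|\mu)=\inf_\pi\int\|x-\int y\,p_x(dy)\|^r\,\mu(dx)$,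 where the infimum is over couplings $\pi(dxdy)=\mu(dx)p_x(dy)$ with first marginal $\mu$ and second marginal $\nu$. $H(\nu|\mu)$ denotes relative entropy ($+\infty$ if $\nu\not\ll\mu$). $\mu$ satisfies $\overline{\mathbf{T}}_r(\kappa_1,\kappa_2)$ if $\overline{\mathcal{T}}_r(\nu_1|\nu_2)\le\kappa_1H(\nu_1|\mu)+\kappa_2H(\nu_2|\mu)$ for all $\nu_1,\nu_2\in\mathcal{P}_1(\mathbb{R}^m)$; $\overline{\mathbf{T}}_r^+(\kappa)$ if $\overline{\mathcal{T}}_r(\nu|\mu)\le\kappa H(\nu|\mu)$ for all $\nu\in\mathcal{P}_1(\mathbb{R}^m)$; $\overline{\mathbf{T}}_r^-(\kappa)$ if $\overline{\mathcal{T}}_r(\mu|\nu)\le\kappa H(\nu|\mu)$ for all $\nu\in\mathcal{P}_1(\mathbb{R}^m)$. *)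

theory Defs
  imports "HOL-Probability.Probability" "HOL-Library.Function_Algebras"
begin

text \<open>
  Points of \<open>(\<real>\<^sup>m)\<^sup>n\<close> are functions in \<open>\<Pi>\<^sub>E i\<in>{..<n}. UNIV\<close> (value \<^const>\<open>undefined\<close> from index
  \<open>n\<close> on), since \<open>n\<close> is quantified inside the statements; this is the space of the product
  measure \<^const>\<open>PiM\<close>.  The pointwise vector space structure below makes \<^const>\<open>convex\<close>,
  \<^const>\<open>hull\<close>, \<^const>\<open>convex_on\<close> and \<^const>\<open>concave_on\<close> available: convex combinations fix
  \<^const>\<open>undefined\<close>, so this set is convex, and it is closed in the product topology, which
  induces on it the usual topology of \<open>(\<real>\<^sup>m)\<^sup>n\<close>.
\<close>

instantiation "fun" :: (type, real_vector) real_vector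
begin

definition scaleR_fun :: "real \<Rightarrow> ('a \<Rightarrow> 'b) \<Rightarrow> 'a \<Rightarrow> 'b"
  where "scaleR_fun c f = (\<lambda>x. c *\<^sub>R f x)"

instance
  by standard
    (simp_all add: scaleR_fun_def plus_fun_def scaleR_add_right scaleR_add_left)

end

abbreviation tuples :: "nat \<Rightarrow> (nat \<Rightarrow> real ^ 'm) set"
  where "tuples n \<equiv> (\<Pi>\<^sub>E i\<in>{..<n}. UNIV)"

abbreviation tuple_borel :: "nat \<Rightarrow> (nat \<Rightarrow> real ^ 'm) measure"
  where "tuple_borel n \<equiv> (\<Pi>\<^sub>M i\<in>{..<n}. borel)"

abbreviation power_measure :: "(real ^ 'm) measure \<Rightarrow> nat \<Rightarrow> (nat \<Rightarrow> real ^ 'm) measure"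
  where "power_measure \<mu> n \<equiv> (\<Pi>\<^sub>M i\<in>{..<n}. \<mu>)"

definition is_norm :: "(real ^ 'm \<Rightarrow> real) \<Rightarrow> bool"
  where "is_norm N \<longleftrightarrow>
    (\<forall>x. N x = 0 \<longleftrightarrow> x = 0) \<and>
    (\<forall>c x. N (c *\<^sub>R x) = \<bar>c\<bar> * N x) \<and>
    (\<forall>x y. N (x + y) \<le> N x + N y)"

text \<open>
  Finiteness of the first moment does not depend on the norm, so the Euclidean one is used.
\<close>

definition P1 :: "(real ^ 'm) measure set"
  where "P1 = {\<mu>. prob_space \<mu> \<and> sets \<mu> = sets borel \<and> integrable \<mu> norm}"

definition P1_tuples :: "nat \<Rightarrow> (nat \<Rightarrow> real ^ 'm) measure set"
  where "P1_tuples n =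
    {p. prob_space p \<and> sets p = sets (tuple_borel n) \<and> integrable p (\<lambda>x. \<Sum>i<n. norm (x i))}"


text \<open>
  If \<open>\<nu>\<close> is absolutely continuous with respect to \<open>\<mu>\<close>, the negative part of the log
  density is always \<open>\<nu>\<close>-integrable, so non-integrability means that the entropy is infinite.
\<close>

definition rel_entropy :: "'a measure \<Rightarrow> 'a measure \<Rightarrow> ennreal"
  where "rel_entropy \<nu> \<mu> =
    (if absolutely_continuous \<mu> \<nu> \<and> integrable \<nu> (entropy_density (exp 1) \<mu> \<nu>)
     then ennreal (KL_divergence (exp 1) \<mu> \<nu>) else \<infinity>)"

definition bary_cost :: "(real ^ 'm \<Rightarrow> real) \<Rightarrow> real \<Rightarrow> real ^ 'm \<Rightarrow> (real ^ 'm) measure \<Rightarrow> real"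
  where "bary_cost N r x p = N (x - (\<integral>y. y \<partial>p)) powr r"

text \<open>Couplings \<open>\<pi>(dx dy) = \<mu>(dx) p\<^sub>x(dy)\<close> of \<open>\<mu>\<close> and \<open>\<nu>\<close>, together with their kernel \<open>p\<close>.\<close>

definition disint_couplings ::
    "(real ^ 'm) measure \<Rightarrow> (real ^ 'm) measure \<Rightarrow>
      (((real ^ 'm) \<times> (real ^ 'm)) measure \<times> (real ^ 'm \<Rightarrow> (real ^ 'm) measure)) set"
  where "disint_couplings \<mu> \<nu> =
    {(\<pi>, p). p \<in> measurable \<mu> (prob_algebra borel) \<and>
      \<pi> = \<mu> \<bind> (\<lambda>x. p x \<bind> (\<lambda>y. return (borel \<Otimes>\<^sub>M borel) (x, y))) \<and>
      distr \<pi> borel fst = \<mu> \<and> distr \<pi> borel snd = \<nu>}"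

text \<open>\<open>bary_transport N r \<nu> \<mu>\<close> is \<open>T\<^sub>r(\<nu>|\<mu>)\<close>: the barycenters are those of the kernel from \<open>\<mu>\<close>.\<close>

definition bary_transport ::
    "(real ^ 'm \<Rightarrow> real) \<Rightarrow> real \<Rightarrow> (real ^ 'm) measure \<Rightarrow> (real ^ 'm) measure \<Rightarrow> ennreal"
  where "bary_transport N r \<nu> \<mu> =
    (INF (\<pi>, p)\<in>disint_couplings \<mu> \<nu>. \<integral>\<^sup>+x. ennreal (bary_cost N r x (p x)) \<partial>\<mu>)"

definition T_ineq :: "(real ^ 'm \<Rightarrow> real) \<Rightarrow> real \<Rightarrow> (real ^ 'm) measure \<Rightarrow> real \<Rightarrow> real \<Rightarrow> bool"
  where "T_ineq N r \<mu> \<kappa>\<^sub>1 \<kappa>\<^sub>2 \<longleftrightarrow>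
    (\<forall>\<nu>\<^sub>1\<in>P1. \<forall>\<nu>\<^sub>2\<in>P1. bary_transport N r \<nu>\<^sub>1 \<nu>\<^sub>2 \<le>
      ennreal \<kappa>\<^sub>1 * rel_entropy \<nu>\<^sub>1 \<mu> + ennreal \<kappa>\<^sub>2 * rel_entropy \<nu>\<^sub>2 \<mu>)"

definition T_plus :: "(real ^ 'm \<Rightarrow> real) \<Rightarrow> real \<Rightarrow> (real ^ 'm) measure \<Rightarrow> real \<Rightarrow> bool"
  where "T_plus N r \<mu> \<kappa> \<longleftrightarrow>
    (\<forall>\<nu>\<in>P1. bary_transport N r \<nu> \<mu> \<le> ennreal \<kappa> * rel_entropy \<nu> \<mu>)"

definition T_minus :: "(real ^ 'm \<Rightarrow> real) \<Rightarrow> real \<Rightarrow> (real ^ 'm) measure \<Rightarrow> real \<Rightarrow> bool"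
  where "T_minus N r \<mu> \<kappa> \<longleftrightarrow>
    (\<forall>\<nu>\<in>P1. bary_transport N r \<mu> \<nu> \<le> ennreal \<kappa> * rel_entropy \<nu> \<mu>)"


definition tuple_norm :: "(real ^ 'm \<Rightarrow> real) \<Rightarrow> real \<Rightarrow> nat \<Rightarrow> (nat \<Rightarrow> real ^ 'm) \<Rightarrow> real"
  where "tuple_norm N r n x = (\<Sum>i<n. N (x i) powr r) powr (1 / r)"

definition tuple_ball :: "(real ^ 'm \<Rightarrow> real) \<Rightarrow> real \<Rightarrow> nat \<Rightarrow> (nat \<Rightarrow> real ^ 'm) set"
  where "tuple_ball N r n = {x \<in> tuples n. (\<Sum>i<n. N (x i) powr r) \<le> 1}"

text \<open>The Minkowski sum \<open>A + t\<^bsup>1/r\<^esup> B\<close>, with \<open>B\<close> the ball above.\<close>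

definition enlarge ::
    "(real ^ 'm \<Rightarrow> real) \<Rightarrow> real \<Rightarrow> nat \<Rightarrow> (nat \<Rightarrow> real ^ 'm) set \<Rightarrow> real \<Rightarrow> (nat \<Rightarrow> real ^ 'm) set"
  where "enlarge N r n A t =
    {\<lambda>i\<in>{..<n}. a i + t powr (1 / r) *\<^sub>R b i | a b. a \<in> A \<and> b \<in> tuple_ball N r n}"

definition set_cost ::
    "(real ^ 'm \<Rightarrow> real) \<Rightarrow> real \<Rightarrow> nat \<Rightarrow> (nat \<Rightarrow> real ^ 'm) set \<Rightarrow> (nat \<Rightarrow> real ^ 'm) \<Rightarrow> ennreal"
  where "set_cost N r n A x =
    (INF p\<in>{p \<in> P1_tuples n. emeasure p A = 1}.
      ennreal (\<Sum>i<n. bary_cost N r (x i) (distr p borel (\<lambda>y. y i))))"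

definition cost_enlarge ::
    "(real ^ 'm \<Rightarrow> real) \<Rightarrow> real \<Rightarrow> nat \<Rightarrow> (nat \<Rightarrow> real ^ 'm) set \<Rightarrow> real \<Rightarrow> (nat \<Rightarrow> real ^ 'm) set"
  where "cost_enlarge N r n A t = {x \<in> tuples n. set_cost N r n A x \<le> ennreal t}"

definition is_median :: "'a measure \<Rightarrow> ('a \<Rightarrow> real) \<Rightarrow> real \<Rightarrow> bool"
  where "is_median M f m \<longleftrightarrow>
    measure M {x \<in> space M. f x \<le> m} \<ge> 1 / 2 \<and> measure M {x \<in> space M. f x \<ge> m} \<ge> 1 / 2"


text \<open>
  For Borel \<open>A\<close> the Minkowski sum \<open>A + t\<^bsup>1/r\<^esup> B\<close> is analytic, hence measurable for the
  completion of \<open>\<mu>\<^sup>n\<close>, but not evidently Borel.  \<^const>\<open>measure\<close> would be \<open>0\<close> on a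
  non-Borel set, whereas \<^const>\<open>outer_measure_of\<close> is the completed measure on such sets.
\<close>

definition set_concentration ::
    "(real ^ 'm \<Rightarrow> real) \<Rightarrow> real \<Rightarrow> (real ^ 'm) measure \<Rightarrow> real \<Rightarrow> real \<Rightarrow> bool"
  where "set_concentration N r \<mu> a b \<longleftrightarrow>
    (\<forall>n\<ge>1. \<forall>t\<ge>0. \<forall>A\<in>sets (tuple_borel n).
      convex A \<or> convex (tuples n - A) \<longrightarrow>
      measure (power_measure \<mu> n) A \<ge> 1 / 2 \<longrightarrow>
      enn2real (outer_measure_of (power_measure \<mu> n) (enlarge N r n A t)) \<ge> 1 - b * exp (- t / a))"

definition lipschitz_concentration ::
    "(real ^ 'm \<Rightarrow> real) \<Rightarrow> real \<Rightarrow> (real ^ 'm) measure \<Rightarrow> real \<Rightarrow> real \<Rightarrow> bool"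
  where "lipschitz_concentration N r \<mu> a b \<longleftrightarrow>
    (\<forall>n\<ge>1. \<forall>t\<ge>0. \<forall>f. \<forall>m.
      convex_on (tuples n) f \<or> concave_on (tuples n) f \<longrightarrow>
      (\<forall>x\<in>tuples n. \<forall>y\<in>tuples n. \<bar>f x - f y\<bar> \<le> tuple_norm N r n (x - y)) \<longrightarrow>
      is_median (power_measure \<mu> n) f m \<longrightarrow>
      measure (power_measure \<mu> n) {x \<in> tuples n. f x > m + t} \<le> b * exp (- (t powr r) / a))"

definition two_set_concentration ::
    "(real ^ 'm \<Rightarrow> real) \<Rightarrow> real \<Rightarrow> (real ^ 'm) measure \<Rightarrow> real \<Rightarrow> real \<Rightarrow> bool"
  where "two_set_concentration N r \<mu> a b \<longleftrightarrow>
    (\<forall>n\<ge>1. \<forall>s\<in>{0<..<1}. \<forall>A\<in>sets (tuple_borel n). \<forall>t\<ge>0.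
      measure (power_measure \<mu> n) (tuples n - cost_enlarge N r n A t) powr (1 / (1 - s) powr (r - 1))
        * measure (power_measure \<mu> n) A powr (1 / s powr (r - 1))
      \<le> b * exp (- t / a))"

definition T_family :: "(real ^ 'm \<Rightarrow> real) \<Rightarrow> real \<Rightarrow> (real ^ 'm) measure \<Rightarrow> real \<Rightarrow> bool"
  where "T_family N r \<mu> a \<longleftrightarrow>
    (\<forall>s\<in>{0<..<1}. T_ineq N r \<mu> (a / s powr (r - 1)) (a / (1 - s) powr (r - 1)))"

definition T_plus_minus :: "(real ^ 'm \<Rightarrow> real) \<Rightarrow> real \<Rightarrow> (real ^ 'm) measure \<Rightarrow> real \<Rightarrow> bool"
  where "T_plus_minus N r \<mu> a \<longleftrightarrow> T_plus N r \<mu> a \<and> T_minus N r \<mu> a"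

end

theory Submission
  imports Defs
begin

text \<open>
  (1) and (2) are compared through the distance to \<open>A\<close>, which is convex if \<open>A\<close> is; if the complement of
  \<open>A\<close> is convex, a concave \<open>1\<close>-Lipschitz function plays its role.  For (4) \<open>\<Rightarrow>\<close> (3) the transport
  inequality is dualized by the Gibbs variational formula, the dual exponential inequality is tensorized,
  and it is applied to a multiple of the distance to the closed convex hull of \<open>A\<close>.

  For (3) \<open>\<Rightarrow>\<close> (4), let \<open>A\<close> be the set of \<open>n\<close>-tuples whose empirical measure is close to \<open>\<nu>\<^sub>1\<close>, and compare
  it with those whose empirical measure is close to \<open>\<nu>\<^sub>2\<close>.  Their \<open>\<mu>\<^sup>n\<close>-probabilities are at least
  \<open>exp (- n H(\<nu>\<^sub>i|\<mu>))\<close> up to subexponential factors, so by (3) some typical tuple for \<open>\<nu>\<^sub>2\<close> has cost about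
  \<open>n \<tau>\<close> to \<open>A\<close> with \<open>\<tau>\<close> the right-hand side of (4).  Averaging the marginals of an optimal \<open>p\<close> along
  this tuple gives an approximate coupling of \<open>\<nu>\<^sub>2\<close> and \<open>\<nu>\<^sub>1\<close>, and one passes to the limit.

  (1) \<open>\<Rightarrow>\<close> (3) is proved directly with a constant that depends on \<open>s\<close>.  The constant is \<open>b\<^sub>1\<close> when
  \<open>b\<^sub>1 \<le> 1\<close>; otherwise the passage through (4), which forgets it, improves it to \<open>1\<close>.
\<close>

section \<open>Norms and convexity\<close>

text \<open>Several obstacles shape the proof. At \<open>t = 0\<close> (1) reads
  \<open>1 - b \<le> \<mu>^n(A)\<close>, which forces \<open>b \<ge> 1 / 2\<close> unless \<mu> is a
  point mass; limits from positive radii do not see this, so nearly symmetric linear functionals are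
  built to recover it from (2) or (3) with the stated constants. A measure in \<open>P1\<close> has
  only a first moment, whereas the discretization in (3) => (4) needs moments of order
  \<open>r\<close>; these come from the tail of the norm under \<mu> and from finite entropy. No
  compactness of couplings on R^m is invoked: the discretization has finite range, so the limit is
  one of finite matrices. The factor \<open>b\<close> is lost in (3) => (4) because
  \<open>ln b\<close> is divided by \<open>n\<close>. (4) <=> (5) rests on gluing kernels. Its
  weights \<open>(1 - s) powr (1 - r)\<close> and \<open>s powr (1 - r)\<close> come from convexity
  of the power \<open>r\<close>, and the same inequality produces the exponents in (1) => (3). The
  cost sees a kernel only through its barycenter; this is why convex hulls of sets and of graphs
  occur throughout.\<close>

lemma expectation_in_closed_convex:
  fixes X :: "'a \<Rightarrow> 'b::euclidean_space"
  assumes "prob_space M" and X: "integrable M X" and S: "closed S" "convex S"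
    and AE: "AE x in M. X x \<in> S"
  shows "integral\<^sup>L M X \<in> S"
proof (rule ccontr)
  interpret prob_space M by fact
  assume "integral\<^sup>L M X \<notin> S"
  from separating_hyperplane_closed_point[OF S(2,1) this] obtain a b
    where ab: "a \<bullet> integral\<^sup>L M X < b" "\<And>x. x \<in> S \<Longrightarrow> a \<bullet> x > b" by auto
  have "b = (\<integral>x. b \<partial>M)" by (simp add: prob_space)
  also have "\<dots> \<le> (\<integral>x. a \<bullet> X x \<partial>M)"
    using AE X by (intro integral_mono_AE integrable_inner_right) (auto simp: less_imp_le ab(2))
  also have "\<dots> = a \<bullet> integral\<^sup>L M X" using X by simp
  finally show False using ab(1) by simp
qed

lemma integral_Pair:
  fixes X :: "'a \<Rightarrow> 'b::euclidean_space" and Y :: "'a \<Rightarrow> 'c::euclidean_space"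
  assumes X: "integrable M X" and Y: "integrable M Y"
  shows "integrable M (\<lambda>x. (X x, Y x))" "(\<integral>x. (X x, Y x) \<partial>M) = (\<integral>x. X x \<partial>M, \<integral>x. Y x \<partial>M)"
proof -
  have 1: "bounded_linear (\<lambda>x::'b. (x, 0::'c))" and 2: "bounded_linear (\<lambda>y::'c. (0::'b, y))"
    by (intro bounded_linear_Pair bounded_linear_ident bounded_linear_zero)+
  have eq: "(\<lambda>x. (X x, Y x)) = (\<lambda>x. (X x, 0) + (0, Y x))" by auto
  show "integrable M (\<lambda>x. (X x, Y x))" unfolding eq
    using integrable_bounded_linear[OF 1 X] integrable_bounded_linear[OF 2 Y] by (rule Bochner_Integration.integrable_add)
  show "(\<integral>x. (X x, Y x) \<partial>M) = (\<integral>x. X x \<partial>M, \<integral>x. Y x \<partial>M)" unfolding eq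
    unfolding Bochner_Integration.integral_add[OF integrable_bounded_linear[OF 1 X] integrable_bounded_linear[OF 2 Y]]
    using integral_bounded_linear[OF 1 X] integral_bounded_linear[OF 2 Y] by simp
qed

lemma convex_on_powr_nonneg:
  fixes r :: real
  assumes "r \<ge> 1" shows "convex_on {0..} (\<lambda>x. x powr r)"
proof (rule convex_onI)
  fix t x y :: real assume t: "0 < t" "t < 1" and xy: "x \<in> {0..}" "y \<in> {0..}"
  have le: "u powr r \<le> u" if "0 < u" "u < 1" for u :: real
    using powr_mono_both'[of 1 r u u] that assms by auto
  consider "x = 0" | "y = 0" | "x > 0" "y > 0" using xy by fastforce
  then show "((1 - t) *\<^sub>R x + t *\<^sub>R y) powr r \<le> (1 - t) * x powr r + t * y powr r"
  proof cases
    case 1 then show ?thesis using xy t le[of t] assms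
      by (auto simp: powr_mult mult_right_mono)
  next
    case 2 then show ?thesis using xy t le[of "1 - t"] assms
      by (auto simp: powr_mult mult_right_mono)
  next
    case 3 then show ?thesis using powr_convex[OF assms] t
      by (auto dest!: convex_onD[of _ _ t x y])
  qed
qed auto

text \<open>Convexity of the power, applied to \<open>u / (1 - e)\<close> and \<open>v / e\<close>
  with weights \<open>1 - e\<close> and \<open>e\<close>. For \<open>e = s\<close> the coefficients
  are the constants of (3) and (4). For small \<open>e\<close> the first one is close to
  \<open>1\<close>, at the price of a large factor on an error \<open>v\<close> that is sent to
  \<open>0\<close> first.\<close>

lemma powr_add_le_weighted:
  fixes u v e r :: real
  assumes "r \<ge> 1" "u \<ge> 0" "v \<ge> 0" "0 < e" "e < 1"
  shows "(u + v) powr r \<le> (1 - e) powr (1 - r) * u powr r + e powr (1 - r) * v powr r"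
proof -
  have "((1 - e) * (u / (1 - e)) + e * (v / e)) powr r \<le>
      (1 - e) * (u / (1 - e)) powr r + e * (v / e) powr r"
    using convex_onD[OF convex_on_powr_nonneg[OF assms(1)], of e "u / (1 - e)" "v / e"] assms by auto
  moreover have "(1 - e) * (u / (1 - e)) + e * (v / e) = u + v" using assms by simp
  ultimately show ?thesis using assms by (simp add: powr_divide powr_diff)
qed

locale norm_power =
  fixes N :: "real ^ 'm \<Rightarrow> real" and r :: real
  assumes norm: "is_norm N" and r: "r \<ge> 1"
begin

lemma N_eq_0 [simp]: "N x = 0 \<longleftrightarrow> x = 0" and N_scaleR: "N (c *\<^sub>R x) = \<bar>c\<bar> * N x"
  and N_triangle: "N (x + y) \<le> N x + N y"
  using norm unfolding is_norm_def by auto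

lemma N_0 [simp]: "N 0 = 0" by simp

lemma N_minus [simp]: "N (- x) = N x" using N_scaleR[of "-1" x] by simp

lemma N_minus_commute: "N (x - y) = N (y - x)" using N_minus[of "x - y"] by simp

lemma N_nonneg [simp]: "0 \<le> N x" using N_triangle[of x "- x"] by simp

lemma N_triangle_abs: "\<bar>N x - N y\<bar> \<le> N (x - y)"
  using N_triangle[of "x - y" y] N_triangle[of "y - x" x] N_minus_commute[of x y] by auto

lemma N_sum_le: "N (sum f S) \<le> (\<Sum>i\<in>S. N (f i))"
proof (induction S rule: infinite_finite_induct)
  case (insert x F) then show ?case using N_triangle[of "f x" "sum f F"] by auto
qed auto

lemma N_le_norm: "\<exists>K>0. \<forall>x. N x \<le> K * norm x"
proof (intro exI conjI allI)
  let ?K = "1 + (\<Sum>b\<in>Basis. N b)"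
  show "0 < ?K" by (intro add_pos_nonneg sum_nonneg) auto
  fix x
  have "N x = N (\<Sum>b\<in>Basis. (x \<bullet> b) *\<^sub>R b)" by (simp add: euclidean_representation)
  also have "\<dots> \<le> (\<Sum>b\<in>Basis. N ((x \<bullet> b) *\<^sub>R b))" by (rule N_sum_le)
  also have "\<dots> \<le> (\<Sum>b\<in>Basis. norm x * N b)"
    by (intro sum_mono) (auto simp: N_scaleR Basis_le_norm mult_right_mono)
  also have "\<dots> \<le> ?K * norm x" by (simp add: sum_distrib_left algebra_simps)
  finally show "N x \<le> ?K * norm x" .
qed

lemma continuous_on_N [continuous_intros]:
  assumes "continuous_on S f" shows "continuous_on S (\<lambda>x. N (f x))"
proof -
  obtain K where K: "K > 0" "\<And>x. N x \<le> K * norm x" using N_le_norm by auto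
  have "K-lipschitz_on UNIV N"
    using K N_triangle_abs by (intro lipschitz_onI) (auto simp: dist_norm intro: order_trans)
  then have "continuous_on UNIV N" by (rule lipschitz_on_continuous_on)
  then show ?thesis using continuous_on_compose2[OF _ assms] by blast
qed

lemma borel_measurable_N [measurable]: "N \<in> borel_measurable borel"
  by (rule borel_measurable_continuous_onI) (intro continuous_intros)

lemma norm_le_N: "\<exists>k>0. \<forall>x. norm x \<le> k * N x"
proof -
  have "compact (sphere (0::real^'m) 1)" "sphere (0::real^'m) 1 \<noteq> {}" by auto
  from continuous_attains_inf[OF this continuous_on_N[OF continuous_on_id]]
  obtain x0 where x0: "norm x0 = 1" "\<And>y. norm y = 1 \<Longrightarrow> N x0 \<le> N y" by (auto simp: dist_norm)
  have pos: "0 < N x0" using x0(1) N_nonneg[of x0] N_eq_0[of x0] norm_zero[where 'a="real^'m"]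
    by (metis order_le_less zero_neq_one)
  have "norm x \<le> (1 / N x0) * N x" for x
  proof (cases "x = 0")
    case False
    then have "N x0 \<le> N ((1 / norm x) *\<^sub>R x)" by (intro x0(2)) auto
    then show ?thesis using False pos by (auto simp: N_scaleR field_simps)
  qed auto
  then show ?thesis using pos by (intro exI[of _ "1 / N x0"]) auto
qed

lemma N_powr_add_le:
  assumes "0 < e" "e < 1"
  shows "N (x + y) powr r \<le> (1 - e) powr (1 - r) * N x powr r + e powr (1 - r) * N y powr r"
proof -
  have "N (x + y) powr r \<le> (N x + N y) powr r" using N_triangle r by (intro powr_mono2) auto
  also have "\<dots> \<le> (1 - e) powr (1 - r) * N x powr r + e powr (1 - r) * N y powr r"
    using r assms by (intro powr_add_le_weighted) auto
  finally show ?thesis .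
qed

lemma N_powr_add_le_2: "N (x + y) powr r \<le> 2 powr (r - 1) * (N x powr r + N y powr r)"
proof -
  have "(1/2) powr (1 - r) = 2 powr (r - 1)" for r :: real
    by (simp add: powr_divide powr_diff)
  then show ?thesis using N_powr_add_le[of "1/2" x y] by (simp add: algebra_simps)
qed

lemma convex_on_N: "convex_on UNIV N"
proof (rule convex_onI)
  fix t x y assume "0 < (t::real)" "t < 1"
  then show "N ((1 - t) *\<^sub>R x + t *\<^sub>R y) \<le> (1 - t) * N x + t * N y"
    using N_triangle[of "(1 - t) *\<^sub>R x" "t *\<^sub>R y"] by (simp add: N_scaleR)
qed auto

lemma convex_on_N_powr: "convex_on UNIV (\<lambda>x. N x powr r)"
proof (rule convex_onI)
  fix t x y assume t: "0 < (t::real)" "t < 1"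
  have "N ((1 - t) *\<^sub>R x + t *\<^sub>R y) powr r \<le> ((1 - t) * N x + t * N y) powr r"
    using t r convex_onD[OF convex_on_N, of t x y] by (intro powr_mono2) auto
  also have "\<dots> \<le> (1 - t) * N x powr r + t * N y powr r"
    using t convex_onD[OF convex_on_powr_nonneg[OF r], of t "N x" "N y"] by auto
  finally show "N ((1 - t) *\<^sub>R x + t *\<^sub>R y) powr r \<le> (1 - t) * N x powr r + t * N y powr r" .
qed auto

lemma N_powr_scaleR_add_le:
  assumes "u \<ge> 0" "v \<ge> 0" "u + v = 1"
  shows "N (u *\<^sub>R x + v *\<^sub>R y) powr r \<le> u * N x powr r + v * N y powr r"
proof -
  have "u = 1 - v" using assms by simp
  show ?thesis unfolding \<open>u = 1 - v\<close> using convex_onD[OF convex_on_N_powr, of v x y] assms(1,2) \<open>u = 1 - v\<close> by simp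
qed

lemma continuous_on_N_powr [continuous_intros]:
  assumes "continuous_on S f" shows "continuous_on S (\<lambda>x. N (f x) powr r)"
  using r assms by (intro continuous_on_powr' continuous_intros) auto

text \<open>Jensen: the mean of the pair \<open>(X, N X powr r)\<close> stays in the closed convex
  epigraph. The right-hand side is an extended integral because, when couplings are glued, only
  \<open>X\<close> is known to be integrable.\<close>

lemma N_powr_expectation_le:
  assumes M: "prob_space M" and X: "integrable M X"
  shows "ennreal (N (integral\<^sup>L M X) powr r) \<le> (\<integral>\<^sup>+x. ennreal (N (X x) powr r) \<partial>M)"
proof (cases "(\<integral>\<^sup>+x. ennreal (N (X x) powr r) \<partial>M) = \<infinity>")
  case False
  interpret prob_space M by fact
  have [measurable]: "X \<in> borel_measurable M" using X by auto
  have int: "integrable M (\<lambda>x. N (X x) powr r)"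
    using False by (intro integrableI_nonneg) (auto simp: top.not_eq_extremum)
  let ?S = "{p :: (real^'m) \<times> real. N (fst p) powr r \<le> snd p}"
  have "closed ?S" by (intro closed_Collect_le continuous_intros)
  moreover have "convex ?S"
    unfolding convex_alt using convex_onD[OF convex_on_N_powr]
    by (fastforce intro: order_trans[OF convex_onD[OF convex_on_N_powr]] add_mono mult_left_mono)
  ultimately have "integral\<^sup>L M (\<lambda>x. (X x, N (X x) powr r)) \<in> ?S"
    using X int by (intro expectation_in_closed_convex integral_Pair) (auto intro: prob_space_axioms)
  then have "N (integral\<^sup>L M X) powr r \<le> (\<integral>x. N (X x) powr r \<partial>M)"
    using X int by (simp add: integral_Pair)
  then show ?thesis using int by (simp add: nn_integral_eq_integral ennreal_leI)
qed simp

lemma N_powr_expectation_le_integral: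
  assumes M: "prob_space M" and X: "integrable M X" and int: "integrable M (\<lambda>x. N (X x) powr r)"
  shows "N (integral\<^sup>L M X) powr r \<le> (\<integral>x. N (X x) powr r \<partial>M)"
  using N_powr_expectation_le[OF M X] int by (simp add: nn_integral_eq_integral)

end

section \<open>Tuples\<close>

lemma minus_tuple_apply [simp]: "(x - y) i = x i - (y i :: 'b::real_vector)"
  by (simp add: fun_diff_def)

lemma scaleR_tuple_apply [simp]: "(c *\<^sub>R x) i = c *\<^sub>R (x i :: 'b::real_vector)"
  by (simp add: scaleR_fun_def)

lemma in_tuples_iff: "x \<in> tuples n \<longleftrightarrow> (\<forall>i\<ge>n. x i = undefined)"
  by (auto simp: PiE_iff extensional_def)

lemma convex_comb_undefined:
  "u + v = 1 \<Longrightarrow> u *\<^sub>R undefined + v *\<^sub>R undefined = (undefined :: 'b::real_vector)"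
  by (simp flip: scaleR_add_left)

lemma convex_tuples [simp]: "convex (tuples n :: (nat \<Rightarrow> real^'m) set)"
  by (auto simp: convex_def in_tuples_iff convex_comb_undefined)

lemma tuples_comb [intro]:
  "x \<in> tuples n \<Longrightarrow> y \<in> tuples n \<Longrightarrow> u + v = 1 \<Longrightarrow> u *\<^sub>R x + v *\<^sub>R y \<in> tuples n"
  by (auto simp: in_tuples_iff convex_comb_undefined)

lemma closed_tuples [simp]: "closed (tuples n :: (nat \<Rightarrow> real^'m) set)"
proof -
  have "tuples n = (\<Inter>i\<in>{n..}. {x :: nat \<Rightarrow> real^'m. x i = undefined})"
    unfolding set_eq_iff in_tuples_iff by (simp, simp add: Ball_def)
  then show ?thesis
    by (simp add: closed_INT closed_Collect_eq)
qed

lemma compact_tuples: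
  "compact {x \<in> tuples n. \<forall>i<n. norm (x i :: real^'m) \<le> R}"
proof -
  have "compactin (product_topology (\<lambda>i. euclidean) UNIV) (PiE UNIV (\<lambda>i. if i < n then cball (0::real^'m) R else {undefined}))"
    by (auto simp: compactin_PiE)
  then have "compact (PiE UNIV (\<lambda>i. if i < n then cball (0::real^'m) R else {undefined}))"
    by (simp add: euclidean_product_topology)
  also have "PiE UNIV (\<lambda>i. if i < n then cball (0::real^'m) R else {undefined}) =
      {x \<in> tuples n. \<forall>i<n. norm (x i) \<le> R}"
    unfolding set_eq_iff mem_Collect_eq in_tuples_iff PiE_UNIV_domain Pi_iff
    by (auto simp: not_less split: if_splits)
  finally show ?thesis .
qed

lemma space_tuple_borel [simp]: "space (tuple_borel n) = tuples n"
  by (simp add: space_PiM)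

text \<open>Coordinates from \<open>n\<close> on are constant on the space, so the product
  sigma-algebra is fine enough for all Borel sets of the function space. Through this map continuity
  and closedness turn into measurability for the product measure.\<close>

lemma id_measurable_tuple_borel: "(\<lambda>x. x) \<in> borel_measurable (tuple_borel n :: (nat \<Rightarrow> real^'m) measure)"
proof (rule measurable_coordinatewise_then_product)
  fix i show "(\<lambda>x. x i) \<in> borel_measurable (tuple_borel n :: (nat \<Rightarrow> real^'m) measure)"
  proof (cases "i < n")
    case False
    then have "x \<in> space (tuple_borel n) \<Longrightarrow> x i = undefined" for x :: "nat \<Rightarrow> real^'m"
      by (auto simp: space_PiM PiE_iff extensional_def)
    then show ?thesis by (subst measurable_cong[where g="\<lambda>_. undefined"]) auto
  qed (auto intro: measurable_component_singleton)
qed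

lemma continuous_imp_measurable_tuple_borel:
  fixes f :: "(nat \<Rightarrow> real^'m) \<Rightarrow> 'b::topological_space"
  assumes "continuous_on (tuples n) f"
  shows "f \<in> borel_measurable (tuple_borel n)"
proof -
  have "(\<lambda>x. x) \<in> measurable (tuple_borel n) (restrict_space borel (tuples n :: (nat \<Rightarrow> real^'m) set))"
    by (intro measurable_restrict_space2 id_measurable_tuple_borel) auto
  moreover have "f \<in> borel_measurable (restrict_space borel (tuples n))"
    using assms by (intro borel_measurable_continuous_on_restrict) auto
  ultimately show ?thesis using measurable_compose by blast
qed

lemma closed_in_sets_tuple_borel:
  assumes "closed C" "C \<subseteq> tuples n"
  shows "C \<in> sets (tuple_borel n :: (nat \<Rightarrow> real^'m) measure)"
proof -
  have "(\<lambda>x. x) -` C \<inter> space (tuple_borel n) \<in> sets (tuple_borel n :: (nat \<Rightarrow> real^'m) measure)"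
    using assms by (intro measurable_sets[OF id_measurable_tuple_borel]) auto
  then show ?thesis using assms(2) by (simp add: Int_absorb2)
qed

section \<open>The norm on tuples and its enlargements\<close>

lemma tuple_norm_ge_0 [simp]: "0 \<le> tuple_norm N r n x"
  by (simp add: tuple_norm_def)

context norm_power
begin

lemma tuple_norm_powr: "tuple_norm N r n x powr r = (\<Sum>i<n. N (x i) powr r)"
  using r by (simp add: tuple_norm_def powr_powr sum_nonneg)

lemma tuple_norm_le_iff:
  "T \<ge> 0 \<Longrightarrow> tuple_norm N r n x \<le> T \<longleftrightarrow> (\<Sum>i<n. N (x i) powr r) \<le> T powr r"
  using r powr_mono2[of r "tuple_norm N r n x" T] powr_less_mono2[of r T "tuple_norm N r n x"]
  by (auto simp flip: tuple_norm_powr simp: not_le[symmetric])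

lemma tuple_norm_eq_0: "tuple_norm N r n x = 0 \<longleftrightarrow> (\<forall>i<n. x i = 0)"
proof -
  have "tuple_norm N r n x = 0 \<longleftrightarrow> (\<Sum>i<n. N (x i) powr r) \<le> 0"
    using tuple_norm_le_iff[of 0 n x] r tuple_norm_ge_0[of N r n x] by auto
  also have "\<dots> \<longleftrightarrow> (\<forall>i<n. x i = 0)"
    using sum_nonneg_eq_0_iff[of "{..<n}" "\<lambda>i. N (x i) powr r"] sum_nonneg[of "{..<n}" "\<lambda>i. N (x i) powr r"]
    by (auto simp: order_antisym_conv)
  finally show ?thesis .
qed

lemma tuple_norm_scaleR [simp]: "tuple_norm N r n (c *\<^sub>R x) = \<bar>c\<bar> * tuple_norm N r n x"
  using r by (simp add: tuple_norm_def N_scaleR powr_mult powr_powr flip: sum_distrib_left)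

lemma tuple_norm_minus_commute: "tuple_norm N r n (x - y) = tuple_norm N r n (y - x)"
  by (simp add: tuple_norm_def N_minus_commute)

lemma tuple_norm_comb_le_1:
  assumes "u \<ge> 0" "v \<ge> 0" "u + v = 1" "tuple_norm N r n x \<le> 1" "tuple_norm N r n y \<le> 1"
  shows "tuple_norm N r n (u *\<^sub>R x + v *\<^sub>R y) \<le> 1"
proof -
  have "(\<Sum>i<n. N (u *\<^sub>R x i + v *\<^sub>R y i) powr r) \<le> (\<Sum>i<n. u * N (x i) powr r + v * N (y i) powr r)"
    using assms by (intro sum_mono N_powr_scaleR_add_le) auto
  also have "\<dots> = u * (\<Sum>i<n. N (x i) powr r) + v * (\<Sum>i<n. N (y i) powr r)"
    by (simp add: sum.distrib sum_distrib_left)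
  also have "\<dots> \<le> u * 1 + v * 1" using assms
    by (intro add_mono mult_left_mono) (auto simp: tuple_norm_le_iff)
  finally show ?thesis using assms by (simp add: tuple_norm_le_iff)
qed

text \<open>Minkowski's inequality, deduced from the convexity of the unit ball: both tuples are
  normalized and then combined with weights proportional to their norms. A tuple of norm
  \<open>0\<close> vanishes below \<open>n\<close> and does not affect the sum.\<close>

lemma tuple_norm_triangle: "tuple_norm N r n (x + y) \<le> tuple_norm N r n x + tuple_norm N r n y"
proof -
  let ?a = "tuple_norm N r n x" and ?b = "tuple_norm N r n y"
  consider "?a = 0" | "?b = 0" | "?a > 0" "?b > 0"
    using tuple_norm_ge_0[of N r n x] tuple_norm_ge_0[of N r n y] by linarith
  then show ?thesis
  proof cases
    case 1 then show ?thesis unfolding tuple_norm_eq_0 by (simp add: tuple_norm_def)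
  next
    case 2 then show ?thesis unfolding tuple_norm_eq_0 by (simp add: tuple_norm_def)
  next
    case 3
    let ?s = "?a + ?b"
    have 1: "tuple_norm N r n ((?a / ?s) *\<^sub>R ((1 / ?a) *\<^sub>R x) + (?b / ?s) *\<^sub>R ((1 / ?b) *\<^sub>R y)) \<le> 1"
      using 3 by (intro tuple_norm_comb_le_1) (simp_all flip: add_divide_distrib)
    have 2: "(?a / ?s) *\<^sub>R ((1 / ?a) *\<^sub>R x) + (?b / ?s) *\<^sub>R ((1 / ?b) *\<^sub>R y) = (1 / ?s) *\<^sub>R (x + y)"
      using 3 by (simp add: scaleR_add_right)
    have "\<bar>1 / ?s\<bar> * tuple_norm N r n (x + y) \<le> 1" using 1 unfolding 2 tuple_norm_scaleR .
    then show ?thesis using 3 by (simp add: field_simps)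
  qed
qed

lemma tuple_norm_diff_triangle:
  "tuple_norm N r n (x - z) \<le> tuple_norm N r n (x - y) + tuple_norm N r n (y - z)"
  using tuple_norm_triangle[of n "x - y" "y - z"] by simp

lemma N_le_tuple_norm: "i < n \<Longrightarrow> N (x i) \<le> tuple_norm N r n x"
proof -
  assume "i < n"
  then have "N (x i) powr r \<le> tuple_norm N r n x powr r" unfolding tuple_norm_powr
    by (intro member_le_sum) auto
  then show ?thesis using r powr_less_mono2[of r "tuple_norm N r n x" "N (x i)"] by force
qed

lemma continuous_on_tuple_norm:
  assumes "continuous_on S f"
  shows "continuous_on S (\<lambda>x. tuple_norm N r n (f x - a))"
  unfolding tuple_norm_def using r assms continuous_on_product_then_coordinatewise[OF assms]
  by (intro continuous_on_powr' continuous_intros) (auto simp: sum_nonneg intro!: continuous_on_diff)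

lemma lipschitz_imp_continuous_on_tuples:
  fixes f :: "(nat \<Rightarrow> real^'m) \<Rightarrow> real"
  assumes "\<And>x y. x \<in> S \<Longrightarrow> y \<in> S \<Longrightarrow> \<bar>f x - f y\<bar> \<le> K * tuple_norm N r n (x - y)"
  shows "continuous_on S f"
  unfolding continuous_on_def
proof
  fix x assume x: "x \<in> S"
  have "((\<lambda>y. K * tuple_norm N r n (y - x)) \<longlongrightarrow> K * tuple_norm N r n (x - x)) (at x within S)"
    using continuous_on_tuple_norm[OF continuous_on_id, of S n x] x
    by (intro tendsto_mult tendsto_const) (auto simp: continuous_on_def)
  moreover have "tuple_norm N r n (x - x) = 0" by (simp add: tuple_norm_eq_0)
  ultimately have "((\<lambda>y. K * tuple_norm N r n (y - x)) \<longlongrightarrow> 0) (at x within S)" by simp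
  moreover have "\<forall>\<^sub>F y in at x within S. norm (f y - f x) \<le> K * tuple_norm N r n (y - x)"
    using assms x by (auto simp: eventually_at_filter)
  ultimately have "((\<lambda>y. f y - f x) \<longlongrightarrow> 0) (at x within S)" by (rule Lim_null_comparison[rotated])
  then show "(f \<longlongrightarrow> f x) (at x within S)" by (rule LIM_zero_cancel)
qed

lemma enlarge_eq:
  assumes A: "A \<subseteq> tuples n" and t: "t \<ge> 0"
  shows "enlarge N r n A t = {x \<in> tuples n. \<exists>a\<in>A. tuple_norm N r n (x - a) \<le> t powr (1 / r)}"
proof (intro set_eqI iffI)
  fix x assume "x \<in> enlarge N r n A t"
  then obtain a b where x: "x = (\<lambda>i\<in>{..<n}. a i + t powr (1 / r) *\<^sub>R b i)" "a \<in> A" "b \<in> tuple_ball N r n"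
    unfolding enlarge_def by auto
  have "tuple_norm N r n (x - a) = tuple_norm N r n (t powr (1/r) *\<^sub>R b)"
    unfolding x(1) tuple_norm_def by simp
  also have "\<dots> \<le> t powr (1/r) * 1" unfolding tuple_norm_scaleR
    using x(3) by (intro mult_mono) (auto simp: tuple_ball_def tuple_norm_le_iff)
  finally show "x \<in> {x \<in> tuples n. \<exists>a\<in>A. tuple_norm N r n (x - a) \<le> t powr (1 / r)}"
    using x by auto
next
  fix x assume "x \<in> {x \<in> tuples n. \<exists>a\<in>A. tuple_norm N r n (x - a) \<le> t powr (1 / r)}"
  then obtain a where a: "x \<in> tuples n" "a \<in> A" "tuple_norm N r n (x - a) \<le> t powr (1 / r)" by auto
  \<comment> \<open>For \<open>t = 0\<close> the factor is \<open>1 / 0 = 0\<close>, so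
    \<open>?b\<close> is the zero tuple; then \<open>x\<close> and \<open>a\<close> agree below
    \<open>n\<close> since their distance is \<open>0\<close>.\<close>
  let ?b = "(\<lambda>i\<in>{..<n}. (1 / t powr (1/r)) *\<^sub>R (x i - a i))"
  have "tuple_norm N r n ?b = tuple_norm N r n ((1 / t powr (1/r)) *\<^sub>R (x - a))"
    by (simp add: tuple_norm_def)
  also have "\<dots> \<le> 1" unfolding tuple_norm_scaleR using a(3) t
    by (cases "t = 0") (auto simp: field_simps)
  finally have "?b \<in> tuple_ball N r n" by (auto simp: tuple_ball_def tuple_norm_le_iff)
  moreover have "x = (\<lambda>i\<in>{..<n}. a i + t powr (1 / r) *\<^sub>R ?b i)"
  proof
    fix i show "x i = (\<lambda>i\<in>{..<n}. a i + t powr (1 / r) *\<^sub>R ?b i) i"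
    proof (cases "i < n")
      case True
      have "x i = a i" if "t = 0"
        using a(3) that True tuple_norm_eq_0[of n "x - a"] tuple_norm_ge_0[of N r n "x - a"] by simp
      with True t show ?thesis by (cases "t = 0") auto
    next
      case False then show ?thesis using a(1) by (auto simp: in_tuples_iff)
    qed
  qed
  ultimately show "x \<in> enlarge N r n A t" unfolding enlarge_def using a(2) by blast
qed

section \<open>Distance to a set of tuples\<close>

definition tdist :: "nat \<Rightarrow> (nat \<Rightarrow> real^'m) set \<Rightarrow> (nat \<Rightarrow> real^'m) \<Rightarrow> real"
  where "tdist n A x = (INF a\<in>A. tuple_norm N r n (x - a))"

lemma tdist_le: "a \<in> A \<Longrightarrow> tdist n A x \<le> tuple_norm N r n (x - a)"
  unfolding tdist_def by (intro cINF_lower bdd_belowI2[where m=0]) auto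

lemma tdist_nonneg: "A \<noteq> {} \<Longrightarrow> 0 \<le> tdist n A x"
  unfolding tdist_def by (intro cINF_greatest) auto

lemma tdist_lessD: "A \<noteq> {} \<Longrightarrow> tdist n A x < T \<Longrightarrow> \<exists>a\<in>A. tuple_norm N r n (x - a) < T"
  unfolding tdist_def by (subst (asm) cINF_less_iff) (auto intro: bdd_belowI2[where m=0])

lemma tdist_le_add:
  assumes "A \<noteq> {}" shows "tdist n A x \<le> tuple_norm N r n (x - y) + tdist n A y"
proof -
  have "tdist n A x - tuple_norm N r n (x - y) \<le> tuple_norm N r n (y - a)" if "a \<in> A" for a
    using tdist_le[OF that, of n x] tuple_norm_diff_triangle[of n x a y] by linarith
  then have "tdist n A x - tuple_norm N r n (x - y) \<le> tdist n A y"
    unfolding tdist_def[of n A y] using assms by (intro cINF_greatest) auto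
  then show ?thesis by simp
qed

lemma tdist_lipschitz: "A \<noteq> {} \<Longrightarrow> \<bar>tdist n A x - tdist n A y\<bar> \<le> tuple_norm N r n (x - y)"
  using tdist_le_add[of A n x y] tdist_le_add[of A n y x] by (auto simp: tuple_norm_minus_commute[of n y x])

lemma tdist_eq_0: "a \<in> A \<Longrightarrow> tdist n A a = 0"
  using tdist_le[of a A n a] tdist_nonneg[of A n a] by (auto simp: tuple_norm_eq_0[THEN iffD2])

lemma continuous_on_tdist: "A \<noteq> {} \<Longrightarrow> continuous_on S (tdist n A)"
  by (rule lipschitz_imp_continuous_on_tuples[of _ _ 1 n]) (auto simp: tdist_lipschitz)

lemma measurable_tdist: "A \<noteq> {} \<Longrightarrow> tdist n A \<in> borel_measurable (tuple_borel n)"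
  by (intro continuous_imp_measurable_tuple_borel continuous_on_tdist)

lemma convex_on_tdist:
  assumes "convex A" "A \<noteq> {}" "convex S"
  shows "convex_on S (tdist n A)"
proof (rule convex_onI)
  fix t x y assume t: "0 < (t::real)" "t < 1"
  show "tdist n A ((1 - t) *\<^sub>R x + t *\<^sub>R y) \<le> (1 - t) * tdist n A x + t * tdist n A y"
  proof (rule field_le_epsilon)
    fix e :: real assume e: "e > 0"
    obtain a b where ab: "a \<in> A" "b \<in> A" "tuple_norm N r n (x - a) < tdist n A x + e"
      "tuple_norm N r n (y - b) < tdist n A y + e"
      using tdist_lessD[OF assms(2)] e by (metis less_add_same_cancel1)
    have c: "(1 - t) *\<^sub>R a + t *\<^sub>R b \<in> A" using ab assms(1) t by (intro convexD) auto
    have "(1 - t) *\<^sub>R x + t *\<^sub>R y - ((1 - t) *\<^sub>R a + t *\<^sub>R b) = (1 - t) *\<^sub>R (x - a) + t *\<^sub>R (y - b)"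
      by (simp add: scaleR_right_diff_distrib)
    then have "tdist n A ((1 - t) *\<^sub>R x + t *\<^sub>R y) \<le> (1 - t) * tuple_norm N r n (x - a) + t * tuple_norm N r n (y - b)"
      using tdist_le[OF c, of n "(1 - t) *\<^sub>R x + t *\<^sub>R y"]
        tuple_norm_triangle[of n "(1 - t) *\<^sub>R (x - a)" "t *\<^sub>R (y - b)"] t by simp
    also have "\<dots> \<le> (1 - t) * (tdist n A x + e) + t * (tdist n A y + e)"
      using t ab by (intro add_mono mult_left_mono) auto
    finally show "tdist n A ((1 - t) *\<^sub>R x + t *\<^sub>R y) \<le> (1 - t) * tdist n A x + t * tdist n A y + e"
      by (simp add: algebra_simps)
  qed
qed fact

text \<open>The open balls around \<open>x\<close> and \<open>y\<close> with radii
  \<open>tdist n A x\<close> and \<open>tdist n A y\<close> avoid \<open>A\<close>. If some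
  \<open>a\<close> in \<open>A\<close> were closer to the combination than the combined radius
  \<rho>, then \<open>a\<close> would be \<open>?z + \<rho> v\<close> with \<open>v\<close> of norm
  less than \<open>1\<close>. Moving \<open>x\<close> and \<open>y\<close> along the same
  \<open>v\<close>, each by its own distance, leads to two points outside \<open>A\<close> whose
  combination is \<open>a\<close>, against convexity of the complement.\<close>

lemma tdist_concave_on_compl:
  assumes A: "A \<noteq> {}" "A \<subseteq> tuples n" and D: "convex (tuples n - A)"
    and x: "x \<in> tuples n - A" and y: "y \<in> tuples n - A" and t: "0 < (t::real)" "t < 1"
  shows "(1 - t) * tdist n A x + t * tdist n A y \<le> tdist n A ((1 - t) *\<^sub>R x + t *\<^sub>R y)"
proof (rule ccontr)
  let ?z = "(1 - t) *\<^sub>R x + t *\<^sub>R y" and ?\<rho> = "(1 - t) * tdist n A x + t * tdist n A y"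
  assume "\<not> ?thesis"
  then have "tdist n A ?z < ?\<rho>" by simp
  then obtain a where a: "a \<in> A" "tuple_norm N r n (?z - a) < ?\<rho>" using tdist_lessD A by blast
  have \<rho>: "?\<rho> > 0" using a(2) by (rule order.strict_trans1[rotated]) simp
  define v where "v = (1 / ?\<rho>) *\<^sub>R (a - ?z)"
  have "s > 0 \<Longrightarrow> tuple_norm N r n (z - a) < s \<Longrightarrow> tuple_norm N r n ((1 / s) *\<^sub>R (a - z)) < 1" for s z
    unfolding tuple_norm_scaleR by (simp add: tuple_norm_minus_commute[of n a])
  then have v: "tuple_norm N r n v < 1" unfolding v_def using a(2) \<rho> by blast
  have un: "a i = undefined \<and> x i = undefined \<and> y i = undefined \<and> v i = 0" if "i \<ge> n" for i
  proof -
    have u: "a i = undefined" "x i = undefined" "y i = undefined" using that a x y A by (auto simp: in_tuples_iff)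
    then show ?thesis by (simp add: v_def convex_comb_undefined)
  qed
  have *: "w + tdist n A w *\<^sub>R v \<in> tuples n - A" if w: "w \<in> tuples n - A" for w
  proof
    show "w + tdist n A w *\<^sub>R v \<in> tuples n" using w un by (auto simp: in_tuples_iff)
    show "w + tdist n A w *\<^sub>R v \<notin> A"
    proof
      assume "w + tdist n A w *\<^sub>R v \<in> A"
      from tdist_le[OF this, of n w] have 1: "tdist n A w \<le> tuple_norm N r n ((- tdist n A w) *\<^sub>R v)" by simp
      also have "\<dots> = tdist n A w * tuple_norm N r n v"
        unfolding tuple_norm_scaleR using tdist_nonneg[OF A(1), of n w] by simp
      finally have "tdist n A w = 0" using tdist_nonneg[OF A(1), of n w] v
        by (metis less_eq_real_def mult_less_cancel_left2 not_le)
      then show False using w \<open>w + tdist n A w *\<^sub>R v \<in> A\<close> by simp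
    qed
  qed
  have "(1 - t) *\<^sub>R (x + tdist n A x *\<^sub>R v) + t *\<^sub>R (y + tdist n A y *\<^sub>R v) \<in> tuples n - A"
    using *[OF x] *[OF y] t by (intro convexD[OF D]) auto
  also have "(1 - t) *\<^sub>R (x + tdist n A x *\<^sub>R v) + t *\<^sub>R (y + tdist n A y *\<^sub>R v) = ?z + ?\<rho> *\<^sub>R v"
    by (simp add: scaleR_add_right scaleR_add_left)
  also have "\<dots> = a" unfolding v_def using \<rho> by simp
  finally show False using a(1) by simp
qed

text \<open>Only points of \<open>C\<close> that are not farther from \<open>x\<close> than a fixed
  \<open>c0\<close> compete for the infimum. \<open>R\<close> bounds their coordinates by the
  triangle inequality and the equivalence of norms, and bounded closed sets of tuples are
  compact.\<close>

lemma tdist_attained: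
  assumes C: "closed C" "C \<subseteq> tuples n" "C \<noteq> {}"
  shows "\<exists>c\<in>C. tuple_norm N r n (x - c) = tdist n C x"
proof -
  obtain k where k: "k > 0" "\<And>x. norm x \<le> k * N x" using norm_le_N by auto
  obtain c0 where c0: "c0 \<in> C" using C by auto
  define R where "R = (\<Sum>i<n. norm (x i)) + k * tuple_norm N r n (x - c0)"
  let ?K = "C \<inter> {y \<in> tuples n. \<forall>i<n. norm (y i) \<le> R}"
  have in_K: "c \<in> ?K" if c: "c \<in> C" "tuple_norm N r n (x - c) \<le> tuple_norm N r n (x - c0)" for c
  proof -
    have "norm (c i) \<le> R" if i: "i < n" for i
    proof -
      have 1: "norm (c i) \<le> norm (x i) + norm (x i - c i)"
        using norm_triangle_ineq4[of "x i" "x i - c i"] by simp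
      have 2: "k * N (x i - c i) \<le> k * tuple_norm N r n (x - c0)"
        using N_le_tuple_norm[OF i, of "x - c"] c(2) k(1) by (intro mult_left_mono) auto
      have 3: "norm (x i) \<le> (\<Sum>i<n. norm (x i))" using i by (intro member_le_sum) auto
      show ?thesis using 1 2 3 k(2)[of "x i - c i"] unfolding R_def by linarith
    qed
    then show ?thesis using c C(2) by auto
  qed
  have 1: "compact ?K" using C(1) compact_tuples by (intro closed_Int_compact)
  have 2: "?K \<noteq> {}" using in_K[OF c0] by auto
  have 3: "continuous_on ?K (\<lambda>c. tuple_norm N r n (x - c))"
    by (subst tuple_norm_minus_commute) (intro continuous_on_tuple_norm continuous_on_id)
  from continuous_attains_inf[OF 1 2 3]
  obtain c where c: "c \<in> ?K" "\<And>y. y \<in> ?K \<Longrightarrow> tuple_norm N r n (x - c) \<le> tuple_norm N r n (x - y)"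
    by auto
  have "tuple_norm N r n (x - c) \<le> tuple_norm N r n (x - y)" if y: "y \<in> C" for y
  proof (cases "tuple_norm N r n (x - y) \<le> tuple_norm N r n (x - c0)")
    case True then show ?thesis using c(2) in_K[OF y] by auto
  next
    case False then show ?thesis using c(2)[OF in_K[OF c0]] by auto
  qed
  then have "tuple_norm N r n (x - c) \<le> tdist n C x"
    unfolding tdist_def using C(3) by (intro cINF_greatest) auto
  then have "tuple_norm N r n (x - c) = tdist n C x" using c(1) tdist_le[of c C n x] by simp
  then show ?thesis using c(1) by blast
qed

lemma enlarge_closed_eq:
  assumes "closed C" "C \<subseteq> tuples n" "C \<noteq> {}" "t \<ge> 0"
  shows "enlarge N r n C t = {x \<in> tuples n. tdist n C x \<le> t powr (1 / r)}"
proof -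
  have "(\<exists>a\<in>C. tuple_norm N r n (x - a) \<le> T) \<longleftrightarrow> tdist n C x \<le> T" for x T
    using tdist_attained[OF assms(1-3), of x] tdist_le[of _ C n x] order_trans by metis
  then show ?thesis unfolding enlarge_eq[OF assms(2,4)] by simp
qed

end

section \<open>Barycenters and the enlargement attached to the barycentric cost\<close>

lemma continuous_on_tuple_comb:
  "continuous_on S (\<lambda>y. u *\<^sub>R (x :: nat \<Rightarrow> real^'m) + v *\<^sub>R y)"
  "continuous_on S (\<lambda>y. u *\<^sub>R y + v *\<^sub>R (x :: nat \<Rightarrow> real^'m))"
  by (auto intro!: continuous_on_coordinatewise_then_product continuous_intros
      continuous_on_subset[OF continuous_on_product_coordinates])

text \<open>Separate continuity of the combination is enough: one argument at a time is moved from
  \<open>K\<close> to its closure.\<close>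

lemma convex_closure_tuple:
  fixes K :: "(nat \<Rightarrow> real^'m) set"
  assumes "convex K" shows "convex (closure K)"
proof -
  have 1: "u *\<^sub>R x + v *\<^sub>R y \<in> closure K"
    if "x \<in> K" "y \<in> closure K" "u \<ge> 0" "v \<ge> 0" "u + v = 1" for x y :: "nat \<Rightarrow> real^'m" and u v
  proof -
    have "(\<lambda>y. u *\<^sub>R x + v *\<^sub>R y) ` closure K \<subseteq> closure K"
      using assms that closure_subset[of K]
      by (intro image_closure_subset continuous_on_tuple_comb) (auto simp: convex_def)
    then show ?thesis using that by auto
  qed
  have "u *\<^sub>R x + v *\<^sub>R y \<in> closure K"
    if "x \<in> closure K" "y \<in> closure K" "u \<ge> 0" "v \<ge> 0" "u + v = 1" for x y :: "nat \<Rightarrow> real^'m" and u v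
  proof -
    have "(\<lambda>x. u *\<^sub>R x + v *\<^sub>R y) ` closure K \<subseteq> closure K"
      using that 1[of _ y] by (intro image_closure_subset continuous_on_tuple_comb) auto
    then show ?thesis using that by auto
  qed
  then show ?thesis by (auto simp: convex_def)
qed

lemma is_norm_norm: "is_norm (norm :: real^'m \<Rightarrow> real)"
  by (auto simp: is_norm_def norm_triangle_ineq)

lemma P1_tuplesD:
  assumes "p \<in> P1_tuples n"
  shows "prob_space p" "sets p = sets (tuple_borel n)" "space p = tuples n"
    "i < n \<Longrightarrow> (\<lambda>y. y i) \<in> borel_measurable p" "i < n \<Longrightarrow> integrable p (\<lambda>y. y i)"
proof -
  show p: "prob_space p" "sets p = sets (tuple_borel n)" using assms by (auto simp: P1_tuples_def)
  from sets_eq_imp_space_eq[OF p(2)] show "space p = tuples n" by simp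
  show m: "(\<lambda>y. y i) \<in> borel_measurable p" if "i < n" for i
    using that measurable_component_singleton[of i "{..<n}" "\<lambda>_. borel"] p(2)
    by (simp cong: measurable_cong_sets)
  have "integrable p (\<lambda>y. \<Sum>i<n. norm (y i))" using assms by (auto simp: P1_tuples_def)
  then show "integrable p (\<lambda>y. y i)" if "i < n"
    by (rule Bochner_Integration.integrable_bound) (use that m in \<open>auto intro!: AE_I2 member_le_sum simp: abs_of_nonneg sum_nonneg\<close>)
qed

lemma bary_cost_marginal:
  assumes "p \<in> P1_tuples n" "i < n"
  shows "bary_cost N r x (distr p borel (\<lambda>y. y i)) = N (x - (\<integral>y. y i \<partial>p)) powr r"
  unfolding bary_cost_def using P1_tuplesD[OF assms(1)] assms(2) by (subst integral_distr) auto

text \<open>The nearest point \<open>w\<close> of the hull satisfies \<open>(z - w) \<bullet> (y - w) \<le> 0\<close> on it; integrating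
  over \<open>y\<close> with barycenter \<open>z\<close> gives \<open>z = w\<close>.\<close>

lemma barycenter_in_closed_convex:
  fixes C :: "(nat \<Rightarrow> real^'m) set"
  assumes p: "p \<in> P1_tuples n" and C: "closed C" "convex C" "C \<subseteq> tuples n" "C \<noteq> {}"
    and AE: "AE y in p. y \<in> C"
  shows "(\<lambda>i\<in>{..<n}. \<integral>y. y i \<partial>p) \<in> C"
proof -
  \<comment> \<open>The claim does not depend on a choice of norm. The Euclidean one with exponent
    \<open>2\<close> is taken because its nearest point is characterized by an inner
    product.\<close>
  interpret e: norm_power "norm :: real^'m \<Rightarrow> real" 2
    by standard (auto simp: is_norm_norm)
  note pD = P1_tuplesD[OF p]
  interpret prob_space p by (rule pD(1))
  let ?z = "(\<lambda>i\<in>{..<n}. \<integral>y. y i \<partial>p)"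
  obtain w where w: "w \<in> C" "tuple_norm norm 2 n (?z - w) = e.tdist n C ?z"
    using e.tdist_attained[OF C(1,3,4)] by auto
  have norm_diff: "norm (a - t *\<^sub>R b) ^ 2 = norm a ^ 2 - 2 * t * (a \<bullet> b) + t^2 * norm b ^ 2"
    for a b :: "real^'m" and t :: real
    unfolding power2_norm_eq_inner
    by (simp add: inner_diff_left inner_diff_right inner_commute power2_eq_square algebra_simps)
  define g where "g y = (\<Sum>i<n. (?z i - w i) \<bullet> (y i - w i))" for y
  have g: "g y \<le> 0" if y: "y \<in> C" for y
  proof (rule ccontr)
    assume "\<not> g y \<le> 0"
    \<comment> \<open>Moving from \<open>w\<close> towards \<open>y\<close> by a fraction
      \<open>t\<close> changes the squared distance to \<open>?z\<close> by
      \<open>t^2 * S - 2 * t * g y\<close>. For \<open>g y > 0\<close> the chosen \<open>t\<close>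
      makes this negative, although \<open>w\<close> is nearest.\<close>
    define S where "S = (\<Sum>i<n. norm (y i - w i) ^ 2)"
    define t where "t = min 1 (g y / (S + 1))"
    have S: "S \<ge> 0" by (simp add: S_def sum_nonneg)
    have t: "0 < t" "t \<le> 1" "t * S < 2 * g y"
    proof -
      show "0 < t" "t \<le> 1" using \<open>\<not> g y \<le> 0\<close> S by (auto simp: t_def)
      have "t * S \<le> g y / (S + 1) * S" using S by (intro mult_right_mono) (auto simp: t_def)
      also have "\<dots> \<le> g y" using S \<open>\<not> g y \<le> 0\<close> by (simp add: field_simps)
      finally show "t * S < 2 * g y" using \<open>\<not> g y \<le> 0\<close> by simp
    qed
    have "(1 - t) *\<^sub>R w + t *\<^sub>R y \<in> C" using y w(1) C(2) t by (intro convexD) auto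
    from e.tdist_le[OF this, of n ?z] have
      "tuple_norm norm 2 n (?z - w) \<le> tuple_norm norm 2 n (?z - ((1 - t) *\<^sub>R w + t *\<^sub>R y))"
      using w(2) by simp
    then have "tuple_norm norm 2 n (?z - w) powr 2 \<le> tuple_norm norm 2 n (?z - ((1 - t) *\<^sub>R w + t *\<^sub>R y)) powr 2"
      by (intro powr_mono2) auto
    then have "(\<Sum>i<n. norm (?z i - w i) ^ 2) \<le> (\<Sum>i<n. norm (?z i - ((1 - t) *\<^sub>R w i + t *\<^sub>R y i)) ^ 2)"
      unfolding e.tuple_norm_powr by simp
    also have "\<dots> = (\<Sum>i<n. norm (?z i - w i) ^ 2 - 2 * t * ((?z i - w i) \<bullet> (y i - w i)) + t^2 * norm (y i - w i) ^ 2)"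
    proof (intro sum.cong refl)
      fix i
      have *: "?z i - ((1 - t) *\<^sub>R w i + t *\<^sub>R y i) = (?z i - w i) - t *\<^sub>R (y i - w i)"
        by (simp add: algebra_simps)
      show "norm (?z i - ((1 - t) *\<^sub>R w i + t *\<^sub>R y i)) ^ 2 =
        norm (?z i - w i) ^ 2 - 2 * t * ((?z i - w i) \<bullet> (y i - w i)) + t^2 * norm (y i - w i) ^ 2"
        unfolding * by (rule norm_diff)
    qed
    also have "\<dots> = (\<Sum>i<n. norm (?z i - w i) ^ 2) - 2 * t * g y + t^2 * S"
      by (simp add: sum.distrib sum_subtractf sum_distrib_left g_def S_def)
    finally have "t * (2 * g y) \<le> t * (t * S)" by (simp add: power2_eq_square)
    then show False using t by simp
  qed
  have int: "integrable p (\<lambda>y. (?z i - w i) \<bullet> (y i - w i))" if "i < n" for i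
    using pD(5)[OF that] by simp
  have "(\<integral>y. g y \<partial>p) \<le> (\<integral>y. 0 \<partial>p)"
    using AE g int unfolding g_def by (intro integral_mono_AE Bochner_Integration.integrable_sum) auto
  also have "(\<integral>y. g y \<partial>p) = (\<Sum>i<n. \<integral>y. (?z i - w i) \<bullet> (y i - w i) \<partial>p)"
    unfolding g_def using int by (intro Bochner_Integration.integral_sum) auto
  also have "\<dots> = (\<Sum>i<n. norm (?z i - w i) ^ 2)"
  proof (intro sum.cong refl)
    fix i assume "i \<in> {..<n}"
    then have "(\<integral>y. (?z i - w i) \<bullet> (y i - w i) \<partial>p) = (?z i - w i) \<bullet> (\<integral>y. y i - w i \<partial>p)"
      using pD(5)[of i] by (intro integral_inner_right) auto
    also have "(\<integral>y. y i - w i \<partial>p) = ?z i - w i" using pD(5)[of i] \<open>i \<in> _\<close> by (simp add: prob_space)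
    finally show "(\<integral>y. (?z i - w i) \<bullet> (y i - w i) \<partial>p) = norm (?z i - w i) ^ 2"
      by (simp add: power2_norm_eq_inner)
  qed
  finally have "(\<Sum>i<n. norm (?z i - w i) ^ 2) \<le> 0" by simp
  then have "(\<Sum>i<n. norm (?z i - w i) ^ 2) = 0" by (intro antisym sum_nonneg) auto
  then have "\<forall>i<n. ?z i = w i" by (subst (asm) sum_nonneg_eq_0_iff) auto
  then have "?z = w" using w(1) C(3) by (auto simp: in_tuples_iff fun_eq_iff)
  then show ?thesis using w(1) by simp
qed

text \<open>The coefficients of a finite convex combination serve as the weights of the atoms of
  \<open>p\<close>. This is the counterpart of \<open>barycenter_in_closed_convex\<close>; points of
  the closure are reached only in a limit.\<close>

lemma convex_hull_barycenter:
  fixes A :: "(nat \<Rightarrow> real^'m) set"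
  assumes A: "A \<in> sets (tuple_borel n)" and k: "k \<in> convex hull A"
  shows "\<exists>p\<in>P1_tuples n. emeasure p A = 1 \<and> (\<forall>i<n. (\<integral>y. y i \<partial>p) = k i)"
proof -
  have At: "A \<subseteq> tuples n" using sets.sets_into_space[OF A] by simp
  obtain S u where S: "finite S" "S \<subseteq> A" "\<And>x. x \<in> S \<Longrightarrow> 0 \<le> u x" "sum u S = 1" "(\<Sum>v\<in>S. u v *\<^sub>R v) = k"
    using k unfolding convex_hull_explicit by auto
  define u' where "u' x = (if x \<in> S then u x else 0)" for x
  have u': "\<And>x. 0 \<le> u' x" using S(3) by (simp add: u'_def)
  have sum_u': "(\<Sum>x\<in>S. u' x *\<^sub>R f x) = (\<Sum>x\<in>S. u x *\<^sub>R f x)" for f :: "_ \<Rightarrow> 'b::real_vector"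
    by (intro sum.cong) (auto simp: u'_def)
  let ?q = "point_measure S (\<lambda>x. ennreal (u' x))"
  have id: "(\<lambda>x. x) \<in> measurable ?q (tuple_borel n)" using S(2) At by (auto simp: space_PiM)
  define p where "p = distr ?q (tuple_borel n) (\<lambda>x. x)"
  have em: "emeasure ?q X = ennreal (\<Sum>x\<in>X. u' x)" if "X \<subseteq> S" for X
    using that S(1) u' by (subst emeasure_point_measure_finite) (auto simp: sum_ennreal)
  have q1: "emeasure ?q S = 1" using em[of S] sum_u'[of "\<lambda>_. 1::real"] S(4) by simp
  interpret q: prob_space ?q by (rule prob_spaceI) (simp add: space_point_measure q1)
  have p: "prob_space p" unfolding p_def by (rule q.prob_space_distr[OF id])
  have int: "integral\<^sup>L p f = (\<Sum>x\<in>S. u x *\<^sub>R f x)" "integrable p f"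
    if f: "f \<in> borel_measurable (tuple_borel n)" for f :: "_ \<Rightarrow> 'b::{banach, second_countable_topology}"
  proof -
    have "integral\<^sup>L p f = (\<Sum>x\<in>S. u' x *\<^sub>R f x)" unfolding p_def using S(1) u' id f
      by (subst integral_distr) (auto simp: lebesgue_integral_point_measure_finite)
    then show "integral\<^sup>L p f = (\<Sum>x\<in>S. u x *\<^sub>R f x)" by (simp add: sum_u')
    show "integrable p f" unfolding p_def using S(1) id f
      by (subst integrable_distr_eq) (auto simp: integrable_point_measure_finite)
  qed
  have comp: "(\<lambda>y. y i) \<in> borel_measurable (tuple_borel n :: (nat \<Rightarrow> real^'m) measure)" if "i < n" for i
    using that by (intro measurable_component_singleton) auto
  have "p \<in> P1_tuples n" unfolding P1_tuples_def using p
    by (auto intro!: int(2) borel_measurable_sum borel_measurable_norm comp) (simp_all add: p_def)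
  moreover have "emeasure p A = 1"
  proof -
    have "emeasure p A = emeasure ?q S" unfolding p_def using S(2) A id
      by (subst emeasure_distr) (auto simp: space_point_measure Int_absorb1)
    then show ?thesis using q1 by simp
  qed
  moreover have "(\<integral>y. y i \<partial>p) = k i" if "i < n" for i
  proof -
    have "(\<Sum>v\<in>S. u v *\<^sub>R v) i = (\<Sum>v\<in>S. (u v *\<^sub>R v) i)"
      using S(1) by (induction S rule: finite_induct) auto
    then show ?thesis using int(1)[OF comp[OF that]] S(5) by simp
  qed
  ultimately show ?thesis by blast
qed

context norm_power
begin

text \<open>A measure carried by \<open>A\<close> has its barycenter in the closed convex hull, so
  its cost is at least the distance to that hull to the power \<open>r\<close>. Conversely each
  point of the hull is a barycenter, and a point of the closure is approximated with an arbitrarily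
  small excess \<open>e\<close> of the radius. For \<open>A = {}\<close> the infimum over no
  measures is infinite and both sides are empty.\<close>

lemma cost_enlarge_eq:
  assumes A: "A \<in> sets (tuple_borel n)" and t: "t \<ge> 0"
  shows "cost_enlarge N r n A t = enlarge N r n (closure (convex hull A)) t"
proof (cases "A = {}")
  case True
  have "set_cost N r n A x = \<infinity>" for x
  proof -
    have empty: "{p \<in> P1_tuples n. emeasure p A = 1} = {}" using True by auto
    show ?thesis unfolding set_cost_def empty by (simp add: top_ennreal_def[symmetric] infinity_ennreal_def)
  qed
  then show ?thesis using True by (auto simp: cost_enlarge_def enlarge_def top_unique)
next
  case False
  have At: "A \<subseteq> tuples n" using sets.sets_into_space[OF A] by simp
  let ?K = "convex hull A"
  let ?C = "closure ?K"
  have Kt: "?K \<subseteq> tuples n" using At by (intro hull_minimal) auto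
  have AC: "A \<subseteq> ?C" using closure_subset[of ?K] hull_subset[of A convex] by (rule order_trans[rotated])
  have C: "closed ?C" "convex ?C" "?C \<subseteq> tuples n" "?C \<noteq> {}" "A \<subseteq> ?C"
    using False Kt AC by (simp_all add: convex_closure_tuple closure_minimal)
  have "set_cost N r n A x \<le> ennreal t \<longleftrightarrow> tdist n ?C x \<le> t powr (1 / r)" if x: "x \<in> tuples n" for x
  proof
    assume le: "set_cost N r n A x \<le> ennreal t"
    have "tdist n ?C x powr r \<le> t"
    proof (rule field_le_epsilon)
      fix e :: real assume e: "e > 0"
      have "set_cost N r n A x < ennreal (t + e)" using le e t
        by (auto intro: order.strict_trans1 ennreal_lessI)
      then obtain p where p: "p \<in> P1_tuples n" "emeasure p A = 1"
        and lt: "ennreal (\<Sum>i<n. bary_cost N r (x i) (distr p borel (\<lambda>y. y i))) < ennreal (t + e)"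
        unfolding set_cost_def INF_less_iff by auto
      note pD = P1_tuplesD[OF p(1)]
      interpret prob_space p by (rule pD(1))
      have "AE y in p. y \<in> A" using p(2) A pD(2) by (intro AE_prob_1) (simp add: measure_def)
      then have "AE y in p. y \<in> ?C" using C(5) by (auto elim!: AE_mp)
      then have z: "(\<lambda>i\<in>{..<n}. \<integral>y. y i \<partial>p) \<in> ?C"
        using p(1) C by (intro barycenter_in_closed_convex) auto
      have "tdist n ?C x powr r \<le> tuple_norm N r n (x - (\<lambda>i\<in>{..<n}. \<integral>y. y i \<partial>p)) powr r"
        using tdist_le[OF z, of n x] tdist_nonneg[OF C(4)] r by (intro powr_mono2) auto
      also have "\<dots> = (\<Sum>i<n. bary_cost N r (x i) (distr p borel (\<lambda>y. y i)))"
        unfolding tuple_norm_powr by (intro sum.cong) (auto simp: bary_cost_marginal[OF p(1)])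
      also have "\<dots> < t + e"
        using lt by (subst (asm) ennreal_less_iff) (auto intro!: sum_nonneg simp: bary_cost_def)
      finally show "tdist n ?C x powr r \<le> t + e" by simp
    qed
    then have "(tdist n ?C x powr r) powr (1 / r) \<le> t powr (1 / r)" using r by (intro powr_mono2) auto
    then show "tdist n ?C x \<le> t powr (1 / r)" using r tdist_nonneg[OF C(4)] by (simp add: powr_powr)
  next
    assume le: "tdist n ?C x \<le> t powr (1 / r)"
    have ne: "?K \<noteq> {}" using False by simp
    obtain c where c: "c \<in> ?C" "tuple_norm N r n (x - c) \<le> t powr (1 / r)"
      using tdist_attained[OF C(1,3,4), of x] le by auto
    have "?C \<subseteq> {y. tdist n ?K y = 0}"
      using tdist_eq_0[of _ ?K n] by (intro closure_minimal closed_Collect_eq continuous_on_tdist ne) auto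
    then have "tdist n ?K c = 0" using c(1) by auto
    then have tK: "tdist n ?K x \<le> t powr (1 / r)" using tdist_le_add[OF ne, of n x c] c(2) by simp
    have *: "set_cost N r n A x \<le> ennreal ((t powr (1 / r) + e) powr r)" if e: "e > 0" for e
    proof -
      obtain k where k: "k \<in> ?K" "tuple_norm N r n (x - k) < t powr (1 / r) + e"
        using tdist_lessD[OF ne, of n x "t powr (1 / r) + e"] tK e by auto
      obtain p where p: "p \<in> P1_tuples n" "emeasure p A = 1" "\<And>i. i < n \<Longrightarrow> (\<integral>y. y i \<partial>p) = k i"
        using convex_hull_barycenter[OF A k(1)] by auto
      have "set_cost N r n A x \<le> ennreal (\<Sum>i<n. bary_cost N r (x i) (distr p borel (\<lambda>y. y i)))"
        unfolding set_cost_def using p by (intro INF_lower) auto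
      also have "(\<Sum>i<n. bary_cost N r (x i) (distr p borel (\<lambda>y. y i))) = tuple_norm N r n (x - k) powr r"
        unfolding tuple_norm_powr by (intro sum.cong) (auto simp: bary_cost_marginal[OF p(1)] p(3))
      also have "ennreal \<dots> \<le> ennreal ((t powr (1 / r) + e) powr r)"
        using k(2) r by (intro ennreal_leI powr_mono2) auto
      finally show ?thesis .
    qed
    have "((\<lambda>e. ennreal ((t powr (1 / r) + e) powr r)) \<longlongrightarrow> ennreal ((t powr (1 / r) + 0) powr r)) (at_right 0)"
      using r by (intro tendsto_ennrealI tendsto_powr' tendsto_intros) (auto simp: eventually_at_filter)
    then have "set_cost N r n A x \<le> ennreal ((t powr (1 / r) + 0) powr r)"
      by (rule tendsto_lowerbound) (use * in \<open>auto simp: eventually_at_filter\<close>)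
    then show "set_cost N r n A x \<le> ennreal t" using r t by (simp add: powr_powr)
  qed
  then show ?thesis unfolding cost_enlarge_def enlarge_closed_eq[OF C(1,3,4) t] by auto
qed

end

section \<open>Relative entropy\<close>

lemma rel_entropy_self: "prob_space \<mu> \<Longrightarrow> rel_entropy \<mu> \<mu> = 0"
proof -
  assume "prob_space \<mu>"
  then interpret prob_space \<mu> .
  have "AE x in \<mu>. 1 = RN_deriv \<mu> \<mu> x"
    by (rule RN_deriv_unique) (auto simp: density_1)
  then have "AE x in \<mu>. entropy_density (exp 1) \<mu> \<mu> x = 0"
  proof eventually_elim
    case (elim x)
    then show ?case by (simp add: entropy_density_def flip: elim)
  qed
  then have "integrable \<mu> (entropy_density (exp 1) \<mu> \<mu>) \<longleftrightarrow> integrable \<mu> (\<lambda>_. 0 :: real)"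
    by (intro integrable_cong_AE) auto
  then show ?thesis using KL_same_eq_0 by (auto simp: rel_entropy_def absolutely_continuous_def)
qed

lemma rel_entropy_density:
  assumes "prob_space \<mu>" and g: "g \<in> borel_measurable \<mu>" "\<And>x. g x > 0"
    and \<nu>: "\<nu> = density \<mu> (\<lambda>x. ennreal (g x))" "prob_space \<nu>" and int: "integrable \<nu> (\<lambda>x. ln (g x))"
  shows "rel_entropy \<nu> \<mu> = ennreal (\<integral>x. ln (g x) \<partial>\<nu>)"
proof -
  interpret prob_space \<mu> by fact
  interpret \<nu>: prob_space \<nu> by fact
  have ac: "absolutely_continuous \<mu> \<nu>" unfolding \<nu>(1) using g by (intro absolutely_continuousI_density) auto
  have "AE x in \<mu>. ennreal (g x) = RN_deriv \<mu> \<nu> x"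
    using g by (intro RN_deriv_unique_sigma_finite \<nu>(1)[symmetric] \<nu>.sigma_finite_measure_axioms) auto
  then have "AE x in \<nu>. ennreal (g x) = RN_deriv \<mu> \<nu> x"
    using ac by (intro absolutely_continuous_AE[OF _ ac]) (auto simp: \<nu>(1))
  then have AE: "AE x in \<nu>. entropy_density (exp 1) \<mu> \<nu> x = ln (g x)"
  proof eventually_elim
    case (elim x)
    then have "enn2real (RN_deriv \<mu> \<nu> x) = g x" using g(2)[of x] by (metis enn2real_ennreal less_imp_le)
    then show ?case by (simp add: entropy_density_def log_def)
  qed
  have m: "entropy_density (exp 1) \<mu> \<nu> \<in> borel_measurable \<nu>" "(\<lambda>x. ln (g x)) \<in> borel_measurable \<nu>"
    using measurable_entropy_density[of "exp 1" \<mu> \<nu>] g(1) by (auto simp: \<nu>(1))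
  have "integrable \<nu> (entropy_density (exp 1) \<mu> \<nu>)"
    using integrable_cong_AE[OF m AE] int by simp
  moreover have "KL_divergence (exp 1) \<mu> \<nu> = (\<integral>x. ln (g x) \<partial>\<nu>)"
    unfolding KL_divergence_def by (rule integral_cong_AE[OF m AE])
  ultimately show ?thesis using ac by (simp add: rel_entropy_def)
qed

text \<open>With \<open>h\<close> the density of \<nu> and \<open>Z\<close> the exponential moment,
  \<open>1 + u \<le> exp u\<close> is integrated against \<nu> for
  \<open>u = \<phi> - ln h - ln Z\<close>. The integral of \<open>exp u\<close> is the
  \<mu>-integral of \<open>exp \<phi> / Z\<close> over the set where \<open>h\<close> does not
  vanish, hence at most \<open>1\<close>.\<close>

lemma Donsker_Varadhan:
  assumes "prob_space \<mu>" "prob_space \<nu>" and sets: "sets \<nu> = sets \<mu>"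
    and fin: "rel_entropy \<nu> \<mu> < \<infinity>"
    and \<phi>: "\<phi> \<in> borel_measurable \<mu>" "\<And>x. \<bar>\<phi> x\<bar> \<le> B"
  shows "(\<integral>x. \<phi> x \<partial>\<nu>) \<le> enn2real (rel_entropy \<nu> \<mu>) + ln (\<integral>x. exp (\<phi> x) \<partial>\<mu>)"
proof -
  interpret prob_space \<mu> by fact
  interpret \<nu>: prob_space \<nu> by fact
  have ac: "absolutely_continuous \<mu> \<nu>" and int: "integrable \<nu> (entropy_density (exp 1) \<mu> \<nu>)"
    using fin by (auto simp: rel_entropy_def split: if_splits)
  note [measurable_cong] = sets
  define h where "h x = enn2real (RN_deriv \<mu> \<nu> x)" for x
  have [measurable]: "h \<in> borel_measurable \<mu>" "h \<in> borel_measurable \<nu>"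
    unfolding h_def by measurable
  have \<phi>'[measurable]: "\<phi> \<in> borel_measurable \<mu>" "\<phi> \<in> borel_measurable \<nu>"
    using \<phi>(1) by measurable
  have ed: "entropy_density (exp 1) \<mu> \<nu> = (\<lambda>x. ln (h x))"
    by (auto simp: entropy_density_def h_def log_def)
  have intl: "integrable \<nu> (\<lambda>x. ln (h x))" using int ed by simp
  have dens: "density \<mu> (RN_deriv \<mu> \<nu>) = \<nu>" by (rule density_RN_deriv[OF ac sets])
  have "AE x in \<mu>. RN_deriv \<mu> \<nu> x \<noteq> \<infinity>"
    by (rule RN_deriv_finite[OF \<nu>.sigma_finite_measure_axioms ac sets])
  then have RN: "AE x in \<mu>. RN_deriv \<mu> \<nu> x = ennreal (h x)"
    by eventually_elim (simp add: h_def less_top)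
  have nu: "\<nu> = density \<mu> (\<lambda>x. ennreal (h x))"
  proof -
    have "density \<mu> (RN_deriv \<mu> \<nu>) = density \<mu> (\<lambda>x. ennreal (h x))"
      by (rule density_cong[OF _ _ RN]) measurable
    then show ?thesis by (simp only: dens)
  qed
  have hpos: "AE x in \<nu>. h x > 0" unfolding nu by (subst AE_density) auto
  have \<phi>b: "- B \<le> \<phi> x" "\<phi> x \<le> B" for x using \<phi>(2)[of x] by auto
  have int_exp: "integrable \<mu> (\<lambda>x. exp (\<phi> x))"
    using \<phi>(2) by (intro integrable_const_bound[of _ "exp B"]) (auto simp: abs_le_iff)
  define Z where "Z = (\<integral>x. exp (\<phi> x) \<partial>\<mu>)"
  have "(\<integral>x. exp (- B) \<partial>\<mu>) \<le> Z" unfolding Z_def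
    using int_exp by (intro integral_mono) (auto intro: \<phi>b)
  then have "exp (- B) \<le> Z" by (simp add: prob_space)
  then have Z: "Z > 0" using exp_gt_zero[of "- B"] by linarith
  have le1: "(\<integral>\<^sup>+x. ennreal (exp (\<phi> x) / (h x * Z)) \<partial>\<nu>) \<le> 1"
  proof -
    have "(\<integral>\<^sup>+x. ennreal (exp (\<phi> x) / (h x * Z)) \<partial>\<nu>) = (\<integral>\<^sup>+x. ennreal (h x) * ennreal (exp (\<phi> x) / (h x * Z)) \<partial>\<mu>)"
      by (subst nu, subst nn_integral_density) auto
    also have "\<dots> \<le> (\<integral>\<^sup>+x. ennreal (exp (\<phi> x) / Z) \<partial>\<mu>)"
    proof (intro nn_integral_mono)
      fix x
      have "h x \<ge> 0" by (simp add: h_def)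
      then show "ennreal (h x) * ennreal (exp (\<phi> x) / (h x * Z)) \<le> ennreal (exp (\<phi> x) / Z)"
        using Z by (cases "h x = 0") (auto simp flip: ennreal_mult)
    qed
    also have "\<dots> = ennreal (\<integral>x. exp (\<phi> x) / Z \<partial>\<mu>)"
      using int_exp Z by (intro nn_integral_eq_integral) auto
    also have "(\<integral>x. exp (\<phi> x) / Z \<partial>\<mu>) = 1" using Z by (simp add: Z_def)
    finally show ?thesis by simp
  qed
  have hn: "h x \<ge> 0" for x by (simp add: h_def)
  have int2: "integrable \<nu> (\<lambda>x. exp (\<phi> x) / (h x * Z))"
    using le1 Z hn by (intro integrableI_nonneg) (auto intro: order.strict_trans1 simp: less_top)
  have le1': "(\<integral>x. exp (\<phi> x) / (h x * Z) \<partial>\<nu>) \<le> 1"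
    using le1 nn_integral_eq_integral[OF int2] Z hn by simp
  have int\<phi>: "integrable \<nu> \<phi>" using \<phi>(2) by (intro \<nu>.integrable_const_bound[of _ B]) auto
  have "(\<integral>x. \<phi> x - ln (h x) - ln Z \<partial>\<nu>) \<le> (\<integral>x. exp (\<phi> x) / (h x * Z) - 1 \<partial>\<nu>)"
  proof (rule integral_mono_AE)
    show "AE x in \<nu>. \<phi> x - ln (h x) - ln Z \<le> exp (\<phi> x) / (h x * Z) - 1"
      using hpos
    proof eventually_elim
      case (elim x)
      have "exp (\<phi> x - ln (h x) - ln Z) = exp (\<phi> x) / (h x * Z)" using elim Z by (simp add: exp_diff)
      then show ?case using exp_ge_add_one_self[of "\<phi> x - ln (h x) - ln Z"] by simp
    qed
  qed (use int\<phi> intl int2 in auto)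
  also have "\<dots> \<le> 0" using le1' int2 by (simp add: \<nu>.prob_space)
  finally have "(\<integral>x. \<phi> x \<partial>\<nu>) \<le> (\<integral>x. ln (h x) \<partial>\<nu>) + ln Z"
    using int\<phi> intl by (simp add: \<nu>.prob_space)
  \<comment> \<open>The real number is recovered from \<open>ennreal\<close>, which sends negative
    values to \<open>0\<close>. Only an inequality is claimed, so the sign of the integral is
    immaterial here.\<close>
  also have "(\<integral>x. ln (h x) \<partial>\<nu>) \<le> enn2real (rel_entropy \<nu> \<mu>)"
    using ac int by (simp add: rel_entropy_def KL_divergence_def ed) (metis enn2real_ennreal enn2real_nonneg ennreal_neg le_cases)
  finally show ?thesis by (simp add: Z_def)
qed

section \<open>Kernels and composition of couplings\<close>

lemma P1D:
  assumes "\<mu> \<in> P1"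
  shows "prob_space \<mu>" "sets \<mu> = sets borel" "space \<mu> = UNIV" "integrable \<mu> (\<lambda>x. x)"
proof -
  show \<mu>: "prob_space \<mu>" "sets \<mu> = sets borel" using assms by (auto simp: P1_def)
  show "space \<mu> = UNIV" using sets_eq_imp_space_eq[OF \<mu>(2)] by simp
  have "integrable \<mu> norm" using assms by (auto simp: P1_def)
  moreover have "(\<lambda>x. x) \<in> borel_measurable \<mu>" using \<mu>(2) by (simp cong: measurable_cong_sets)
  ultimately show "integrable \<mu> (\<lambda>x. x)" by (auto simp: integrable_norm_iff)
qed

lemma kernelD:
  assumes "p \<in> \<mu> \<rightarrow>\<^sub>M prob_algebra borel" "x \<in> space \<mu>"
  shows "prob_space (p x)" "sets (p x) = sets borel" "space (p x) = UNIV"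
proof -
  show 1: "prob_space (p x)" "sets (p x) = sets borel"
    using measurable_space[OF assms] by (auto simp: space_prob_algebra)
  show "space (p x) = UNIV" using sets_eq_imp_space_eq[OF 1(2)] by simp
qed

text \<open>The coupling is determined by its kernel: the first marginal is \<mu> automatically and
  the second is \<open>\<mu> \<bind> p\<close>. The infimum may therefore run over kernels that push
  \<mu> to \<nu>, which is the form in which couplings are composed below.\<close>

lemma bary_transport_kernel:
  fixes \<mu> \<nu> :: "(real^'m) measure"
  assumes \<mu>: "prob_space \<mu>" "sets \<mu> = sets borel"
  shows "bary_transport N r \<nu> \<mu> =
    (INF p\<in>{p \<in> \<mu> \<rightarrow>\<^sub>M prob_algebra borel. \<mu> \<bind> p = \<nu>}. \<integral>\<^sup>+x. ennreal (bary_cost N r x (p x)) \<partial>\<mu>)"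
proof -
  interpret prob_space \<mu> by fact
  have marg: "distr (\<mu> \<bind> (\<lambda>x. p x \<bind> (\<lambda>y. return (borel \<Otimes>\<^sub>M borel) (x, y)))) borel fst = \<mu>"
      "distr (\<mu> \<bind> (\<lambda>x. p x \<bind> (\<lambda>y. return (borel \<Otimes>\<^sub>M borel) (x, y)))) borel snd = \<mu> \<bind> p"
    if p: "p \<in> \<mu> \<rightarrow>\<^sub>M prob_algebra borel" for p :: "real^'m \<Rightarrow> (real^'m) measure"
  proof -
    note [measurable_cong] = \<mu>(2)
    note p[measurable]
    have k: "(\<lambda>x. p x \<bind> (\<lambda>y. return (borel \<Otimes>\<^sub>M borel) (x, y))) \<in> \<mu> \<rightarrow>\<^sub>M subprob_algebra (borel \<Otimes>\<^sub>M borel)"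
      by (intro measurable_prob_algebraD) measurable
    have inner: "p x \<in> space (subprob_algebra borel)" if "x \<in> space \<mu>" for x
      using measurable_space[OF measurable_prob_algebraD[OF p] that] .
    have d: "distr (p x \<bind> (\<lambda>y. return (borel \<Otimes>\<^sub>M borel) (x, y))) borel g =
        p x \<bind> (\<lambda>y. return borel (g (x, y)))"
      if x: "x \<in> space \<mu>" and g[measurable]: "g \<in> borel \<Otimes>\<^sub>M borel \<rightarrow>\<^sub>M borel" for x and g :: "_ \<Rightarrow> real^'m"
    proof -
      have [measurable_cong]: "sets (p x) = sets borel" using kernelD[OF p x] by simp
      show ?thesis using kernelD[OF p x]
        by (subst distr_bind[where K="borel \<Otimes>\<^sub>M borel"])
          (auto intro!: bind_cong simp: distr_return space_pair_measure)
    qed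
    have "distr (\<mu> \<bind> (\<lambda>x. p x \<bind> (\<lambda>y. return (borel \<Otimes>\<^sub>M borel) (x, y)))) borel fst =
        \<mu> \<bind> (\<lambda>x. p x \<bind> (\<lambda>y. return borel x))"
      by (subst distr_bind[OF k]) (auto simp: not_empty d intro!: bind_cong)
    also have "\<dots> = \<mu> \<bind> return borel"
      using kernelD[OF p] by (intro bind_cong refl bind_const' prob_space_imp_subprob_space prob_space_return) auto
    also have "\<dots> = \<mu>" by (rule bind_return''[OF \<mu>(2)])
    finally show "distr (\<mu> \<bind> (\<lambda>x. p x \<bind> (\<lambda>y. return (borel \<Otimes>\<^sub>M borel) (x, y)))) borel fst = \<mu>" .
    have "distr (\<mu> \<bind> (\<lambda>x. p x \<bind> (\<lambda>y. return (borel \<Otimes>\<^sub>M borel) (x, y)))) borel snd =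
        \<mu> \<bind> (\<lambda>x. p x \<bind> return borel)"
      by (subst distr_bind[OF k]) (auto simp: not_empty d intro!: bind_cong)
    also have "\<dots> = \<mu> \<bind> p"
      using kernelD[OF p] by (intro bind_cong refl bind_return'') auto
    finally show "distr (\<mu> \<bind> (\<lambda>x. p x \<bind> (\<lambda>y. return (borel \<Otimes>\<^sub>M borel) (x, y)))) borel snd = \<mu> \<bind> p" .
  qed
  show ?thesis unfolding bary_transport_def
  proof (rule INF_eq)
    fix c :: "((real^'m) \<times> (real^'m)) measure \<times> (real^'m \<Rightarrow> (real^'m) measure)"
    assume "c \<in> disint_couplings \<mu> \<nu>"
    then show "\<exists>p\<in>{p \<in> \<mu> \<rightarrow>\<^sub>M prob_algebra borel. \<mu> \<bind> p = \<nu>}.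
        (\<integral>\<^sup>+x. ennreal (bary_cost N r x (p x)) \<partial>\<mu>) \<le> (case c of (\<pi>, p) \<Rightarrow> \<integral>\<^sup>+x. ennreal (bary_cost N r x (p x)) \<partial>\<mu>)"
      using marg by (cases c) (auto simp: disint_couplings_def)
  next
    fix p assume "p \<in> {p \<in> \<mu> \<rightarrow>\<^sub>M prob_algebra borel. \<mu> \<bind> p = \<nu>}"
    then show "\<exists>c\<in>disint_couplings \<mu> \<nu>. (case c of (\<pi>, p) \<Rightarrow> \<integral>\<^sup>+x. ennreal (bary_cost N r x (p x)) \<partial>\<mu>) \<le>
        (\<integral>\<^sup>+x. ennreal (bary_cost N r x (p x)) \<partial>\<mu>)"
      using marg by (intro bexI[of _ "(\<mu> \<bind> (\<lambda>x. p x \<bind> (\<lambda>y. return (borel \<Otimes>\<^sub>M borel) (x, y))), p)"])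
        (auto simp: disint_couplings_def)
  qed
qed

lemma ennreal_INF_approx:
  fixes f :: "'a \<Rightarrow> ennreal"
  assumes "(INF x\<in>S. f x) < \<top>" "e > 0"
  shows "\<exists>x\<in>S. f x < (INF x\<in>S. f x) + ennreal e"
proof -
  obtain i where i: "(INF x\<in>S. f x) = ennreal i" "i \<ge> 0" using assms(1) by (cases "INF x\<in>S. f x") auto
  have "(INF x\<in>S. f x) < (INF x\<in>S. f x) + ennreal e"
    unfolding i using i assms(2) by (simp add: ennreal_less_iff flip: ennreal_plus)
  then show ?thesis unfolding INF_less_iff .
qed

lemma kernel_nn_integral:
  assumes p: "p \<in> \<mu> \<rightarrow>\<^sub>M prob_algebra borel" and f: "f \<in> borel_measurable borel"
  shows "(\<integral>\<^sup>+y. f y \<partial>(\<mu> \<bind> p)) = (\<integral>\<^sup>+x. \<integral>\<^sup>+y. f y \<partial>p x \<partial>\<mu>)"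
  by (rule nn_integral_bind[OF f measurable_prob_algebraD[OF p]])

lemma kernel_AE_integrable:
  fixes f :: "'b::topological_space \<Rightarrow> 'c::{banach, second_countable_topology}"
  assumes p: "p \<in> \<mu> \<rightarrow>\<^sub>M prob_algebra borel" and f: "integrable (\<mu> \<bind> p) f"
    and meas[measurable]: "f \<in> borel_measurable borel"
  shows "AE x in \<mu>. integrable (p x) f"
proof -
  have "(\<integral>\<^sup>+x. \<integral>\<^sup>+y. ennreal (norm (f y)) \<partial>p x \<partial>\<mu>) < \<infinity>"
    using f unfolding integrable_iff_bounded by (subst (asm) kernel_nn_integral[OF p]) auto
  then have "AE x in \<mu>. (\<integral>\<^sup>+y. ennreal (norm (f y)) \<partial>p x) \<noteq> \<infinity>"
    using measurable_prob_algebraD[OF p] by (intro nn_integral_PInf_AE) auto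
  then show ?thesis
    using AE_space
  proof eventually_elim
    case (elim x)
    then show ?case using kernelD(2)[OF p elim(2)] meas
      by (auto simp: integrable_iff_bounded less_top cong: measurable_cong_sets)
  qed
qed

text \<open>Disintegration for vector-valued integrands; with the identity as integrand it says that
  the barycenter of a mixture is the mean of the barycenters.\<close>

lemma integral_bind_kernel:
  fixes f :: "'b::topological_space \<Rightarrow> 'c::{banach, second_countable_topology}"
  assumes \<mu>: "prob_space \<mu>" and p: "p \<in> \<mu> \<rightarrow>\<^sub>M prob_algebra borel" and f: "integrable (\<mu> \<bind> p) f"
  shows "integrable \<mu> (\<lambda>x. \<integral>y. f y \<partial>p x)" "(\<integral>y. f y \<partial>(\<mu> \<bind> p)) = (\<integral>x. \<integral>y. f y \<partial>p x \<partial>\<mu>)"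
proof -
  interpret prob_space \<mu> by fact
  note p' = measurable_prob_algebraD[OF p]
  note p'[measurable]
  have sets_bind: "sets (\<mu> \<bind> p) = sets borel" by (rule sets_bind[OF kernelD(2)[OF p] not_empty])
  have meas: "g \<in> borel_measurable borel" if "integrable (\<mu> \<bind> p) g" for g :: "'b \<Rightarrow> 'c"
    using borel_measurable_integrable[OF that] unfolding measurable_cong_sets[OF sets_bind refl] .
  have int: "integrable \<mu> (\<lambda>x. \<integral>y. g y \<partial>p x)" if g: "integrable (\<mu> \<bind> p) g"
    for g :: "'b \<Rightarrow> 'd::{banach, second_countable_topology}"
  proof (subst integrable_iff_bounded, intro conjI)
    have [measurable]: "g \<in> borel_measurable borel"
      using borel_measurable_integrable[OF g] unfolding measurable_cong_sets[OF sets_bind refl] .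
    show "(\<lambda>x. \<integral>y. g y \<partial>p x) \<in> borel_measurable \<mu>" by measurable
    have "(\<integral>\<^sup>+x. ennreal (norm (\<integral>y. g y \<partial>p x)) \<partial>\<mu>) \<le> (\<integral>\<^sup>+x. \<integral>\<^sup>+y. ennreal (norm (g y)) \<partial>p x \<partial>\<mu>)"
      using kernel_AE_integrable[OF p g]
      by (intro nn_integral_mono_AE) (auto elim!: eventually_mono integral_norm_bound_ennreal)
    also have "\<dots> < \<infinity>"
      using g unfolding integrable_iff_bounded by (subst (asm) kernel_nn_integral[OF p]) auto
    finally show "(\<integral>\<^sup>+x. ennreal (norm (\<integral>y. g y \<partial>p x)) \<partial>\<mu>) < \<infinity>" .
  qed
  show "integrable \<mu> (\<lambda>x. \<integral>y. f y \<partial>p x)" by (rule int[OF f])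
  show "(\<integral>y. f y \<partial>(\<mu> \<bind> p)) = (\<integral>x. \<integral>y. f y \<partial>p x \<partial>\<mu>)"
    using f
  proof (induction rule: integrable_induct)
    case (base A c)
    then have A: "A \<in> sets borel" using sets_bind by simp
    have "measure (\<mu> \<bind> p) A = (\<integral>x. measure (p x) A \<partial>\<mu>)"
      by (rule measure_bind[OF p' A])
    moreover have "(\<integral>x. \<integral>y. indicator A y *\<^sub>R c \<partial>p x \<partial>\<mu>) = (\<integral>x. measure (p x) A *\<^sub>R c \<partial>\<mu>)"
      using kernelD[OF p] A
      by (intro Bochner_Integration.integral_cong refl)
        (auto simp: prob_space_def finite_measure.emeasure_finite less_top[symmetric])
    moreover have "integrable \<mu> (\<lambda>x. measure (p x) A)"
      using A kernelD(1)[OF p] by (intro integrable_const_bound[of _ 1]) (auto simp: prob_space.prob_le_1)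
    ultimately show ?case using base by simp
  next
    case (add f g)
    have "(\<integral>x. \<integral>y. f y + g y \<partial>p x \<partial>\<mu>) = (\<integral>x. (\<integral>y. f y \<partial>p x) + (\<integral>y. g y \<partial>p x) \<partial>\<mu>)"
    proof (rule integral_cong_AE)
      show "AE x in \<mu>. (\<integral>y. f y + g y \<partial>p x) = (\<integral>y. f y \<partial>p x) + (\<integral>y. g y \<partial>p x)"
        using kernel_AE_integrable[OF p add(1) meas[OF add(1)]] kernel_AE_integrable[OF p add(2) meas[OF add(2)]]
        by eventually_elim simp
    qed (use int[OF add(1)] int[OF add(2)] int[OF Bochner_Integration.integrable_add[OF add(1,2)]] in auto)
    then show ?case using add int[OF add(1)] int[OF add(2)] by simp
  next
    case (lim f s)
    have "(\<lambda>i. \<integral>y. s i y \<partial>(\<mu> \<bind> p)) \<longlonglongrightarrow> (\<integral>y. f y \<partial>(\<mu> \<bind> p))"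
      using lim.hyps by (intro integral_dominated_convergence[where w="\<lambda>y. 2 * norm (f y)"]) auto
    moreover have "(\<lambda>i. \<integral>x. \<integral>y. s i y \<partial>p x \<partial>\<mu>) \<longlonglongrightarrow> (\<integral>x. \<integral>y. f y \<partial>p x \<partial>\<mu>)"
    proof (rule integral_dominated_convergence[where w="\<lambda>x. 2 * (\<integral>y. norm (f y) \<partial>p x)"])
      have nf: "integrable (\<mu> \<bind> p) (\<lambda>y. norm (f y))" using lim.hyps(4) by auto
      show "integrable \<mu> (\<lambda>x. 2 * (\<integral>y. norm (f y) \<partial>p x))" using int[OF nf] by simp
      have sp: "space (\<mu> \<bind> p) = UNIV" using sets_eq_imp_space_eq[OF sets_bind] by simp
      have AEf: "AE x in \<mu>. integrable (p x) f" by (rule kernel_AE_integrable[OF p lim.hyps(4) meas[OF lim.hyps(4)]])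
      show "AE x in \<mu>. (\<lambda>i. \<integral>y. s i y \<partial>p x) \<longlonglongrightarrow> (\<integral>y. f y \<partial>p x)"
        using AEf AE_space
      proof eventually_elim
        case (elim x)
        have "g \<in> borel_measurable (p x)" if "integrable (\<mu> \<bind> p) g" for g :: "'b \<Rightarrow> 'c"
          using meas[OF that] kernelD(2)[OF p elim(2)] by (simp cong: measurable_cong_sets)
        then show ?case using lim.hyps elim sp
          by (intro integral_dominated_convergence[where w="\<lambda>y. 2 * norm (f y)"]) auto
      qed
      show "AE x in \<mu>. norm (\<integral>y. s i y \<partial>p x) \<le> 2 * (\<integral>y. norm (f y) \<partial>p x)" for i
        using AEf kernel_AE_integrable[OF p lim.hyps(1) meas[OF lim.hyps(1)], of i]
      proof eventually_elim
        case (elim x)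
        have "norm (\<integral>y. s i y \<partial>p x) \<le> (\<integral>y. norm (s i y) \<partial>p x)" by (rule integral_norm_bound)
        also have "\<dots> \<le> (\<integral>y. 2 * norm (f y) \<partial>p x)"
          using elim lim.hyps(3) sp by (intro integral_mono) auto
        finally show ?case by simp
      qed
    qed (use int[OF lim.hyps(1)] int[OF lim.hyps(4)] in auto)
    ultimately show ?case unfolding lim.IH by (rule LIMSEQ_unique)
  qed
qed

section \<open>Gluing of couplings and the equivalence of (4) and (5)\<close>

context norm_power
begin

text \<open>A kernel \<open>p\<close> from \<nu>2 to \<mu> is followed by a kernel \<open>q\<close>
  from \<mu> to \<nu>1. The displacement from \<open>x\<close> to the barycenter of the composition
  is the displacement under \<open>p\<close> plus the mean, over \<open>z\<close> drawn from
  \<open>p x\<close>, of the displacement of \<open>z\<close> under \<open>q\<close>. Weighted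
  convexity separates the two terms, Jensen moves the second mean outside the cost, and averaging
  \<open>p x\<close> over \<nu>2 restores \<mu>.\<close>

lemma bary_transport_triangle:
  assumes \<nu>1: "\<nu>1 \<in> P1" and \<nu>2: "\<nu>2 \<in> P1" and \<mu>: "\<mu> \<in> P1" and s: "0 < s" "s < 1"
  shows "bary_transport N r \<nu>1 \<nu>2 \<le>
    ennreal ((1 - s) powr (1 - r)) * bary_transport N r \<mu> \<nu>2 + ennreal (s powr (1 - r)) * bary_transport N r \<nu>1 \<mu>"
proof -
  note \<nu>2D = P1D[OF \<nu>2] and \<mu>D = P1D[OF \<mu>] and \<nu>1D = P1D[OF \<nu>1]
  interpret \<nu>2: prob_space \<nu>2 by (rule \<nu>2D)
  note [measurable_cong] = \<nu>2D(2) \<mu>D(2)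
  let ?c1 = "ennreal ((1 - s) powr (1 - r))" and ?c2 = "ennreal (s powr (1 - r))"
  let ?K1 = "{p \<in> \<nu>2 \<rightarrow>\<^sub>M prob_algebra borel. \<nu>2 \<bind> p = \<mu>}"
  let ?K2 = "{q \<in> \<mu> \<rightarrow>\<^sub>M prob_algebra borel. \<mu> \<bind> q = \<nu>1}"
  have main: "bary_transport N r \<nu>1 \<nu>2 \<le> ?c1 * (\<integral>\<^sup>+x. ennreal (bary_cost N r x (p x)) \<partial>\<nu>2)
      + ?c2 * (\<integral>\<^sup>+z. ennreal (bary_cost N r z (q z)) \<partial>\<mu>)"
    if p: "p \<in> ?K1" and q: "q \<in> ?K2" for p q
  proof -
    have pm[measurable]: "p \<in> \<nu>2 \<rightarrow>\<^sub>M prob_algebra borel" and pb: "\<nu>2 \<bind> p = \<mu>" using p by auto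
    have qm: "q \<in> \<mu> \<rightarrow>\<^sub>M prob_algebra borel" and qb: "\<mu> \<bind> q = \<nu>1" using q by auto
    have qm'[measurable]: "q \<in> borel \<rightarrow>\<^sub>M prob_algebra borel"
      using qm measurable_cong_sets[OF \<mu>D(2) refl] by blast
    note [measurable] = measurable_prob_algebraD[OF pm] measurable_prob_algebraD[OF qm']
    define pq where "pq x = p x \<bind> q" for x
    have pqm: "pq \<in> \<nu>2 \<rightarrow>\<^sub>M prob_algebra borel"
      unfolding pq_def by (rule measurable_bind_prob_space[OF pm qm'])
    have pqb: "\<nu>2 \<bind> pq = \<nu>1"
      unfolding pq_def using bind_assoc[OF measurable_prob_algebraD[OF pm] measurable_prob_algebraD[OF qm']] pb qb by simp
    have "bary_transport N r \<nu>1 \<nu>2 \<le> (\<integral>\<^sup>+x. ennreal (bary_cost N r x (pq x)) \<partial>\<nu>2)"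
      unfolding bary_transport_kernel[OF \<nu>2D(1,2)] using pqm pqb by (intro INF_lower) auto
    also have "\<dots> \<le> (\<integral>\<^sup>+x. ?c1 * ennreal (bary_cost N r x (p x)) + ?c2 * (\<integral>\<^sup>+z. ennreal (bary_cost N r z (q z)) \<partial>p x) \<partial>\<nu>2)"
    proof (rule nn_integral_mono_AE)
      have "AE x in \<nu>2. integrable (p x) (\<lambda>z. z)"
        by (rule kernel_AE_integrable[OF pm]) (simp_all only: pb \<mu>D(4) measurable_ident_sets)
      moreover have "AE x in \<nu>2. integrable (pq x) (\<lambda>z. z)"
        by (rule kernel_AE_integrable[OF pqm]) (simp_all only: pqb \<nu>1D(4) measurable_ident_sets)
      ultimately show "AE x in \<nu>2. ennreal (bary_cost N r x (pq x)) \<le>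
          ?c1 * ennreal (bary_cost N r x (p x)) + ?c2 * (\<integral>\<^sup>+z. ennreal (bary_cost N r z (q z)) \<partial>p x)"
        using AE_space
      proof eventually_elim
        case (elim x)
        note px = kernelD[OF pm elim(3)]
        interpret px: prob_space "p x" by (rule px)
        have qx: "q \<in> p x \<rightarrow>\<^sub>M prob_algebra borel" using qm' px(2) by (simp cong: measurable_cong_sets)
        note ib = integral_bind_kernel[OF px(1) qx elim(2)[unfolded pq_def]]
        have "x - (\<integral>y. y \<partial>pq x) = (x - (\<integral>z. z \<partial>p x)) + (\<integral>z. z - (\<integral>y. y \<partial>q z) \<partial>p x)"
          unfolding pq_def ib(2) using elim(1) ib(1) by simp
        from N_powr_add_le[OF s, of "x - (\<integral>z. z \<partial>p x)" "\<integral>z. z - (\<integral>y. y \<partial>q z) \<partial>p x", folded this]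
        have "bary_cost N r x (pq x) \<le> (1 - s) powr (1 - r) * N (x - (\<integral>z. z \<partial>p x)) powr r
            + s powr (1 - r) * N (\<integral>z. z - (\<integral>y. y \<partial>q z) \<partial>p x) powr r"
          unfolding bary_cost_def .
        then have "ennreal (bary_cost N r x (pq x)) \<le> ?c1 * ennreal (bary_cost N r x (p x))
            + ?c2 * ennreal (N (\<integral>z. z - (\<integral>y. y \<partial>q z) \<partial>p x) powr r)"
          by (simp add: bary_cost_def ennreal_leI flip: ennreal_mult ennreal_plus)
        also have "ennreal (N (\<integral>z. z - (\<integral>y. y \<partial>q z) \<partial>p x) powr r) \<le> (\<integral>\<^sup>+z. ennreal (bary_cost N r z (q z)) \<partial>p x)"
          unfolding bary_cost_def using elim(1) ib(1) by (intro N_powr_expectation_le px(1)) auto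
        finally show ?case by (simp add: mult_left_mono add_left_mono)
      qed
    qed
    also have "\<dots> = ?c1 * (\<integral>\<^sup>+x. ennreal (bary_cost N r x (p x)) \<partial>\<nu>2) + ?c2 * (\<integral>\<^sup>+x. \<integral>\<^sup>+z. ennreal (bary_cost N r z (q z)) \<partial>p x \<partial>\<nu>2)"
      unfolding bary_cost_def by (simp add: nn_integral_add nn_integral_cmult)
    also have "(\<integral>\<^sup>+x. \<integral>\<^sup>+z. ennreal (bary_cost N r z (q z)) \<partial>p x \<partial>\<nu>2) = (\<integral>\<^sup>+z. ennreal (bary_cost N r z (q z)) \<partial>\<mu>)"
      unfolding pb[symmetric] bary_cost_def by (subst kernel_nn_integral[OF pm]) auto
    finally show ?thesis .
  qed
  note eq = bary_transport_kernel[OF \<nu>2D(1,2), of N r \<mu>] bary_transport_kernel[OF \<mu>D(1,2), of N r \<nu>1]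
  have c: "(1 - s) powr (1 - r) > 0" "s powr (1 - r) > 0" using s by auto
  show ?thesis
  proof (rule ennreal_le_epsilon)
    fix e :: real
    assume fin: "?c1 * bary_transport N r \<mu> \<nu>2 + ?c2 * bary_transport N r \<nu>1 \<mu> < \<top>" and e: "0 < e"
    have fin': "bary_transport N r \<mu> \<nu>2 < \<top>" "bary_transport N r \<nu>1 \<mu> < \<top>"
      using fin c by (auto simp: ennreal_mult_less_top ennreal_add_eq_top less_top)
    define d where "d = e / ((1 - s) powr (1 - r) + s powr (1 - r))"
    have "(1 - s) powr (1 - r) + s powr (1 - r) > 0" using c by linarith
    then have d: "d > 0" "(1 - s) powr (1 - r) * d + s powr (1 - r) * d = e"
      unfolding d_def distrib_right[symmetric] using e by auto
    obtain p where p: "p \<in> ?K1" "(\<integral>\<^sup>+x. ennreal (bary_cost N r x (p x)) \<partial>\<nu>2) < bary_transport N r \<mu> \<nu>2 + ennreal d"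
      using ennreal_INF_approx[OF fin'(1)[unfolded eq] d(1)] unfolding eq by blast
    obtain q where q: "q \<in> ?K2" "(\<integral>\<^sup>+z. ennreal (bary_cost N r z (q z)) \<partial>\<mu>) < bary_transport N r \<nu>1 \<mu> + ennreal d"
      using ennreal_INF_approx[OF fin'(2)[unfolded eq] d(1)] unfolding eq by blast
    have "bary_transport N r \<nu>1 \<nu>2 \<le> ?c1 * (bary_transport N r \<mu> \<nu>2 + ennreal d) + ?c2 * (bary_transport N r \<nu>1 \<mu> + ennreal d)"
      using p(2) q(2) by (intro order_trans[OF main[OF p(1) q(1)]] add_mono mult_left_mono) auto
    also have "\<dots> = ?c1 * bary_transport N r \<mu> \<nu>2 + ?c2 * bary_transport N r \<nu>1 \<mu> + (?c1 * ennreal d + ?c2 * ennreal d)"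
      by (simp add: algebra_simps)
    also have "?c1 * ennreal d + ?c2 * ennreal d = ennreal e"
      using d c by (simp flip: ennreal_mult ennreal_plus)
    finally show "bary_transport N r \<nu>1 \<nu>2 \<le> ?c1 * bary_transport N r \<mu> \<nu>2 + ?c2 * bary_transport N r \<nu>1 \<mu> + ennreal e" .
  qed
qed

lemma divide_powr_eq: "x > 0 \<Longrightarrow> a / x powr (r - 1) = x powr (1 - r) * a"
  by (simp add: powr_diff)

text \<open>Putting \<mu> in place of one of the two measures removes one entropy; letting
  \<open>s\<close> tend to \<open>1\<close> or to \<open>0\<close> then turns the remaining constant
  into \<open>a\<close>. In the other direction the triangle inequality passes through \<mu> and has
  exactly the weights that occur in (4).\<close>

lemma T_family_iff:
  assumes \<mu>: "\<mu> \<in> P1" and a: "a > 0"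
  shows "T_family N r \<mu> a \<longleftrightarrow> T_plus_minus N r \<mu> a"
proof
  assume T: "T_family N r \<mu> a"
  have ent0: "rel_entropy \<mu> \<mu> = 0" using P1D(1)[OF \<mu>] by (rule rel_entropy_self)
  show "T_plus_minus N r \<mu> a"
    unfolding T_plus_minus_def T_plus_def T_minus_def
  proof (intro conjI ballI)
    fix \<nu> :: "(real^'m) measure" assume \<nu>: "\<nu> \<in> P1"
    show "bary_transport N r \<nu> \<mu> \<le> ennreal a * rel_entropy \<nu> \<mu>"
    proof (cases "rel_entropy \<nu> \<mu>")
      case (real h)
      have "((\<lambda>s. ennreal (a / s powr (r - 1) * h)) \<longlongrightarrow> ennreal (a / 1 powr (r - 1) * h)) (at_left 1)"
        by (intro tendsto_intros) auto
      moreover have "\<forall>\<^sub>F s in at_left 1. bary_transport N r \<nu> \<mu> \<le> ennreal (a / s powr (r - 1) * h)"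
        unfolding eventually_at_left_field
      proof (intro exI[of _ 0] conjI allI impI)
        fix s :: real assume s: "0 < s" "s < 1"
        then have "bary_transport N r \<nu> \<mu> \<le> ennreal (a / s powr (r - 1)) * rel_entropy \<nu> \<mu>
            + ennreal (a / (1 - s) powr (r - 1)) * rel_entropy \<mu> \<mu>"
          using T \<nu> \<mu> by (auto simp: T_family_def T_ineq_def)
        then show "bary_transport N r \<nu> \<mu> \<le> ennreal (a / s powr (r - 1) * h)"
          using real a by (subst ennreal_mult) (simp_all add: ent0)
      qed simp
      ultimately have "bary_transport N r \<nu> \<mu> \<le> ennreal (a / 1 powr (r - 1) * h)"
        by (intro tendsto_lowerbound) auto
      then show ?thesis using real a by (subst (asm) ennreal_mult) simp_all
    qed (use a in \<open>simp add: ennreal_mult_top\<close>)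
    show "bary_transport N r \<mu> \<nu> \<le> ennreal a * rel_entropy \<nu> \<mu>"
    proof (cases "rel_entropy \<nu> \<mu>")
      case (real h)
      have "((\<lambda>s. ennreal (a / (1 - s) powr (r - 1) * h)) \<longlongrightarrow> ennreal (a / (1 - 0) powr (r - 1) * h)) (at_right 0)"
        by (intro tendsto_intros) auto
      moreover have "\<forall>\<^sub>F s in at_right 0. bary_transport N r \<mu> \<nu> \<le> ennreal (a / (1 - s) powr (r - 1) * h)"
        unfolding eventually_at_right_field
      proof (intro exI[of _ 1] conjI allI impI)
        fix s :: real assume s: "0 < s" "s < 1"
        then have "bary_transport N r \<mu> \<nu> \<le> ennreal (a / s powr (r - 1)) * rel_entropy \<mu> \<mu>
            + ennreal (a / (1 - s) powr (r - 1)) * rel_entropy \<nu> \<mu>"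
          using T \<nu> \<mu> by (auto simp: T_family_def T_ineq_def)
        then show "bary_transport N r \<mu> \<nu> \<le> ennreal (a / (1 - s) powr (r - 1) * h)"
          using real a by (subst ennreal_mult) (simp_all add: ent0)
      qed simp
      ultimately have "bary_transport N r \<mu> \<nu> \<le> ennreal (a / (1 - 0) powr (r - 1) * h)"
        by (intro tendsto_lowerbound) auto
      then show ?thesis using real a by (subst (asm) ennreal_mult) simp_all
    qed (use a in \<open>simp add: ennreal_mult_top\<close>)
  qed
next
  assume T: "T_plus_minus N r \<mu> a"
  show "T_family N r \<mu> a"
    unfolding T_family_def T_ineq_def
  proof (intro ballI)
    fix s :: real and \<nu>1 \<nu>2 :: "(real^'m) measure"
    assume s: "s \<in> {0<..<1}" and \<nu>: "\<nu>1 \<in> P1" "\<nu>2 \<in> P1"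
    have "bary_transport N r \<nu>1 \<nu>2 \<le> ennreal ((1 - s) powr (1 - r)) * bary_transport N r \<mu> \<nu>2
        + ennreal (s powr (1 - r)) * bary_transport N r \<nu>1 \<mu>"
      using s \<nu> \<mu> by (intro bary_transport_triangle) auto
    also have "\<dots> \<le> ennreal ((1 - s) powr (1 - r)) * (ennreal a * rel_entropy \<nu>2 \<mu>)
        + ennreal (s powr (1 - r)) * (ennreal a * rel_entropy \<nu>1 \<mu>)"
      using T \<nu> unfolding T_plus_minus_def T_plus_def T_minus_def by (intro add_mono mult_left_mono) auto
    also have "\<dots> = ennreal (a / s powr (r - 1)) * rel_entropy \<nu>1 \<mu> + ennreal (a / (1 - s) powr (r - 1)) * rel_entropy \<nu>2 \<mu>"
      using s a by (simp add: divide_powr_eq ennreal_mult mult.assoc add.commute)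
    finally show "bary_transport N r \<nu>1 \<nu>2 \<le> ennreal (a / s powr (r - 1)) * rel_entropy \<nu>1 \<mu>
        + ennreal (a / (1 - s) powr (r - 1)) * rel_entropy \<nu>2 \<mu>" .
  qed
qed

end

section \<open>Concentration on product spaces\<close>

text \<open>The median produced is the smallest one, the infimum of the levels at which the
  distribution function reaches one half; right continuity gives one inequality and left limits the
  other. The upper bound \<open>c\<close> matters: a median that is at most \<open>0\<close> lets
  constants pass unchanged from (2) to (1).\<close>

lemma (in prob_space) exists_median_le:
  assumes f[measurable]: "f \<in> borel_measurable M" and c: "prob {x \<in> space M. f x \<le> c} \<ge> 1 / 2"
  shows "\<exists>m\<le>c. is_median M f m"
proof -
  let ?D = "distr M borel f"
  interpret D: prob_space ?D by (rule prob_space_distr[OF f])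
  interpret D: finite_borel_measure ?D by standard auto
  have F: "cdf ?D x = prob {y \<in> space M. f y \<le> x}" for x
    by (auto simp: cdf_def measure_distr intro!: arg_cong[where f=prob])
  define S where "S = {x. cdf ?D x \<ge> 1 / 2}"
  have "\<forall>\<^sub>F x in at_bot. cdf ?D x < 1 / 2" by (rule order_tendstoD[OF D.cdf_lim_at_bot]) simp
  then obtain l where l: "\<And>x. x \<le> l \<Longrightarrow> cdf ?D x < 1 / 2" by (auto simp: eventually_at_bot_linorder)
  have bdd: "bdd_below S"
  proof (rule bdd_belowI[of _ l])
    fix x assume "x \<in> S"
    then show "l \<le> x" using l[of x] by (cases "x \<le> l") (auto simp: S_def)
  qed
  have cS: "c \<in> S" using c by (simp add: S_def F)
  define m where "m = Inf S"
  have mc: "m \<le> c" unfolding m_def by (rule cInf_lower[OF cS bdd])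
  have "\<forall>\<^sub>F x in at_right m. 1 / 2 \<le> cdf ?D x"
    unfolding eventually_at_right_field
  proof (intro exI[of _ "m + 1"] conjI allI impI)
    fix y assume "m < y" "y < m + 1"
    then obtain z where "z \<in> S" "z < y" using cInf_lessD[of S y] cS by (auto simp: m_def)
    then show "1 / 2 \<le> cdf ?D y" using D.cdf_nondecreasing[of z y] by (auto simp: S_def)
  qed simp
  then have 1: "1 / 2 \<le> cdf ?D m"
    using D.cdf_is_right_cont[of m] by (intro tendsto_lowerbound[of "cdf ?D" _ "at_right m"]) (auto simp: continuous_within)
  have "\<forall>\<^sub>F x in at_left m. cdf ?D x \<le> 1 / 2"
    unfolding eventually_at_left_field
  proof (intro exI[of _ "m - 1"] conjI allI impI)
    fix y assume "m - 1 < y" "y < m"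
    then have "y \<notin> S" using cInf_lower[OF _ bdd] by (force simp: m_def)
    then show "cdf ?D y \<le> 1 / 2" by (simp add: S_def)
  qed simp
  then have "measure ?D {..<m} \<le> 1 / 2"
    by (intro tendsto_upperbound[OF D.cdf_at_left]) auto
  then have "prob {x \<in> space M. f x < m} \<le> 1 / 2"
    by (auto simp: measure_distr vimage_def Int_def conj_commute)
  moreover have "prob {x \<in> space M. f x < m} + prob {x \<in> space M. f x \<ge> m} = 1"
    using prob_compl[of "{x \<in> space M. f x < m}"]
    by (auto simp: set_diff_eq not_less intro!: arg_cong[where f=prob] cong: conj_cong)
  ultimately have "is_median M f m" using 1 by (simp add: is_median_def F)
  then show ?thesis using mc by blast
qed

locale power_prob =
  fixes \<mu> :: "(real ^ 'm) measure"
  assumes prob: "prob_space \<mu>" and sets_borel [measurable_cong]: "sets \<mu> = sets borel"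
begin

abbreviation "P \<equiv> power_measure \<mu>"

lemma sets_P [measurable_cong]: "sets (P n) = sets (tuple_borel n)"
  by (intro sets_PiM_cong refl sets_borel)

lemma space_P [simp]: "space (P n) = tuples n"
  using sets_eq_imp_space_eq[OF sets_P[of n]] by simp

lemma space_\<mu> [simp]: "space \<mu> = UNIV"
  using sets_eq_imp_space_eq[OF sets_borel] by simp

lemma prob_P: "prob_space (P n)"
  by (intro prob_space_PiM prob)

lemma measurable_P: "f \<in> borel_measurable (tuple_borel n) \<Longrightarrow> f \<in> borel_measurable (P n)"
  by (simp cong: measurable_cong_sets add: sets_P)

sublocale prod: product_sigma_finite "\<lambda>_::nat. \<mu>"
  by (simp add: product_sigma_finite_def prob prob_space_imp_sigma_finite)

lemma nn_integral_P_Suc: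
  assumes "f \<in> borel_measurable (P (Suc n))"
  shows "(\<integral>\<^sup>+x. f x \<partial>P (Suc n)) = (\<integral>\<^sup>+x. \<integral>\<^sup>+y. f (x(n := y)) \<partial>\<mu> \<partial>P n)"
  using assms unfolding lessThan_Suc by (intro prod.product_nn_integral_insert) auto

lemma measurable_add_coord:
  "(\<lambda>(x, y). x(n := y)) \<in> P n \<Otimes>\<^sub>M \<mu> \<rightarrow>\<^sub>M P (Suc n)"
  unfolding lessThan_Suc by (rule measurable_add_dim)

lemma measurable_coord: "i < n \<Longrightarrow> (\<lambda>x. x i) \<in> borel_measurable (P n)"
  by (intro measurable_P measurable_component_singleton) auto

lemma measure_compl:
  "A \<in> sets (P n) \<Longrightarrow> measure (P n) (tuples n - A) = 1 - measure (P n) A"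
  using prob_space.prob_compl[OF prob_P, of A n] by simp

section \<open>Nearly symmetric linear functionals\<close>

definition Dirac :: bool where "Dirac \<longleftrightarrow> (\<exists>c. AE y in \<mu>. y = c)"

text \<open>The exceptional case in which (1) at \<open>t = 0\<close> puts no lower bound on
  \<open>b\<close>: a set of measure at least one half already has full measure.\<close>

lemma Dirac_imp_measure_1:
  assumes "Dirac" and A: "A \<in> sets (P n)" "measure (P n) A > 0"
  shows "measure (P n) A = 1"
proof -
  interpret Pn: prob_space "P n" by (rule prob_P)
  obtain c where c: "AE y in \<mu>. y = c" using assms(1) by (auto simp: Dirac_def)
  let ?p = "\<lambda>i\<in>{..<n}. c"
  have "AE x in P n. \<forall>i\<in>{..<n}. x i = c"
    using AE_PiM_component[of "{..<n}" "\<lambda>_. \<mu>" _ "\<lambda>y. y = c"] prob c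
    by (intro AE_finite_allI) auto
  then have p: "AE x in P n. x = ?p"
    using AE_space by eventually_elim (auto simp: in_tuples_iff fun_eq_iff)
  have "?p \<in> A"
  proof (rule ccontr)
    assume "?p \<notin> A"
    then have "AE x in P n. x \<notin> A" using p by (auto elim!: eventually_mono)
    then have "Pn.prob A = 0" using A(1) by (subst Pn.prob_eq_0) auto
    then show False using A(2) by simp
  qed
  then have "AE x in P n. x \<in> A" using p by (auto elim!: eventually_mono)
  then show ?thesis using A(1) by (subst Pn.prob_eq_1) auto
qed

text \<open>Exchanges \<open>2 * j\<close> and \<open>2 * j + 1\<close>. This preserves the product
  measure, so a linear functional whose weights change sign under the exchange has the same law as
  its negative.\<close>

definition swap_pairs :: "nat \<Rightarrow> nat" where "swap_pairs i = (if even i then Suc i else i - 1)"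

lemma swap_pairs_less: "i < 2 * k \<Longrightarrow> swap_pairs i < 2 * k"
  by (auto simp: swap_pairs_def elim!: evenE)

lemma swap_pairs_swap_pairs [simp]: "swap_pairs (swap_pairs i) = i"
  by (auto simp: swap_pairs_def elim!: oddE)

definition lin :: "(nat \<Rightarrow> real^'m) \<Rightarrow> nat \<Rightarrow> (nat \<Rightarrow> real^'m) \<Rightarrow> real"
  where "lin v n x = (\<Sum>i<n. v i \<bullet> x i)"

lemma lin_measurable [measurable]: "lin v n \<in> borel_measurable (P n)"
  unfolding lin_def by (intro borel_measurable_sum borel_measurable_inner measurable_coord) auto

lemma prob_P_swap:
  assumes A: "A \<in> sets (P (2 * k))"
  shows "measure (P (2 * k)) {x \<in> tuples (2 * k). (\<lambda>i\<in>{..<2*k}. x (swap_pairs i)) \<in> A} = measure (P (2 * k)) A"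
proof -
  let ?T = "\<lambda>x. \<lambda>i\<in>{..<2*k}. x (swap_pairs i)"
  have d: "distr (P (2*k)) (P (2*k)) ?T = P (2*k)"
    using swap_pairs_less by (intro distr_PiM_reindex prob) (auto intro!: inj_on_inverseI[where g=swap_pairs])
  have m: "?T \<in> P (2*k) \<rightarrow>\<^sub>M P (2*k)"
    using swap_pairs_less by (intro measurable_restrict measurable_component_singleton) auto
  have "measure (P (2*k)) A = measure (distr (P (2*k)) (P (2*k)) ?T) A" by (simp only: d)
  also have "\<dots> = measure (P (2 * k)) (?T -` A \<inter> space (P (2 * k)))" by (rule measure_distr[OF m A])
  also have "?T -` A \<inter> space (P (2 * k)) = {x \<in> tuples (2 * k). ?T x \<in> A}" by auto
  finally show ?thesis by simp
qed

lemma prob_lin_symmetric: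
  assumes v: "\<And>i. i < 2 * k \<Longrightarrow> v (swap_pairs i) = - v i"
  shows "measure (P (2*k)) {x \<in> tuples (2*k). lin v (2*k) x > 0} = measure (P (2*k)) {x \<in> tuples (2*k). lin v (2*k) x < 0}"
proof -
  have lin: "lin v (2*k) (\<lambda>i\<in>{..<2*k}. x (swap_pairs i)) = - lin v (2*k) x" for x
  proof -
    have "lin v (2*k) (\<lambda>i\<in>{..<2*k}. x (swap_pairs i)) = (\<Sum>i<2*k. v i \<bullet> x (swap_pairs i))"
      by (simp add: lin_def)
    also have "\<dots> = (\<Sum>i<2*k. v (swap_pairs i) \<bullet> x i)"
      using swap_pairs_less by (intro sum.reindex_bij_witness[of _ swap_pairs swap_pairs]) auto
    also have "\<dots> = - lin v (2*k) x" using v by (simp add: lin_def sum_negf)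
    finally show ?thesis .
  qed
  have "{x \<in> space (P (2*k)). lin v (2*k) x > 0} \<in> sets (P (2*k))" by measurable
  then have "measure (P (2*k)) {x \<in> tuples (2*k). lin v (2*k) x > 0}
      = measure (P (2 * k)) {x \<in> tuples (2 * k). (\<lambda>i\<in>{..<2*k}. x (swap_pairs i)) \<in> {x \<in> tuples (2*k). lin v (2*k) x > 0}}"
    by (subst prob_P_swap) auto
  also have "{x \<in> tuples (2 * k). (\<lambda>i\<in>{..<2*k}. x (swap_pairs i)) \<in> {x \<in> tuples (2*k). lin v (2*k) x > 0}}
      = {x \<in> tuples (2*k). lin v (2*k) x < 0}"
    unfolding mem_Collect_eq lin by (auto simp: in_tuples_iff)
  finally show ?thesis .
qed

text \<open>The events \<open>Z + c Y = 0 \<noteq> Y\<close> are disjoint for different \<open>c\<close>.\<close>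

lemma (in prob_space) exists_weight_small_atom:
  assumes Z[measurable]: "Z \<in> borel_measurable M" and Y[measurable]: "Y \<in> borel_measurable M" and e: "e > 0"
  shows "\<exists>c::real. prob {x \<in> space M. Z x + c * Y x = 0} \<le> prob {x \<in> space M. Z x = 0 \<and> Y x = 0} + e"
proof (rule ccontr)
  assume H: "\<not> ?thesis"
  obtain K :: nat where K: "1 < real K * e" using reals_Archimedean3[OF e] by blast
  define E where "E c = {x \<in> space M. Z x + real c * Y x = 0 \<and> Y x \<noteq> 0}" for c :: nat
  have [measurable]: "E c \<in> events" for c unfolding E_def by measurable
  have big: "prob (E c) > e" for c
  proof -
    have "prob {x \<in> space M. Z x + real c * Y x = 0} = prob ({x \<in> space M. Z x = 0 \<and> Y x = 0} \<union> E c)"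
      by (intro arg_cong[where f=prob]) (auto simp: E_def)
    also have "\<dots> \<le> prob {x \<in> space M. Z x = 0 \<and> Y x = 0} + prob (E c)"
      by (intro measure_Un_le) auto
    finally show ?thesis using H by (auto simp: not_le dest: spec[of _ "real c"])
  qed
  have "(\<Sum>c<K. prob (E c)) = prob (\<Union>c<K. E c)"
  proof (intro finite_measure_finite_Union[symmetric])
    have "c = d" if "x \<in> E c" "x \<in> E d" for x c d
    proof -
      have "real c * Y x = real d * Y x" using that unfolding E_def mem_Collect_eq by linarith
      then show ?thesis using that by (simp add: E_def)
    qed
    then show "disjoint_family_on E {..<K}" unfolding disjoint_family_on_def by blast
  qed auto
  also have "\<dots> \<le> 1" by (rule prob_le_1)
  finally have "(\<Sum>c<K. prob (E c)) \<le> 1" .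
  moreover have "(\<Sum>c<K. prob (E c)) \<ge> (\<Sum>c<K. e)" using big by (intro sum_mono) (simp add: less_imp_le)
  ultimately show False using K by simp
qed

text \<open>The probability that two independent samples have the same component along
  \<open>b\<close>. It is the factor by which the atom at \<open>0\<close> of a symmetric functional
  can be reduced when one more pair of coordinates is added.\<close>

definition coincidence :: "real^'m \<Rightarrow> real"
  where "coincidence b = measure (\<mu> \<Otimes>\<^sub>M \<mu>) {z \<in> space (\<mu> \<Otimes>\<^sub>M \<mu>). b \<bullet> fst z = b \<bullet> snd z}"

lemma coincidence_less_1:
  assumes "\<nexists>c. AE y in \<mu>. b \<bullet> y = c"
  shows "coincidence b < 1"
proof (rule ccontr)
  interpret \<mu>: prob_space \<mu> by (rule prob)
  interpret pair: pair_prob_space \<mu> \<mu> ..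
  assume "\<not> coincidence b < 1"
  then have "coincidence b = 1" using pair.prob_le_1 by (simp add: coincidence_def antisym)
  then have "AE z in \<mu> \<Otimes>\<^sub>M \<mu>. z \<in> {z \<in> space (\<mu> \<Otimes>\<^sub>M \<mu>). b \<bullet> fst z = b \<bullet> snd z}"
    unfolding coincidence_def by (subst (asm) pair.prob_eq_1) auto
  then have "AE z in \<mu> \<Otimes>\<^sub>M \<mu>. b \<bullet> fst z = b \<bullet> snd z" by (auto elim!: eventually_mono)
  from pair.AE_pair[OF this] have "AE x in \<mu>. AE y in \<mu>. b \<bullet> x = b \<bullet> y" by simp
  then obtain x where "AE y in \<mu>. b \<bullet> x = b \<bullet> y"
    using \<mu>.AE_contr by (metis (mono_tags, lifting) eventually_mono)
  then show False using assms by (metis (mono_tags, lifting) eventually_mono)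
qed

text \<open>The new pair contributes \<open>c * Y\<close> with \<open>Y\<close> the difference of
  the \<open>b\<close>-components of its two samples. By the choice of \<open>c\<close>, the event
  \<open>Z + c * Y = 0\<close> is hardly more likely than \<open>Z = 0\<close> and
  \<open>Y = 0\<close> together. \<open>Z\<close> depends on the earlier coordinates only, so the
  probability of this intersection is a product, with second factor
  \<open>coincidence b\<close>.\<close>

lemma prob_lin_eq_0_le:
  "e > 0 \<Longrightarrow> \<exists>v. (\<forall>i<2*k. v (swap_pairs i) = - v i) \<and>
    measure (P (2*k)) {x \<in> tuples (2*k). lin v (2*k) x = 0} \<le> coincidence b ^ k + e"
proof (induction k arbitrary: e)
  case 0
  interpret P0: prob_space "P (2*0)" by (rule prob_P)
  have "measure (P (2*0)) {x \<in> tuples (2*0). lin (\<lambda>_. 0) (2*0) x = 0} \<le> coincidence b ^ 0 + e"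
    using P0.prob_le_1[of "{x \<in> tuples (2*0). lin (\<lambda>_. 0) (2*0) x = 0}"] 0 by simp
  then show ?case by (intro exI[of _ "\<lambda>_. 0"] conjI) auto
next
  case (Suc k)
  let ?q = "coincidence b"
  interpret \<mu>: prob_space \<mu> by (rule prob)
  interpret pair: pair_prob_space \<mu> \<mu> ..
  interpret Pn: prob_space "P n" for n by (rule prob_P)
  have q: "0 \<le> ?q" "?q \<le> 1" by (auto simp: coincidence_def)
  obtain v where v: "\<And>i. i < 2 * k \<Longrightarrow> v (swap_pairs i) = - v i"
    "measure (P (2*k)) {x \<in> tuples (2*k). lin v (2*k) x = 0} \<le> ?q ^ k + e / 2"
    using Suc.IH[of "e/2"] Suc.prems by auto
  let ?n = "2 * k"
  have n: "2 * Suc k = Suc (Suc ?n)" by simp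
  define Z where "Z x = lin v ?n x" for x
  define Y where "Y x = b \<bullet> x ?n - b \<bullet> x (Suc ?n)" for x :: "nat \<Rightarrow> real^'m"
  have Zm: "Z \<in> borel_measurable (P (Suc (Suc ?n)))" unfolding Z_def lin_def
    by (intro borel_measurable_sum borel_measurable_inner measurable_coord) auto
  have Ym: "Y \<in> borel_measurable (P (Suc (Suc ?n)))" unfolding Y_def
    by (intro borel_measurable_diff borel_measurable_inner measurable_coord) auto
  obtain c where c: "measure (P (Suc (Suc ?n))) {x \<in> space (P (Suc (Suc ?n))). Z x + c * Y x = 0}
      \<le> measure (P (Suc (Suc ?n))) {x \<in> space (P (Suc (Suc ?n))). Z x = 0 \<and> Y x = 0} + e / 2"
    using Pn.exists_weight_small_atom[OF Zm Ym, of "e/2"] Suc.prems by auto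
  define S where "S = {x \<in> space (P (Suc (Suc ?n))). Z x = 0 \<and> Y x = 0}"
  have Sm: "S \<in> sets (P (Suc (Suc ?n)))" unfolding S_def using Zm Ym by measurable
  let ?D = "{z \<in> space (\<mu> \<Otimes>\<^sub>M \<mu>). b \<bullet> fst z = b \<bullet> snd z}"
  have Dm: "?D \<in> sets (\<mu> \<Otimes>\<^sub>M \<mu>)" by measurable
  have "emeasure (P (Suc (Suc ?n))) S = (\<integral>\<^sup>+x. indicator S x \<partial>P (Suc (Suc ?n)))" using Sm by simp
  also have "\<dots> = (\<integral>\<^sup>+x. \<integral>\<^sup>+y'. indicator S (x(Suc ?n := y')) \<partial>\<mu> \<partial>P (Suc ?n))"
    using Sm by (intro nn_integral_P_Suc) auto
  also have "\<dots> = (\<integral>\<^sup>+x. \<integral>\<^sup>+y. \<integral>\<^sup>+y'. indicator S (x(?n := y, Suc ?n := y')) \<partial>\<mu> \<partial>\<mu> \<partial>P ?n)"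
  proof (intro nn_integral_P_Suc)
    have "(\<lambda>(x, y). indicator S (x(Suc ?n := y)) :: ennreal) \<in> borel_measurable (P (Suc ?n) \<Otimes>\<^sub>M \<mu>)"
      using measurable_compose[OF measurable_add_coord[of "Suc ?n"] borel_measurable_indicator[OF Sm]]
      by (simp add: case_prod_beta')
    then show "(\<lambda>x. \<integral>\<^sup>+y'. indicator S (x(Suc ?n := y')) \<partial>\<mu>) \<in> borel_measurable (P (Suc ?n))"
      by (rule sigma_finite_measure.borel_measurable_nn_integral[OF prob_space_imp_sigma_finite[OF prob]])
  qed
  also have "\<dots> = (\<integral>\<^sup>+x. indicator {x \<in> tuples ?n. Z x = 0} x * ennreal ?q \<partial>P ?n)"
  proof (intro nn_integral_cong)
    fix x assume "x \<in> space (P ?n)"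
    then have x: "x \<in> tuples ?n" by simp
    have Zx: "Z (x(?n := y, Suc ?n := y')) = Z x" for y y' by (simp add: Z_def lin_def)
    have ind: "indicator S (x(?n := y, Suc ?n := y')) = (indicator {x \<in> tuples ?n. Z x = 0} x * indicator ?D (y, y') :: ennreal)" for y y'
      using x by (auto simp: S_def Zx Y_def indicator_def space_pair_measure in_tuples_iff)
    have "(\<integral>\<^sup>+y. \<integral>\<^sup>+y'. indicator S (x(?n := y, Suc ?n := y')) \<partial>\<mu> \<partial>\<mu>)
        = indicator {x \<in> tuples ?n. Z x = 0} x * (\<integral>\<^sup>+y. \<integral>\<^sup>+y'. indicator ?D (y, y') \<partial>\<mu> \<partial>\<mu>)"
      unfolding ind using Dm by (subst nn_integral_cmult, measurable)+
    also have "(\<integral>\<^sup>+y. \<integral>\<^sup>+y'. indicator ?D (y, y') \<partial>\<mu> \<partial>\<mu>) = emeasure (\<mu> \<Otimes>\<^sub>M \<mu>) ?D"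
      using Dm by (subst sigma_finite_measure.nn_integral_fst[OF prob_space_imp_sigma_finite[OF prob]]) auto
    also have "\<dots> = ennreal ?q" by (simp add: coincidence_def pair.emeasure_eq_measure)
    finally show "(\<integral>\<^sup>+y. \<integral>\<^sup>+y'. indicator S (x(?n := y, Suc ?n := y')) \<partial>\<mu> \<partial>\<mu>)
        = indicator {x \<in> tuples ?n. Z x = 0} x * ennreal ?q" .
  qed
  also have "\<dots> = emeasure (P ?n) {x \<in> tuples ?n. Z x = 0} * ennreal ?q"
  proof -
    have "{x \<in> space (P ?n). Z x = 0} \<in> sets (P ?n)" unfolding Z_def by measurable
    then show ?thesis by (subst nn_integral_multc) auto
  qed
  finally have "measure (P (Suc (Suc ?n))) S = measure (P ?n) {x \<in> tuples ?n. Z x = 0} * ?q"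
    using q by (simp add: Pn.emeasure_eq_measure flip: ennreal_mult)
  also have "\<dots> \<le> (?q ^ k + e / 2) * ?q" using v(2) q by (intro mult_right_mono) (auto simp: Z_def)
  also have "\<dots> \<le> ?q ^ Suc k + e / 2" using q Suc.prems mult_left_le[of ?q "e/2"] by (simp add: algebra_simps)
  finally have S_le: "measure (P (Suc (Suc ?n))) S \<le> ?q ^ Suc k + e / 2" .
  define w where "w = v(?n := c *\<^sub>R b, Suc ?n := - c *\<^sub>R b)"
  have lin_w: "lin w (Suc (Suc ?n)) x = Z x + c * Y x" for x
  proof -
    have "(\<Sum>i<?n. w i \<bullet> x i) = (\<Sum>i<?n. v i \<bullet> x i)" by (intro sum.cong) (auto simp: w_def)
    then show ?thesis by (simp add: lin_def Z_def Y_def w_def algebra_simps)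
  qed
  have "w (swap_pairs i) = - w i" if "i < Suc (Suc ?n)" for i
  proof -
    consider "i < ?n" | "i = ?n" | "i = Suc ?n" using \<open>i < Suc (Suc ?n)\<close> by linarith
    then show ?thesis
    proof cases
      case 1 then show ?thesis using v(1)[OF 1] swap_pairs_less[OF 1] by (simp add: w_def)
    qed (simp_all add: w_def swap_pairs_def)
  qed
  moreover have "measure (P (Suc (Suc ?n))) {x \<in> tuples (Suc (Suc ?n)). lin w (Suc (Suc ?n)) x = 0} \<le> ?q ^ Suc k + e"
    unfolding lin_w using c S_le unfolding S_def by simp
  ultimately show ?case unfolding n by blast
qed

text \<open>Supplies a function to which (2) can be applied with \<open>t = 0\<close>: the conclusion is that \<open>b \<ge> 1 / 2\<close>,
  which (1) needs at \<open>t = 0\<close>.  Almost symmetry comes from pairing the coordinates with opposite weights, and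
  the weights of successive pairs are chosen so that the atom at \<open>0\<close> decays.\<close>

lemma not_Dirac_imp_balanced_linear:
  assumes "\<not> Dirac" and e: "e > 0"
  shows "\<exists>n\<ge>1. \<exists>v. measure (P n) {x \<in> tuples n. lin v n x > 0} \<ge> 1 / 2 - e \<and>
    measure (P n) {x \<in> tuples n. lin v n x \<le> 0} \<ge> 1 / 2 \<and> is_median (P n) (lin v n) 0"
proof -
  interpret Pn: prob_space "P n" for n by (rule prob_P)
  have "\<exists>b. \<nexists>c. AE y in \<mu>. b \<bullet> y = c"
  proof (rule ccontr)
    assume "\<not> ?thesis"
    then obtain c where c: "\<And>b. AE y in \<mu>. b \<bullet> y = c b" by metis
    have "AE y in \<mu>. \<forall>b\<in>Basis. b \<bullet> y = c b" using c by (intro AE_finite_allI) auto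
    then have "AE y in \<mu>. y = (\<Sum>b\<in>Basis. c b *\<^sub>R b)"
    proof eventually_elim
      case (elim y)
      have "y = (\<Sum>b\<in>Basis. (y \<bullet> b) *\<^sub>R b)" by (simp add: euclidean_representation)
      also have "\<dots> = (\<Sum>b\<in>Basis. c b *\<^sub>R b)" using elim by (intro sum.cong) (auto simp: inner_commute)
      finally show ?case .
    qed
    then show False using assms(1) by (auto simp: Dirac_def)
  qed
  then obtain b where "\<nexists>c. AE y in \<mu>. b \<bullet> y = c" by blast
  then have q: "coincidence b < 1" "0 \<le> coincidence b" using coincidence_less_1 by (auto simp: coincidence_def)
  have "(\<lambda>k. coincidence b ^ k) \<longlonglongrightarrow> 0" using q by (intro LIMSEQ_power_zero) auto
  then have "\<forall>\<^sub>F k in sequentially. coincidence b ^ k < e" using e by (rule order_tendstoD)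
  then obtain k0 where "\<And>k. k \<ge> k0 \<Longrightarrow> coincidence b ^ k < e" by (auto simp: eventually_sequentially)
  then have k: "coincidence b ^ Suc k0 < e" by (metis le_add2 plus_1_eq_Suc)
  let ?n = "2 * Suc k0"
  obtain v where v: "\<And>i. i < ?n \<Longrightarrow> v (swap_pairs i) = - v i"
    "measure (P ?n) {x \<in> tuples ?n. lin v ?n x = 0} \<le> coincidence b ^ Suc k0 + e"
    using prob_lin_eq_0_le[OF e, of "Suc k0" b] by blast
  define p z where "p = measure (P ?n) {x \<in> tuples ?n. lin v ?n x > 0}"
    and "z = measure (P ?n) {x \<in> tuples ?n. lin v ?n x = 0}"
  have m: "measure (P ?n) {x \<in> tuples ?n. lin v ?n x < 0} = p"
    unfolding p_def using v(1) by (intro prob_lin_symmetric[symmetric]) auto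
  have meas: "{x \<in> tuples ?n. lin v ?n x > 0} \<in> sets (P ?n)" "{x \<in> tuples ?n. lin v ?n x = 0} \<in> sets (P ?n)"
    "{x \<in> tuples ?n. lin v ?n x < 0} \<in> sets (P ?n)"
    unfolding space_P[symmetric] by measurable
  have un_le: "{x \<in> T. g x \<le> 0} = {x \<in> T. g x = 0} \<union> {x \<in> T. g x < 0}"
    and un_ge: "{x \<in> T. g x \<ge> 0} = {x \<in> T. g x = 0} \<union> {x \<in> T. g x > 0}"
    and disj: "{x \<in> T. g x = 0} \<inter> {x \<in> T. g x < 0} = {}" "{x \<in> T. g x = 0} \<inter> {x \<in> T. g x > 0} = {}"
    and not_gt: "T - {x \<in> T. g x > 0} = {x \<in> T. g x \<le> 0}"
    for T and g :: "(nat \<Rightarrow> real^'m) \<Rightarrow> real" by auto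
  have le: "measure (P ?n) {x \<in> tuples ?n. lin v ?n x \<le> 0} = z + p"
    unfolding z_def m[symmetric] un_le using meas by (intro Pn.finite_measure_Union disj)
  have ge: "measure (P ?n) {x \<in> tuples ?n. lin v ?n x \<ge> 0} = z + p"
    unfolding z_def p_def un_ge using meas by (intro Pn.finite_measure_Union disj)
  \<comment> \<open>By symmetry both open half-spaces have measure \<open>p\<close>, so
    \<open>2 * p + z = 1\<close>; a small atom \<open>z\<close> makes \<open>p\<close> nearly one
    half.\<close>
  have "1 - p = z + p" using measure_compl[OF meas(1)] by (simp only: le p_def not_gt)
  moreover have "0 \<le> z" "z \<le> 2 * e" using v(2) k by (auto simp: z_def)
  ultimately have "p \<ge> 1/2 - e" "z + p \<ge> 1/2" by auto
  then have "1/2 - e \<le> measure (P ?n) {x \<in> tuples ?n. lin v ?n x > 0} \<and>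
      1/2 \<le> measure (P ?n) {x \<in> tuples ?n. lin v ?n x \<le> 0} \<and> is_median (P ?n) (lin v ?n) 0"
    unfolding is_median_def space_P by (simp only: le ge p_def)
  moreover have "1 \<le> ?n" by simp
  ultimately show ?thesis by blast
qed

end

section \<open>Convex concentration\<close>

lemma convex_sublevel:
  assumes "convex_on S f"
  shows "convex {x \<in> S. f x \<le> c}" "convex {x \<in> S. f x < c}"
proof -
  have *: "(1 - u) *\<^sub>R x + u *\<^sub>R y \<in> S \<and> f ((1 - u) *\<^sub>R x + u *\<^sub>R y) \<le> (1 - u) * f x + u * f y"
    if "x \<in> S" "y \<in> S" "0 \<le> u" "u \<le> 1" for x y u
    using that convex_onD[OF assms, of u x y] convex_on_imp_convex[OF assms] by (auto simp: convex_alt)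
  show "convex {x \<in> S. f x \<le> c}" unfolding convex_alt
  proof (intro ballI allI impI)
    fix x y u assume "x \<in> {x \<in> S. f x \<le> c}" "y \<in> {x \<in> S. f x \<le> c}" "0 \<le> (u::real) \<and> u \<le> 1"
    then show "(1 - u) *\<^sub>R x + u *\<^sub>R y \<in> {x \<in> S. f x \<le> c}"
      using *[of x y u] convex_bound_le[of "f x" c "f y" "1 - u" u] by auto
  qed
  show "convex {x \<in> S. f x < c}" unfolding convex_alt
  proof (intro ballI allI impI)
    fix x y u assume "x \<in> {x \<in> S. f x < c}" "y \<in> {x \<in> S. f x < c}" "0 \<le> (u::real) \<and> u \<le> 1"
    then show "(1 - u) *\<^sub>R x + u *\<^sub>R y \<in> {x \<in> S. f x < c}"
      using *[of x y u] convex_bound_lt[of "f x" c "f y" "1 - u" u] by auto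
  qed
qed

lemma convex_superlevel:
  assumes "concave_on S f"
  shows "convex {x \<in> S. c < f x}"
  using convex_sublevel(2)[OF assms[unfolded concave_on_def], of "- c"] by simp

lemma diff_Collect_le: "S - {x \<in> S. f x \<le> c} = {x \<in> S. c < (f x :: real)}"
  and diff_Collect_less: "S - {x \<in> S. f x < c} = {x \<in> S. c \<le> (f x :: real)}"
  by auto

lemma Collect_conj_mono: "(\<And>x. x \<in> S \<Longrightarrow> Q x \<Longrightarrow> R x) \<Longrightarrow> {x \<in> S. Q x} \<subseteq> {x \<in> S. R x}"
  by auto

lemma lipschitz_concentrationD:
  assumes "lipschitz_concentration N r \<mu> a b" "n \<ge> 1" "t \<ge> 0"
    "convex_on (tuples n) f \<or> concave_on (tuples n) f"
    "\<And>x y. x \<in> tuples n \<Longrightarrow> y \<in> tuples n \<Longrightarrow> \<bar>f x - f y\<bar> \<le> tuple_norm N r n (x - y)"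
    "is_median (power_measure \<mu> n) f m"
  shows "measure (power_measure \<mu> n) {x \<in> tuples n. f x > m + t} \<le> b * exp (- (t powr r) / a)"
  using assms unfolding lipschitz_concentration_def by blast

locale norm_power_prob = norm_power N r + power_prob \<mu>
  for N :: "real ^ 'm \<Rightarrow> real" and r :: real and \<mu> :: "(real ^ 'm) measure"
begin

lemma sets_tdist [measurable]:
  assumes "A \<noteq> {}"
  shows "{x \<in> tuples n. tdist n A x \<le> u} \<in> sets (P n)" "{x \<in> tuples n. tdist n A x < u} \<in> sets (P n)"
    "{x \<in> tuples n. u < tdist n A x} \<in> sets (P n)" "{x \<in> tuples n. u \<le> tdist n A x} \<in> sets (P n)"
proof -
  note [measurable] = measurable_P[OF measurable_tdist[OF assms, of n]]
  show "{x \<in> tuples n. tdist n A x \<le> u} \<in> sets (P n)" "{x \<in> tuples n. tdist n A x < u} \<in> sets (P n)"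
    "{x \<in> tuples n. u < tdist n A x} \<in> sets (P n)" "{x \<in> tuples n. u \<le> tdist n A x} \<in> sets (P n)"
    unfolding space_P[symmetric] by measurable
qed

lemma outer_le_measure:
  assumes "A \<subseteq> E" "E \<in> sets (P n)"
  shows "enn2real (outer_measure_of (P n) A) \<le> measure (P n) E"
proof -
  interpret prob_space "P n" by (rule prob_P)
  have "outer_measure_of (P n) A \<le> emeasure (P n) E"
    using outer_measure_of_mono[OF assms(1), of "P n"] assms(2) by simp
  then show ?thesis unfolding measure_def by (intro enn2real_mono) (auto simp: less_top[symmetric])
qed

lemma measure_le_outer:
  assumes "E \<subseteq> A" "E \<in> sets (P n)" "A \<subseteq> tuples n"
  shows "measure (P n) E \<le> enn2real (outer_measure_of (P n) A)"
proof -
  interpret prob_space "P n" by (rule prob_P)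
  have "emeasure (P n) E \<le> outer_measure_of (P n) A"
    using outer_measure_of_mono[OF assms(1), of "P n"] assms(2) by simp
  moreover have "outer_measure_of (P n) A \<le> emeasure (P n) (space (P n))"
    using outer_measure_of_mono[of A "space (P n)" "P n"] assms(3) by simp
  then have "outer_measure_of (P n) A < \<top>"
    using emeasure_space_1 by (auto intro: order.strict_trans1)
  ultimately show ?thesis unfolding measure_def by (intro enn2real_mono)
qed

text \<open>The set is \<open>{f \<le> m}\<close>, convex for convex \<open>f\<close> and with
  convex complement for concave \<open>f\<close>. Enlarging it by radius \<open>t\<close>, that is
  with parameter \<open>t powr r\<close>, stays inside \<open>{f \<le> m + t}\<close>.\<close>

lemma set_imp_lipschitz:
  assumes "set_concentration N r \<mu> a b"
  shows "lipschitz_concentration N r \<mu> a b"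
  unfolding lipschitz_concentration_def
proof (intro allI impI)
  fix n :: nat and t m :: real and f :: "(nat \<Rightarrow> real^'m) \<Rightarrow> real"
  assume n: "n \<ge> 1" and t: "t \<ge> 0" and conv: "convex_on (tuples n) f \<or> concave_on (tuples n) f"
    and lip: "\<forall>x\<in>tuples n. \<forall>y\<in>tuples n. \<bar>f x - f y\<bar> \<le> tuple_norm N r n (x - y)"
    and med: "is_median (P n) f m"
  interpret prob_space "P n" by (rule prob_P)
  have "continuous_on (tuples n) f"
    using lip by (intro lipschitz_imp_continuous_on_tuples[of _ _ 1 n]) auto
  then have [measurable]: "f \<in> borel_measurable (P n)"
    by (intro measurable_P continuous_imp_measurable_tuple_borel)
  let ?A = "{x \<in> tuples n. f x \<le> m}"
  have lev: "{x \<in> tuples n. f x \<le> c} \<in> sets (P n)" for c unfolding space_P[symmetric] by measurable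
  have "convex ?A \<or> convex (tuples n - ?A)"
    using conv
  proof
    assume "convex_on (tuples n) f"
    then show ?thesis using convex_sublevel(1) by blast
  next
    assume c: "concave_on (tuples n) f"
    show ?thesis unfolding diff_Collect_le using convex_superlevel[OF c] by blast
  qed
  moreover have "?A \<in> sets (tuple_borel n)" using lev sets_P by simp
  moreover have "1 / 2 \<le> prob ?A" using med by (simp add: is_median_def)
  moreover have "0 \<le> t powr r" by simp
  ultimately have 1: "1 - b * exp (- (t powr r) / a) \<le> enn2real (outer_measure_of (P n) (enlarge N r n ?A (t powr r)))"
    using assms n unfolding set_concentration_def by blast
  have "enlarge N r n ?A (t powr r) \<subseteq> {x \<in> tuples n. f x \<le> m + t}"
  proof
    fix x assume "x \<in> enlarge N r n ?A (t powr r)"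
    then obtain y where xy: "x \<in> tuples n" "y \<in> ?A" "tuple_norm N r n (x - y) \<le> (t powr r) powr (1 / r)"
      unfolding enlarge_eq[OF Collect_restrict powr_ge_zero] by blast
    then have "f x - f y \<le> t" using lip[rule_format, of x y] r t by (simp add: powr_powr)
    then show "x \<in> {x \<in> tuples n. f x \<le> m + t}" using xy by simp
  qed
  then have 2: "enn2real (outer_measure_of (P n) (enlarge N r n ?A (t powr r))) \<le> prob {x \<in> tuples n. f x \<le> m + t}"
    by (rule outer_le_measure) (rule lev)
  have "prob (tuples n - {x \<in> tuples n. f x \<le> m + t}) = 1 - prob {x \<in> tuples n. f x \<le> m + t}"
    by (rule measure_compl) (rule lev)
  then show "prob {x \<in> tuples n. f x > m + t} \<le> b * exp (- (t powr r) / a)"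
    unfolding diff_Collect_le using 1 2 by simp
qed

text \<open>A distance strictly below the radius guarantees a point of \<open>A\<close> within the
  radius, while a distance equal to it does not. The bound for the closed condition is therefore
  obtained from radii \<open>u\<close> increasing to \<open>t\<close>. At \<open>t = 0\<close> there
  is no smaller radius, which explains the separate hypothesis \<open>zero\<close>.\<close>

lemma set_concentrationI:
  assumes a: "a > 0"
    and pos: "\<And>n A u. n \<ge> 1 \<Longrightarrow> A \<in> sets (tuple_borel n) \<Longrightarrow> A \<noteq> {} \<Longrightarrow> convex A \<or> convex (tuples n - A) \<Longrightarrow>
      measure (P n) A \<ge> 1 / 2 \<Longrightarrow> u > 0 \<Longrightarrow>
      measure (P n) {x \<in> tuples n. u powr (1 / r) < tdist n A x} \<le> b * exp (- u / a)"
    and zero: "Dirac \<or> b \<ge> 1 / 2" and b: "b \<ge> 0"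
  shows "set_concentration N r \<mu> a b"
  unfolding set_concentration_def
proof (intro allI impI ballI)
  fix n :: nat and t :: real and A :: "(nat \<Rightarrow> real^'m) set"
  assume n: "1 \<le> n" and t: "0 \<le> t" and A: "A \<in> sets (tuple_borel n)"
    and c: "convex A \<or> convex (tuples n - A)" and half: "1 / 2 \<le> measure (P n) A"
  interpret prob_space "P n" by (rule prob_P)
  have At: "A \<subseteq> tuples n" using sets.sets_into_space[OF A] by simp
  have AP: "A \<in> sets (P n)" using A sets_P by simp
  have ne: "A \<noteq> {}" using half by auto
  have et: "enlarge N r n A t \<subseteq> tuples n" unfolding enlarge_eq[OF At t] by auto
  show "1 - b * exp (- t / a) \<le> enn2real (outer_measure_of (P n) (enlarge N r n A t))"
  proof (cases "t = 0")
    case True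
    have "A \<subseteq> enlarge N r n A t"
    proof
      fix x assume "x \<in> A"
      moreover have "tuple_norm N r n (x - x) = 0" by (simp add: tuple_norm_eq_0)
      ultimately show "x \<in> enlarge N r n A t" unfolding enlarge_eq[OF At t] using At by force
    qed
    then have "prob A \<le> enn2real (outer_measure_of (P n) (enlarge N r n A t))"
      using AP et by (rule measure_le_outer)
    moreover have "1 - b \<le> prob A"
      using zero half b Dirac_imp_measure_1[OF _ AP] by auto
    ultimately show ?thesis using True by simp
  next
    case False
    let ?T = "t powr (1 / r)"
    have "?T > 0" using False by simp
    have "{x \<in> tuples n. tdist n A x < ?T} \<subseteq> enlarge N r n A t"
      unfolding enlarge_eq[OF At t] using tdist_lessD[OF ne] by (force intro: less_imp_le)
    then have 1: "prob {x \<in> tuples n. tdist n A x < ?T} \<le> enn2real (outer_measure_of (P n) (enlarge N r n A t))"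
      by (rule measure_le_outer) (rule sets_tdist[OF ne] et)+
    have "\<forall>\<^sub>F u in at_left t. prob {x \<in> tuples n. ?T \<le> tdist n A x} \<le> b * exp (- u / a)"
      unfolding eventually_at_left_field
    proof (intro exI[of _ 0] conjI allI impI)
      show "0 < t" using t False by simp
      fix u assume u: "0 < u" "u < t"
      have "u powr (1 / r) < ?T" using u r by (intro powr_less_mono2) auto
      then have "prob {x \<in> tuples n. ?T \<le> tdist n A x} \<le> prob {x \<in> tuples n. u powr (1 / r) < tdist n A x}"
        by (intro finite_measure_mono sets_tdist ne Collect_conj_mono) simp
      also have "\<dots> \<le> b * exp (- u / a)" using pos[OF n A ne c half u(1)] .
      finally show "prob {x \<in> tuples n. ?T \<le> tdist n A x} \<le> b * exp (- u / a)" .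
    qed
    moreover have "((\<lambda>u. b * exp (- u / a)) \<longlongrightarrow> b * exp (- t / a)) (at_left t)"
      using a by (intro tendsto_intros) auto
    ultimately have "prob {x \<in> tuples n. ?T \<le> tdist n A x} \<le> b * exp (- t / a)"
      by (intro tendsto_lowerbound[where F="at_left t"]) auto
    moreover have "prob (tuples n - {x \<in> tuples n. tdist n A x < ?T}) = 1 - prob {x \<in> tuples n. tdist n A x < ?T}"
      by (intro measure_compl sets_tdist ne)
    ultimately show ?thesis unfolding diff_Collect_less using 1 by simp
  qed
qed

text \<open>The distance to \<open>A\<close> is concave only on the convex complement of \<open>A\<close>; this extends it from there to
  a concave \<open>1\<close>-Lipschitz function on the whole space, which is nonpositive on \<open>A\<close>.\<close>

definition sdist :: "nat \<Rightarrow> (nat \<Rightarrow> real^'m) set \<Rightarrow> (nat \<Rightarrow> real^'m) \<Rightarrow> real"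
  where "sdist n A x = (SUP y\<in>tuples n - A. tdist n A y - tuple_norm N r n (x - y))"

context
  fixes n :: nat and A :: "(nat \<Rightarrow> real^'m) set"
  assumes A: "A \<noteq> {}" "A \<subseteq> tuples n" and D: "tuples n - A \<noteq> {}" "convex (tuples n - A)"
begin

lemma sdist_term_le: "tdist n A y - tuple_norm N r n (x - y) \<le> tdist n A x"
  using tdist_le_add[OF A(1), of n y x] by (simp add: tuple_norm_minus_commute[of n y x])

lemma sdist_bdd: "bdd_above ((\<lambda>y. tdist n A y - tuple_norm N r n (x - y)) ` (tuples n - A))"
  using sdist_term_le by (intro bdd_aboveI2)

lemma sdist_ge: "y \<in> tuples n - A \<Longrightarrow> tdist n A y - tuple_norm N r n (x - y) \<le> sdist n A x"
  unfolding sdist_def by (intro cSUP_upper sdist_bdd)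

lemma sdist_le_tdist: "sdist n A x \<le> tdist n A x"
  unfolding sdist_def using D by (intro cSUP_least sdist_term_le)

lemma sdist_ge_tdist: "x \<in> tuples n - A \<Longrightarrow> tdist n A x \<le> sdist n A x"
  using sdist_ge[of x x] tuple_norm_eq_0[of n "x - x"] by simp

lemma sdist_lipschitz: "\<bar>sdist n A x - sdist n A y\<bar> \<le> tuple_norm N r n (x - y)"
proof -
  have *: "sdist n A x \<le> sdist n A y + tuple_norm N r n (x - y)" for x y
  proof -
    have "tdist n A z - tuple_norm N r n (x - z) \<le> sdist n A y + tuple_norm N r n (x - y)"
      if "z \<in> tuples n - A" for z
      using sdist_ge[OF that, of y] tuple_norm_diff_triangle[of n y z x]
      by (simp add: tuple_norm_minus_commute[of n y x])
    then show ?thesis unfolding sdist_def[of n A x] using D by (intro cSUP_least) auto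
  qed
  show ?thesis using *[of x y] *[of y x] by (simp add: tuple_norm_minus_commute[of n y x] abs_le_iff)
qed

text \<open>\<open>sdist\<close> is a sup-convolution of the distance, concave on the complement,
  with minus the norm. Near-optimal points for \<open>x\<close> and \<open>y\<close> combine to a
  point of the convex complement, which competes for the combination of \<open>x\<close> and
  \<open>y\<close>.\<close>

lemma concave_on_sdist: "concave_on (tuples n) (sdist n A)"
  unfolding concave_on_def
proof (rule convex_onI)
  fix t :: real and x y :: "nat \<Rightarrow> real^'m"
  assume t: "0 < t" "t < 1" and xy: "x \<in> tuples n" "y \<in> tuples n"
  let ?z = "(1 - t) *\<^sub>R x + t *\<^sub>R y"
  have "(1 - t) * sdist n A x + t * sdist n A y \<le> sdist n A ?z"
  proof (rule field_le_epsilon)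
    fix e :: real assume e: "e > 0"
    have ex: "\<exists>u\<in>tuples n - A. sdist n A w - e < tdist n A u - tuple_norm N r n (w - u)" for w
      using e D(1) sdist_bdd[of w] unfolding sdist_def by (subst less_cSUP_iff[symmetric]) auto
    obtain u v where uv: "u \<in> tuples n - A" "v \<in> tuples n - A"
      "sdist n A x - e < tdist n A u - tuple_norm N r n (x - u)"
      "sdist n A y - e < tdist n A v - tuple_norm N r n (y - v)" using ex[of x] ex[of y] by auto
    let ?w = "(1 - t) *\<^sub>R u + t *\<^sub>R v"
    have w: "?w \<in> tuples n - A" using uv t by (intro convexD[OF D(2)]) auto
    have eq: "?z - ?w = (1 - t) *\<^sub>R (x - u) + t *\<^sub>R (y - v)" by (simp add: scaleR_right_diff_distrib)
    have "tuple_norm N r n (?z - ?w) \<le> (1 - t) * tuple_norm N r n (x - u) + t * tuple_norm N r n (y - v)"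
      unfolding eq using tuple_norm_triangle[of n "(1 - t) *\<^sub>R (x - u)" "t *\<^sub>R (y - v)"] t by simp
    moreover have "(1 - t) * tdist n A u + t * tdist n A v \<le> tdist n A ?w"
      using A D(2) uv(1,2) t by (rule tdist_concave_on_compl)
    moreover have "(1 - t) * (sdist n A x - e) + t * (sdist n A y - e)
        \<le> (1 - t) * (tdist n A u - tuple_norm N r n (x - u)) + t * (tdist n A v - tuple_norm N r n (y - v))"
      using uv t by (intro add_mono mult_left_mono) auto
    ultimately show "(1 - t) * sdist n A x + t * sdist n A y \<le> sdist n A ?z + e"
      using sdist_ge[OF w, of ?z] by (simp add: algebra_simps)
  qed
  then show "- sdist n A ?z \<le> (1 - t) * - sdist n A x + t * - sdist n A y" by simp
qed simp

end

lemma scaled_lin_lipschitz: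
  "\<exists>L>0. \<forall>x y. \<bar>lin v n x / L - lin v n y / L\<bar> \<le> tuple_norm N r n (x - y)"
proof -
  obtain k where k: "k > 0" "\<And>x. norm x \<le> k * N x" using norm_le_N by auto
  define L where "L = 1 + (\<Sum>i<n. norm (v i) * k)"
  have L: "L > 0" unfolding L_def using k by (intro add_pos_nonneg sum_nonneg) auto
  have "\<bar>lin v n x - lin v n y\<bar> \<le> L * tuple_norm N r n (x - y)" for x y
  proof -
    have "\<bar>lin v n x - lin v n y\<bar> = \<bar>\<Sum>i<n. v i \<bullet> (x i - y i)\<bar>"
      by (simp add: lin_def inner_diff_right sum_subtractf)
    also have "\<dots> \<le> (\<Sum>i<n. norm (v i) * k * tuple_norm N r n (x - y))"
    proof (intro order_trans[OF sum_abs] sum_mono)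
      fix i assume "i \<in> {..<n}"
      then have "k * N (x i - y i) \<le> k * tuple_norm N r n (x - y)"
        using N_le_tuple_norm[of i n "x - y"] k(1) by simp
      then have "norm (x i - y i) \<le> k * tuple_norm N r n (x - y)" using k(2) order_trans by blast
      then have "norm (v i) * norm (x i - y i) \<le> norm (v i) * (k * tuple_norm N r n (x - y))"
        by (intro mult_left_mono) auto
      then show "\<bar>v i \<bullet> (x i - y i)\<bar> \<le> norm (v i) * k * tuple_norm N r n (x - y)"
        using Cauchy_Schwarz_ineq2[of "v i" "x i - y i"] by (simp add: mult.assoc)
    qed
    also have "\<dots> \<le> L * tuple_norm N r n (x - y)"
      by (simp add: L_def algebra_simps flip: sum_distrib_left sum_distrib_right)
    finally show ?thesis .
  qed
  then have "\<bar>lin v n x / L - lin v n y / L\<bar> \<le> tuple_norm N r n (x - y)" for x y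
    using L by (simp add: field_simps abs_divide flip: diff_divide_distrib)
  then show ?thesis using L by blast
qed

lemma convex_on_lin: "convex_on S (lin v n) \<longleftrightarrow> convex S"
proof -
  have "lin v n (u *\<^sub>R x + w *\<^sub>R y) = u * lin v n x + w * lin v n y" for u w x y
    by (simp add: lin_def inner_add_right sum.distrib sum_distrib_left)
  then show ?thesis by (simp add: convex_on_def)
qed

text \<open>For convex \<open>A\<close> the distance itself has median \<open>0\<close>. If the
  complement is convex, \<open>sdist\<close> is nonpositive on \<open>A\<close>, so it has a median
  that is at most \<open>0\<close>, and it equals the distance outside \<open>A\<close>; hence in
  both cases the tail bound of (2) passes to the distance with unchanged constants. The bound on
  \<open>b\<close> needed at \<open>t = 0\<close> comes from (2) at \<open>t = 0\<close> for a
  balanced linear functional, rescaled to be \<open>1\<close>-Lipschitz.\<close>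

lemma lipschitz_imp_set:
  assumes lc: "lipschitz_concentration N r \<mu> a b" and a: "a > 0" and b: "b > 0"
  shows "set_concentration N r \<mu> a b"
proof (rule set_concentrationI[OF a])
  fix n :: nat and A u
  assume n: "n \<ge> 1" and A: "A \<in> sets (tuple_borel n)" "A \<noteq> {}" "convex A \<or> convex (tuples n - A)"
    and half: "measure (P n) A \<ge> 1 / 2" and u: "u > (0::real)"
  interpret prob_space "P n" by (rule prob_P)
  have At: "A \<subseteq> tuples n" using sets.sets_into_space[OF A(1)] by simp
  let ?s = "u powr (1 / r)"
  have s: "?s \<ge> 0" "?s powr r = u" using u r by (auto simp: powr_powr)
  have zero: "A \<subseteq> {x \<in> tuples n. tdist n A x \<le> 0}"
    using At tdist_eq_0[of _ A n] by (simp add: subset_iff)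
  have half': "prob {x \<in> tuples n. tdist n A x \<le> 0} \<ge> 1 / 2"
    using finite_measure_mono[OF zero sets_tdist(1)[OF A(2)]] half by simp
  show "prob {x \<in> tuples n. ?s < tdist n A x} \<le> b * exp (- u / a)"
  proof (cases "convex A")
    case True
    have "{x \<in> space (P n). 0 \<le> tdist n A x} = space (P n)" using tdist_nonneg[OF A(2)] by simp
    then have "is_median (P n) (tdist n A) 0" using half' prob_space by (simp add: is_median_def)
    then have "prob {x \<in> tuples n. tdist n A x > 0 + ?s} \<le> b * exp (- (?s powr r) / a)"
      using convex_on_tdist[OF True A(2), of "tuples n" n] tdist_lipschitz[OF A(2)]
      by (intro lipschitz_concentrationD[OF lc n s(1)]) simp_all
    then show ?thesis using s by simp
  next
    case False
    show ?thesis
    proof (cases "tuples n - A = {}")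
      case True
      then have "tdist n A x = 0" if "x \<in> tuples n" for x using that tdist_eq_0[of x A n] by blast
      then have "{x \<in> tuples n. ?s < tdist n A x} = {}" using u by fastforce
      then show ?thesis using b by (simp only: measure_empty) auto
    next
      case D: False
      have D2: "convex (tuples n - A)" using A(3) \<open>\<not> convex A\<close> by simp
      note sd = sdist_le_tdist[OF A(2) At D D2] sdist_ge_tdist[OF A(2) At D D2]
        sdist_lipschitz[OF A(2) At D D2] concave_on_sdist[OF A(2) At D D2]
      have "continuous_on (tuples n) (sdist n A)"
        using sd(3) by (intro lipschitz_imp_continuous_on_tuples[of _ _ 1 n]) auto
      then have m[measurable]: "sdist n A \<in> borel_measurable (P n)"
        by (intro measurable_P continuous_imp_measurable_tuple_borel)
      have "prob {x \<in> tuples n. tdist n A x \<le> 0} \<le> prob {x \<in> space (P n). sdist n A x \<le> 0}"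
        using sd(1) sets_tdist[OF A(2)] unfolding space_P
        by (intro finite_measure_mono Collect_conj_mono) (rule order_trans, assumption+, unfold space_P[symmetric], measurable)
      then obtain c where c: "c \<le> 0" "is_median (P n) (sdist n A) c"
        using exists_median_le[OF m, of 0] half' by auto
      have "prob {x \<in> tuples n. sdist n A x > c + ?s} \<le> b * exp (- (?s powr r) / a)"
        using sd(3,4) c(2) by (intro lipschitz_concentrationD[OF lc n s(1)]) simp_all
      moreover have "prob {x \<in> tuples n. ?s < tdist n A x} \<le> prob {x \<in> tuples n. sdist n A x > c + ?s}"
      proof (intro finite_measure_mono subsetI)
        fix x assume x: "x \<in> {x \<in> tuples n. ?s < tdist n A x}"
        have "x \<notin> A" using x tdist_eq_0[of x A n] s(1) by fastforce
        then show "x \<in> {x \<in> tuples n. sdist n A x > c + ?s}" using sd(2)[of x] x c(1) by simp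
      qed (unfold space_P[symmetric], measurable)
      ultimately show ?thesis using s by simp
    qed
  qed
next
  show "Dirac \<or> 1 / 2 \<le> b"
  proof (rule ccontr)
    assume "\<not> ?thesis"
    then have "\<not> Dirac" and b2: "b < 1/2" by auto
    define e where "e = (1/2 - b) / 2"
    have e: "e > 0" "b < 1/2 - e" using b2 by (auto simp: e_def field_simps)
    obtain n v where n: "n \<ge> 1" and v: "measure (P n) {x \<in> tuples n. lin v n x > 0} \<ge> 1 / 2 - e"
      and med: "is_median (P n) (lin v n) 0"
      using not_Dirac_imp_balanced_linear[OF \<open>\<not> Dirac\<close> e(1)] by blast
    obtain L where L: "L > 0" "\<And>x y. \<bar>lin v n x / L - lin v n y / L\<bar> \<le> tuple_norm N r n (x - y)"
      using scaled_lin_lipschitz[of v n] by blast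
    let ?f = "\<lambda>x. lin v n x / L"
    have sgn: "?f x \<le> 0 \<longleftrightarrow> lin v n x \<le> 0" "?f x \<ge> 0 \<longleftrightarrow> lin v n x \<ge> 0" "?f x > 0 \<longleftrightarrow> lin v n x > 0" for x
      using L(1) by (auto simp: field_simps)
    have "is_median (P n) ?f 0" using med unfolding is_median_def sgn .
    moreover have "convex_on (tuples n) ?f"
      using convex_on_cdiv[of L "tuples n" "lin v n"] L(1) by (simp add: convex_on_lin)
    ultimately have "measure (P n) {x \<in> tuples n. ?f x > 0 + 0} \<le> b * exp (- (0 powr r) / a)"
      using L(2) by (intro lipschitz_concentrationD[OF lc n]) simp_all
    then show False using v e r by (simp add: sgn)
  qed
qed (use b in auto)

end

section \<open>The two-set inequality at a fixed parameter\<close>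

lemma set_concentrationD:
  assumes "set_concentration N r \<mu> a b" "n \<ge> 1" "t \<ge> 0" "A \<in> sets (tuple_borel n)"
    "convex A \<or> convex (tuples n - A)" "measure (power_measure \<mu> n) A \<ge> 1 / 2"
  shows "1 - b * exp (- t / a) \<le> enn2real (outer_measure_of (power_measure \<mu> n) (enlarge N r n A t))"
  using assms unfolding set_concentration_def by blast

lemma diff_Collect_greater: "S - {x \<in> S. c < f x} = {x \<in> S. f x \<le> (c :: real)}"
  and diff_Collect_greater_eq: "S - {x \<in> S. c \<le> f x} = {x \<in> S. f x < (c :: real)}"
  by auto

context norm_power_prob
begin

text \<open>(3) for a single \<open>s\<close>. The direct proof of (3) from (1) has a factor that
  depends on \<open>s\<close>, and the passage between (3) and (4) takes place at each
  \<open>s\<close> separately, so an \<open>s\<close>-dependent factor does no harm there.\<close>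

definition two_set_at :: "real \<Rightarrow> real \<Rightarrow> real \<Rightarrow> bool"
  where "two_set_at a b s \<longleftrightarrow> (\<forall>n\<ge>1. \<forall>A\<in>sets (tuple_borel n). \<forall>t\<ge>0.
      measure (P n) (tuples n - cost_enlarge N r n A t) powr (1 / (1 - s) powr (r - 1))
        * measure (P n) A powr (1 / s powr (r - 1)) \<le> b * exp (- t / a))"

lemma two_set_atD:
  assumes "two_set_at a b s" "n \<ge> 1" "A \<in> sets (tuple_borel n)" "t \<ge> 0"
  shows "measure (P n) (tuples n - cost_enlarge N r n A t) powr (1 / (1 - s) powr (r - 1))
        * measure (P n) A powr (1 / s powr (r - 1)) \<le> b * exp (- t / a)"
  using assms unfolding two_set_at_def by blast

lemma two_set_iff: "two_set_concentration N r \<mu> a b \<longleftrightarrow> (\<forall>s\<in>{0<..<1}. two_set_at a b s)"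
  unfolding two_set_concentration_def two_set_at_def by blast

lemma tdist_closure:
  assumes "A \<noteq> {}" shows "tdist n (closure A) x = tdist n A x"
proof (rule antisym)
  have "closure A \<subseteq> {y. tdist n A y = 0}"
    using tdist_eq_0[of _ A n] assms by (intro closure_minimal closed_Collect_eq continuous_on_tdist) auto
  then have "tdist n A x \<le> tuple_norm N r n (x - c)" if "c \<in> closure A" for c
    using tdist_le_add[OF assms, of n x c] that by auto
  then show "tdist n A x \<le> tdist n (closure A) x"
    unfolding tdist_def[of n "closure A"] using assms by (intro cINF_greatest) auto
  show "tdist n (closure A) x \<le> tdist n A x"
    unfolding tdist_def[of n A] using assms closure_subset[of A]
    by (intro cINF_greatest tdist_le) auto
qed

lemma hull_closure:
  assumes "A \<in> sets (tuple_borel n)" "A \<noteq> {}"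
  shows "closed (closure (convex hull A))" "convex (closure (convex hull A))"
    "closure (convex hull A) \<subseteq> tuples n" "closure (convex hull A) \<noteq> {}" "A \<subseteq> closure (convex hull A)"
proof -
  have At: "A \<subseteq> tuples n" using sets.sets_into_space[OF assms(1)] by simp
  have Kt: "convex hull A \<subseteq> tuples n" using At by (intro hull_minimal) auto
  show "closure (convex hull A) \<subseteq> tuples n" using Kt by (intro closure_minimal closed_tuples)
  show "A \<subseteq> closure (convex hull A)"
    using closure_subset[of "convex hull A"] hull_subset[of A convex] by (rule order_trans[rotated])
qed (use assms in \<open>simp_all add: convex_closure_tuple\<close>)

lemma compl_cost_enlarge:
  assumes A: "A \<in> sets (tuple_borel n)" "A \<noteq> {}" and t: "t \<ge> 0"
  shows "tuples n - cost_enlarge N r n A t =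
    {x \<in> tuples n. t powr (1 / r) < tdist n (closure (convex hull A)) x}"
  unfolding cost_enlarge_eq[OF A(1) t] enlarge_closed_eq[OF hull_closure(1,3,4)[OF A] t]
  by (rule diff_Collect_le)

text \<open>The form in which (1) is applied below: a measurable set far from \<open>E\<close> has
  small measure. The outer measure of the enlargement has disappeared from the statement.\<close>

lemma set_compl_enlarge_le:
  assumes sc: "set_concentration N r \<mu> a b" and n: "n \<ge> 1" and t: "t \<ge> 0"
    and E: "E \<in> sets (tuple_borel n)" "convex E \<or> convex (tuples n - E)" "measure (P n) E \<ge> 1 / 2"
    and G: "G \<in> sets (P n)" "G \<subseteq> tuples n" "\<And>x e. x \<in> G \<Longrightarrow> e \<in> E \<Longrightarrow> t powr (1 / r) < tuple_norm N r n (x - e)"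
  shows "measure (P n) G \<le> b * exp (- t / a)"
proof -
  have Et: "E \<subseteq> tuples n" using sets.sets_into_space[OF E(1)] by simp
  have "enlarge N r n E t \<subseteq> tuples n - G"
    unfolding enlarge_eq[OF Et t] using G(3) by (fastforce simp: not_le[symmetric])
  then have "enn2real (outer_measure_of (P n) (enlarge N r n E t)) \<le> measure (P n) (tuples n - G)"
    by (rule outer_le_measure) (use G(1) sets.compl_sets[OF G(1)] in simp)
  moreover have "1 - b * exp (- t / a) \<le> enn2real (outer_measure_of (P n) (enlarge N r n E t))"
    by (rule set_concentrationD[OF sc n t E])
  ultimately show ?thesis using measure_compl[OF G(1)] by simp
qed

lemma powr_le_self: "0 \<le> x \<Longrightarrow> x \<le> 1 \<Longrightarrow> 1 \<le> p \<Longrightarrow> x powr p \<le> (x::real)"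
  using powr_mono'[of 1 p x] by simp

lemma exponent_ge_1: "0 < s \<Longrightarrow> s < 1 \<Longrightarrow> 1 \<le> 1 / s powr (r - 1)"
  using r powr_le1[of "r - 1" s] by (simp add: field_simps)

text \<open>Let \<open>m\<close> be a median of the distance to the closed hull \<open>C\<close> and
  \<open>T\<close> the radius. If \<open>m \<le> T\<close>, the convex set
  \<open>{tdist n C \<le> m}\<close> controls the points beyond \<open>T\<close>, at distance more
  than \<open>T - m\<close> from it, and the set \<open>{m \<le> tdist n C}\<close>, with convex
  complement, controls \<open>C\<close>. Since \<open>T = (T - m) + m\<close>, weighted convexity
  gives \<open>t \<le> \<alpha> * u + \<beta> * v\<close>, so the exponents combine to the right
  exponential, with factor \<open>b powr (\<alpha> + \<beta>)\<close>. The plain \<open>b\<close> in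
  the maximum serves the cases in which only one of the two estimates is used.\<close>

lemma set_imp_two_set_at:
  assumes sc: "set_concentration N r \<mu> a b" and a: "a > 0" and b: "b > 0" and s: "0 < s" "s < 1"
  shows "two_set_at a (max b (b powr (1 / (1 - s) powr (r - 1) + 1 / s powr (r - 1)))) s"
  unfolding two_set_at_def
proof (intro allI impI ballI)
  fix n :: nat and A :: "(nat \<Rightarrow> real^'m) set" and t :: real
  assume n: "1 \<le> n" and A: "A \<in> sets (tuple_borel n)" and t: "0 \<le> t"
  interpret prob_space "P n" by (rule prob_P)
  define \<alpha> \<beta> where "\<alpha> = 1 / (1 - s) powr (r - 1)" and "\<beta> = 1 / s powr (r - 1)"
  have ab: "\<alpha> \<ge> 1" "\<beta> \<ge> 1" unfolding \<alpha>_def \<beta>_def using s exponent_ge_1[of "1 - s"] exponent_ge_1[of s] by auto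
  let ?B = "max b (b powr (\<alpha> + \<beta>))"
  show "prob (tuples n - cost_enlarge N r n A t) powr (1 / (1 - s) powr (r - 1)) * prob A powr (1 / s powr (r - 1))
      \<le> max b (b powr (1 / (1 - s) powr (r - 1) + 1 / s powr (r - 1))) * exp (- t / a)"
    unfolding \<alpha>_def[symmetric] \<beta>_def[symmetric]
  proof (cases "A = {}")
    case True
    then show "prob (tuples n - cost_enlarge N r n A t) powr \<alpha> * prob A powr \<beta> \<le> ?B * exp (- t / a)"
      using b by (simp add: max_def)
  next
    case ne: False
    define C where "C = closure (convex hull A)"
    note C = hull_closure[OF A ne, folded C_def]
    define T where "T = t powr (1 / r)"
    have T: "T \<ge> 0" "T powr r = t" using t r by (auto simp: T_def powr_powr)
    have CP: "C \<in> sets (P n)" using closed_in_sets_tuple_borel[OF C(1,3)] sets_P by simp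
    have AP: "A \<in> sets (P n)" using A sets_P by simp
    have borel: "X \<in> sets (P n) \<Longrightarrow> X \<in> sets (tuple_borel n)" for X using sets_P by simp
    note sets_C = sets_tdist[OF C(4), of n]
    note cv = convex_on_tdist[OF C(2,4) convex_tuples, of n n]
    define x where "x = prob {x \<in> tuples n. T < tdist n C x}"
    define y where "y = prob A"
    have xy: "0 \<le> x" "x \<le> 1" "0 \<le> y" "y \<le> 1" by (auto simp: x_def y_def)
    have yC: "y \<le> prob C" unfolding y_def using C(5) CP by (rule finite_measure_mono)
    have C0: "tdist n C z = 0" if "z \<in> C" for z using that by (rule tdist_eq_0)
    have close: "\<bar>tdist n C z - tdist n C w\<bar> \<le> tuple_norm N r n (z - w)" for z w
      by (rule tdist_lipschitz[OF C(4)])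
    have m[measurable]: "tdist n C \<in> borel_measurable (P n)" by (intro measurable_P measurable_tdist C)

    have goal: "x powr \<alpha> * y powr \<beta> \<le> ?B * exp (- t / a)"
    proof (cases "prob {z \<in> tuples n. tdist n C z \<le> T} \<ge> 1 / 2")
      \<comment> \<open>More than half of the mass lies beyond \<open>T\<close>. That region has
        convex complement and is at distance more than \<open>T\<close> from \<open>C\<close>, so
        \<open>A\<close> alone already has exponentially small measure.\<close>
      case False
      have "prob {z \<in> tuples n. T < tdist n C z} \<ge> 1 / 2"
        using False measure_compl[OF sets_C(1), of T] unfolding diff_Collect_le by simp
      moreover have "convex (tuples n - {z \<in> tuples n. T < tdist n C z})"
        unfolding diff_Collect_greater by (rule convex_sublevel(1)[OF cv])
      moreover have "t powr (1 / r) < tuple_norm N r n (z - w)"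
        if "z \<in> C" "w \<in> {z \<in> tuples n. T < tdist n C z}" for z w
        using that close[of z w] C0[of z] by (simp add: T_def abs_le_iff)
      ultimately have "prob C \<le> b * exp (- t / a)"
        using C(3) by (intro set_compl_enlarge_le[OF sc n t borel[OF sets_C(3)[of T]] _ _ CP]) blast+
      then have y_le: "y \<le> b * exp (- t / a)" using yC by simp
      have "x powr \<alpha> * y powr \<beta> \<le> 1 * y"
        using xy ab powr_le_self[of y \<beta>] by (intro mult_mono powr_le1) auto
      also have "\<dots> \<le> ?B * exp (- t / a)" using y_le by (simp add: order_trans[OF _ mult_right_mono])
      finally show ?thesis .
    next
      case True
      then obtain m where m: "m \<le> T" "is_median (P n) (tdist n C) m" using exists_median_le[OF m, of T] by auto
      have m0: "m \<ge> 0"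
      proof (rule ccontr)
        assume "\<not> ?thesis"
        then have "m < tdist n C x" for x using tdist_nonneg[OF C(4), of n x] by simp
        then have "{x \<in> tuples n. tdist n C x \<le> m} = {}" by (simp add: not_le)
        then have "prob {x \<in> tuples n. tdist n C x \<le> m} = 0" by (simp only: measure_empty)
        then show False using m(2) by (simp add: is_median_def)
      qed
      define u where "u = (T - m) powr r"
      have u: "u \<ge> 0" "u powr (1 / r) = T - m" using m(1) r by (auto simp: u_def powr_powr)
      have x_le: "x \<le> b * exp (- u / a)" unfolding x_def
      proof (rule set_compl_enlarge_le[OF sc n u(1) borel[OF sets_C(1)[of m]] _ _ sets_C(3)[of T]])
        show "convex {x \<in> tuples n. tdist n C x \<le> m} \<or> convex (tuples n - {x \<in> tuples n. tdist n C x \<le> m})"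
          using convex_sublevel(1)[OF cv] by blast
        show "1 / 2 \<le> prob {x \<in> tuples n. tdist n C x \<le> m}" using m(2) by (simp add: is_median_def)
        show "u powr (1 / r) < tuple_norm N r n (z - e)"
          if "z \<in> {x \<in> tuples n. T < tdist n C x}" "e \<in> {x \<in> tuples n. tdist n C x \<le> m}" for z e
          using that close[of z e] u(2) by (simp add: abs_le_iff)
      qed (rule Collect_restrict)
      show ?thesis
      proof (cases "m = 0")
        \<comment> \<open>With \<open>m = 0\<close> there is no radius between \<open>0\<close> and
          \<open>m\<close> with which to estimate \<open>C\<close>, but then \<open>u = t\<close>
          and the first estimate is enough.\<close>
        case True
        then have "u = t" using T by (simp add: u_def)
        have "x powr \<alpha> * y powr \<beta> \<le> x * 1"
          using xy ab powr_le_self[of x \<alpha>] by (intro mult_mono powr_le1) auto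
        also have "\<dots> \<le> ?B * exp (- t / a)" using x_le \<open>u = t\<close> by (simp add: order_trans[OF _ mult_right_mono])
        finally show ?thesis .
      next
        case False
        then have mpos: "m > 0" using m0 by simp
        define v where "v = m powr r"
        have v: "v > 0" using mpos by (simp add: v_def)
        \<comment> \<open>Points with \<open>m \<le> tdist n C\<close> may be at distance exactly
          \<open>m\<close> from \<open>C\<close>, whereas (1) separates sets at strictly larger
          distance; hence the detour over \<open>w < v\<close>.\<close>
        have "prob C \<le> b * exp (- w / a)" if w: "0 < w" "w < v" for w
        proof -
          have "w powr (1 / r) < v powr (1 / r)" using w r by (intro powr_less_mono2) auto
          then have wm: "w powr (1 / r) < m" using r mpos by (simp add: v_def powr_powr)
          show ?thesis
          proof (rule set_compl_enlarge_le[OF sc n less_imp_le[OF w(1)] borel[OF sets_C(4)[of m]] _ _ CP C(3)])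
            show "convex {x \<in> tuples n. m \<le> tdist n C x} \<or> convex (tuples n - {x \<in> tuples n. m \<le> tdist n C x})"
              unfolding diff_Collect_greater_eq using convex_sublevel(2)[OF cv] by blast
            show "1 / 2 \<le> prob {x \<in> tuples n. m \<le> tdist n C x}" using m(2) by (simp add: is_median_def)
            show "w powr (1 / r) < tuple_norm N r n (z - e)"
              if "z \<in> C" "e \<in> {x \<in> tuples n. m \<le> tdist n C x}" for z e
              using that close[of z e] C0[of z] wm by (simp add: abs_le_iff)
          qed
        qed
        then have "\<forall>\<^sub>F w in at_left v. prob C \<le> b * exp (- w / a)"
          unfolding eventually_at_left_field using v by (intro exI[of _ 0]) simp
        moreover have "((\<lambda>w. b * exp (- w / a)) \<longlongrightarrow> b * exp (- v / a)) (at_left v)"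
          using a by (intro tendsto_intros) auto
        ultimately have "prob C \<le> b * exp (- v / a)" by (intro tendsto_lowerbound[where F="at_left v"]) auto
        then have y_le: "y \<le> b * exp (- v / a)" using yC by simp
        have "t \<le> \<alpha> * u + \<beta> * v"
          using powr_add_le_weighted[of r "T - m" m s] r m(1) mpos s T(2) divide_powr_eq[of s 1] divide_powr_eq[of "1 - s" 1]
          by (simp add: u_def v_def \<alpha>_def \<beta>_def)
        then have "t / a \<le> (\<alpha> * u + \<beta> * v) / a" using a by (intro divide_right_mono) auto
        then have e: "exp (- u / a * \<alpha> + - v / a * \<beta>) \<le> exp (- t / a)"
          by (simp add: add_divide_distrib mult.commute)
        have "x powr \<alpha> * y powr \<beta> \<le> (b * exp (- u / a)) powr \<alpha> * (b * exp (- v / a)) powr \<beta>"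
          using xy x_le y_le ab by (intro mult_mono powr_mono2) auto
        also have "(b * exp (- u / a)) powr \<alpha> = b powr \<alpha> * exp (- u / a * \<alpha>)"
          using b by (simp add: powr_mult exp_powr_real)
        also have "(b * exp (- v / a)) powr \<beta> = b powr \<beta> * exp (- v / a * \<beta>)"
          using b by (simp add: powr_mult exp_powr_real)
        also have "b powr \<alpha> * exp (- u / a * \<alpha>) * (b powr \<beta> * exp (- v / a * \<beta>))
            = b powr (\<alpha> + \<beta>) * exp (- u / a * \<alpha> + - v / a * \<beta>)"
          by (simp only: powr_add exp_add mult.assoc mult.left_commute mult.commute)
        also have "\<dots> \<le> ?B * exp (- t / a)" using e b by (intro mult_mono) auto
        finally show ?thesis .
      qed
    qed
    then show "prob (tuples n - cost_enlarge N r n A t) powr \<alpha> * prob A powr \<beta> \<le> ?B * exp (- t / a)"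
      unfolding compl_cost_enlarge[OF A ne t] x_def y_def T_def C_def .
  qed
qed

text \<open>For convex \<open>A\<close> the hull adds nothing and (3) is solved for the measure of
  the far set. If the complement is convex, the far set \<open>?E\<close> is convex by concavity of
  the distance there; (3) is then applied to \<open>?E\<close> with \<open>1 - s\<close>, and
  \<open>A\<close> lies in the complement of its enlargement, so that the two factors appear with
  the same exponents as before. At \<open>t = 0\<close> a half-space of a balanced linear functional
  shows that the constant is at least \<open>1 / 2\<close>.\<close>

lemma two_set_imp_set:
  assumes ts: "two_set_concentration N r \<mu> a b" and a: "a > 0" and b: "b > 0" and s: "0 < s" "s < 1"
  shows "set_concentration N r \<mu> (a / (1 - s) powr (r - 1))
    (b powr ((1 - s) powr (r - 1)) * 2 powr ((1 - s) powr (r - 1) / s powr (r - 1)))"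
proof -
  define p q where "p = (1 - s) powr (r - 1)" and "q = s powr (r - 1)"
  have pq: "p > 0" "q > 0" using s by (auto simp: p_def q_def)
  let ?b = "b powr p * 2 powr (p / q)"
  \<comment> \<open>With \<open>y \<ge> 1 / 2\<close> the inequality gives
    \<open>x powr (1 / p) \<le> b * 2 powr (1 / q) * exp (- u / a)\<close>; raising it to the power
    \<open>p\<close> produces both \<open>?b\<close> and \<open>a / p\<close>.\<close>
  have solve: "x \<le> ?b * exp (- u / (a / p))" if "0 \<le> x" "1 / 2 \<le> y" "x powr (1 / p) * y powr (1 / q) \<le> b * exp (- u / a)"
    for x y u
  proof -
    have "x powr (1 / p) * (1 / 2) powr (1 / q) \<le> x powr (1 / p) * y powr (1 / q)"
      using that pq by (intro mult_left_mono powr_mono2) auto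
    also have "\<dots> \<le> b * exp (- u / a)" by fact
    finally have "x powr (1 / p) \<le> b * exp (- u / a) * 2 powr (1 / q)"
      by (simp add: powr_divide field_simps)
    then have "(x powr (1 / p)) powr p \<le> (b * exp (- u / a) * 2 powr (1 / q)) powr p"
      using pq by (intro powr_mono2) auto
    then show ?thesis using that(1) pq b by (simp add: powr_powr powr_mult exp_powr_real field_simps)
  qed
  have at: "two_set_at a b s" "two_set_at a b (1 - s)" using ts s by (auto simp: two_set_iff)
  have "set_concentration N r \<mu> (a / p) ?b"
  proof (rule set_concentrationI)
    fix n :: nat and A :: "(nat \<Rightarrow> real^'m) set" and u :: real
    assume n: "1 \<le> n" and A: "A \<in> sets (tuple_borel n)" "A \<noteq> {}" "convex A \<or> convex (tuples n - A)"
      and half: "1 / 2 \<le> measure (P n) A" and u: "0 < u"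
    interpret prob_space "P n" by (rule prob_P)
    have At: "A \<subseteq> tuples n" using sets.sets_into_space[OF A(1)] by simp
    let ?E = "{x \<in> tuples n. u powr (1 / r) < tdist n A x}"
    show "prob ?E \<le> ?b * exp (- u / (a / p))"
    proof (cases "convex A")
      case True
      then have "tuples n - cost_enlarge N r n A u = ?E"
        using compl_cost_enlarge[OF A(1,2), of u] u by (simp add: hull_same tdist_closure[OF A(2)])
      then have "prob ?E powr (1 / p) * prob A powr (1 / q) \<le> b * exp (- u / a)"
        using two_set_atD[OF at(1) n A(1), of u] u by (simp add: p_def q_def)
      then show ?thesis using half by (intro solve[of _ "prob A"]) auto
    next
      case False
      then have D: "convex (tuples n - A)" using A(3) by simp
      have ET: "?E \<in> sets (tuple_borel n)" using sets_tdist(3)[OF A(2)] sets_P by simp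
      show ?thesis
      proof (cases "?E = {}")
        case True
        show ?thesis unfolding True by simp
      next
        case E: False
        have conv: "convex ?E" unfolding convex_alt
        proof (intro ballI allI impI)
          fix x y w assume xy: "x \<in> ?E" "y \<in> ?E" and w: "0 \<le> (w::real) \<and> w \<le> 1"
          have out: "z \<in> tuples n - A" if "z \<in> ?E" for z using that tdist_eq_0[of z A n] by fastforce
          show "(1 - w) *\<^sub>R x + w *\<^sub>R y \<in> ?E"
          proof (cases "w = 0 \<or> w = 1")
            case True then show ?thesis using xy by (elim disjE) simp_all
          next
            case False
            then have "0 < w" "w < 1" using w by auto
            from tdist_concave_on_compl[OF A(2) At D out[OF xy(1)] out[OF xy(2)] this]
            have "(1 - w) * tdist n A x + w * tdist n A y \<le> tdist n A ((1 - w) *\<^sub>R x + w *\<^sub>R y)" .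
            moreover have "u powr (1 / r) < (1 - w) * tdist n A x + w * tdist n A y"
              using convex_bound_lt[of "- tdist n A x" "- (u powr (1 / r))" "- tdist n A y" "1 - w" w] xy w by simp
            moreover have "(1 - w) *\<^sub>R x + w *\<^sub>R y \<in> tuples n" using xy by (intro tuples_comb) simp_all
            ultimately show ?thesis by simp
          qed
        qed
        \<comment> \<open>Points of \<open>A\<close> are at distance at least
          \<open>u powr (1 / r)\<close> from \<open>?E\<close>, possibly exactly that, and so lie
          outside the enlargement of \<open>?E\<close> only for \<open>w < u\<close>.\<close>
        have "prob ?E powr (1 / p) * prob A powr (1 / q) \<le> b * exp (- w / a)" if w: "0 < w" "w < u" for w
        proof -
          have "w powr (1 / r) < u powr (1 / r)" using w r by (intro powr_less_mono2) auto
          moreover have "u powr (1 / r) \<le> tdist n ?E x" if "x \<in> A" for x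
            unfolding tdist_def[of n ?E] using E tdist_le[OF that, of n]
            by (intro cINF_greatest) (auto simp: tuple_norm_minus_commute[of n x] intro: order_trans[OF less_imp_le])
          ultimately have "A \<subseteq> {x \<in> tuples n. w powr (1 / r) < tdist n ?E x}" using At by force
          also have "\<dots> = tuples n - cost_enlarge N r n ?E w"
            using compl_cost_enlarge[OF ET E, of w] w(1) conv by (simp add: hull_same tdist_closure[OF E])
          finally have sub: "A \<subseteq> tuples n - cost_enlarge N r n ?E w" .
          have "prob A \<le> prob (tuples n - cost_enlarge N r n ?E w)"
            using sub compl_cost_enlarge[OF ET E, of w] w(1) sets_tdist(3)[OF hull_closure(4)[OF ET E]]
            by (intro finite_measure_mono) simp_all
          then have "prob A powr (1 / q) * prob ?E powr (1 / p) \<le>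
              prob (tuples n - cost_enlarge N r n ?E w) powr (1 / q) * prob ?E powr (1 / p)"
            using pq by (intro mult_right_mono powr_mono2) auto
          also have "\<dots> \<le> b * exp (- w / a)"
            using two_set_atD[OF at(2) n ET, of w] w(1) by (simp add: p_def q_def)
          finally show ?thesis by (simp add: mult.commute)
        qed
        then have "\<forall>\<^sub>F w in at_left u. prob ?E powr (1 / p) * prob A powr (1 / q) \<le> b * exp (- w / a)"
          unfolding eventually_at_left_field using u by (intro exI[of _ 0]) simp
        moreover have "((\<lambda>w. b * exp (- w / a)) \<longlongrightarrow> b * exp (- u / a)) (at_left u)"
          using a by (intro tendsto_intros) auto
        ultimately have "prob ?E powr (1 / p) * prob A powr (1 / q) \<le> b * exp (- u / a)"
          by (intro tendsto_lowerbound[where F="at_left u"]) auto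
        then show ?thesis using half by (intro solve[of _ "prob A"]) auto
      qed
    qed
  next
    show "Dirac \<or> 1 / 2 \<le> ?b"
    proof (cases Dirac)
      case nd: False
      have "1/2 - e \<le> ?b" if e: "e > 0" for e
      proof -
        obtain n v where n: "n \<ge> 1" and v: "1 / 2 - e \<le> measure (P n) {x \<in> tuples n. lin v n x > 0}"
          "1 / 2 \<le> measure (P n) {x \<in> tuples n. lin v n x \<le> 0}"
          using not_Dirac_imp_balanced_linear[OF nd e] by blast
        interpret prob_space "P n" by (rule prob_P)
        let ?A = "{x \<in> tuples n. lin v n x \<le> 0}"
        have cont: "continuous_on S (lin v n)" for S
          unfolding lin_def by (intro continuous_intros continuous_on_subset[OF continuous_on_product_coordinates]) auto
        have cl: "closed ?A"
          using closed_Int[OF closed_tuples closed_Collect_le[OF cont continuous_on_const]]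
          by (simp only: Collect_conj_eq Collect_mem_eq)
        have AT: "?A \<in> sets (tuple_borel n)" by (intro closed_in_sets_tuple_borel cl Collect_restrict)
        have conv: "convex ?A" by (rule convex_sublevel(1)) (simp add: convex_on_lin)
        have ne: "?A \<noteq> {}"
        proof
          assume e: "?A = {}"
          show False using v(2) unfolding e by simp
        qed
        \<comment> \<open>The closed half-space is convex and closed, so its enlargement with
          parameter \<open>0\<close> is itself; the open half-space opposite to it is the remaining
          set in (3).\<close>
        have sub: "{x \<in> tuples n. lin v n x > 0} \<subseteq> tuples n - cost_enlarge N r n ?A 0"
        proof -
          have *: "lin v n x \<le> 0" if "tdist n ?A x \<le> 0" "x \<in> tuples n" for x
          proof -
            obtain c where c: "c \<in> ?A" "tuple_norm N r n (x - c) = tdist n ?A x"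
              using tdist_attained[OF cl Collect_restrict ne] by blast
            then have "tuple_norm N r n (x - c) = 0" using that tuple_norm_ge_0[of N r n "x - c"] by simp
            then have "lin v n x = lin v n c" by (simp add: tuple_norm_eq_0 lin_def)
            then show ?thesis using c(1) by simp
          qed
          then show ?thesis unfolding compl_cost_enlarge[OF AT ne order_refl]
            using conv r by (simp add: hull_same tdist_closure[OF ne] subset_iff) (meson not_le)
        qed
        have meas: "tuples n - cost_enlarge N r n ?A 0 \<in> sets (P n)"
          unfolding compl_cost_enlarge[OF AT ne order_refl] by (intro sets_tdist hull_closure(4)[OF AT ne])
        have x: "1/2 - e \<le> prob (tuples n - cost_enlarge N r n ?A 0)"
          using v(1) finite_measure_mono[OF sub meas] by (rule order_trans)
        have "prob (tuples n - cost_enlarge N r n ?A 0) powr (1 / p) * prob ?A powr (1 / q) \<le> b * exp (- 0 / a)"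
          using two_set_atD[OF at(1) n AT order_refl] by (simp add: p_def q_def)
        then have "prob (tuples n - cost_enlarge N r n ?A 0) \<le> ?b * exp (- 0 / (a / p))"
          by (intro solve[OF measure_nonneg v(2)])
        then show ?thesis using x by simp
      qed
      then have "1 / 2 \<le> ?b + e" if "e > 0" for e using that by (simp add: diff_le_eq)
      then have "1 / 2 \<le> ?b" by (rule field_le_epsilon)
      then show ?thesis ..
    qed simp
  qed (use a b pq in auto)
  then show ?thesis by (simp add: p_def q_def)
qed

end

section \<open>Dual form of the transport inequality and tensorization\<close>

text \<open>In \<open>rel_entropy_density\<close> the conversion \<open>ennreal\<close> would hide a
  negative integral. The sign permits the entropies to be handled as real numbers.\<close>

lemma density_entropy_nonneg:
  assumes "prob_space \<mu>" and g[measurable]: "g \<in> borel_measurable \<mu>" and gpos: "\<And>x. g x > 0"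
    and \<nu>: "\<nu> = density \<mu> (\<lambda>x. ennreal (g x))" "prob_space \<nu>" and int: "integrable \<nu> (\<lambda>x. ln (g x))"
  shows "0 \<le> (\<integral>x. ln (g x) \<partial>\<nu>)"
proof -
  interpret prob_space \<mu> by fact
  interpret \<nu>: prob_space \<nu> by fact
  have 1: "integrable \<nu> (\<lambda>x. 1 / g x)" "(\<integral>x. 1 / g x \<partial>\<nu>) = 1"
    unfolding \<nu>(1) using gpos by (auto simp: integrable_density integral_density less_imp_le prob_space less_imp_neq[symmetric])
  have "(\<integral>x. - ln (g x) \<partial>\<nu>) \<le> (\<integral>x. 1 / g x - 1 \<partial>\<nu>)"
  proof (intro integral_mono)
    fix x show "- ln (g x) \<le> 1 / g x - 1"
      using ln_le_minus_one[of "1 / g x"] gpos[of x] by (simp add: ln_div)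
  qed (use int 1 in auto)
  also have "\<dots> = 0" using 1 by (simp add: \<nu>.prob_space)
  finally show ?thesis by simp
qed

lemma density_bounded_P1:
  assumes \<mu>: "\<mu> \<in> P1" and g[measurable]: "g \<in> borel_measurable \<mu>" and gpos: "\<And>x. g x \<ge> 0" and B: "\<And>x. g x \<le> B"
    and one: "(\<integral>x. g x \<partial>\<mu>) = 1"
  shows "density \<mu> (\<lambda>x. ennreal (g x)) \<in> P1"
proof -
  note \<mu>D = P1D[OF \<mu>]
  interpret prob_space \<mu> by (rule \<mu>D(1))
  have int: "integrable \<mu> g" using one not_integrable_integral_eq by fastforce
  have "emeasure (density \<mu> (\<lambda>x. ennreal (g x))) (space \<mu>) = (\<integral>\<^sup>+x. ennreal (g x) \<partial>\<mu>)"
    by (subst emeasure_density) (auto intro!: nn_integral_cong)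
  also have "\<dots> = 1" using one nn_integral_eq_integral[OF int] gpos by simp
  finally have p: "prob_space (density \<mu> (\<lambda>x. ennreal (g x)))" by (intro prob_spaceI) simp
  note [measurable_cong] = \<mu>D(2)
  have nm: "norm \<in> borel_measurable \<mu>" by measurable
  have "integrable \<mu> (\<lambda>x. g x * norm x)"
  proof (rule Bochner_Integration.integrable_bound)
    show "integrable \<mu> (\<lambda>x. B * norm x)" using \<mu>D(4) by auto
    show "AE x in \<mu>. norm (g x * norm x) \<le> norm (B * norm x)"
      using gpos B by (auto intro!: AE_I2 mult_right_mono simp: abs_mult intro: order_trans[OF B abs_ge_self])
  qed (use nm in measurable)
  then have "integrable (density \<mu> (\<lambda>x. ennreal (g x))) norm"
    using nm gpos by (subst integrable_density) auto
  then show ?thesis using p \<mu>D(2) by (auto simp: P1_def)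
qed

text \<open>The convex envelope of \<open>f\<close> at a point is the infimum of the second
  coordinates over that point. Keeping the hull of the graph itself avoids questions about
  regularity or attainment of the envelope, and convexity of a condition extends it from the graph
  to all pairs.\<close>

definition graph_hull :: "'a::real_vector set \<Rightarrow> ('a \<Rightarrow> real) \<Rightarrow> ('a \<times> real) set"
  where "graph_hull S f = convex hull ((\<lambda>x. (x, f x)) ` S)"

lemma graph_hullI: "x \<in> S \<Longrightarrow> (x, f x) \<in> graph_hull S f"
  unfolding graph_hull_def by (intro hull_inc) auto

lemma convex_graph_hull: "convex (graph_hull S f)"
  by (simp add: graph_hull_def)

lemma graph_hull_minimal:
  "convex T \<Longrightarrow> (\<And>x. x \<in> S \<Longrightarrow> (x, f x) \<in> T) \<Longrightarrow> graph_hull S f \<subseteq> T"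
  unfolding graph_hull_def by (intro hull_minimal) auto

lemma graph_hull_nonneg:
  assumes "\<And>x. x \<in> S \<Longrightarrow> 0 \<le> f x" "p \<in> graph_hull S f"
  shows "0 \<le> snd p"
proof -
  have "convex {p :: 'a \<times> real. 0 \<le> snd p}" by (auto simp: convex_def)
  then show ?thesis using graph_hull_minimal[of "{p. 0 \<le> snd p}" S f] assms by auto
qed

section \<open>Infimum convolutions\<close>

context norm_power
begin

text \<open>The infimum convolution \<open>Q f\<close> of the convex hull of \<open>f\<close> with the cost, on \<open>\<real>\<^sup>m\<close> and on tuples.\<close>

definition Q1 :: "(real^'m \<Rightarrow> real) \<Rightarrow> real^'m \<Rightarrow> real"
  where "Q1 f y = (INF p\<in>graph_hull UNIV f. snd p + N (y - fst p) powr r)"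

definition Qn :: "nat \<Rightarrow> ((nat \<Rightarrow> real^'m) \<Rightarrow> real) \<Rightarrow> (nat \<Rightarrow> real^'m) \<Rightarrow> real"
  where "Qn n f x = (INF p\<in>graph_hull (tuples n) f. snd p + (\<Sum>i<n. N (x i - fst p i) powr r))"

context
  fixes f :: "real^'m \<Rightarrow> real" assumes f0: "\<And>x. f x \<ge> 0"
begin

lemma Q1_bdd: "bdd_below ((\<lambda>p. snd p + N (y - fst p) powr r) ` graph_hull UNIV f)"
  using graph_hull_nonneg[of UNIV f] f0 by (intro bdd_belowI2[of _ 0]) auto

lemma Q1_ne: "graph_hull UNIV f \<noteq> {}"
  using graph_hullI[of undefined UNIV f] by auto

lemma Q1_le: "p \<in> graph_hull UNIV f \<Longrightarrow> Q1 f y \<le> snd p + N (y - fst p) powr r"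
  unfolding Q1_def by (intro cINF_lower Q1_bdd)

lemma Q1_nonneg: "0 \<le> Q1 f y"
  unfolding Q1_def using Q1_ne graph_hull_nonneg[of UNIV f] f0 by (intro cINF_greatest) auto

lemma Q1_less_iff: "Q1 f y < c \<longleftrightarrow> (\<exists>p\<in>graph_hull UNIV f. snd p + N (y - fst p) powr r < c)"
  unfolding Q1_def by (rule cINF_less_iff[OF Q1_ne Q1_bdd])

lemma Q1_measurable: "Q1 f \<in> borel_measurable borel"
proof (rule borel_measurableI_less)
  fix c
  have "{y \<in> space borel. Q1 f y < c} = (\<Union>p\<in>graph_hull UNIV f. {y. snd p + N (y - fst p) powr r < c})"
    by (auto simp: Q1_less_iff)
  also have "open \<dots>" by (intro open_UN ballI open_Collect_less continuous_intros)
  finally show "{y \<in> space borel. Q1 f y < c} \<in> sets borel" by simp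
qed

text \<open>The pair of means lies in the closure of the hull of the graph, and the bound in
  \<open>Q1_le\<close> is a closed condition on the pair. This is where the barycentric cost meets
  the infimum convolution: integrated against a kernel it is the easy half of duality.\<close>

lemma Q1_le_expectation:
  assumes p: "prob_space p" "integrable p (\<lambda>y. y)" and f: "integrable p f"
  shows "Q1 f x \<le> (\<integral>y. f y \<partial>p) + N (x - (\<integral>y. y \<partial>p)) powr r"
proof -
  have "(\<integral>y. (y, f y) \<partial>p) \<in> closure (graph_hull UNIV f)"
    using graph_hullI[of _ UNIV f] closure_subset[of "graph_hull UNIV f"]
    by (intro expectation_in_closed_convex p integral_Pair f convex_closure convex_graph_hull) auto
  also have "\<dots> \<subseteq> {q. Q1 f x \<le> snd q + N (x - fst q) powr r}"
    using Q1_le by (intro closure_minimal closed_Collect_le continuous_intros) auto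
  finally show ?thesis using integral_Pair(2)[OF p(2) f] by simp
qed

end

context
  fixes f :: "(nat \<Rightarrow> real^'m) \<Rightarrow> real" and n :: nat assumes f0: "\<And>x. x \<in> tuples n \<Longrightarrow> f x \<ge> 0"
begin

lemma Qn_bdd: "bdd_below ((\<lambda>p. snd p + (\<Sum>i<n. N (x i - fst p i) powr r)) ` graph_hull (tuples n) f)"
  using graph_hull_nonneg[of "tuples n" f] f0
  by (intro bdd_belowI2[of _ 0] add_nonneg_nonneg sum_nonneg) simp_all

lemma Qn_ne: "graph_hull (tuples n) f \<noteq> {}"
  using graph_hullI[of "\<lambda>_. undefined" "tuples n" f] by (auto simp: in_tuples_iff)

lemma Qn_le: "p \<in> graph_hull (tuples n) f \<Longrightarrow> Qn n f x \<le> snd p + (\<Sum>i<n. N (x i - fst p i) powr r)"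
  unfolding Qn_def by (intro cINF_lower Qn_bdd)

lemma Qn_less_iff: "Qn n f x < c \<longleftrightarrow> (\<exists>p\<in>graph_hull (tuples n) f. snd p + (\<Sum>i<n. N (x i - fst p i) powr r) < c)"
  unfolding Qn_def by (rule cINF_less_iff[OF Qn_ne Qn_bdd])

lemma Qn_measurable: "Qn n f \<in> borel_measurable (tuple_borel n)"
proof (rule borel_measurableI_less)
  fix c
  have "{x \<in> space (tuple_borel n). Qn n f x < c} =
      (\<lambda>x. x) -` (\<Union>p\<in>graph_hull (tuples n) f. {x. snd p + (\<Sum>i<n. N (x i - fst p i) powr r) < c}) \<inter> space (tuple_borel n)"
    by (auto simp: Qn_less_iff simp del: space_tuple_borel)
  also have "\<dots> \<in> sets (tuple_borel n)"
    by (intro measurable_sets[OF id_measurable_tuple_borel] borel_open open_UN ballI open_Collect_less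
        continuous_intros continuous_on_product_coordinates)
  finally show "{x \<in> space (tuple_borel n). Qn n f x < c} \<in> sets (tuple_borel n)" .
qed

end
end

context norm_power_prob
begin

text \<open>A soft minimum of \<open>f\<close>: by the Gibbs variational formula, the infimum over
  \<nu> of the mean of \<open>f\<close> under \<nu> plus \<kappa> times the entropy of \<nu>
  relative to \<open>M\<close>.\<close>

definition log_laplace :: "'c measure \<Rightarrow> real \<Rightarrow> ('c \<Rightarrow> real) \<Rightarrow> real"
  where "log_laplace M \<kappa> f = - \<kappa> * ln (\<integral>x. exp (- f x / \<kappa>) \<partial>M)"

text \<open>Test the inequality on \<open>\<nu>\<^sub>1 \<propto> exp (- f / \<kappa>\<^sub>1) \<mu>\<close> and \<open>\<nu>\<^sub>2 \<propto> exp (min (Q f) k / \<kappa>\<^sub>2) \<mu>\<close>.\<close>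

lemma T_ineq_imp_dual_bounded:
  assumes T: "T_ineq N r \<mu> \<kappa>1 \<kappa>2" and \<mu>P1: "\<mu> \<in> P1" and \<kappa>: "\<kappa>1 > 0" "\<kappa>2 > 0"
    and f[measurable]: "f \<in> borel_measurable borel" and f0: "\<And>x. f x \<ge> 0"
  shows "(\<integral>x. exp (min (Q1 f x) (real k) / \<kappa>2) \<partial>\<mu>) \<le> exp (log_laplace \<mu> \<kappa>1 f / \<kappa>2)"
proof -
  interpret prob_space \<mu> by (rule prob)
  note [measurable] = Q1_measurable[OF f0]
  \<comment> \<open>The truncation keeps the density of \<open>\<nu>2\<close> bounded, so that
    \<open>\<nu>2\<close> has a finite first moment; for \<open>\<nu>1\<close> the bound comes from
    \<open>f \<ge> 0\<close>.\<close>
  define \<phi> where "\<phi> x = min (Q1 f x) (real k)" for x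
  have \<phi>: "0 \<le> \<phi> x" "\<phi> x \<le> real k" "\<phi> x \<le> Q1 f x" for x using Q1_nonneg[OF f0] by (auto simp: \<phi>_def)
  have [measurable]: "\<phi> \<in> borel_measurable borel" unfolding \<phi>_def by measurable
  have int1: "integrable \<mu> (\<lambda>x. exp (- f x / \<kappa>1))"
    using f0 \<kappa> by (intro integrable_const_bound[of _ 1]) auto
  have int2: "integrable \<mu> (\<lambda>x. exp (\<phi> x / \<kappa>2))"
    using \<phi> \<kappa> by (intro integrable_const_bound[of _ "exp (real k / \<kappa>2)"]) (auto simp: divide_right_mono)
  define Z1 where "Z1 = (\<integral>x. exp (- f x / \<kappa>1) \<partial>\<mu>)"
  define Z2 where "Z2 = (\<integral>x. exp (\<phi> x / \<kappa>2) \<partial>\<mu>)"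
  have Z1: "Z1 > 0"
  proof -
    have "Z1 \<noteq> 0" unfolding Z1_def using integral_nonneg_eq_0_iff_AE[OF int1] AE_contr[of "\<lambda>_. False"] by auto
    then show ?thesis unfolding Z1_def by (simp add: order_less_le)
  qed
  have "(\<integral>x. 1 \<partial>\<mu>) \<le> Z2" unfolding Z2_def using \<phi> \<kappa> int2 by (intro integral_mono) auto
  then have Z2: "Z2 \<ge> 1" using prob_space by simp
  define g1 where "g1 x = exp (- f x / \<kappa>1) / Z1" for x
  define g2 where "g2 x = exp (\<phi> x / \<kappa>2) / Z2" for x
  have [measurable]: "g1 \<in> borel_measurable \<mu>" "g2 \<in> borel_measurable \<mu>" unfolding g1_def g2_def by measurable
  have gpos: "g1 x > 0" "g2 x > 0" for x using Z1 Z2 by (auto simp: g1_def g2_def)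
  define \<nu>1 where "\<nu>1 = density \<mu> (\<lambda>x. ennreal (g1 x))"
  define \<nu>2 where "\<nu>2 = density \<mu> (\<lambda>x. ennreal (g2 x))"
  have g1B: "g1 x \<le> 1 / Z1" for x unfolding g1_def using f0[of x] \<kappa> Z1 by (intro divide_right_mono) auto
  have g2B: "g2 x \<le> exp (real k / \<kappa>2) / Z2" for x
    unfolding g2_def using \<phi>[of x] \<kappa> Z2 by (intro divide_right_mono) (auto simp: divide_right_mono)
  have \<nu>: "\<nu>1 \<in> P1" "\<nu>2 \<in> P1"
    unfolding \<nu>1_def \<nu>2_def using gpos g1B g2B Z1 Z2 int1 int2
    by (auto intro!: density_bounded_P1[OF \<mu>P1] simp: less_imp_le) (auto simp: g1_def g2_def Z1_def Z2_def)
  note \<nu>1D = P1D[OF \<nu>(1)] and \<nu>2D = P1D[OF \<nu>(2)]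
  interpret \<nu>1: prob_space \<nu>1 by (rule \<nu>1D)
  interpret \<nu>2: prob_space \<nu>2 by (rule \<nu>2D)
  note [measurable_cong] = \<nu>1D(2) \<nu>2D(2)
  have intf: "integrable \<nu>1 f"
  proof -
    have "integrable \<mu> (\<lambda>x. g1 x * f x)"
    proof (rule integrable_const_bound[of _ "\<kappa>1 / Z1"])
      show "AE x in \<mu>. norm (g1 x * f x) \<le> \<kappa>1 / Z1"
      proof (rule AE_I2)
        fix x
        have "f x / \<kappa>1 \<le> exp (f x / \<kappa>1)" using exp_ge_add_one_self[of "f x / \<kappa>1"] by linarith
        then have "exp (- f x / \<kappa>1) * f x \<le> \<kappa>1" using \<kappa> by (simp add: exp_minus field_simps)
        then show "norm (g1 x * f x) \<le> \<kappa>1 / Z1" using Z1 f0[of x] gpos(1)[of x]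
          by (simp add: g1_def abs_mult divide_right_mono)
      qed
    qed simp
    then show ?thesis unfolding \<nu>1_def using gpos by (subst integrable_density) (auto simp: less_imp_le)
  qed
  have int\<phi>: "integrable \<nu>2 \<phi>" using \<phi> by (intro \<nu>2.integrable_const_bound[of _ "real k"]) auto
  have ln1: "ln (g1 x) = - f x / \<kappa>1 - ln Z1" for x using Z1 by (simp add: g1_def ln_div)
  have ln2: "ln (g2 x) = \<phi> x / \<kappa>2 - ln Z2" for x using Z2 by (simp add: g2_def ln_div)
  define H1 where "H1 = - (\<integral>x. f x \<partial>\<nu>1) / \<kappa>1 - ln Z1"
  define H2 where "H2 = (\<integral>x. \<phi> x \<partial>\<nu>2) / \<kappa>2 - ln Z2"
  have i1: "integrable \<nu>1 (\<lambda>x. ln (g1 x))" "(\<integral>x. ln (g1 x) \<partial>\<nu>1) = H1"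
    unfolding ln1 H1_def using intf by (auto simp: \<nu>1.prob_space)
  have i2: "integrable \<nu>2 (\<lambda>x. ln (g2 x))" "(\<integral>x. ln (g2 x) \<partial>\<nu>2) = H2"
    unfolding ln2 H2_def using int\<phi> by (auto simp: \<nu>2.prob_space)
  have H: "rel_entropy \<nu>1 \<mu> = ennreal H1" "rel_entropy \<nu>2 \<mu> = ennreal H2" "H1 \<ge> 0" "H2 \<ge> 0"
    using rel_entropy_density[OF prob _ gpos(1) \<nu>1_def \<nu>1D(1) i1(1)] rel_entropy_density[OF prob _ gpos(2) \<nu>2_def \<nu>2D(1) i2(1)]
      density_entropy_nonneg[OF prob _ gpos(1) \<nu>1_def \<nu>1D(1) i1(1)] density_entropy_nonneg[OF prob _ gpos(2) \<nu>2_def \<nu>2D(1) i2(1)]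
    by (simp_all add: i1(2) i2(2))
  define R where "R = \<kappa>1 * H1 + \<kappa>2 * H2"
  have "bary_transport N r \<nu>1 \<nu>2 \<le> ennreal \<kappa>1 * ennreal H1 + ennreal \<kappa>2 * ennreal H2"
    using T \<nu> H unfolding T_ineq_def by metis
  also have "\<dots> = ennreal R" using \<kappa> H(3,4) by (simp add: R_def ennreal_mult)
  finally have bt: "bary_transport N r \<nu>1 \<nu>2 \<le> ennreal R" .
  have R0: "R \<ge> 0" using \<kappa> H by (simp add: R_def)
  \<comment> \<open>The entropies in \<open>R\<close> contain the mean of \<open>f\<close> under
    \<open>\<nu>1\<close> and that of \<open>\<phi>\<close> under \<open>\<nu>2\<close> with the
    signs opposite to those in the integrated inequality; both cancel and only the normalizations
    \<open>Z1\<close> and \<open>Z2\<close> remain.\<close>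
  have "\<kappa>1 * ln Z1 + \<kappa>2 * ln Z2 \<le> 0 + e" if e: "e > 0" for e
  proof -
    let ?K = "{p \<in> \<nu>2 \<rightarrow>\<^sub>M prob_algebra borel. \<nu>2 \<bind> p = \<nu>1}"
    note eq = bary_transport_kernel[OF \<nu>2D(1,2), of N r \<nu>1]
    have "bary_transport N r \<nu>1 \<nu>2 < ennreal (R + e)" using bt R0 e by (auto intro: order.strict_trans1 ennreal_lessI)
    then obtain p where p: "p \<in> ?K" "(\<integral>\<^sup>+x. ennreal (bary_cost N r x (p x)) \<partial>\<nu>2) < ennreal (R + e)"
      unfolding eq INF_less_iff by blast
    have pm[measurable]: "p \<in> \<nu>2 \<rightarrow>\<^sub>M prob_algebra borel" and pb: "\<nu>2 \<bind> p = \<nu>1" using p by auto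
    note [measurable] = measurable_prob_algebraD[OF pm]
    have "(\<integral>\<^sup>+x. ennreal (\<phi> x) \<partial>\<nu>2) \<le> (\<integral>\<^sup>+x. (\<integral>\<^sup>+y. ennreal (f y) \<partial>p x) + ennreal (bary_cost N r x (p x)) \<partial>\<nu>2)"
    proof (rule nn_integral_mono_AE)
      have "AE x in \<nu>2. integrable (p x) (\<lambda>z. z)"
        by (rule kernel_AE_integrable[OF pm]) (simp_all only: pb \<nu>1D(4) measurable_ident_sets)
      moreover have "AE x in \<nu>2. integrable (p x) f"
        by (rule kernel_AE_integrable[OF pm]) (simp_all only: pb intf f)
      ultimately show "AE x in \<nu>2. ennreal (\<phi> x) \<le> (\<integral>\<^sup>+y. ennreal (f y) \<partial>p x) + ennreal (bary_cost N r x (p x))"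
        using AE_space
      proof eventually_elim
        case (elim x)
        have "\<phi> x \<le> (\<integral>y. f y \<partial>p x) + bary_cost N r x (p x)"
          using Q1_le_expectation[OF f0 kernelD(1)[OF pm elim(3)] elim(1,2), of x] \<phi>(3)[of x]
          by (simp add: bary_cost_def)
        moreover have "0 \<le> (\<integral>y. f y \<partial>p x)" using f0 by simp
        ultimately have "ennreal (\<phi> x) \<le> ennreal (\<integral>y. f y \<partial>p x) + ennreal (bary_cost N r x (p x))"
          by (simp add: bary_cost_def ennreal_leI flip: ennreal_plus)
        also have "ennreal (\<integral>y. f y \<partial>p x) = (\<integral>\<^sup>+y. ennreal (f y) \<partial>p x)"
          using nn_integral_eq_integral[OF elim(2)] f0 by simp
        finally show ?case .
      qed
    qed
    also have "\<dots> = (\<integral>\<^sup>+x. \<integral>\<^sup>+y. ennreal (f y) \<partial>p x \<partial>\<nu>2) + (\<integral>\<^sup>+x. ennreal (bary_cost N r x (p x)) \<partial>\<nu>2)"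
      unfolding bary_cost_def by (intro nn_integral_add) measurable
    also have "(\<integral>\<^sup>+x. \<integral>\<^sup>+y. ennreal (f y) \<partial>p x \<partial>\<nu>2) = (\<integral>\<^sup>+y. ennreal (f y) \<partial>\<nu>1)"
      unfolding pb[symmetric] by (rule kernel_nn_integral[OF pm, symmetric]) simp
    also have "\<dots> = ennreal (\<integral>y. f y \<partial>\<nu>1)" using nn_integral_eq_integral[OF intf] f0 by simp
    also have "(\<integral>\<^sup>+x. ennreal (\<phi> x) \<partial>\<nu>2) = ennreal (\<integral>x. \<phi> x \<partial>\<nu>2)" using nn_integral_eq_integral[OF int\<phi>] \<phi> by simp
    finally have "ennreal (\<integral>x. \<phi> x \<partial>\<nu>2) \<le> ennreal (\<integral>y. f y \<partial>\<nu>1) + ennreal (R + e)"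
      using p(2) by (meson add_left_mono less_imp_le order_trans)
    moreover have "0 \<le> (\<integral>y. f y \<partial>\<nu>1)" using f0 by simp
    ultimately have "ennreal (\<integral>x. \<phi> x \<partial>\<nu>2) \<le> ennreal ((\<integral>y. f y \<partial>\<nu>1) + (R + e))"
      using R0 e by (subst ennreal_plus) auto
    then have "(\<integral>x. \<phi> x \<partial>\<nu>2) \<le> (\<integral>y. f y \<partial>\<nu>1) + (R + e)"
      by (rule ennreal_le_iff[THEN iffD1, rotated]) (use \<open>0 \<le> (\<integral>y. f y \<partial>\<nu>1)\<close> R0 e in simp)
    moreover have "\<kappa>1 * H1 = - (\<integral>y. f y \<partial>\<nu>1) - \<kappa>1 * ln Z1" "\<kappa>2 * H2 = (\<integral>x. \<phi> x \<partial>\<nu>2) - \<kappa>2 * ln Z2"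
      using \<kappa> by (auto simp: H1_def H2_def field_simps)
    ultimately show ?thesis by (simp add: R_def)
  qed
  then have "\<kappa>1 * ln Z1 + \<kappa>2 * ln Z2 \<le> 0" by (rule field_le_epsilon)
  then have "ln Z2 \<le> log_laplace \<mu> \<kappa>1 f / \<kappa>2" using \<kappa> by (simp add: log_laplace_def Z1_def field_simps)
  then have "exp (ln Z2) \<le> exp (log_laplace \<mu> \<kappa>1 f / \<kappa>2)" by simp
  moreover have "exp (ln Z2) = Z2" using Z2 by simp
  ultimately show ?thesis unfolding Z2_def \<phi>_def by simp
qed

lemma T_ineq_imp_dual:
  assumes T: "T_ineq N r \<mu> \<kappa>1 \<kappa>2" and \<mu>P1: "\<mu> \<in> P1" and \<kappa>: "\<kappa>1 > 0" "\<kappa>2 > 0"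
    and f[measurable]: "f \<in> borel_measurable borel" and f0: "\<And>x. f x \<ge> 0"
  shows "(\<integral>\<^sup>+x. ennreal (exp (Q1 f x / \<kappa>2)) \<partial>\<mu>) \<le> ennreal (exp (log_laplace \<mu> \<kappa>1 f / \<kappa>2))"
proof -
  interpret prob_space \<mu> by (rule prob)
  note [measurable] = Q1_measurable[OF f0]
  have lim: "(\<lambda>k. ennreal (exp (min (Q1 f x) (real k) / \<kappa>2))) \<longlonglongrightarrow> ennreal (exp (Q1 f x / \<kappa>2))" for x
  proof (rule tendsto_eventually)
    obtain k0 :: nat where "Q1 f x \<le> real k0" using real_arch_simple by blast
    then show "\<forall>\<^sub>F k in sequentially. ennreal (exp (min (Q1 f x) (real k) / \<kappa>2)) = ennreal (exp (Q1 f x / \<kappa>2))"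
      unfolding eventually_sequentially by (intro exI[of _ k0]) (auto simp: min_def)
  qed
  have "(\<integral>\<^sup>+x. ennreal (exp (Q1 f x / \<kappa>2)) \<partial>\<mu>)
      = (\<integral>\<^sup>+x. liminf (\<lambda>k. ennreal (exp (min (Q1 f x) (real k) / \<kappa>2))) \<partial>\<mu>)"
    using lim_imp_Liminf[OF trivial_limit_sequentially lim] by simp
  also have "\<dots> \<le> liminf (\<lambda>k. \<integral>\<^sup>+x. ennreal (exp (min (Q1 f x) (real k) / \<kappa>2)) \<partial>\<mu>)"
    by (intro nn_integral_liminf) measurable
  also have "\<dots> \<le> liminf (\<lambda>k::nat. ennreal (exp (log_laplace \<mu> \<kappa>1 f / \<kappa>2)))"
  proof (intro Liminf_mono always_eventually allI)
    fix k
    have "integrable \<mu> (\<lambda>x. exp (min (Q1 f x) (real k) / \<kappa>2))"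
      using \<kappa> by (intro integrable_const_bound[of _ "exp (real k / \<kappa>2)"]) (auto simp: divide_right_mono)
    then show "(\<integral>\<^sup>+x. ennreal (exp (min (Q1 f x) (real k) / \<kappa>2)) \<partial>\<mu>) \<le> ennreal (exp (log_laplace \<mu> \<kappa>1 f / \<kappa>2))"
      using T_ineq_imp_dual_bounded[OF assms, of k] by (subst nn_integral_eq_integral) (auto simp: ennreal_leI)
  qed
  also have "\<dots> = ennreal (exp (log_laplace \<mu> \<kappa>1 f / \<kappa>2))" by (simp add: Liminf_const)
  finally show ?thesis .
qed

text \<open>The convexity that makes the dual inequality tensorize: it extends a bound on the graph of \<open>f\<close>, fibre
  by fibre, to the convex hull of the graph.\<close>

lemma convex_dominated:
  fixes f :: "(nat \<Rightarrow> real^'m) \<Rightarrow> real"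
  assumes \<kappa>: "\<kappa> > 0"
  shows "convex {p :: (nat \<Rightarrow> real^'m) \<times> real. \<exists>h\<in>borel_measurable borel.
      (\<integral>\<^sup>+y. ennreal (exp ((h y - snd p) / \<kappa>)) \<partial>\<mu>) \<le> 1 \<and>
      (\<forall>y. \<forall>e>0. \<exists>y' v'. ((fst p)(n := y'), v') \<in> graph_hull (tuples (Suc n)) f \<and> v' + N (y - y') powr r \<le> h y + e)}"
    (is "convex ?S")
  unfolding convex_def
proof (intro ballI allI impI)
  fix p q and a b :: real
  assume "p \<in> ?S" and "q \<in> ?S" and ab: "0 \<le> a" "0 \<le> b" "a + b = 1"
  then obtain h k where h[measurable]: "h \<in> borel_measurable borel" and k[measurable]: "k \<in> borel_measurable borel"
    and hi: "(\<integral>\<^sup>+y. ennreal (exp ((h y - snd p) / \<kappa>)) \<partial>\<mu>) \<le> 1"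
    and ki: "(\<integral>\<^sup>+y. ennreal (exp ((k y - snd q) / \<kappa>)) \<partial>\<mu>) \<le> 1"
    and hd: "\<And>y e. e > 0 \<Longrightarrow> \<exists>y' v'. ((fst p)(n := y'), v') \<in> graph_hull (tuples (Suc n)) f \<and> v' + N (y - y') powr r \<le> h y + e"
    and kd: "\<And>y e. e > 0 \<Longrightarrow> \<exists>y' v'. ((fst q)(n := y'), v') \<in> graph_hull (tuples (Suc n)) f \<and> v' + N (y - y') powr r \<le> k y + e"
    by auto
  \<comment> \<open>The same combination of the two dominating functions is a witness. Convexity of
    the exponential preserves the normalization; convexity of the hull and of
    \<open>N powr r\<close> preserves the domination. The slack \<open>e\<close> is there because
    the infimum defining \<open>Q1\<close> need not be attained.\<close>
  define g where "g y = a * h y + b * k y" for y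
  have [measurable]: "g \<in> borel_measurable borel" unfolding g_def by measurable
  have "(\<integral>\<^sup>+y. ennreal (exp ((g y - snd (a *\<^sub>R p + b *\<^sub>R q)) / \<kappa>)) \<partial>\<mu>)
      \<le> (\<integral>\<^sup>+y. ennreal a * ennreal (exp ((h y - snd p) / \<kappa>)) + ennreal b * ennreal (exp ((k y - snd q) / \<kappa>)) \<partial>\<mu>)"
  proof (intro nn_integral_mono)
    fix y
    have "(g y - snd (a *\<^sub>R p + b *\<^sub>R q)) / \<kappa> = a * ((h y - snd p) / \<kappa>) + b * ((k y - snd q) / \<kappa>)"
      using \<kappa> by (simp add: g_def field_simps)
    moreover have "exp (a * ((h y - snd p) / \<kappa>) + b * ((k y - snd q) / \<kappa>))
        \<le> a * exp ((h y - snd p) / \<kappa>) + b * exp ((k y - snd q) / \<kappa>)"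
      using exp_convex ab unfolding convex_on_def real_scaleR_def by blast
    ultimately show "ennreal (exp ((g y - snd (a *\<^sub>R p + b *\<^sub>R q)) / \<kappa>))
        \<le> ennreal a * ennreal (exp ((h y - snd p) / \<kappa>)) + ennreal b * ennreal (exp ((k y - snd q) / \<kappa>))"
      using ab by (simp add: ennreal_leI flip: ennreal_mult ennreal_plus)
  qed
  also have "\<dots> = ennreal a * (\<integral>\<^sup>+y. ennreal (exp ((h y - snd p) / \<kappa>)) \<partial>\<mu>)
      + ennreal b * (\<integral>\<^sup>+y. ennreal (exp ((k y - snd q) / \<kappa>)) \<partial>\<mu>)"
    by (simp add: nn_integral_add nn_integral_cmult)
  also have "\<dots> \<le> ennreal a * 1 + ennreal b * 1" using hi ki by (intro add_mono mult_left_mono) auto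
  also have "\<dots> = 1" using ab by (simp flip: ennreal_plus)
  finally have 1: "(\<integral>\<^sup>+y. ennreal (exp ((g y - snd (a *\<^sub>R p + b *\<^sub>R q)) / \<kappa>)) \<partial>\<mu>) \<le> 1" .
  have 2: "\<exists>y' v'. ((fst (a *\<^sub>R p + b *\<^sub>R q))(n := y'), v') \<in> graph_hull (tuples (Suc n)) f \<and> v' + N (y - y') powr r \<le> g y + e"
    if e: "e > 0" for y e
  proof -
    obtain y1 v1 where 1: "((fst p)(n := y1), v1) \<in> graph_hull (tuples (Suc n)) f" "v1 + N (y - y1) powr r \<le> h y + e"
      using hd[OF e] by blast
    obtain y2 v2 where 2: "((fst q)(n := y2), v2) \<in> graph_hull (tuples (Suc n)) f" "v2 + N (y - y2) powr r \<le> k y + e"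
      using kd[OF e] by blast
    have eq: "a *\<^sub>R ((fst p)(n := y1), v1) + b *\<^sub>R ((fst q)(n := y2), v2)
        = ((fst (a *\<^sub>R p + b *\<^sub>R q))(n := a *\<^sub>R y1 + b *\<^sub>R y2), a * v1 + b * v2)"
      by (simp add: fun_eq_iff)
    have mem: "((fst (a *\<^sub>R p + b *\<^sub>R q))(n := a *\<^sub>R y1 + b *\<^sub>R y2), a * v1 + b * v2) \<in> graph_hull (tuples (Suc n)) f"
      unfolding eq[symmetric] using 1(1) 2(1) ab by (intro convexD[OF convex_graph_hull])
    have "y - (a *\<^sub>R y1 + b *\<^sub>R y2) = a *\<^sub>R (y - y1) + b *\<^sub>R (y - y2)"
      using ab(3) by (simp add: scaleR_right_diff_distrib) (metis scaleR_add_left scaleR_one add_diff_eq diff_add_eq diff_diff_add)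
    then have "N (y - (a *\<^sub>R y1 + b *\<^sub>R y2)) powr r \<le> a * N (y - y1) powr r + b * N (y - y2) powr r"
      using N_powr_scaleR_add_le[OF ab] by simp
    then have "(a * v1 + b * v2) + N (y - (a *\<^sub>R y1 + b *\<^sub>R y2)) powr r
        \<le> a * (v1 + N (y - y1) powr r) + b * (v2 + N (y - y2) powr r)" by (simp add: algebra_simps)
    also have "\<dots> \<le> a * (h y + e) + b * (k y + e)"
      by (rule add_mono[OF mult_left_mono[OF 1(2) ab(1)] mult_left_mono[OF 2(2) ab(2)]])
    also have "\<dots> = g y + (a + b) * e" by (simp add: g_def algebra_simps)
    finally have "(a * v1 + b * v2) + N (y - (a *\<^sub>R y1 + b *\<^sub>R y2)) powr r \<le> g y + e" using ab(3) by simp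
    then show ?thesis using mem by blast
  qed
  show "a *\<^sub>R p + b *\<^sub>R q \<in> ?S" using 1 2 by (intro CollectI bexI[of _ g]) auto
qed

text \<open>Induction that removes the last coordinate. \<open>g x\<close> is the soft minimum of
  \<open>f\<close> over the fibre of \<open>x\<close>, and the one-dimensional inequality on each
  fibre dominates \<open>Q1\<close> of that fibre normalized by \<open>g\<close>. By
  \<open>convex_dominated\<close> this extends from the graph of \<open>g\<close> to its hull, which
  bounds the fibre integral of \<open>exp (Qn (Suc n) f / \<kappa>2)\<close> by
  \<open>exp (Qn n g x / \<kappa>2)\<close>. Nothing is lost on the other side, because the soft
  minimum of \<open>g\<close> under \<open>P n\<close> equals that of \<open>f\<close> under
  \<open>P (Suc n)\<close>.\<close>

lemma T_ineq_imp_dual_n: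
  assumes T: "T_ineq N r \<mu> \<kappa>1 \<kappa>2" and \<mu>P1: "\<mu> \<in> P1" and \<kappa>: "\<kappa>1 > 0" "\<kappa>2 > 0"
  shows "f \<in> borel_measurable (P n) \<Longrightarrow> (\<And>x. f x \<ge> 0) \<Longrightarrow>
    (\<integral>\<^sup>+x. ennreal (exp (Qn n f x / \<kappa>2)) \<partial>P n) \<le> ennreal (exp (log_laplace (P n) \<kappa>1 f / \<kappa>2))"
proof (induction n arbitrary: f)
  case 0
  interpret P0: prob_space "P 0" by (rule prob_P)
  let ?u = "\<lambda>_::nat. undefined :: real^'m"
  have t0: "tuples 0 = {?u}" by (auto simp: in_tuples_iff)
  have "(\<integral>x. exp (- f x / \<kappa>1) \<partial>P 0) = (\<integral>x. exp (- f ?u / \<kappa>1) \<partial>P 0)"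
    by (intro Bochner_Integration.integral_cong refl) (simp only: space_P t0 singleton_iff)
  then have "log_laplace (P 0) \<kappa>1 f = f ?u"
    using \<kappa> P0.prob_space by (simp add: log_laplace_def)
  moreover have "(\<integral>\<^sup>+x. ennreal (exp (Qn 0 f x / \<kappa>2)) \<partial>P 0) \<le> (\<integral>\<^sup>+x. ennreal (exp (f ?u / \<kappa>2)) \<partial>P 0)"
  proof (intro nn_integral_mono)
    fix x
    have "Qn 0 f x \<le> snd (?u, f ?u) + (\<Sum>i<0. N (x i - fst (?u, f ?u) i) powr r)"
      using 0 t0 by (intro Qn_le graph_hullI) auto
    then show "ennreal (exp (Qn 0 f x / \<kappa>2)) \<le> ennreal (exp (f ?u / \<kappa>2))"
      using \<kappa> by (simp add: ennreal_leI divide_right_mono)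
  qed
  ultimately show ?case using P0.emeasure_space_1 by simp
next
  case (Suc n)
  note f[measurable] = Suc.prems(1) and f0 = Suc.prems(2)
  interpret \<mu>: prob_space \<mu> by (rule prob)
  interpret Pn: prob_space "P k" for k by (rule prob_P)
  have add_coord: "(\<lambda>(x, y). x(n := y)) \<in> P n \<Otimes>\<^sub>M \<mu> \<rightarrow>\<^sub>M P (Suc n)" by (rule measurable_add_coord)
  have fpair: "(\<lambda>(x, y). f (x(n := y))) \<in> borel_measurable (P n \<Otimes>\<^sub>M \<mu>)"
    using measurable_compose[OF add_coord f] by (simp add: case_prod_beta' fun_upd_def)
  have fsec: "(\<lambda>y. f (x(n := y))) \<in> borel_measurable borel" if "x \<in> tuples n" for x
    using measurable_compose[OF measurable_Pair1'[of x "P n" \<mu>] fpair] that by (simp cong: measurable_cong_sets add: sets_borel)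
  define E where "E x = (\<integral>y. exp (- f (x(n := y)) / \<kappa>1) \<partial>\<mu>)" for x
  \<comment> \<open>The value \<open>0\<close> outside \<open>tuples n\<close> keeps
    \<open>g\<close> nonnegative everywhere, as the induction hypothesis demands.\<close>
  define g where "g x = (if x \<in> tuples n then log_laplace \<mu> \<kappa>1 (\<lambda>y. f (x(n := y))) else 0)" for x
  have intE: "integrable \<mu> (\<lambda>y. exp (- f (x(n := y)) / \<kappa>1))" if "x \<in> tuples n" for x
    using f0 \<kappa> fsec[OF that] by (intro \<mu>.integrable_const_bound[of _ 1]) auto
  have E: "E x > 0" "E x \<le> 1" if "x \<in> tuples n" for x
  proof -
    have "E x \<noteq> 0" unfolding E_def using integral_nonneg_eq_0_iff_AE[OF intE[OF that]] \<mu>.AE_contr[of "\<lambda>_. False"] by auto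
    then show "E x > 0" unfolding E_def by (simp add: order_less_le)
    have "E x \<le> (\<integral>y. 1 \<partial>\<mu>)" unfolding E_def using f0 \<kappa> intE[OF that] by (intro integral_mono) auto
    then show "E x \<le> 1" using \<mu>.prob_space by simp
  qed
  have g_eq: "g x = - \<kappa>1 * ln (E x)" if "x \<in> tuples n" for x using that by (simp add: g_def log_laplace_def E_def)
  have g0: "g x \<ge> 0" for x
  proof (cases "x \<in> tuples n")
    case True
    then have "ln (E x) \<le> 0" using E[OF True] by simp
    then show ?thesis using \<kappa> by (simp add: g_eq[OF True] mult_nonneg_nonpos)
  qed (simp add: g_def)
  have exp_g: "exp (- g x / \<kappa>1) = E x" if "x \<in> tuples n" for x using \<kappa> E[OF that] by (simp add: g_eq[OF that])
  have gm: "g \<in> borel_measurable (P n)"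
  proof -
    have "(\<lambda>(x, y). exp (- f (x(n := y)) / \<kappa>1)) \<in> borel_measurable (P n \<Otimes>\<^sub>M \<mu>)"
      using borel_measurable_exp fpair by measurable
    then have "E \<in> borel_measurable (P n)"
      unfolding E_def by (rule sigma_finite_measure.borel_measurable_lebesgue_integral[OF prob_space_imp_sigma_finite[OF prob]])
    then have "(\<lambda>x. - \<kappa>1 * ln (E x)) \<in> borel_measurable (P n)" by measurable
    then show ?thesis using g_eq by (subst measurable_cong[where g="\<lambda>x. - \<kappa>1 * ln (E x)"]) simp_all
  qed
  have Qm: "Qn (Suc n) f \<in> borel_measurable (P (Suc n))" using f0 by (intro measurable_P Qn_measurable)
  have sec: "(\<integral>\<^sup>+y. ennreal (exp (Qn (Suc n) f (x(n := y)) / \<kappa>2)) \<partial>\<mu>) \<le> ennreal (exp (Qn n g x / \<kappa>2))"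
    if x: "x \<in> tuples n" for x
  proof -
    let ?L = "\<integral>\<^sup>+y. ennreal (exp (Qn (Suc n) f (x(n := y)) / \<kappa>2)) \<partial>\<mu>"
    let ?S = "{p :: (nat \<Rightarrow> real^'m) \<times> real. \<exists>h\<in>borel_measurable borel.
      (\<integral>\<^sup>+y. ennreal (exp ((h y - snd p) / \<kappa>2)) \<partial>\<mu>) \<le> 1 \<and>
      (\<forall>y. \<forall>e>0. \<exists>y' v'. ((fst p)(n := y'), v') \<in> graph_hull (tuples (Suc n)) f \<and> v' + N (y - y') powr r \<le> h y + e)}"
    have "graph_hull (tuples n) g \<subseteq> ?S"
    proof (rule graph_hull_minimal[OF convex_dominated[OF \<kappa>(2)]])
      fix z :: "nat \<Rightarrow> real^'m" assume z: "z \<in> tuples n"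
      let ?F = "\<lambda>y. f (z(n := y))"
      have F0: "?F y \<ge> 0" for y using f0 .
      have Q1m[measurable]: "Q1 ?F \<in> borel_measurable borel" using F0 by (rule Q1_measurable)
      have "(\<integral>\<^sup>+y. ennreal (exp ((Q1 ?F y - g z) / \<kappa>2)) \<partial>\<mu>) =
          (\<integral>\<^sup>+y. ennreal (exp (Q1 ?F y / \<kappa>2)) * ennreal (exp (- g z / \<kappa>2)) \<partial>\<mu>)"
        by (intro nn_integral_cong) (simp add: diff_divide_distrib flip: ennreal_mult exp_add)
      also have "\<dots> = (\<integral>\<^sup>+y. ennreal (exp (Q1 ?F y / \<kappa>2)) \<partial>\<mu>) * ennreal (exp (- g z / \<kappa>2))"
        using Q1m by (intro nn_integral_multc) measurable
      also have "\<dots> \<le> ennreal (exp (log_laplace \<mu> \<kappa>1 ?F / \<kappa>2)) * ennreal (exp (- g z / \<kappa>2))"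
        using T_ineq_imp_dual[OF T \<mu>P1 \<kappa> fsec[OF z] F0] by (rule mult_right_mono) simp
      also have "\<dots> = 1" using z by (simp add: g_def exp_minus flip: ennreal_mult)
      finally have 1: "(\<integral>\<^sup>+y. ennreal (exp ((Q1 ?F y - g z) / \<kappa>2)) \<partial>\<mu>) \<le> 1" .
      have lift: "graph_hull UNIV ?F \<subseteq> {p. (z(n := fst p), snd p) \<in> graph_hull (tuples (Suc n)) f}"
      proof (rule graph_hull_minimal)
        show "convex {p. (z(n := fst p), snd p) \<in> graph_hull (tuples (Suc n)) f}"
          unfolding convex_def
        proof (intro ballI allI impI CollectI)
          fix p q and a b :: real
          assume pq: "p \<in> {p. (z(n := fst p), snd p) \<in> graph_hull (tuples (Suc n)) f}"
            "q \<in> {p. (z(n := fst p), snd p) \<in> graph_hull (tuples (Suc n)) f}" and ab: "0 \<le> a" "0 \<le> b" "a + b = 1"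
          have "a *\<^sub>R (z(n := fst p), snd p) + b *\<^sub>R (z(n := fst q), snd q) \<in> graph_hull (tuples (Suc n)) f"
            using pq ab by (intro convexD[OF convex_graph_hull]) simp_all
          moreover have "a *\<^sub>R (z(n := fst p), snd p) + b *\<^sub>R (z(n := fst q), snd q) =
              (z(n := fst (a *\<^sub>R p + b *\<^sub>R q)), snd (a *\<^sub>R p + b *\<^sub>R q))"
            using ab(3) by (simp add: fun_eq_iff flip: scaleR_add_left)
          ultimately show "(z(n := fst (a *\<^sub>R p + b *\<^sub>R q)), snd (a *\<^sub>R p + b *\<^sub>R q)) \<in> graph_hull (tuples (Suc n)) f" by simp
        qed
        fix y :: "real^'m"
        have "z(n := y) \<in> tuples (Suc n)" using z by (simp add: in_tuples_iff)
        then show "(y, f (z(n := y))) \<in> {p. (z(n := fst p), snd p) \<in> graph_hull (tuples (Suc n)) f}"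
          using graph_hullI by fastforce
      qed
      have 2: "\<exists>y' v'. (z(n := y'), v') \<in> graph_hull (tuples (Suc n)) f \<and> v' + N (y - y') powr r \<le> Q1 ?F y + e"
        if e: "e > 0" for y e
      proof -
        obtain p where "p \<in> graph_hull UNIV ?F" "snd p + N (y - fst p) powr r < Q1 ?F y + e"
          using Q1_less_iff[of ?F y "Q1 ?F y + e"] F0 e by auto
        then show ?thesis using lift by (intro exI[of _ "fst p"] exI[of _ "snd p"]) auto
      qed
      show "(z, g z) \<in> ?S" using 1 2 by (intro CollectI bexI[OF _ Q1m]) simp
    qed
    then have le: "?L \<le> ennreal (exp ((snd p + (\<Sum>i<n. N (x i - fst p i) powr r)) / \<kappa>2))"
      if p: "p \<in> graph_hull (tuples n) g" for p
    proof -
      let ?c = "\<Sum>i<n. N (x i - fst p i) powr r"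
      obtain h where h[measurable]: "h \<in> borel_measurable borel"
        and hi: "(\<integral>\<^sup>+y. ennreal (exp ((h y - snd p) / \<kappa>2)) \<partial>\<mu>) \<le> 1"
        and hd: "\<And>y e. e > 0 \<Longrightarrow> \<exists>y' v'. ((fst p)(n := y'), v') \<in> graph_hull (tuples (Suc n)) f \<and> v' + N (y - y') powr r \<le> h y + e"
        using \<open>graph_hull (tuples n) g \<subseteq> ?S\<close> p by blast
      have Q: "Qn (Suc n) f (x(n := y)) \<le> ?c + h y" for y
      proof (rule field_le_epsilon)
        fix e :: real assume "e > 0"
        then obtain y' v' where y': "((fst p)(n := y'), v') \<in> graph_hull (tuples (Suc n)) f" "v' + N (y - y') powr r \<le> h y + e"
          using hd by blast
        have "Qn (Suc n) f (x(n := y)) \<le> snd ((fst p)(n := y'), v') +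
            (\<Sum>i<Suc n. N ((x(n := y)) i - fst ((fst p)(n := y'), v') i) powr r)"
          using f0 y'(1) by (intro Qn_le)
        also have "\<dots> = v' + N (y - y') powr r + ?c" by simp
        finally show "Qn (Suc n) f (x(n := y)) \<le> ?c + h y + e" using y'(2) by simp
      qed
      have "?L \<le> (\<integral>\<^sup>+y. ennreal (exp ((snd p + ?c) / \<kappa>2)) * ennreal (exp ((h y - snd p) / \<kappa>2)) \<partial>\<mu>)"
      proof (intro nn_integral_mono)
        fix y
        have "exp (Qn (Suc n) f (x(n := y)) / \<kappa>2) \<le> exp ((snd p + ?c) / \<kappa>2 + (h y - snd p) / \<kappa>2)"
          using Q[of y] \<kappa> by (simp add: divide_right_mono flip: add_divide_distrib)
        then show "ennreal (exp (Qn (Suc n) f (x(n := y)) / \<kappa>2)) \<le> ennreal (exp ((snd p + ?c) / \<kappa>2)) * ennreal (exp ((h y - snd p) / \<kappa>2))"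
          by (simp add: exp_add ennreal_leI flip: ennreal_mult)
      qed
      also have "\<dots> = ennreal (exp ((snd p + ?c) / \<kappa>2)) * (\<integral>\<^sup>+y. ennreal (exp ((h y - snd p) / \<kappa>2)) \<partial>\<mu>)"
        by (intro nn_integral_cmult) measurable
      also have "\<dots> \<le> ennreal (exp ((snd p + ?c) / \<kappa>2)) * 1" using hi by (intro mult_left_mono) auto
      finally show ?thesis by simp
    qed
    have ne: "graph_hull (tuples n) g \<noteq> {}" by (rule Qn_ne) (rule g0)
    show ?thesis
    \<comment> \<open>\<open>le\<close> bounds \<open>?L\<close> by an exponential for each
      \<open>p\<close>. The infimum over \<open>p\<close> sits inside the exponential, so it is
      taken after a logarithm, and the values \<open>0\<close> and infinity are treated
      apart.\<close>
    proof (cases ?L)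
      case (real l)
      show ?thesis
      proof (cases "l = 0")
        case True then show ?thesis using real by simp
      next
        case False
        then have lpos: "l > 0" using real by simp
        have "\<kappa>2 * ln l \<le> Qn n g x"
          unfolding Qn_def
        proof (rule cINF_greatest[OF ne])
          fix p assume "p \<in> graph_hull (tuples n) g"
          from le[OF this] have "l \<le> exp ((snd p + (\<Sum>i<n. N (x i - fst p i) powr r)) / \<kappa>2)" using real by simp
          then have "ln l \<le> (snd p + (\<Sum>i<n. N (x i - fst p i) powr r)) / \<kappa>2"
            using lpos by (subst (asm) ln_le_cancel_iff[symmetric]) auto
          then show "\<kappa>2 * ln l \<le> snd p + (\<Sum>i<n. N (x i - fst p i) powr r)" using \<kappa> by (simp add: field_simps)
        qed
        then have "ln l \<le> Qn n g x / \<kappa>2" using \<kappa> by (simp add: field_simps)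
        then have "l \<le> exp (Qn n g x / \<kappa>2)" using lpos by (metis exp_le_cancel_iff exp_ln)
        then show ?thesis using real by (simp add: ennreal_leI)
      qed
    next
      case top
      obtain p where "p \<in> graph_hull (tuples n) g" using ne by blast
      from le[OF this] show ?thesis using top by (simp add: top_unique)
    qed
  qed
  have "(\<integral>\<^sup>+x. ennreal (exp (Qn (Suc n) f x / \<kappa>2)) \<partial>P (Suc n)) =
      (\<integral>\<^sup>+x. \<integral>\<^sup>+y. ennreal (exp (Qn (Suc n) f (x(n := y)) / \<kappa>2)) \<partial>\<mu> \<partial>P n)"
    by (rule nn_integral_P_Suc[OF measurable_compose[OF Qm, of "\<lambda>q. ennreal (exp (q / \<kappa>2))" borel]]) measurable
  also have "\<dots> \<le> (\<integral>\<^sup>+x. ennreal (exp (Qn n g x / \<kappa>2)) \<partial>P n)"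
    using sec by (intro nn_integral_mono) simp
  also have "\<dots> \<le> ennreal (exp (log_laplace (P n) \<kappa>1 g / \<kappa>2))"
    by (rule Suc.IH[OF gm g0])
  also have "log_laplace (P n) \<kappa>1 g = log_laplace (P (Suc n)) \<kappa>1 f"
  proof -
    have int: "integrable (P (Suc n)) (\<lambda>x. exp (- f x / \<kappa>1))"
      using f0 \<kappa> by (intro Pn.integrable_const_bound[of _ 1]) auto
    have "(\<integral>x. exp (- f x / \<kappa>1) \<partial>P (Suc n)) = (\<integral>x. E x \<partial>P n)"
      unfolding E_def using int unfolding lessThan_Suc by (intro prod.product_integral_insert) auto
    also have "\<dots> = (\<integral>x. exp (- g x / \<kappa>1) \<partial>P n)"
      using exp_g by (intro Bochner_Integration.integral_cong) simp_all
    finally show ?thesis by (simp add: log_laplace_def)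
  qed
  finally show ?case .
qed

text \<open>Bernoulli's inequality for the integer \<open>nat \<lceil>r\<rceil>\<close>, whose power
  of \<open>1 - d / T\<close> is at most the power \<open>r\<close> because the base does not exceed
  \<open>1\<close>. It says that a linear penalty of this slope in \<open>d\<close> makes up for the
  reduction of the distance from \<open>T\<close> to \<open>T - d\<close>.\<close>

lemma Bernoulli_powr:
  fixes d T :: real
  assumes "0 \<le> d" "0 < T"
  shows "T powr r \<le> (real (nat \<lceil>r\<rceil>) * T powr (r - 1)) * d + (max 0 (T - d)) powr r"
proof (cases "d \<ge> T")
  case True
  have "1 \<le> real (nat \<lceil>r\<rceil>)" using r by linarith
  have "T powr r = 1 * T powr (r - 1) * T" using assms by (simp add: powr_diff)
  also have "\<dots> \<le> real (nat \<lceil>r\<rceil>) * T powr (r - 1) * d"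
    using True assms \<open>1 \<le> _\<close> by (intro mult_mono) auto
  finally show ?thesis by (simp add: add_increasing2)
next
  case False
  define e where "e = d / T"
  let ?k = "nat \<lceil>r\<rceil>"
  have e: "0 \<le> e" "e < 1" "d = e * T" using False assms by (auto simp: e_def)
  have "1 - real ?k * e \<le> (1 - e) ^ ?k" using Bernoulli_inequality[of "- e" ?k] e by simp
  also have "\<dots> = (1 - e) powr real ?k" using e by (simp add: powr_realpow)
  also have "\<dots> \<le> (1 - e) powr r" using e r by (intro powr_mono') auto
  finally have "T powr r * (1 - real ?k * e) \<le> T powr r * (1 - e) powr r" by (intro mult_left_mono) auto
  moreover have "max 0 (T - d) = T * (1 - e)" using e assms by (simp add: max_def algebra_simps)
  moreover have "T powr (r - 1) * T = T powr r" using assms by (simp add: powr_diff)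
  ultimately have "T powr r \<le> T powr r * (1 - e) powr r + real ?k * e * (T powr (r - 1) * T)"
    by (simp add: algebra_simps)
  also have "\<dots> = (real ?k * T powr (r - 1)) * d + (T * (1 - e)) powr r"
    using e assms by (simp add: powr_mult)
  finally show ?thesis using \<open>max 0 (T - d) = T * (1 - e)\<close> by simp
qed

text \<open>The natural test function, \<open>0\<close> on \<open>C\<close> and infinite elsewhere,
  is not real-valued; a steep multiple of the distance does as well. It vanishes on
  \<open>A\<close>, so its soft minimum is at most \<open>- \<kappa>1 * ln y\<close>. Beyond
  distance \<open>T'\<close> its infimum convolution is at least \<open>t\<close>, where convexity
  of the distance extends the estimate from the graph to its hull. Bounding the exponential integral
  below on this far set then gives the claim with factor \<open>1\<close>.\<close>

lemma T_ineq_imp_two_set_at: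
  assumes T: "T_ineq N r \<mu> (a / s powr (r - 1)) (a / (1 - s) powr (r - 1))" and \<mu>P1: "\<mu> \<in> P1"
    and a: "a > 0" and s: "0 < s" "s < 1"
  shows "two_set_at a 1 s"
  unfolding two_set_at_def
proof (intro allI impI ballI)
  fix n :: nat and A :: "(nat \<Rightarrow> real^'m) set" and t :: real
  assume n: "1 \<le> n" and A: "A \<in> sets (tuple_borel n)" and t: "0 \<le> t"
  interpret prob_space "P n" by (rule prob_P)
  define \<alpha> \<beta> where "\<alpha> = 1 / (1 - s) powr (r - 1)" and "\<beta> = 1 / s powr (r - 1)"
  have ab: "\<alpha> \<ge> 1" "\<beta> \<ge> 1" unfolding \<alpha>_def \<beta>_def using s exponent_ge_1[of "1 - s"] exponent_ge_1[of s] by auto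
  show "prob (tuples n - cost_enlarge N r n A t) powr (1 / (1 - s) powr (r - 1)) * prob A powr (1 / s powr (r - 1))
      \<le> 1 * exp (- t / a)"
    unfolding \<alpha>_def[symmetric] \<beta>_def[symmetric]
  \<comment> \<open>The excluded cases are trivial, both probabilities being at most
    \<open>1\<close>; afterwards the two measures are positive and logarithms may be taken.\<close>
  proof (cases "A = {} \<or> t = 0 \<or> prob A = 0 \<or> prob (tuples n - cost_enlarge N r n A t) = 0")
    case True
    have "prob X powr p \<le> 1" if "p \<ge> 1" for X p using that by (intro powr_le1) auto
    then have "prob (tuples n - cost_enlarge N r n A t) powr \<alpha> * prob A powr \<beta> \<le> 1 * 1"
      using ab by (intro mult_mono) auto
    then show "prob (tuples n - cost_enlarge N r n A t) powr \<alpha> * prob A powr \<beta> \<le> 1 * exp (- t / a)"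
      using True ab by auto
  next
    case False
    then have ne: "A \<noteq> {}" and tpos: "t > 0" and ypos: "prob A > 0" using t by (auto simp: zero_less_measure_iff)
    define C where "C = closure (convex hull A)"
    note C = hull_closure[OF A ne, folded C_def]
    define T' where "T' = t powr (1 / r)"
    have T': "T' > 0" "T' powr r = t" using tpos r by (auto simp: T'_def powr_powr)
    have xeq: "tuples n - cost_enlarge N r n A t = {x \<in> tuples n. T' < tdist n C x}"
      using compl_cost_enlarge[OF A ne t] by (simp add: C_def T'_def)
    \<comment> \<open>A slope for which Bernoulli's inequality yields \<open>Q f \<ge> t\<close> at distance \<open>T'\<close>.\<close>
    define K where "K = real (nat \<lceil>r\<rceil>) * T' powr (r - 1)"
    have K: "K \<ge> 0" by (simp add: K_def)
    define f where "f x = K * tdist n C x" for x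
    have f0: "f x \<ge> 0" for x using K tdist_nonneg[OF C(4)] by (simp add: f_def)
    have fm: "f \<in> borel_measurable (P n)" unfolding f_def
      using measurable_P[OF measurable_tdist[OF C(4), of n]] by measurable
    have Q: "t \<le> Qn n f x" if x: "T' < tdist n C x" for x
      unfolding Qn_def
    proof (rule cINF_greatest)
      show "graph_hull (tuples n) f \<noteq> {}" by (rule Qn_ne) (rule f0)
      fix p assume p: "p \<in> graph_hull (tuples n) f"
      have "graph_hull (tuples n) f \<subseteq> {p. K * tdist n C (fst p) \<le> snd p}"
      proof (rule graph_hull_minimal)
        show "convex {p. K * tdist n C (fst p) \<le> snd p}"
          unfolding convex_alt
        proof (intro ballI allI impI CollectI)
          fix p q and u :: real
          assume pq: "p \<in> {p. K * tdist n C (fst p) \<le> snd p}" "q \<in> {p. K * tdist n C (fst p) \<le> snd p}" and u: "0 \<le> u \<and> u \<le> 1"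
          have "tdist n C ((1 - u) *\<^sub>R fst p + u *\<^sub>R fst q) \<le> (1 - u) * tdist n C (fst p) + u * tdist n C (fst q)"
            using u convex_onD[OF convex_on_tdist[OF C(2,4) convex_UNIV]] by simp
          then have "K * tdist n C ((1 - u) *\<^sub>R fst p + u *\<^sub>R fst q) \<le> K * ((1 - u) * tdist n C (fst p) + u * tdist n C (fst q))"
            using K by (rule mult_left_mono)
          also have "\<dots> = (1 - u) * (K * tdist n C (fst p)) + u * (K * tdist n C (fst q))" by (simp add: algebra_simps)
          also have "\<dots> \<le> (1 - u) * snd p + u * snd q" using pq u by (intro add_mono mult_left_mono) simp_all
          finally show "K * tdist n C (fst ((1 - u) *\<^sub>R p + u *\<^sub>R q)) \<le> snd ((1 - u) *\<^sub>R p + u *\<^sub>R q)" by simp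
        qed
      qed (simp add: f_def)
      then have v: "K * tdist n C (fst p) \<le> snd p" using p by auto
      have "max 0 (T' - tdist n C (fst p)) \<le> tuple_norm N r n (x - fst p)"
        using tdist_le_add[OF C(4), of n x "fst p"] x by simp
      then have "(max 0 (T' - tdist n C (fst p))) powr r \<le> tuple_norm N r n (x - fst p) powr r"
        using r by (intro powr_mono2) auto
      then show "t \<le> snd p + (\<Sum>i<n. N (x i - fst p i) powr r)"
        using Bernoulli_powr[OF tdist_nonneg[OF C(4)] T'(1), of n "fst p"] v T'(2)
        unfolding tuple_norm_powr K_def by simp
    qed
    define \<kappa>1 \<kappa>2 where "\<kappa>1 = a * \<beta>" and "\<kappa>2 = a * \<alpha>"
    have "\<alpha> > 0" "\<beta> > 0" using ab by auto
    then have \<kappa>: "\<kappa>1 > 0" "\<kappa>2 > 0" "T_ineq N r \<mu> \<kappa>1 \<kappa>2"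
      using a T by (simp_all add: \<kappa>1_def \<kappa>2_def) (simp add: \<alpha>_def \<beta>_def)
    define x y where "x = prob {x \<in> tuples n. T' < tdist n C x}" and "y = prob A"
    have y: "y > 0" using ypos by (simp add: y_def)
    have x: "x > 0" using False xeq by (simp add: x_def zero_less_measure_iff)
    have intf: "integrable (P n) (\<lambda>x. exp (- f x / \<kappa>1))"
      using f0 \<kappa> fm by (intro integrable_const_bound[of _ 1]) auto
    have AP: "A \<in> sets (P n)" using A sets_P by simp
    have "y = (\<integral>x. indicator A x \<partial>P n)"
      using AP sets.sets_into_space[OF AP] by (simp add: y_def Int_absorb2)
    also have "\<dots> \<le> (\<integral>x. exp (- f x / \<kappa>1) \<partial>P n)"
    proof (intro integral_mono intf)
      fix x show "indicator A x \<le> exp (- f x / \<kappa>1)"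
        using C(5) tdist_eq_0[of x C n] by (auto simp: indicator_def f_def)
    qed (intro integrable_real_indicator AP, simp add: less_top[symmetric])
    finally have "ln y \<le> ln (\<integral>x. exp (- f x / \<kappa>1) \<partial>P n)" using y by simp
    then have G: "log_laplace (P n) \<kappa>1 f \<le> - \<kappa>1 * ln y" using \<kappa> by (simp add: log_laplace_def)
    have "ennreal (x * exp (t / \<kappa>2)) = (\<integral>\<^sup>+z. ennreal (exp (t / \<kappa>2)) * indicator {x \<in> tuples n. T' < tdist n C x} z \<partial>P n)"
      using sets_tdist(3)[OF C(4)] by (subst nn_integral_cmult_indicator) (auto simp: x_def emeasure_eq_measure ennreal_mult mult.commute)
    also have "\<dots> \<le> (\<integral>\<^sup>+z. ennreal (exp (Qn n f z / \<kappa>2)) \<partial>P n)"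
      using Q \<kappa> by (intro nn_integral_mono) (simp add: indicator_def divide_right_mono ennreal_leI)
    also have "\<dots> \<le> ennreal (exp (log_laplace (P n) \<kappa>1 f / \<kappa>2))"
      by (rule T_ineq_imp_dual_n[OF \<kappa>(3) \<mu>P1 \<kappa>(1,2) fm f0])
    also have "\<dots> \<le> ennreal (exp (- \<kappa>1 * ln y / \<kappa>2))"
      using divide_right_mono[OF G, of \<kappa>2] \<kappa> by (intro ennreal_leI) simp
    finally have "x * exp (t / \<kappa>2) \<le> exp (- \<kappa>1 * ln y / \<kappa>2)" by simp
    then have "ln (x * exp (t / \<kappa>2)) \<le> ln (exp (- \<kappa>1 * ln y / \<kappa>2))" using x by (subst ln_le_cancel_iff) auto
    then have "ln (x * exp (t / \<kappa>2)) \<le> - \<kappa>1 * ln y / \<kappa>2" by simp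
    then have "ln x + t / \<kappa>2 \<le> - \<kappa>1 * ln y / \<kappa>2" using x by (simp add: ln_mult)
    then have "\<kappa>2 * (ln x + t / \<kappa>2) \<le> \<kappa>2 * (- \<kappa>1 * ln y / \<kappa>2)" using \<kappa> by (intro mult_left_mono) auto
    then have "\<kappa>2 * ln x + t \<le> - \<kappa>1 * ln y" using \<kappa> by (simp add: distrib_left)
    then have "a * (\<alpha> * ln x + \<beta> * ln y) \<le> - t" by (simp add: \<kappa>1_def \<kappa>2_def algebra_simps)
    then have "\<alpha> * ln x + \<beta> * ln y \<le> - t / a" using a by (simp add: field_simps)
    then have "exp (\<alpha> * ln x + \<beta> * ln y) \<le> exp (- t / a)" by simp
    then have "x powr \<alpha> * y powr \<beta> \<le> exp (- t / a)" using x y by (simp add: powr_def exp_add)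
    then show "prob (tuples n - cost_enlarge N r n A t) powr \<alpha> * prob A powr \<beta> \<le> 1 * exp (- t / a)"
      unfolding xeq x_def y_def by simp
  qed
qed

end

section \<open>Typical sets\<close>

context power_prob
begin

lemma integrable_P_bounded:
  assumes "f \<in> borel_measurable (P n)" "\<And>x. \<bar>f x\<bar> \<le> (B::real)"
  shows "integrable (P n) f"
  using assms prob_P[of n] by (intro finite_measure.integrable_const_bound[of _ _ B] prob_space.finite_measure) auto

lemma integral_P_Suc:
  assumes "f \<in> borel_measurable (P (Suc n))" "\<And>x. \<bar>f x\<bar> \<le> (B::real)"
  shows "(\<integral>x. f x \<partial>P (Suc n)) = (\<integral>x. \<integral>y. f (x(n := y)) \<partial>\<mu> \<partial>P n)"
  using integrable_P_bounded[OF assms] unfolding lessThan_Suc by (intro prod.product_integral_insert) auto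

lemma measurable_section:
  assumes "f \<in> borel_measurable (P (Suc n))" "x \<in> tuples n"
  shows "(\<lambda>y. f (x(n := y))) \<in> borel_measurable borel"
proof -
  have "(\<lambda>(x, y). f (x(n := y))) \<in> borel_measurable (P n \<Otimes>\<^sub>M \<mu>)"
    using measurable_compose[OF measurable_add_coord assms(1)] by (simp add: case_prod_beta' fun_upd_def)
  from measurable_compose[OF measurable_Pair1'[of x "P n" \<mu>] this] show ?thesis
    using assms(2) by (simp cong: measurable_cong_sets add: sets_borel)
qed

lemma measurable_integral_section:
  fixes f :: "_ \<Rightarrow> real"
  assumes "f \<in> borel_measurable (P (Suc n))"
  shows "(\<lambda>x. \<integral>y. f (x(n := y)) \<partial>\<mu>) \<in> borel_measurable (P n)"
proof -
  have "(\<lambda>(x, y). f (x(n := y))) \<in> borel_measurable (P n \<Otimes>\<^sub>M \<mu>)"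
    using measurable_compose[OF measurable_add_coord assms(1)] by (simp add: case_prod_beta' fun_upd_def)
  then show ?thesis
    by (rule sigma_finite_measure.borel_measurable_lebesgue_integral[OF prob_space_imp_sigma_finite[OF prob]])
qed

lemma integral_P_0: "(\<integral>x. f x \<partial>P 0) = (f (\<lambda>_. undefined) :: real)"
proof -
  interpret P0: prob_space "P 0" by (rule prob_P)
  have t0: "tuples 0 = {\<lambda>_::nat. undefined :: real^'m}" by (auto simp: in_tuples_iff)
  have "(\<integral>x. f x \<partial>P 0) = (\<integral>x. f (\<lambda>_. undefined) \<partial>P 0)"
    by (intro Bochner_Integration.integral_cong refl) (simp only: space_P t0 singleton_iff)
  then show ?thesis using P0.prob_space by simp
qed

text \<open>Takes the place of the additivity of entropy over products. The last coordinate is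
  integrated out under \<open>\<nu>\<close>, each time at the cost of one entropy, and the logarithm
  of its exponential integral under \<open>\<mu>\<close> is the next test function.\<close>

lemma Donsker_Varadhan_n:
  assumes \<nu>: "prob_space \<nu>" "sets \<nu> = sets borel" and fin: "rel_entropy \<nu> \<mu> < \<infinity>"
  shows "\<phi> \<in> borel_measurable (tuple_borel n) \<Longrightarrow> (\<And>x. \<bar>\<phi> x\<bar> \<le> B) \<Longrightarrow>
    (\<integral>x. \<phi> x \<partial>power_measure \<nu> n) \<le> real n * enn2real (rel_entropy \<nu> \<mu>) + ln (\<integral>x. exp (\<phi> x) \<partial>P n)"
proof (induction n arbitrary: \<phi>)
  case 0
  interpret V: power_prob \<nu> by (intro power_prob.intro \<nu>)
  show ?case by (simp only: integral_P_0 V.integral_P_0) simp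
next
  case (Suc n)
  interpret V: power_prob \<nu> by (intro power_prob.intro \<nu>)
  interpret \<mu>: prob_space \<mu> by (rule prob)
  interpret \<nu>: prob_space \<nu> by fact
  interpret Vn: prob_space "V.P n" by (rule V.prob_P)
  let ?H = "enn2real (rel_entropy \<nu> \<mu>)"
  note \<phi> = Suc.prems(1) and b = Suc.prems(2)
  have B: "B \<ge> 0" using b[of undefined] by simp
  have b': "- B \<le> \<phi> x" "\<phi> x \<le> B" for x using b[of x] by auto
  have sec: "(\<lambda>y. \<phi> (x(n := y))) \<in> borel_measurable borel" if "x \<in> tuples n" for x
    using measurable_section[OF measurable_P[OF \<phi>] that] .
  have expm: "(\<lambda>x. exp (\<phi> x)) \<in> borel_measurable (P (Suc n))" using measurable_P[OF \<phi>] by measurable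
  have expb: "\<bar>exp (\<phi> x)\<bar> \<le> exp B" for x using b' by simp
  define E where "E x = (\<integral>y. exp (\<phi> (x(n := y))) \<partial>\<mu>)" for x
  have E: "exp (- B) \<le> E x" "E x \<le> exp B" if "x \<in> tuples n" for x
  proof -
    have int: "integrable \<mu> (\<lambda>y. exp (\<phi> (x(n := y))))"
      using sec[OF that] b' by (intro \<mu>.integrable_const_bound[of _ "exp B"]) auto
    have "(\<integral>y. exp (- B) \<partial>\<mu>) \<le> E x" unfolding E_def using int b' by (intro integral_mono) auto
    then show "exp (- B) \<le> E x" using \<mu>.prob_space by simp
    have "E x \<le> (\<integral>y. exp B \<partial>\<mu>)" unfolding E_def using int b' by (intro integral_mono) auto
    then show "E x \<le> exp B" using \<mu>.prob_space by simp
  qed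
  define \<psi> where "\<psi> x = (if x \<in> tuples n then ln (E x) else 0)" for x
  have \<psi>b: "\<bar>\<psi> x\<bar> \<le> B" for x
  proof (cases "x \<in> tuples n")
    case True
    have "0 < E x" using E(1)[OF True] exp_gt_zero[of "- B"] by linarith
    then have "- B \<le> ln (E x)" "ln (E x) \<le> B"
      using E[OF True] by (metis ln_exp ln_le_cancel_iff exp_gt_zero)+
    then show ?thesis using True by (simp add: \<psi>_def)
  qed (simp add: \<psi>_def B)
  have "E \<in> borel_measurable (P n)" unfolding E_def by (rule measurable_integral_section[OF expm])
  then have "(\<lambda>x. ln (E x)) \<in> borel_measurable (P n)" by measurable
  then have "\<psi> \<in> borel_measurable (P n)"
    by (subst measurable_cong[where g="\<lambda>x. ln (E x)"]) (simp_all add: \<psi>_def)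
  then have \<psi>m: "\<psi> \<in> borel_measurable (tuple_borel n)" by (simp cong: measurable_cong_sets add: sets_P)
  have "(\<integral>x. \<phi> x \<partial>V.P (Suc n)) = (\<integral>x. \<integral>y. \<phi> (x(n := y)) \<partial>\<nu> \<partial>V.P n)"
    by (rule V.integral_P_Suc[OF V.measurable_P[OF \<phi>] b])
  also have "\<dots> \<le> (\<integral>x. ?H + \<psi> x \<partial>V.P n)"
  proof (rule integral_mono)
    show "integrable (V.P n) (\<lambda>x. \<integral>y. \<phi> (x(n := y)) \<partial>\<nu>)"
    proof (rule V.integrable_P_bounded[where B=B])
      fix x show "\<bar>\<integral>y. \<phi> (x(n := y)) \<partial>\<nu>\<bar> \<le> B"
      \<comment> \<open>The bound is wanted for every \<open>x\<close>, including those outside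
        \<open>tuples n\<close>, where the section may fail to be integrable; its integral is then
        \<open>0\<close>, which also satisfies the bound.\<close>
      proof (cases "integrable \<nu> (\<lambda>y. \<phi> (x(n := y)))")
        case True
        have "(\<integral>y. \<phi> (x(n := y)) \<partial>\<nu>) \<le> (\<integral>y. B \<partial>\<nu>)" using True b' by (intro integral_mono) auto
        moreover have "(\<integral>y. - B \<partial>\<nu>) \<le> (\<integral>y. \<phi> (x(n := y)) \<partial>\<nu>)" using True b' by (intro integral_mono) auto
        ultimately show ?thesis using \<nu>.prob_space by simp
      qed (simp add: B not_integrable_integral_eq)
    qed (rule V.measurable_integral_section[OF V.measurable_P[OF \<phi>]])
    show "integrable (V.P n) (\<lambda>x. ?H + \<psi> x)"
    proof (rule V.integrable_P_bounded[where B="?H + B"])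
      show "\<bar>?H + \<psi> x\<bar> \<le> ?H + B" for x using \<psi>b[of x] enn2real_nonneg[of "rel_entropy \<nu> \<mu>"] by linarith
    qed (use V.measurable_P[OF \<psi>m] in measurable)
    fix x assume "x \<in> space (V.P n)"
    then have x: "x \<in> tuples n" by simp
    have m: "(\<lambda>y. \<phi> (x(n := y))) \<in> borel_measurable \<mu>" using sec[OF x] by (simp cong: measurable_cong_sets add: sets_borel)
    show "(\<integral>y. \<phi> (x(n := y)) \<partial>\<nu>) \<le> ?H + \<psi> x"
      using Donsker_Varadhan[OF prob \<nu>(1) _ fin m b] \<nu>(2) sets_borel x by (simp add: \<psi>_def E_def fun_upd_def)
  qed
  also have "\<dots> = ?H + (\<integral>x. \<psi> x \<partial>V.P n)"
    using V.integrable_P_bounded[OF V.measurable_P[OF \<psi>m] \<psi>b] Vn.prob_space by simp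
  also have "\<dots> \<le> ?H + (real n * ?H + ln (\<integral>x. exp (\<psi> x) \<partial>P n))"
    using Suc.IH[OF \<psi>m \<psi>b] by simp
  also have "(\<integral>x. exp (\<psi> x) \<partial>P n) = (\<integral>x. E x \<partial>P n)"
  proof (intro Bochner_Integration.integral_cong refl)
    fix x assume "x \<in> space (P n)"
    then have x: "x \<in> tuples n" by simp
    then have "0 < E x" using E(1)[OF x] exp_gt_zero[of "- B"] by linarith
    then show "exp (\<psi> x) = E x" using x by (simp add: \<psi>_def)
  qed
  also have "\<dots> = (\<integral>x. exp (\<phi> x) \<partial>P (Suc n))"
    unfolding E_def by (rule integral_P_Suc[OF expm expb, symmetric])
  finally show ?case by (simp add: algebra_simps)
qed

text \<open>The variational inequality is tested with \<open>K\<close> times the indicator of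
  \<open>A\<close>. If \<open>A\<close> had \<open>\<mu>^n\<close>-measure \<open>0\<close>, a large
  \<open>K\<close> would contradict finite entropy. Otherwise \<open>K = ln (1 / q)\<close> balances
  the exponential moment, whose logarithm is then at most \<open>ln 2\<close>, whatever
  \<open>n\<close> is.\<close>

lemma entropy_lower_bound:
  assumes \<nu>: "prob_space \<nu>" "sets \<nu> = sets borel" and fin: "rel_entropy \<nu> \<mu> < \<infinity>"
    and A: "A \<in> sets (tuple_borel n)" and pos: "measure (power_measure \<nu> n) A > 0"
  shows "measure (P n) A > 0"
    "measure (power_measure \<nu> n) A * ln (1 / measure (P n) A) \<le> real n * enn2real (rel_entropy \<nu> \<mu>) + ln 2"
proof -
  interpret V: power_prob \<nu> by (intro power_prob.intro \<nu>)
  interpret Pn: prob_space "P n" by (rule prob_P)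
  interpret Vn: prob_space "V.P n" by (rule V.prob_P)
  define p q H where "p = measure (V.P n) A" and "q = measure (P n) A" and "H = real n * enn2real (rel_entropy \<nu> \<mu>)"
  have AP: "A \<in> sets (P n)" "A \<in> sets (V.P n)" using A sets_P V.sets_P by simp_all
  have main: "p * K \<le> H + ln (1 + exp K * q)" if K: "K \<ge> 0" for K
  proof -
    have i: "(\<integral>x. K * indicator A x \<partial>V.P n) \<le> H + ln (\<integral>x. exp (K * indicator A x) \<partial>P n)"
      unfolding H_def using A K
      by (intro Donsker_Varadhan_n[OF \<nu> fin, of _ n K]) (auto simp: indicator_def)
    have ii: "(\<integral>x. K * indicator A x \<partial>V.P n) = p * K"
      using AP sets.sets_into_space[OF AP(2)] by (simp add: p_def Int_absorb2)
    have iii: "(\<integral>x. exp (K * indicator A x) \<partial>P n) = 1 + (exp K - 1) * q"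
    proof -
      have "(\<integral>x. exp (K * indicator A x) \<partial>P n) = (\<integral>x. 1 + (exp K - 1) * indicator A x \<partial>P n)"
        by (intro Bochner_Integration.integral_cong) (auto simp: indicator_def)
      also have "\<dots> = 1 + (exp K - 1) * q"
        using AP sets.sets_into_space[OF AP(1)] Pn.prob_space
        by (subst Bochner_Integration.integral_add) (auto simp: q_def Int_absorb2 less_top[symmetric])
      finally show ?thesis .
    qed
    have iv: "ln (1 + (exp K - 1) * q) \<le> ln (1 + exp K * q)"
    proof (subst ln_le_cancel_iff)
      have "0 \<le> (exp K - 1) * q" "0 \<le> exp K * q" using K by (auto simp: q_def)
      then show "0 < 1 + (exp K - 1) * q" "0 < 1 + exp K * q" by linarith+
      show "1 + (exp K - 1) * q \<le> 1 + exp K * q" by (simp add: q_def algebra_simps)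
    qed
    show ?thesis using i iv unfolding ii iii by linarith
  qed
  have "q \<noteq> 0"
  proof
    assume "q = 0"
    then have "p * ((H + 1) / p) \<le> H" using main[of "(H + 1) / p"] pos by (simp add: H_def p_def)
    then show False using pos by (simp add: p_def)
  qed
  then have q: "q > 0" "q \<le> 1" by (auto simp: q_def order_less_le)
  then show "measure (P n) A > 0" by (simp add: q_def)
  have "p * ln (1 / q) \<le> H + ln (1 + exp (ln (1 / q)) * q)" using q by (intro main) simp
  also have "exp (ln (1 / q)) * q = 1" using q by simp
  finally show "measure (V.P n) A * ln (1 / measure (P n) A) \<le> real n * enn2real (rel_entropy \<nu> \<mu>) + ln 2"
    by (simp add: p_def q_def H_def)
qed

text \<open>When the last coordinate is integrated out the cross term vanishes, so only the second
  moments, each at most \<open>1\<close>, add up.\<close>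

lemma integral_square_sum_le:
  fixes f :: "real^'m \<Rightarrow> real"
  assumes f[measurable]: "f \<in> borel_measurable borel" and b: "\<And>x. \<bar>f x\<bar> \<le> 1" and zero: "(\<integral>x. f x \<partial>\<mu>) = 0"
  shows "(\<integral>x. (\<Sum>i<n. f (x i))\<^sup>2 \<partial>P n) \<le> real n"
proof (induction n)
  case 0
  show ?case by (simp only: integral_P_0) simp
next
  case (Suc n)
  interpret \<mu>: prob_space \<mu> by (rule prob)
  interpret Pn: prob_space "P n" by (rule prob_P)
  let ?S = "\<lambda>(n::nat) (x :: nat \<Rightarrow> real^'m). \<Sum>i<n. f (x i)"
  have Sb: "\<bar>?S k x\<bar> \<le> real k" for k x
    using sum_mono[of "{..<k}" "\<lambda>i. \<bar>f (x i)\<bar>" "\<lambda>_. 1"] b by (intro order_trans[OF sum_abs]) auto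
  have Sm[measurable]: "?S k \<in> borel_measurable (P k)" for k
    by (intro borel_measurable_sum measurable_compose[OF measurable_coord f]) auto
  have S2: "\<bar>(?S k x)\<^sup>2\<bar> \<le> (real k)\<^sup>2" for k x using Sb by (simp add: abs_le_square_iff[symmetric])
  have intf: "integrable \<mu> f" using b by (intro \<mu>.integrable_const_bound[of _ 1]) auto
  have f2: "\<bar>(f y)\<^sup>2\<bar> \<le> 1" for y using b[of y] by (simp add: abs_square_le_1)
  have intf2: "integrable \<mu> (\<lambda>y. (f y)\<^sup>2)" using f2 by (intro \<mu>.integrable_const_bound[of _ 1]) auto
  have "(\<integral>y. (f y)\<^sup>2 \<partial>\<mu>) \<le> (\<integral>y. 1 \<partial>\<mu>)" using intf2 f2 by (intro integral_mono) auto
  then have f2_le: "(\<integral>y. (f y)\<^sup>2 \<partial>\<mu>) \<le> 1" using \<mu>.prob_space by simp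
  have intS: "integrable (P k) (\<lambda>x. (?S k x)\<^sup>2)" for k by (rule integrable_P_bounded[OF _ S2]) measurable
  have "(\<integral>x. (?S (Suc n) x)\<^sup>2 \<partial>P (Suc n)) = (\<integral>x. \<integral>y. (?S (Suc n) (x(n := y)))\<^sup>2 \<partial>\<mu> \<partial>P n)"
    by (rule integral_P_Suc[OF _ S2]) measurable
  also have "\<dots> = (\<integral>x. (?S n x)\<^sup>2 + (\<integral>y. (f y)\<^sup>2 \<partial>\<mu>) \<partial>P n)"
  proof (intro Bochner_Integration.integral_cong refl)
    fix x
    have "(\<integral>y. (?S (Suc n) (x(n := y)))\<^sup>2 \<partial>\<mu>) = (\<integral>y. ((?S n x)\<^sup>2 + 2 * ?S n x * f y) + (f y)\<^sup>2 \<partial>\<mu>)"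
      by (intro Bochner_Integration.integral_cong) (auto simp: power2_sum algebra_simps)
    also have "\<dots> = (?S n x)\<^sup>2 + (\<integral>y. (f y)\<^sup>2 \<partial>\<mu>)"
      using intf intf2 zero \<mu>.prob_space by simp
    finally show "(\<integral>y. (?S (Suc n) (x(n := y)))\<^sup>2 \<partial>\<mu>) = (?S n x)\<^sup>2 + (\<integral>y. (f y)\<^sup>2 \<partial>\<mu>)" .
  qed
  also have "\<dots> = (\<integral>x. (?S n x)\<^sup>2 \<partial>P n) + (\<integral>y. (f y)\<^sup>2 \<partial>\<mu>)"
    using intS[of n] Pn.prob_space by simp
  also have "\<dots> \<le> real (Suc n)" using Suc.IH f2_le by simp
  finally show ?case .
qed

lemma deviation_le:
  fixes f :: "real^'m \<Rightarrow> real"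
  assumes f[measurable]: "f \<in> borel_measurable borel" and b: "\<And>x. \<bar>f x\<bar> \<le> 1" and zero: "(\<integral>x. f x \<partial>\<mu>) = 0"
    and d: "d > 0" and n: "n \<ge> 1"
  shows "measure (P n) {x \<in> tuples n. real n * d < \<bar>\<Sum>i<n. f (x i)\<bar>} \<le> 1 / (real n * d\<^sup>2)"
proof -
  interpret Pn: prob_space "P n" by (rule prob_P)
  let ?S = "\<lambda>x. \<Sum>i<n. f (x i)"
  have Sb: "\<bar>?S x\<bar> \<le> real n" for x
    using sum_mono[of "{..<n}" "\<lambda>i. \<bar>f (x i)\<bar>" "\<lambda>_. 1"] b by (intro order_trans[OF sum_abs]) auto
  have Sm[measurable]: "?S \<in> borel_measurable (P n)"
    by (intro borel_measurable_sum measurable_compose[OF measurable_coord f]) auto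
  have int: "integrable (P n) (\<lambda>x. (?S x)\<^sup>2)"
    using Sb by (intro integrable_P_bounded[of _ _ "(real n)\<^sup>2"]) (auto simp: abs_le_square_iff[symmetric])
  have nd: "(real n * d)\<^sup>2 > 0" using d n by simp
  have "measure (P n) {x \<in> tuples n. real n * d < \<bar>?S x\<bar>} \<le> measure (P n) {x \<in> space (P n). (real n * d)\<^sup>2 \<le> (?S x)\<^sup>2}"
    unfolding space_P
  proof (intro Pn.finite_measure_mono Collect_conj_mono)
    fix x assume "real n * d < \<bar>?S x\<bar>"
    then have "\<bar>real n * d\<bar> \<le> \<bar>?S x\<bar>" using d by simp
    then show "(real n * d)\<^sup>2 \<le> (?S x)\<^sup>2" by (simp only: abs_le_square_iff)
  qed (unfold space_P[symmetric], measurable)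
  also have "\<dots> \<le> (\<integral>x. (?S x)\<^sup>2 \<partial>P n) / (real n * d)\<^sup>2"
    by (rule integral_Markov_inequality_measure[OF int sets.empty_sets]) (use nd in auto)
  also have "\<dots> \<le> real n / (real n * d)\<^sup>2"
    using integral_square_sum_le[OF f b zero] nd by (intro divide_right_mono) auto
  also have "\<dots> = 1 / (real n * d\<^sup>2)" using n by (simp add: power2_eq_square)
  finally show ?thesis .
qed

lemma nn_integral_coord:
  assumes "g \<in> borel_measurable borel" "i < n"
  shows "(\<integral>\<^sup>+x. g (x i) \<partial>P n) = (\<integral>\<^sup>+y. g y \<partial>\<mu>)"
proof -
  have "distr (P n) \<mu> (\<lambda>x. x i) = \<mu>" using assms(2) prob by (intro distr_PiM_component) auto
  then have "(\<integral>\<^sup>+y. g y \<partial>\<mu>) = (\<integral>\<^sup>+y. g y \<partial>distr (P n) \<mu> (\<lambda>x. x i))" by simp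
  also have "\<dots> = (\<integral>\<^sup>+x. g (x i) \<partial>P n)"
    using assms by (intro nn_integral_distr measurable_component_singleton) (auto simp: sets_borel cong: measurable_cong_sets)
  finally show ?thesis by simp
qed

end

section \<open>Typical tuples and their probability\<close>

context norm_power
begin

text \<open>A concrete form of closeness of the empirical measure to \<nu>: the frequency of each
  cell of the discretization \<phi> is right up to \<open>d\<close>, and the discretization moves
  the points by little on average in the cost of order \<open>r\<close>.\<close>

definition typical :: "(real^'m \<Rightarrow> real^'m) \<Rightarrow> (real^'m) measure \<Rightarrow> real \<Rightarrow> real \<Rightarrow> nat \<Rightarrow> (nat \<Rightarrow> real^'m) set"
  where "typical \<phi> \<nu> d \<theta> n = {x \<in> tuples n.
    (\<forall>c\<in>range \<phi>. \<bar>\<Sum>i<n. indicator {c} (\<phi> (x i)) - measure \<nu> (\<phi> -` {c})\<bar> \<le> real n * d) \<and>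
    (\<Sum>i<n. N (x i - \<phi> (x i)) powr r) \<le> real n * \<theta>}"

lemma typical_measurable:
  assumes \<phi>[measurable]: "\<phi> \<in> borel_measurable borel" and fin: "finite (range \<phi>)"
  shows "typical \<phi> \<nu> d \<theta> n \<in> sets (tuple_borel n)"
proof -
  have coord: "(\<lambda>x. x i) \<in> borel_measurable (tuple_borel n :: (nat \<Rightarrow> real^'m) measure)" if "i < n" for i
    using that by (intro measurable_component_singleton) auto
  have 1: "(\<lambda>x. \<Sum>i<n. indicator {c} (\<phi> (x i)) - measure \<nu> (\<phi> -` {c}) :: real) \<in> borel_measurable (tuple_borel n)" for c
    by (intro borel_measurable_sum borel_measurable_diff measurable_compose[OF coord]) measurable
  have 2: "(\<lambda>x. \<Sum>i<n. N (x i - \<phi> (x i)) powr r) \<in> borel_measurable (tuple_borel n)"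
    by (intro borel_measurable_sum measurable_compose[OF coord, of _ "\<lambda>y. N (y - \<phi> y) powr r"]) measurable
  have "typical \<phi> \<nu> d \<theta> n = (\<Inter>c\<in>range \<phi>. {x \<in> space (tuple_borel n). \<bar>\<Sum>i<n. indicator {c} (\<phi> (x i)) - measure \<nu> (\<phi> -` {c})\<bar> \<le> real n * d})
      \<inter> {x \<in> space (tuple_borel n). (\<Sum>i<n. N (x i - \<phi> (x i)) powr r) \<le> real n * \<theta>}"
    unfolding typical_def space_tuple_borel by blast
  also have "\<dots> \<in> sets (tuple_borel n)"
  proof (intro sets.Int sets.finite_INT fin)
    show "{x \<in> space (tuple_borel n). \<bar>\<Sum>i<n. indicator {c} (\<phi> (x i)) - measure \<nu> (\<phi> -` {c})\<bar> \<le> real n * d} \<in> sets (tuple_borel n)" for c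
      using 1[of c] by measurable
    show "{x \<in> space (tuple_borel n). (\<Sum>i<n. N (x i - \<phi> (x i)) powr r) \<le> real n * \<theta>} \<in> sets (tuple_borel n)"
      using 2 by measurable
  qed auto
  finally show ?thesis .
qed

text \<open>Chebyshev's inequality applies to each of the \<open>k\<close> cells, and their total
  failure \<open>k / (n * d^2)\<close> falls below \<theta> for large \<open>n\<close>. For the
  displacement Markov's inequality with mean at most \<open>\<theta>^2\<close> and threshold
  \<theta> gives another \<theta>; this is why the hypothesis has a square.\<close>

lemma typical_probability:
  assumes \<nu>: "prob_space \<nu>" "sets \<nu> = sets borel"
    and \<phi>[measurable]: "\<phi> \<in> borel_measurable borel" and fin: "finite (range \<phi>)"
    and \<theta>: "\<theta> > 0" "(\<integral>\<^sup>+y. ennreal (N (y - \<phi> y) powr r) \<partial>\<nu>) \<le> ennreal (\<theta>\<^sup>2)" and d: "d > 0"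
  shows "\<exists>n0. \<forall>n\<ge>n0. 1 - 2 * \<theta> \<le> measure (power_measure \<nu> n) (typical \<phi> \<nu> d \<theta> n)"
proof -
  interpret V: power_prob \<nu> by (intro power_prob.intro \<nu>)
  interpret \<nu>: prob_space \<nu> by fact
  interpret Vn: prob_space "V.P n" for n by (rule V.prob_P)
  note [measurable_cong] = \<nu>(2)
  define k where "k = card (range \<phi>)"
  obtain n1 :: nat where n1: "real k / (\<theta> * d\<^sup>2) \<le> real n1" using real_arch_simple by blast
  show ?thesis
  proof (intro exI[of _ "max 1 n1"] allI impI)
    fix n assume "n \<ge> max 1 n1"
    then have n: "n \<ge> 1" "real k / (\<theta> * d\<^sup>2) \<le> real n" using n1 by auto
    let ?f = "\<lambda>c y. indicator {c} (\<phi> y) - measure \<nu> (\<phi> -` {c})"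
    define Bad where "Bad c = {x \<in> tuples n. real n * d < \<bar>\<Sum>i<n. ?f c (x i)\<bar>}" for c
    define Far where "Far = {x \<in> tuples n. real n * \<theta> < (\<Sum>i<n. N (x i - \<phi> (x i)) powr r)}"
    have fm: "?f c \<in> borel_measurable borel" for c by measurable
    have m1: "(\<lambda>x. \<Sum>i<n. ?f c (x i)) \<in> borel_measurable (V.P n)" for c
      by (intro borel_measurable_sum measurable_compose[OF V.measurable_coord fm]) auto
    have m2: "(\<lambda>x. \<Sum>i<n. N (x i - \<phi> (x i)) powr r) \<in> borel_measurable (V.P n)"
      by (intro borel_measurable_sum measurable_compose[OF V.measurable_coord, of _ _ "\<lambda>y. N (y - \<phi> y) powr r"]) auto
    have Bm: "Bad c \<in> sets (V.P n)" for c
      unfolding Bad_def V.space_P[symmetric] using m1[of c] by measurable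
    have Fm: "Far \<in> sets (V.P n)" unfolding Far_def V.space_P[symmetric] using m2 by measurable
    have Bp: "measure (V.P n) (Bad c) \<le> 1 / (real n * d\<^sup>2)" for c
      unfolding Bad_def
    proof (rule V.deviation_le[OF fm _ _ d n(1)])
      show "\<bar>?f c y\<bar> \<le> 1" for y
        using \<nu>.prob_le_1[of "\<phi> -` {c}"] measure_nonneg[of \<nu> "\<phi> -` {c}"] by (auto simp: indicator_def)
      have "\<phi> -` {c} \<in> sets \<nu>" using measurable_sets[OF \<phi>, of "{c}"] \<nu>(2) by simp
      moreover have "(\<lambda>y. indicator {c} (\<phi> y) :: real) = indicator (\<phi> -` {c})" by (auto simp: indicator_def)
      ultimately show "(\<integral>y. ?f c y \<partial>\<nu>) = 0"
        using \<nu>.prob_space sets_eq_imp_space_eq[OF \<nu>(2)]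
        by (subst Bochner_Integration.integral_diff) (auto simp: less_top[symmetric])
    qed
    have Fp: "measure (V.P n) Far \<le> \<theta>"
    proof -
      have "emeasure (V.P n) Far \<le> emeasure (V.P n) ({x \<in> space (V.P n). 1 \<le> ennreal (1 / (real n * \<theta>)) * ennreal (\<Sum>i<n. N (x i - \<phi> (x i)) powr r)})"
      proof (rule emeasure_mono)
        show "Far \<subseteq> {x \<in> space (V.P n). 1 \<le> ennreal (1 / (real n * \<theta>)) * ennreal (\<Sum>i<n. N (x i - \<phi> (x i)) powr r)}"
          unfolding Far_def V.space_P
        proof (rule Collect_conj_mono)
          fix x assume "real n * \<theta> < (\<Sum>i<n. N (x i - \<phi> (x i)) powr r)"
          then have "1 \<le> 1 / (real n * \<theta>) * (\<Sum>i<n. N (x i - \<phi> (x i)) powr r)" using n \<theta> by (simp add: field_simps)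
          then show "1 \<le> ennreal (1 / (real n * \<theta>)) * ennreal (\<Sum>i<n. N (x i - \<phi> (x i)) powr r)"
            using \<theta> by (subst ennreal_mult[symmetric]) (auto simp: sum_nonneg ennreal_ge_1)
        qed
      qed (use m2 in measurable)
      also have "\<dots> \<le> ennreal (1 / (real n * \<theta>)) * (\<integral>\<^sup>+x. ennreal (\<Sum>i<n. N (x i - \<phi> (x i)) powr r) * indicator (space (V.P n)) x \<partial>V.P n)"
        by (rule nn_integral_Markov_inequality) (use m2 in measurable)
      also have "(\<integral>\<^sup>+x. ennreal (\<Sum>i<n. N (x i - \<phi> (x i)) powr r) * indicator (space (V.P n)) x \<partial>V.P n)
          = (\<integral>\<^sup>+x. (\<Sum>i<n. ennreal (N (x i - \<phi> (x i)) powr r)) \<partial>V.P n)"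
        by (intro nn_integral_cong) (simp add: sum_ennreal)
      also have "\<dots> = (\<Sum>i<n. \<integral>\<^sup>+x. ennreal (N (x i - \<phi> (x i)) powr r) \<partial>V.P n)"
        by (intro nn_integral_sum measurable_compose[OF V.measurable_coord, of _ _ "\<lambda>y. ennreal (N (y - \<phi> y) powr r)"]) auto
      also have "\<dots> = (\<Sum>i<n. \<integral>\<^sup>+y. ennreal (N (y - \<phi> y) powr r) \<partial>\<nu>)"
        by (intro sum.cong refl V.nn_integral_coord[of "\<lambda>y. ennreal (N (y - \<phi> y) powr r)"]) auto
      also have "\<dots> \<le> (\<Sum>i<n. ennreal (\<theta>\<^sup>2))" using \<theta>(2) by (intro sum_mono)
      also have "\<dots> = ennreal (real n * \<theta>\<^sup>2)" by (simp add: ennreal_of_nat_eq_real_of_nat flip: ennreal_mult)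
      also have "ennreal (1 / (real n * \<theta>)) * ennreal (real n * \<theta>\<^sup>2) = ennreal \<theta>"
        using n \<theta> by (simp add: power2_eq_square flip: ennreal_mult)
      finally have "emeasure (V.P n) Far \<le> ennreal \<theta>" by (simp add: mult_left_mono)
      then show ?thesis using \<theta>(1) by (simp add: Vn.emeasure_eq_measure)
    qed
    have U: "(\<Union>c\<in>range \<phi>. Bad c) \<in> sets (V.P n)" using Bm by (intro sets.finite_UN fin)
    have "tuples n - typical \<phi> \<nu> d \<theta> n \<subseteq> (\<Union>c\<in>range \<phi>. Bad c) \<union> Far"
      unfolding typical_def Bad_def Far_def by (auto simp: not_le)
    then have "measure (V.P n) (tuples n - typical \<phi> \<nu> d \<theta> n) \<le> measure (V.P n) ((\<Union>c\<in>range \<phi>. Bad c) \<union> Far)"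
      by (intro Vn.finite_measure_mono sets.Un U Fm)
    also have "\<dots> \<le> measure (V.P n) (\<Union>c\<in>range \<phi>. Bad c) + measure (V.P n) Far"
      by (intro measure_Un_le U Fm)
    also have "measure (V.P n) (\<Union>c\<in>range \<phi>. Bad c) \<le> (\<Sum>c\<in>range \<phi>. measure (V.P n) (Bad c))"
      using Bm fin by (intro measure_UNION_le) auto
    also have "\<dots> \<le> (\<Sum>c\<in>range \<phi>. 1 / (real n * d\<^sup>2))" using Bp by (intro sum_mono)
    also have "\<dots> = real k / (real n * d\<^sup>2)" by (simp add: k_def)
    also have "\<dots> \<le> \<theta>" using n \<theta> d by (simp add: field_simps)
    finally have "measure (V.P n) (tuples n - typical \<phi> \<nu> d \<theta> n) \<le> 2 * \<theta>" using Fp by simp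
    moreover have "typical \<phi> \<nu> d \<theta> n \<in> sets (V.P n)" using typical_measurable[OF \<phi> fin] V.sets_P by simp
    ultimately show "1 - 2 * \<theta> \<le> measure (V.P n) (typical \<phi> \<nu> d \<theta> n)" using V.measure_compl by simp
  qed
qed

text \<open>A single sequence of finite-range approximations of the identity serves both measures.
  Dominated convergence needs moments of order \<open>r\<close>, which membership in
  \<open>P1\<close> does not supply.\<close>

lemma simple_approximation:
  assumes \<nu>: "prob_space \<nu>1" "sets \<nu>1 = sets borel" "prob_space \<nu>2" "sets \<nu>2 = sets borel"
    and int: "integrable \<nu>1 (\<lambda>y. N y powr r)" "integrable \<nu>2 (\<lambda>y. N y powr r)" and e: "e > 0"
  shows "\<exists>\<phi>. \<phi> \<in> borel_measurable borel \<and> finite (range \<phi>) \<and>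
    (\<integral>\<^sup>+y. ennreal (N (y - \<phi> y) powr r) \<partial>\<nu>1) \<le> ennreal e \<and> (\<integral>\<^sup>+y. ennreal (N (y - \<phi> y) powr r) \<partial>\<nu>2) \<le> ennreal e"
proof -
  obtain K where K: "K > 0" "\<And>x. N x \<le> K * norm x" using N_le_norm by auto
  obtain k where k: "k > 0" "\<And>x. norm x \<le> k * N x" using norm_le_N by auto
  obtain F where F: "\<And>i. simple_function borel (F i)" "\<And>x. (\<lambda>i. F i x) \<longlonglongrightarrow> (x :: real^'m)"
    "\<And>i x. dist (F i x) 0 \<le> 2 * dist x 0"
    using borel_measurable_implies_sequence_metric[of "\<lambda>x::real^'m. x" borel 0] by auto
  have Fm: "F i \<in> borel_measurable borel" for i by (rule borel_measurable_simple_function[OF F(1)])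
  have Ff: "finite (range (F i))" for i using simple_functionD(1)[OF F(1)[of i]] by simp
  have bound: "N (y - F i y) powr r \<le> (3 * K * k) powr r * N y powr r" for i y
  proof -
    have "N (y - F i y) \<le> K * norm (y - F i y)" by (rule K)
    also have "norm (y - F i y) \<le> 3 * norm y" using norm_triangle_ineq4[of y "F i y"] F(3)[of i y] by simp
    also have "norm y \<le> k * N y" by (rule k)
    finally have "N (y - F i y) \<le> 3 * K * k * N y" using K k by (simp add: algebra_simps)
    then have "N (y - F i y) powr r \<le> (3 * K * k * N y) powr r" using r by (intro powr_mono2) auto
    then show ?thesis using K k by (simp add: powr_mult)
  qed
  have lim: "\<forall>\<^sub>F i in sequentially. (\<integral>\<^sup>+y. ennreal (N (y - F i y) powr r) \<partial>\<nu>) \<le> ennreal e"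
    if \<nu>: "sets \<nu> = sets borel" and int: "integrable \<nu> (\<lambda>y. N y powr r)" for \<nu>
  proof -
    note [measurable_cong] = \<nu>
    note Fm[measurable]
    have intF: "integrable \<nu> (\<lambda>y. N (y - F i y) powr r)" for i
    proof (rule Bochner_Integration.integrable_bound)
      show "integrable \<nu> (\<lambda>y. (3 * K * k) powr r * N y powr r)" using int by simp
      show "AE y in \<nu>. norm (N (y - F i y) powr r) \<le> norm ((3 * K * k) powr r * N y powr r)" using bound by simp
    qed measurable
    have "(\<lambda>i. \<integral>y. N (y - F i y) powr r \<partial>\<nu>) \<longlonglongrightarrow> (\<integral>y. 0 \<partial>\<nu>)"
    proof (rule integral_dominated_convergence[where w="\<lambda>y. (3 * K * k) powr r * N y powr r"])
      show "AE y in \<nu>. (\<lambda>i. N (y - F i y) powr r) \<longlonglongrightarrow> 0"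
      proof (rule AE_I2)
        fix y
        have "continuous_on UNIV (\<lambda>z. N (y - z) powr r)" by (intro continuous_intros)
        then have "(\<lambda>i. N (y - F i y) powr r) \<longlonglongrightarrow> N (y - y) powr r"
          using F(2)[of y] by (intro continuous_on_tendsto_compose[where f="\<lambda>z. N (y - z) powr r" and s=UNIV]) auto
        then show "(\<lambda>i. N (y - F i y) powr r) \<longlonglongrightarrow> 0" using r by simp
      qed
    qed (use int bound in auto)
    then have "\<forall>\<^sub>F i in sequentially. (\<integral>y. N (y - F i y) powr r \<partial>\<nu>) < e" using e by (intro order_tendstoD(2)) auto
    then show ?thesis
    proof eventually_elim
      case (elim i)
      then show ?case using intF[of i] by (subst nn_integral_eq_integral) (auto intro: ennreal_leI)
    qed
  qed
  obtain i where "(\<integral>\<^sup>+y. ennreal (N (y - F i y) powr r) \<partial>\<nu>1) \<le> ennreal e"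
    "(\<integral>\<^sup>+y. ennreal (N (y - F i y) powr r) \<partial>\<nu>2) \<le> ennreal e"
    using eventually_conj[OF lim[OF \<nu>(2) int(1)] lim[OF \<nu>(4) int(2)]] eventually_happens'[OF sequentially_bot] by blast
  then show ?thesis using Fm Ff by blast
qed

end

section \<open>From couplings of typical tuples to couplings of measures\<close>

lemma finite_convergent_subseq:
  fixes X :: "nat \<Rightarrow> 'a \<Rightarrow> real"
  assumes "finite J" "\<And>k j. j \<in> J \<Longrightarrow> X k j \<in> {0..1}"
  shows "\<exists>\<sigma> L. strict_mono \<sigma> \<and> (\<forall>j\<in>J. (\<lambda>k. X (\<sigma> k) j) \<longlonglongrightarrow> L j)"
  using assms
proof (induction J rule: finite_induct)
  case empty
  show ?case by (intro exI[of _ id]) (auto simp: strict_mono_def)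
next
  case (insert j J)
  then have "\<exists>\<sigma> L. strict_mono \<sigma> \<and> (\<forall>j\<in>J. (\<lambda>k. X (\<sigma> k) j) \<longlonglongrightarrow> L j)" by simp
  then obtain \<sigma> L where \<sigma>: "strict_mono \<sigma>" "\<And>j. j \<in> J \<Longrightarrow> (\<lambda>k. X (\<sigma> k) j) \<longlonglongrightarrow> L j"
    by blast
  have "compact {0..1::real}" by simp
  moreover have "\<forall>k. X (\<sigma> k) j \<in> {0..1}" using insert.prems by auto
  ultimately obtain l \<rho> where \<rho>: "strict_mono \<rho>" "((\<lambda>k. X (\<sigma> k) j) \<circ> \<rho>) \<longlonglongrightarrow> l"
    using compact_imp_seq_compact[unfolded seq_compact_def] by metis
  have "(\<lambda>k. X ((\<sigma> \<circ> \<rho>) k) i) \<longlonglongrightarrow> (L(j := l)) i" if "i \<in> insert j J" for i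
  proof (cases "i = j")
    case True then show ?thesis using \<rho>(2) by (simp add: o_def)
  next
    case False
    then show ?thesis using that LIMSEQ_subseq_LIMSEQ[OF \<sigma>(2)[of i] \<rho>(1)] by (simp add: o_def)
  qed
  then show ?case using strict_mono_o[OF \<sigma>(1) \<rho>(1)] by blast
qed

lemma nn_integral_finite_range:
  assumes \<phi>: "\<phi> \<in> borel_measurable M" and fin: "finite (range \<phi>)"
  shows "(\<integral>\<^sup>+x. F (\<phi> x) \<partial>M) = (\<Sum>c\<in>range \<phi>. F c * emeasure M (\<phi> -` {c :: 'b::t2_space} \<inter> space M))"
proof -
  have m: "\<phi> -` {c} \<inter> space M \<in> sets M" for c using measurable_sets[OF \<phi>, of "{c}"] by simp
  have "(\<integral>\<^sup>+x. F (\<phi> x) \<partial>M) = (\<integral>\<^sup>+x. (\<Sum>c\<in>range \<phi>. F c * indicator (\<phi> -` {c} \<inter> space M) x) \<partial>M)"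
  proof (intro nn_integral_cong)
    fix x assume x: "x \<in> space M"
    have "(\<Sum>c\<in>range \<phi>. F c * indicator (\<phi> -` {c} \<inter> space M) x) = (\<Sum>c\<in>range \<phi>. if c = \<phi> x then F c else 0)"
      using x by (intro sum.cong) (auto simp: indicator_def)
    then show "F (\<phi> x) = (\<Sum>c\<in>range \<phi>. F c * indicator (\<phi> -` {c} \<inter> space M) x)" using fin by simp
  qed
  also have "\<dots> = (\<Sum>c\<in>range \<phi>. \<integral>\<^sup>+x. F c * indicator (\<phi> -` {c} \<inter> space M) x \<partial>M)"
    using m by (intro nn_integral_sum) auto
  also have "\<dots> = (\<Sum>c\<in>range \<phi>. F c * emeasure M (\<phi> -` {c} \<inter> space M))"
    using m by (intro sum.cong refl nn_integral_cmult_indicator)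
  finally show ?thesis .
qed

lemma integral_finite_range:
  fixes F :: "'b::t2_space \<Rightarrow> 'c::{banach, second_countable_topology}"
  assumes "prob_space M" and \<phi>: "\<phi> \<in> borel_measurable M" and fin: "finite (range \<phi>)"
  shows "integrable M (\<lambda>x. F (\<phi> x))"
    "(\<integral>x. F (\<phi> x) \<partial>M) = (\<Sum>c\<in>range \<phi>. measure M (\<phi> -` {c} \<inter> space M) *\<^sub>R F c)"
proof -
  interpret prob_space M by fact
  have m: "\<phi> -` {c} \<inter> space M \<in> sets M" for c using measurable_sets[OF \<phi>, of "{c}"] by simp
  have eq: "F (\<phi> x) = (\<Sum>c\<in>range \<phi>. indicator (\<phi> -` {c} \<inter> space M) x *\<^sub>R F c)" if x: "x \<in> space M" for x
  proof -
    have "(\<Sum>c\<in>range \<phi>. indicator (\<phi> -` {c} \<inter> space M) x *\<^sub>R F c) = (\<Sum>c\<in>range \<phi>. if c = \<phi> x then F c else 0)"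
      using x by (intro sum.cong) (auto simp: indicator_def)
    then show ?thesis using fin by simp
  qed
  have int: "integrable M (\<lambda>x. indicator (\<phi> -` {c} \<inter> space M) x *\<^sub>R F c)" for c
    using m[of c] by (intro integrable_scaleR_left integrable_real_indicator) (auto simp: less_top[symmetric])
  show "integrable M (\<lambda>x. F (\<phi> x))"
    using int by (subst Bochner_Integration.integrable_cong[OF refl eq]) auto
  have "(\<integral>x. F (\<phi> x) \<partial>M) = (\<integral>x. (\<Sum>c\<in>range \<phi>. indicator (\<phi> -` {c} \<inter> space M) x *\<^sub>R F c) \<partial>M)"
    using eq by (intro Bochner_Integration.integral_cong refl)
  also have "\<dots> = (\<Sum>c\<in>range \<phi>. \<integral>x. indicator (\<phi> -` {c} \<inter> space M) x *\<^sub>R F c \<partial>M)"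
    using int by (intro Bochner_Integration.integral_sum)
  also have "\<dots> = (\<Sum>c\<in>range \<phi>. measure M (\<phi> -` {c} \<inter> space M) *\<^sub>R F c)"
    using m by (intro sum.cong refl) (simp add: less_top[symmetric] Int_absorb2)
  finally show "(\<integral>x. F (\<phi> x) \<partial>M) = (\<Sum>c\<in>range \<phi>. measure M (\<phi> -` {c} \<inter> space M) *\<^sub>R F c)" .
qed

context norm_power
begin

text \<open>\<open>D\<close> is the integrated displacement of a row of mass \<open>w\<close>; a row of mass \<open>0\<close> costs nothing.\<close>

definition row_cost :: "real \<Rightarrow> real^'m \<Rightarrow> real"
  where "row_cost w D = w * N ((1 / w) *\<^sub>R D) powr r"

text \<open>\<open>M c c'\<close> is the mass sent from cell \<open>c\<close> to cell
  \<open>c'\<close>; the marginals are correct only up to \<open>d\<close>. The bound of the entries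
  by \<open>1\<close> provides compactness when \<open>d\<close> tends to \<open>0\<close>.\<close>

definition coupling_matrix :: "(real^'m) set \<Rightarrow> (real^'m \<Rightarrow> real) \<Rightarrow> (real^'m \<Rightarrow> real) \<Rightarrow> real \<Rightarrow> real \<Rightarrow>
    (real^'m \<Rightarrow> real^'m \<Rightarrow> real) \<Rightarrow> bool"
  where "coupling_matrix I v w d B M \<longleftrightarrow>
    (\<forall>c\<in>I. \<forall>c'\<in>I. 0 \<le> M c c' \<and> M c c' \<le> 1) \<and>
    (\<forall>c\<in>I. \<bar>(\<Sum>c'\<in>I. M c c') - v c\<bar> \<le> d) \<and>
    (\<forall>c'\<in>I. \<bar>(\<Sum>c\<in>I. M c c') - w c'\<bar> \<le> d) \<and>
    (\<Sum>c\<in>I. row_cost (\<Sum>c'\<in>I. M c c') (\<Sum>c'\<in>I. M c c' *\<^sub>R (c - c'))) \<le> B"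

lemma N_powr_add3_le:
  assumes "0 < e" "e < 1"
  shows "N (x + (y + z)) powr r \<le> (1 - e) powr (1 - r) * N x powr r
    + e powr (1 - r) * 2 powr (r - 1) * (N y powr r + N z powr r)"
proof -
  have "N (x + (y + z)) powr r \<le> (1 - e) powr (1 - r) * N x powr r + e powr (1 - r) * N (y + z) powr r"
    by (rule N_powr_add_le[OF assms])
  also have "\<dots> \<le> (1 - e) powr (1 - r) * N x powr r + e powr (1 - r) * (2 powr (r - 1) * (N y powr r + N z powr r))"
    by (intro add_left_mono mult_left_mono N_powr_add_le_2) auto
  finally show ?thesis by (simp add: mult.assoc)
qed

text \<open>Under \<open>p\<close> the discretized coordinate \<open>i\<close> has law
  \<open>q i\<close>; row \<open>c\<close> of the matrix collects these laws over the indices with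
  \<open>\<phi> (x i) = c\<close>. The row sums are the cell frequencies of \<open>x\<close>,
  typical for \<open>\<nu>2\<close>; the column sums are mean frequencies under \<open>p\<close>,
  which is carried by tuples typical for \<open>\<nu>1\<close>. Collecting several indices in one
  row only decreases the barycentric cost.\<close>

lemma coupling_matrix_of_typical:
  assumes \<phi>: "\<phi> \<in> borel_measurable borel" and fin: "finite (range \<phi>)" and n: "n \<ge> 1" and e: "0 < e" "e < 1"
    and x: "x \<in> typical \<phi> \<nu>2 d \<theta> n" and p: "p \<in> P1_tuples n" and pA: "emeasure p (typical \<phi> \<nu>1 d \<theta> n) = 1"
    and cost: "(\<Sum>i<n. N (x i - (\<integral>y. y i \<partial>p)) powr r) \<le> real n * \<tau>"
  shows "\<exists>M. coupling_matrix (range \<phi>) (\<lambda>c. measure \<nu>2 (\<phi> -` {c})) (\<lambda>c. measure \<nu>1 (\<phi> -` {c})) d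
    ((1 - e) powr (1 - r) * \<tau> + e powr (1 - r) * 2 powr (r - 1) * (2 * \<theta>)) M"
proof -
  note pD = P1_tuplesD[OF p]
  interpret prob_space p by (rule pD)
  let ?I = "range \<phi>"
  have npos: "real n > 0" using n by simp
  have \<phi>i: "(\<lambda>y. \<phi> (y i)) \<in> borel_measurable p" if "i < n" for i
    using measurable_compose[OF pD(4)[OF that] \<phi>] .
  have fini: "finite (range (\<lambda>y. \<phi> (y i)))" for i :: nat
    by (rule finite_subset[OF _ fin]) auto
  have rangei: "range (\<lambda>y :: nat \<Rightarrow> real^'m. \<phi> (y i)) = ?I" for i
  proof
    show "?I \<subseteq> range (\<lambda>y :: nat \<Rightarrow> real^'m. \<phi> (y i))"
    proof
      fix c assume "c \<in> ?I"
      then obtain z where "c = \<phi> z" by auto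
      then show "c \<in> range (\<lambda>y :: nat \<Rightarrow> real^'m. \<phi> (y i))" by (intro image_eqI[of _ _ "\<lambda>_. z"]) auto
    qed
  qed auto
  define q where "q i c = measure p ((\<lambda>y. \<phi> (y i)) -` {c} \<inter> space p)" for i c
  have int_R: "integrable p (\<lambda>y. F (\<phi> (y i)))" "(\<integral>y. F (\<phi> (y i)) \<partial>p) = (\<Sum>c\<in>?I. q i c *\<^sub>R F c)"
    if "i < n" for i and F :: "real^'m \<Rightarrow> real"
    using integral_finite_range[OF pD(1) \<phi>i[OF that] fini, of F] unfolding rangei q_def by auto
  have int_V: "integrable p (\<lambda>y. F (\<phi> (y i)))" "(\<integral>y. F (\<phi> (y i)) \<partial>p) = (\<Sum>c\<in>?I. q i c *\<^sub>R F c)"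
    if "i < n" for i and F :: "real^'m \<Rightarrow> real^'m"
    using integral_finite_range[OF pD(1) \<phi>i[OF that] fini, of F] unfolding rangei q_def by auto
  have q1: "(\<Sum>c\<in>?I. q i c) = 1" if "i < n" for i
    using int_R(2)[OF that, of "\<lambda>_. 1"] prob_space by simp
  define M where "M c c' = (\<Sum>i<n. indicator {c} (\<phi> (x i)) * q i c') / real n" for c c'
  have ind1: "(\<Sum>c\<in>?I. indicator {c} (\<phi> z) * g) = (g :: real)" for z g
  proof -
    have "(\<Sum>c\<in>?I. indicator {c} (\<phi> z) * g) = (\<Sum>c\<in>?I. if c = \<phi> z then g else 0)"
      by (intro sum.cong) (auto simp: indicator_def)
    then show ?thesis using fin by simp
  qed
  have row: "(\<Sum>c'\<in>?I. M c c') = (\<Sum>i<n. indicator {c} (\<phi> (x i))) / real n" for c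
  proof -
    have "(\<Sum>c'\<in>?I. M c c') = (\<Sum>c'\<in>?I. \<Sum>i<n. indicator {c} (\<phi> (x i)) * q i c') / real n"
      by (simp add: M_def sum_divide_distrib)
    also have "(\<Sum>c'\<in>?I. \<Sum>i<n. indicator {c} (\<phi> (x i)) * q i c') = (\<Sum>i<n. indicator {c} (\<phi> (x i)) * (\<Sum>c'\<in>?I. q i c'))"
      by (subst sum.swap) (simp add: sum_distrib_left)
    also have "\<dots> = (\<Sum>i<n. indicator {c} (\<phi> (x i)))" using q1 by (intro sum.cong) auto
    finally show ?thesis .
  qed
  have col: "(\<Sum>c\<in>?I. M c c') = (\<Sum>i<n. q i c') / real n" for c'
  proof -
    have "(\<Sum>c\<in>?I. M c c') = (\<Sum>c\<in>?I. \<Sum>i<n. indicator {c} (\<phi> (x i)) * q i c') / real n"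
      by (simp add: M_def sum_divide_distrib)
    also have "(\<Sum>c\<in>?I. \<Sum>i<n. indicator {c} (\<phi> (x i)) * q i c') = (\<Sum>i<n. q i c')"
      by (subst sum.swap) (simp add: ind1)
    finally show ?thesis .
  qed
  have tm: "typical \<phi> \<nu>1 d \<theta> n \<in> events" using typical_measurable[OF \<phi> fin] pD(2) by simp
  have AEt: "AE y in p. y \<in> typical \<phi> \<nu>1 d \<theta> n"
    using pA tm by (intro AE_prob_1) (simp add: measure_def)
  have M01: "0 \<le> M c c'" "M c c' \<le> 1" for c c'
  proof -
    show "0 \<le> M c c'" unfolding M_def q_def by (intro divide_nonneg_nonneg sum_nonneg mult_nonneg_nonneg) auto
    have "(\<Sum>i<n. indicator {c} (\<phi> (x i)) * q i c') \<le> (\<Sum>i<n. 1 * 1)"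
      unfolding q_def by (intro sum_mono mult_mono) (auto simp: indicator_def)
    then show "M c c' \<le> 1" using npos by (simp add: M_def)
  qed
  have rows: "\<bar>(\<Sum>c'\<in>?I. M c c') - measure \<nu>2 (\<phi> -` {c})\<bar> \<le> d" if "c \<in> ?I" for c
  proof -
    have "\<bar>\<Sum>i<n. indicator {c} (\<phi> (x i)) - measure \<nu>2 (\<phi> -` {c})\<bar> \<le> real n * d"
      using x that unfolding typical_def by blast
    moreover have "(\<Sum>i<n. indicator {c} (\<phi> (x i)) - measure \<nu>2 (\<phi> -` {c})) = real n * ((\<Sum>c'\<in>?I. M c c') - measure \<nu>2 (\<phi> -` {c}))"
      using npos unfolding row by (simp add: sum_subtractf field_simps)
    ultimately show ?thesis using npos by (simp add: abs_mult)
  qed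
  have cols: "\<bar>(\<Sum>c\<in>?I. M c c') - measure \<nu>1 (\<phi> -` {c'})\<bar> \<le> d" if c': "c' \<in> ?I" for c'
  proof -
    let ?S = "\<lambda>y. \<Sum>i<n. (indicator {c'} (\<phi> (y i)) :: real) - measure \<nu>1 (\<phi> -` {c'})"
    have ii: "integrable p (\<lambda>y. indicator {c'} (\<phi> (y i)) :: real)" if "i < n" for i
      using int_R(1)[OF that, of "indicator {c'}"] .
    have intS: "integrable p ?S" using ii by (intro Bochner_Integration.integrable_sum Bochner_Integration.integrable_diff) auto
    have "(\<integral>y. (indicator {c'} (\<phi> (y i)) :: real) \<partial>p) = q i c'" if "i < n" for i
    proof -
      have "(\<integral>y. (indicator {c'} (\<phi> (y i)) :: real) \<partial>p) = (\<Sum>c\<in>?I. q i c *\<^sub>R indicator {c'} c)"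
        by (rule int_R(2)[OF that])
      also have "\<dots> = (\<Sum>c\<in>?I. if c = c' then q i c else 0)" by (intro sum.cong) (auto simp: indicator_def)
      also have "\<dots> = q i c'" using fin c' by simp
      finally show ?thesis .
    qed
    then have "(\<integral>y. ?S y \<partial>p) = (\<Sum>i<n. q i c' - measure \<nu>1 (\<phi> -` {c'}))"
      using ii prob_space by (subst Bochner_Integration.integral_sum) (auto intro!: sum.cong)
    also have "\<dots> = real n * ((\<Sum>c\<in>?I. M c c') - measure \<nu>1 (\<phi> -` {c'}))"
      using npos unfolding col by (simp add: sum_subtractf field_simps)
    finally have eq: "(\<integral>y. ?S y \<partial>p) = real n * ((\<Sum>c\<in>?I. M c c') - measure \<nu>1 (\<phi> -` {c'}))" .
    have "\<bar>\<integral>y. ?S y \<partial>p\<bar> \<le> (\<integral>y. \<bar>?S y\<bar> \<partial>p)" by (rule integral_abs_bound)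
    also have "\<dots> \<le> (\<integral>y. real n * d \<partial>p)"
    proof (rule integral_mono_AE)
      show "AE y in p. \<bar>?S y\<bar> \<le> real n * d"
        using AEt unfolding typical_def by eventually_elim (use c' in blast)
    qed (use intS in auto)
    also have "\<dots> = real n * d" using prob_space by simp
    finally show ?thesis unfolding eq using npos by (simp add: abs_mult)
  qed
  define E where "E i = (\<integral>y. N (y i - \<phi> (y i)) powr r \<partial>p)" for i
  have Nm: "(\<lambda>y. N (y i - \<phi> (y i)) powr r) \<in> borel_measurable p" if "i < n" for i
    using pD(4)[OF that] \<phi>i[OF that] by measurable
  have single: "N (y i - \<phi> (y i)) powr r \<le> (\<Sum>i<n. N (y i - \<phi> (y i)) powr r)" if "i < n" for i y
    using that by (intro member_le_sum) auto
  have intE: "integrable p (\<lambda>y. N (y i - \<phi> (y i)) powr r)" if i: "i < n" for i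
  proof (rule integrable_const_bound[of _ "real n * \<theta>"])
    show "AE y in p. norm (N (y i - \<phi> (y i)) powr r) \<le> real n * \<theta>"
      using AEt by eventually_elim (use single[OF i] in \<open>auto simp: typical_def intro: order_trans\<close>)
  qed (rule Nm[OF i])
  have sumE: "(\<Sum>i<n. E i) \<le> real n * \<theta>"
  proof -
    have "(\<Sum>i<n. E i) = (\<integral>y. (\<Sum>i<n. N (y i - \<phi> (y i)) powr r) \<partial>p)"
      unfolding E_def using intE by (intro Bochner_Integration.integral_sum[symmetric]) auto
    also have "\<dots> \<le> (\<integral>y. real n * \<theta> \<partial>p)"
    proof (rule integral_mono_AE)
      show "AE y in p. (\<Sum>i<n. N (y i - \<phi> (y i)) powr r) \<le> real n * \<theta>"
        using AEt by eventually_elim (simp add: typical_def)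
    qed (use intE in auto)
    also have "\<dots> = real n * \<theta>" using prob_space by simp
    finally show ?thesis .
  qed
  \<comment> \<open>\<open>m i\<close> is \<open>\<phi> (x i)\<close> minus the mean of
    \<open>\<phi> (y i)\<close> under \<open>p\<close>. It differs from the true displacement by the
    rounding of \<open>x i\<close> and the mean rounding of \<open>y i\<close>, and both errors are
    at most \<theta> on average over \<open>i\<close>.\<close>
  define m where "m i = (\<Sum>c'\<in>?I. q i c' *\<^sub>R (\<phi> (x i) - c'))" for i
  let ?K = "e powr (1 - r) * 2 powr (r - 1)"
  have m_le: "N (m i) powr r \<le> (1 - e) powr (1 - r) * N (x i - (\<integral>y. y i \<partial>p)) powr r + ?K * (N (x i - \<phi> (x i)) powr r + E i)"
    if i: "i < n" for i
  proof -
    have "m i = (\<Sum>c'\<in>?I. q i c' *\<^sub>R \<phi> (x i)) - (\<Sum>c'\<in>?I. q i c' *\<^sub>R c')"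
      by (simp add: m_def scaleR_right_diff_distrib sum_subtractf)
    also have "(\<Sum>c'\<in>?I. q i c' *\<^sub>R \<phi> (x i)) = \<phi> (x i)" using q1[OF i] by (simp flip: scaleR_sum_left)
    also have "(\<Sum>c'\<in>?I. q i c' *\<^sub>R c') = (\<integral>y. \<phi> (y i) \<partial>p)" using int_V(2)[OF i, of "\<lambda>c. c"] by simp
    also have "\<phi> (x i) - (\<integral>y. \<phi> (y i) \<partial>p) =
        (x i - (\<integral>y. y i \<partial>p)) + ((\<phi> (x i) - x i) + (\<integral>y. y i - \<phi> (y i) \<partial>p))"
      using int_V(1)[OF i, of "\<lambda>c. c"] pD(5)[OF i] by simp
    finally have mi: "m i = (x i - (\<integral>y. y i \<partial>p)) + ((\<phi> (x i) - x i) + (\<integral>y. y i - \<phi> (y i) \<partial>p))" .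
    have "N (m i) powr r \<le> (1 - e) powr (1 - r) * N (x i - (\<integral>y. y i \<partial>p)) powr r
        + ?K * (N (\<phi> (x i) - x i) powr r + N (\<integral>y. y i - \<phi> (y i) \<partial>p) powr r)"
      unfolding mi by (rule N_powr_add3_le[OF e])
    also have "\<dots> \<le> (1 - e) powr (1 - r) * N (x i - (\<integral>y. y i \<partial>p)) powr r + ?K * (N (x i - \<phi> (x i)) powr r + E i)"
      unfolding E_def using N_powr_expectation_le_integral[OF pD(1) _ intE[OF i]] int_V(1)[OF i, of "\<lambda>c. c"] pD(5)[OF i]
      by (intro add_left_mono mult_left_mono add_mono) (simp_all add: N_minus_commute[of "\<phi> (x i)"])
    finally show ?thesis .
  qed
  have xt: "(\<Sum>i<n. N (x i - \<phi> (x i)) powr r) \<le> real n * \<theta>" using x by (simp add: typical_def)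
  have "(\<Sum>i<n. N (m i) powr r) \<le> (\<Sum>i<n. (1 - e) powr (1 - r) * N (x i - (\<integral>y. y i \<partial>p)) powr r + ?K * (N (x i - \<phi> (x i)) powr r + E i))"
    using m_le by (intro sum_mono) simp
  also have "\<dots> = (1 - e) powr (1 - r) * (\<Sum>i<n. N (x i - (\<integral>y. y i \<partial>p)) powr r)
      + ?K * ((\<Sum>i<n. N (x i - \<phi> (x i)) powr r) + (\<Sum>i<n. E i))"
    by (simp add: sum.distrib flip: sum_distrib_left)
  also have "\<dots> \<le> (1 - e) powr (1 - r) * (real n * \<tau>) + ?K * (real n * \<theta> + real n * \<theta>)"
    using cost sumE xt by (intro add_mono mult_left_mono) auto
  also have "\<dots> = real n * ((1 - e) powr (1 - r) * \<tau> + ?K * (2 * \<theta>))" by (simp add: algebra_simps)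
  finally have total: "(\<Sum>i<n. N (m i) powr r) / real n \<le> (1 - e) powr (1 - r) * \<tau> + ?K * (2 * \<theta>)"
    using npos by (simp add: pos_divide_le_eq mult.commute)
  have row_le: "row_cost (\<Sum>c'\<in>?I. M c c') (\<Sum>c'\<in>?I. M c c' *\<^sub>R (c - c')) \<le> (\<Sum>i<n. indicator {c} (\<phi> (x i)) * N (m i) powr r) / real n"
    for c
  proof -
    let ?S = "{i \<in> {..<n}. \<phi> (x i) = c}"
    have ind: "(\<Sum>i<n. indicator {c} (\<phi> (x i)) * g i) = (\<Sum>i\<in>?S. g i)" for g :: "nat \<Rightarrow> real"
    proof -
      have "(\<Sum>i<n. indicator {c} (\<phi> (x i)) * g i) = (\<Sum>i<n. if \<phi> (x i) = c then g i else 0)"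
        by (rule sum.cong) (simp_all add: indicator_def)
      then show ?thesis unfolding sum.inter_filter[OF finite_lessThan] .
    qed
    have indv: "(\<Sum>i<n. indicator {c} (\<phi> (x i)) *\<^sub>R g i) = (\<Sum>i\<in>?S. g i)" for g :: "nat \<Rightarrow> real^'m"
    proof -
      have "(\<Sum>i<n. indicator {c} (\<phi> (x i)) *\<^sub>R g i) = (\<Sum>i<n. if \<phi> (x i) = c then g i else 0)"
        by (rule sum.cong) (simp_all add: indicator_def)
      then show ?thesis unfolding sum.inter_filter[OF finite_lessThan] .
    qed
    have w: "(\<Sum>c'\<in>?I. M c c') = real (card ?S) / real n"
      unfolding row using ind[of "\<lambda>_. 1"] by simp
    have "(\<Sum>c'\<in>?I. M c c' *\<^sub>R (c - c')) = (\<Sum>c'\<in>?I. \<Sum>i<n. (1 / real n) *\<^sub>R (indicator {c} (\<phi> (x i)) *\<^sub>R (q i c' *\<^sub>R (c - c'))))"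
      unfolding M_def sum_divide_distrib scaleR_sum_left by (intro sum.cong refl) simp
    also have "\<dots> = (1 / real n) *\<^sub>R (\<Sum>i<n. indicator {c} (\<phi> (x i)) *\<^sub>R (\<Sum>c'\<in>?I. q i c' *\<^sub>R (c - c')))"
      by (subst sum.swap) (simp only: scaleR_sum_right)
    also have "(\<Sum>i<n. indicator {c} (\<phi> (x i)) *\<^sub>R (\<Sum>c'\<in>?I. q i c' *\<^sub>R (c - c'))) = (\<Sum>i\<in>?S. m i)"
      unfolding indv by (rule sum.cong) (simp_all add: m_def)
    finally have D: "(\<Sum>c'\<in>?I. M c c' *\<^sub>R (c - c')) = (1 / real n) *\<^sub>R (\<Sum>i\<in>?S. m i)" .
    show ?thesis
    proof (cases "?S = {}")
      case True
      then have "(\<Sum>c'\<in>?I. M c c') = 0" unfolding w by (simp only: card.empty)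
      then show ?thesis unfolding ind row_cost_def by (simp add: sum_nonneg)
    next
      case False
      have alg: "k / real n * (\<Sum>i\<in>?S. (1 / k) * N (m i) powr r) = (\<Sum>i\<in>?S. N (m i) powr r) / real n" if "k > 0" for k
        using that by (simp add: field_simps flip: sum_distrib_left sum_divide_distrib)
      have fS: "finite ?S" by simp
      then have cpos: "real (card ?S) > 0" using False by (simp add: card_gt_0_iff)
      have "(1 / (real (card ?S) / real n)) *\<^sub>R (1 / real n) *\<^sub>R (\<Sum>i\<in>?S. m i) = (\<Sum>i\<in>?S. (1 / real (card ?S)) *\<^sub>R m i)"
        using npos by (simp flip: scaleR_sum_right)
      \<comment> \<open>The displacement of a merged row is the average of the \<open>m i\<close>
        over the indices in its cell, so convexity of the cost applies.\<close>
      moreover have "N (\<Sum>i\<in>?S. (1 / real (card ?S)) *\<^sub>R m i) powr r \<le> (\<Sum>i\<in>?S. (1 / real (card ?S)) * N (m i) powr r)"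
      proof (rule convex_on_sum[OF fS False convex_on_N_powr])
        show "(\<Sum>i\<in>?S. 1 / real (card ?S)) = 1" unfolding sum_constant times_divide_eq_right mult_1_right
          by (rule divide_self[OF less_imp_neq[OF cpos, symmetric]])
      qed simp_all
      ultimately have "row_cost (\<Sum>c'\<in>?I. M c c') (\<Sum>c'\<in>?I. M c c' *\<^sub>R (c - c')) \<le>
          real (card ?S) / real n * (\<Sum>i\<in>?S. (1 / real (card ?S)) * N (m i) powr r)"
        unfolding row_cost_def w D by (intro mult_left_mono) simp_all
      also have "\<dots> = (\<Sum>i\<in>?S. N (m i) powr r) / real n" by (rule alg[OF cpos])
      finally show ?thesis unfolding ind .
    qed
  qed
  have "(\<Sum>c\<in>?I. row_cost (\<Sum>c'\<in>?I. M c c') (\<Sum>c'\<in>?I. M c c' *\<^sub>R (c - c')))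
      \<le> (\<Sum>c\<in>?I. (\<Sum>i<n. indicator {c} (\<phi> (x i)) * N (m i) powr r) / real n)"
    using row_le by (intro sum_mono)
  also have "\<dots> = (\<Sum>i<n. N (m i) powr r) / real n"
    unfolding sum_divide_distrib[symmetric] by (subst sum.swap) (simp add: ind1)
  finally have "(\<Sum>c\<in>?I. row_cost (\<Sum>c'\<in>?I. M c c') (\<Sum>c'\<in>?I. M c c' *\<^sub>R (c - c')))
      \<le> (1 - e) powr (1 - r) * \<tau> + ?K * (2 * \<theta>)" using total by linarith
  then show ?thesis unfolding coupling_matrix_def using M01 rows cols by blast
qed

text \<open>The cells are finitely many and stay fixed while \<open>d\<close> tends to
  \<open>0\<close>, so a subsequence of the matrices converges entrywise; the limit has exact
  marginals.\<close>

lemma coupling_matrix_limit: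
  assumes fin: "finite I" and v: "\<And>c. c \<in> I \<Longrightarrow> v c \<ge> 0"
    and M: "\<And>d. d > 0 \<Longrightarrow> \<exists>M. coupling_matrix I v w d B M"
  shows "\<exists>M. (\<forall>c\<in>I. \<forall>c'\<in>I. 0 \<le> M c c') \<and> (\<forall>c\<in>I. (\<Sum>c'\<in>I. M c c') = v c) \<and> (\<forall>c'\<in>I. (\<Sum>c\<in>I. M c c') = w c') \<and>
    (\<Sum>c\<in>I. row_cost (v c) (\<Sum>c'\<in>I. M c c' *\<^sub>R (c - c'))) \<le> B"
proof -
  have "\<exists>M. \<forall>k::nat. coupling_matrix I v w (1 / real (Suc k)) B (M k)"
    using M by (intro choice allI) simp
  then obtain M where M: "\<And>k. coupling_matrix I v w (1 / real (Suc k)) B (M k)" by blast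
  have "\<exists>\<sigma> L. strict_mono \<sigma> \<and> (\<forall>j\<in>I \<times> I. (\<lambda>k. (\<lambda>(c, c'). M (\<sigma> k) c c') j) \<longlonglongrightarrow> L j)"
    using M fin by (intro finite_convergent_subseq) (auto simp: coupling_matrix_def)
  then obtain \<sigma> L where \<sigma>: "strict_mono \<sigma>" and L: "\<And>c c'. c \<in> I \<Longrightarrow> c' \<in> I \<Longrightarrow> (\<lambda>k. M (\<sigma> k) c c') \<longlonglongrightarrow> L (c, c')"
    by fastforce
  have small: "(\<lambda>k. 1 / real (Suc (\<sigma> k))) \<longlonglongrightarrow> 0"
    using LIMSEQ_subseq_LIMSEQ[OF LIMSEQ_inverse_real_of_nat \<sigma>] by (simp add: o_def inverse_eq_divide)
  have lim_eq: "X = y" if "s \<longlonglongrightarrow> X" "\<And>k. \<bar>s k - y\<bar> \<le> 1 / real (Suc (\<sigma> k))" for s :: "nat \<Rightarrow> real" and X y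
  proof -
    have "(\<lambda>k. s k - y) \<longlonglongrightarrow> 0" using that(2) by (intro Lim_null_comparison[OF _ small]) simp
    then have "s \<longlonglongrightarrow> y" by (rule LIM_zero_cancel)
    then show ?thesis using that(1) LIMSEQ_unique by blast
  qed
  have rowlim: "(\<lambda>k. \<Sum>c'\<in>I. M (\<sigma> k) c c') \<longlonglongrightarrow> (\<Sum>c'\<in>I. L (c, c'))" if "c \<in> I" for c
    using L that by (intro tendsto_sum)
  have row: "(\<Sum>c'\<in>I. L (c, c')) = v c" if "c \<in> I" for c
    using rowlim[OF that] by (rule lim_eq) (use M that in \<open>simp add: coupling_matrix_def\<close>)
  have col: "(\<Sum>c\<in>I. L (c, c')) = w c'" if "c' \<in> I" for c'
    by (rule lim_eq[of "\<lambda>k. \<Sum>c\<in>I. M (\<sigma> k) c c'"]) (use M L that in \<open>auto intro!: tendsto_sum simp: coupling_matrix_def\<close>)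
  have nonneg: "0 \<le> L (c, c')" if "c \<in> I" "c' \<in> I" for c c'
    by (rule LIMSEQ_le_const[OF L[OF that]]) (use M that in \<open>auto simp: coupling_matrix_def\<close>)
  have cont: "continuous_on UNIV (\<lambda>z. N z powr r)" by (intro continuous_intros)
  \<comment> \<open>The row cost divides by the mass of the row, so the limit is taken only along
    rows of positive limiting mass. The omitted terms are nonnegative before the limit, and rows of
    mass \<open>0\<close> cost nothing afterwards.\<close>
  let ?J = "{c \<in> I. v c > 0}"
  have "(\<lambda>k. \<Sum>c\<in>?J. row_cost (\<Sum>c'\<in>I. M (\<sigma> k) c c') (\<Sum>c'\<in>I. M (\<sigma> k) c c' *\<^sub>R (c - c')))
      \<longlonglongrightarrow> (\<Sum>c\<in>?J. row_cost (v c) (\<Sum>c'\<in>I. L (c, c') *\<^sub>R (c - c')))"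
  proof (rule tendsto_sum)
    fix c assume c: "c \<in> ?J"
    have r1: "(\<lambda>k. \<Sum>c'\<in>I. M (\<sigma> k) c c') \<longlonglongrightarrow> v c" using rowlim[of c] row[of c] c by simp
    have r2: "(\<lambda>k. \<Sum>c'\<in>I. M (\<sigma> k) c c' *\<^sub>R (c - c')) \<longlonglongrightarrow> (\<Sum>c'\<in>I. L (c, c') *\<^sub>R (c - c'))"
      using L c by (intro tendsto_sum tendsto_scaleR tendsto_const) auto
    have "(\<lambda>k. (1 / (\<Sum>c'\<in>I. M (\<sigma> k) c c')) *\<^sub>R (\<Sum>c'\<in>I. M (\<sigma> k) c c' *\<^sub>R (c - c')))
        \<longlonglongrightarrow> (1 / v c) *\<^sub>R (\<Sum>c'\<in>I. L (c, c') *\<^sub>R (c - c'))"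
      using c by (intro tendsto_scaleR tendsto_divide tendsto_const r1 r2) auto
    then have "(\<lambda>k. N ((1 / (\<Sum>c'\<in>I. M (\<sigma> k) c c')) *\<^sub>R (\<Sum>c'\<in>I. M (\<sigma> k) c c' *\<^sub>R (c - c'))) powr r)
        \<longlonglongrightarrow> N ((1 / v c) *\<^sub>R (\<Sum>c'\<in>I. L (c, c') *\<^sub>R (c - c'))) powr r"
      by (intro continuous_on_tendsto_compose[OF cont]) auto
    then show "(\<lambda>k. row_cost (\<Sum>c'\<in>I. M (\<sigma> k) c c') (\<Sum>c'\<in>I. M (\<sigma> k) c c' *\<^sub>R (c - c')))
        \<longlonglongrightarrow> row_cost (v c) (\<Sum>c'\<in>I. L (c, c') *\<^sub>R (c - c'))"
      unfolding row_cost_def by (intro tendsto_mult r1)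
  qed
  moreover have "(\<Sum>c\<in>?J. row_cost (\<Sum>c'\<in>I. M (\<sigma> k) c c') (\<Sum>c'\<in>I. M (\<sigma> k) c c' *\<^sub>R (c - c'))) \<le> B" for k
  proof -
    have "(\<Sum>c\<in>?J. row_cost (\<Sum>c'\<in>I. M (\<sigma> k) c c') (\<Sum>c'\<in>I. M (\<sigma> k) c c' *\<^sub>R (c - c')))
        \<le> (\<Sum>c\<in>I. row_cost (\<Sum>c'\<in>I. M (\<sigma> k) c c') (\<Sum>c'\<in>I. M (\<sigma> k) c c' *\<^sub>R (c - c')))"
      using fin M[of "\<sigma> k"] by (intro sum_mono2) (auto simp: row_cost_def coupling_matrix_def intro!: mult_nonneg_nonneg sum_nonneg)
    also have "\<dots> \<le> B" using M[of "\<sigma> k"] by (simp add: coupling_matrix_def)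
    finally show ?thesis .
  qed
  ultimately have "(\<Sum>c\<in>?J. row_cost (v c) (\<Sum>c'\<in>I. L (c, c') *\<^sub>R (c - c'))) \<le> B"
    by (intro LIMSEQ_le_const2) auto
  also have "(\<Sum>c\<in>?J. row_cost (v c) (\<Sum>c'\<in>I. L (c, c') *\<^sub>R (c - c'))) = (\<Sum>c\<in>I. row_cost (v c) (\<Sum>c'\<in>I. L (c, c') *\<^sub>R (c - c')))"
  proof (rule sum.mono_neutral_left)
    show "\<forall>c\<in>I - ?J. row_cost (v c) (\<Sum>c'\<in>I. L (c, c') *\<^sub>R (c - c')) = 0"
    proof
      fix c assume "c \<in> I - ?J"
      then have "v c = 0" using v[of c] by auto
      then show "row_cost (v c) (\<Sum>c'\<in>I. L (c, c') *\<^sub>R (c - c')) = 0" by (simp add: row_cost_def)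
    qed
  qed (use fin in auto)
  finally show ?thesis using row col nonneg by (intro exI[of _ "\<lambda>c c'. L (c, c')"]) auto
qed

text \<open>The matrix is turned into a kernel: a point of cell \<open>c\<close> goes to cell
  \<open>c'\<close> with probability \<open>M c c' / w2 c\<close> and is distributed inside
  \<open>c'\<close> as \<open>\<nu>1\<close> is. Rounding the starting point and the target costs
  the two error terms, while the rounded displacement is that of the matrix.\<close>

lemma bary_transport_le_matrix:
  assumes \<nu>: "\<nu>1 \<in> P1" "\<nu>2 \<in> P1"
    and \<phi>[measurable]: "\<phi> \<in> borel_measurable borel" and fin: "finite (range \<phi>)" and e: "0 < e" "e < 1"
    and \<theta>: "\<theta> \<ge> 0" "(\<integral>\<^sup>+y. ennreal (N (y - \<phi> y) powr r) \<partial>\<nu>1) \<le> ennreal \<theta>" "(\<integral>\<^sup>+y. ennreal (N (y - \<phi> y) powr r) \<partial>\<nu>2) \<le> ennreal \<theta>"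
    and M: "\<And>c c'. c \<in> range \<phi> \<Longrightarrow> c' \<in> range \<phi> \<Longrightarrow> 0 \<le> M c c'"
      "\<And>c. c \<in> range \<phi> \<Longrightarrow> (\<Sum>c'\<in>range \<phi>. M c c') = measure \<nu>2 (\<phi> -` {c})"
      "\<And>c'. c' \<in> range \<phi> \<Longrightarrow> (\<Sum>c\<in>range \<phi>. M c c') = measure \<nu>1 (\<phi> -` {c'})"
    and B: "(\<Sum>c\<in>range \<phi>. row_cost (measure \<nu>2 (\<phi> -` {c})) (\<Sum>c'\<in>range \<phi>. M c c' *\<^sub>R (c - c'))) \<le> B"
  shows "bary_transport N r \<nu>1 \<nu>2 \<le> ennreal ((1 - e) powr (1 - r) * B + e powr (1 - r) * 2 powr (r - 1) * (2 * \<theta>))"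
proof -
  note \<nu>1D = P1D[OF \<nu>(1)] and \<nu>2D = P1D[OF \<nu>(2)]
  interpret \<nu>1: prob_space \<nu>1 by (rule \<nu>1D)
  interpret \<nu>2: prob_space \<nu>2 by (rule \<nu>2D)
  note [measurable_cong] = \<nu>1D(2) \<nu>2D(2)
  let ?I = "range \<phi>"
  have \<phi>1: "\<phi> \<in> borel_measurable \<nu>1" and \<phi>2: "\<phi> \<in> borel_measurable \<nu>2" by measurable
  define w1 w2 where "w1 c = measure \<nu>1 (\<phi> -` {c})" and "w2 c = measure \<nu>2 (\<phi> -` {c})" for c
  have w: "w1 c \<ge> 0" "w2 c \<ge> 0" for c by (auto simp: w1_def w2_def)
  have em: "emeasure \<nu>1 (\<phi> -` {c} \<inter> space \<nu>1) = ennreal (w1 c)" "emeasure \<nu>2 (\<phi> -` {c} \<inter> space \<nu>2) = ennreal (w2 c)" for c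
    by (simp_all add: w1_def w2_def \<nu>1.emeasure_eq_measure \<nu>2.emeasure_eq_measure \<nu>1D(3) \<nu>2D(3))
  note fr1 = nn_integral_finite_range[OF \<phi>1 fin, unfolded em]
  note fr2 = nn_integral_finite_range[OF \<phi>2 fin, unfolded em]
  have M0: "M c c' = 0" if "c \<in> ?I" "c' \<in> ?I" "w1 c' = 0 \<or> w2 c = 0" for c c'
    using that(3)
  proof
    assume "w1 c' = 0"
    then have "(\<Sum>c\<in>?I. M c c') = 0" using M(3)[OF that(2)] by (simp add: w1_def)
    then show ?thesis using M(1) that fin by (subst (asm) sum_nonneg_eq_0_iff) auto
  next
    assume "w2 c = 0"
    then have "(\<Sum>c'\<in>?I. M c c') = 0" using M(2)[OF that(1)] by (simp add: w2_def)
    then show ?thesis using M(1) that fin by (subst (asm) sum_nonneg_eq_0_iff) auto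
  qed
  \<comment> \<open>The density relative to \<open>\<nu>1\<close> of the law sent from cell
    \<open>c\<close>. The value \<open>1\<close> for cells without mass makes \<open>K c\<close>
    equal to \<open>\<nu>1\<close>, so that every \<open>K c\<close> is a probability measure. If
    \<open>w1 c' = 0\<close>, division by zero gives \<open>0\<close>, in accordance with
    \<open>M c c' = 0\<close>.\<close>
  define h where "h c c' = (if w2 c > 0 then M c c' / (w2 c * w1 c') else 1)" for c c'
  have wI: "c \<in> ?I" if "w2 c > 0" for c
  proof (rule ccontr)
    assume "c \<notin> ?I"
    then have "\<phi> -` {c} = {}" by auto
    then show False using that by (simp add: w2_def)
  qed
  have h0: "h c c' \<ge> 0" if "c' \<in> ?I" for c c' using M(1)[OF wI that] w by (auto simp: h_def)
  have hw: "h c c' * w1 c' = M c c' / w2 c" if "c' \<in> ?I" "w2 c > 0" for c c'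
    using that M0[OF wI[OF that(2)] that(1)] by (cases "w1 c' = 0") (auto simp: h_def)
  have h_sum: "(\<Sum>c'\<in>?I. h c c' * w1 c') = 1" for c
  proof (cases "w2 c > 0")
    case True
    then have "(\<Sum>c'\<in>?I. h c c' * w1 c') = (\<Sum>c'\<in>?I. M c c') / w2 c"
      by (simp add: hw sum_divide_distrib)
    then show ?thesis using M(2)[OF wI[OF True]] True by (simp add: w2_def)
  next
    case False
    have "ennreal 1 = (\<integral>\<^sup>+y. 1 \<partial>\<nu>1)" using \<nu>1.emeasure_space_1 by simp
    also have "\<dots> = (\<Sum>c'\<in>?I. 1 * ennreal (w1 c'))" using fr1[of "\<lambda>_. 1"] .
    also have "\<dots> = ennreal (\<Sum>c'\<in>?I. w1 c')" using w by simp
    finally have "(\<Sum>c'\<in>?I. w1 c') = 1" using w by (subst (asm) ennreal_inj) (auto intro: sum_nonneg)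
    then show ?thesis using False by (simp add: h_def)
  qed
  \<comment> \<open>As \<phi> is a simple function, every function of the cell is measurable, in
    particular the kernel \<open>\<lambda>x. K (\<phi> x)\<close>.\<close>
  have cs: "\<phi> \<in> \<nu>1 \<rightarrow>\<^sub>M count_space UNIV" "\<phi> \<in> \<nu>2 \<rightarrow>\<^sub>M count_space UNIV"
    using fin finite_subset[OF image_mono[OF subset_UNIV] fin] \<phi>1 \<phi>2
    by (auto intro!: measurable_simple_function simple_function_borel_measurable)
  have hm[measurable]: "(\<lambda>y. h c (\<phi> y)) \<in> borel_measurable \<nu>1" for c
    by (rule measurable_compose[OF cs(1)]) simp
  define K where "K c = density \<nu>1 (\<lambda>y. ennreal (h c (\<phi> y)))" for c
  have Kp: "prob_space (K c)" for c
  proof (rule prob_spaceI)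
    have "emeasure (K c) (space (K c)) = (\<integral>\<^sup>+y. ennreal (h c (\<phi> y)) \<partial>\<nu>1)"
      unfolding K_def using hm by (subst emeasure_density) (auto intro!: nn_integral_cong)
    also have "\<dots> = (\<Sum>c'\<in>?I. ennreal (h c c') * ennreal (w1 c'))" by (rule fr1)
    also have "\<dots> = ennreal (\<Sum>c'\<in>?I. h c c' * w1 c')"
      using h0 w by (subst sum_ennreal[symmetric]) (auto simp: ennreal_mult)
    finally show "emeasure (K c) (space (K c)) = 1" using h_sum by simp
  qed
  have Ks: "sets (K c) = sets borel" for c by (simp add: K_def \<nu>1D(2))
  define p where "p x = K (\<phi> x)" for x
  have pm: "p \<in> \<nu>2 \<rightarrow>\<^sub>M prob_algebra borel"
    unfolding p_def by (rule measurable_compose[OF cs(2)]) (simp add: space_prob_algebra Kp Ks)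
  note pm' = measurable_prob_algebraD[OF pm]
  have nnK: "(\<integral>\<^sup>+y. F y \<partial>K c) = (\<integral>\<^sup>+y. ennreal (h c (\<phi> y)) * F y \<partial>\<nu>1)" if "F \<in> borel_measurable borel" for F c
    unfolding K_def using that hm by (subst nn_integral_density) auto
  have pos1: "AE y in \<nu>1. w1 (\<phi> y) > 0"
  proof -
    have "AE y in \<nu>1. \<forall>c\<in>?I. w1 c = 0 \<longrightarrow> \<phi> y \<noteq> c"
    proof (rule AE_finite_allI[OF fin])
      fix c
      show "AE y in \<nu>1. w1 c = 0 \<longrightarrow> \<phi> y \<noteq> c"
      proof (cases "w1 c = 0")
        case True
        have "\<phi> -` {c} \<inter> space \<nu>1 \<in> null_sets \<nu>1"
          using em(1)[of c] True measurable_sets[OF \<phi>1, of "{c}"] by (auto simp: null_sets_def)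
        from AE_not_in[OF this] show ?thesis using \<nu>1D(3) by (auto elim!: eventually_mono)
      qed simp
    qed
    then show ?thesis by eventually_elim (use w in \<open>auto simp: order_less_le\<close>)
  qed
  have pb: "\<nu>2 \<bind> p = \<nu>1"
  proof (rule measure_eqI)
    have sb: "sets (\<nu>2 \<bind> p) = sets borel" by (rule sets_bind[OF _ \<nu>2.not_empty]) (simp add: p_def Ks)
    then show "sets (\<nu>2 \<bind> p) = sets \<nu>1" by (simp add: \<nu>1D(2))
    fix E assume "E \<in> sets (\<nu>2 \<bind> p)"
    then have E: "E \<in> sets borel" "E \<in> sets \<nu>1" by (simp_all add: sb \<nu>1D(2))
    have "emeasure (\<nu>2 \<bind> p) E = (\<integral>\<^sup>+x. emeasure (K (\<phi> x)) E \<partial>\<nu>2)"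
      using emeasure_bind[OF \<nu>2.not_empty pm' E(1)] by (simp add: p_def)
    also have "\<dots> = (\<Sum>c\<in>?I. emeasure (K c) E * ennreal (w2 c))" by (rule fr2)
    also have "\<dots> = (\<Sum>c\<in>?I. \<integral>\<^sup>+y. ennreal (h c (\<phi> y) * w2 c) * indicator E y \<partial>\<nu>1)"
    proof (intro sum.cong refl)
      fix c assume c: "c \<in> ?I"
      have "emeasure (K c) E * ennreal (w2 c) = (\<integral>\<^sup>+y. ennreal (h c (\<phi> y)) * indicator E y \<partial>\<nu>1) * ennreal (w2 c)"
        unfolding K_def using hm E by (subst emeasure_density) auto
      also have "\<dots> = (\<integral>\<^sup>+y. ennreal (h c (\<phi> y)) * indicator E y * ennreal (w2 c) \<partial>\<nu>1)"
        using hm E by (intro nn_integral_multc[symmetric]) auto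
      also have "\<dots> = (\<integral>\<^sup>+y. ennreal (h c (\<phi> y) * w2 c) * indicator E y \<partial>\<nu>1)"
        using h0 w by (intro nn_integral_cong) (simp add: ennreal_mult mult_ac)
      finally show "emeasure (K c) E * ennreal (w2 c) = (\<integral>\<^sup>+y. ennreal (h c (\<phi> y) * w2 c) * indicator E y \<partial>\<nu>1)" .
    qed
    also have "\<dots> = (\<integral>\<^sup>+y. (\<Sum>c\<in>?I. ennreal (h c (\<phi> y) * w2 c) * indicator E y) \<partial>\<nu>1)"
      using hm E by (intro nn_integral_sum[symmetric]) auto
    also have "\<dots> = (\<integral>\<^sup>+y. indicator E y \<partial>\<nu>1)"
    proof (rule nn_integral_cong_AE)
      show "AE y in \<nu>1. (\<Sum>c\<in>?I. ennreal (h c (\<phi> y) * w2 c) * indicator E y) = indicator E y"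
        using pos1
      proof eventually_elim
        case (elim y)
        have "h c (\<phi> y) * w2 c = M c (\<phi> y) / w1 (\<phi> y)" if "c \<in> ?I" for c
          using w(2)[of c] M0[of c "\<phi> y"] that by (cases "w2 c = 0") (auto simp: h_def)
        then have "(\<Sum>c\<in>?I. h c (\<phi> y) * w2 c) = (\<Sum>c\<in>?I. M c (\<phi> y)) / w1 (\<phi> y)"
          by (simp add: sum_divide_distrib)
        also have "\<dots> = 1" using M(3)[of "\<phi> y"] elim by (simp add: w1_def)
        finally have "(\<Sum>c\<in>?I. ennreal (h c (\<phi> y) * w2 c)) = 1"
          using h0 w by (subst sum_ennreal) auto
        then show ?case by (simp flip: sum_distrib_right)
      qed
    qed
    also have "\<dots> = emeasure \<nu>1 E" using E by simp
    finally show "emeasure (\<nu>2 \<bind> p) E = emeasure \<nu>1 E" .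
  qed
  have pos2: "AE x in \<nu>2. w2 (\<phi> x) > 0"
  proof -
    have "AE y in \<nu>2. \<forall>c\<in>?I. w2 c = 0 \<longrightarrow> \<phi> y \<noteq> c"
    proof (rule AE_finite_allI[OF fin])
      fix c
      show "AE y in \<nu>2. w2 c = 0 \<longrightarrow> \<phi> y \<noteq> c"
      proof (cases "w2 c = 0")
        case True
        have "\<phi> -` {c} \<inter> space \<nu>2 \<in> null_sets \<nu>2"
          using em(2)[of c] True measurable_sets[OF \<phi>2, of "{c}"] by (auto simp: null_sets_def)
        from AE_not_in[OF this] show ?thesis using \<nu>2D(3) by (auto elim!: eventually_mono)
      qed simp
    qed
    then show ?thesis by eventually_elim (use w in \<open>auto simp: order_less_le\<close>)
  qed
  define D where "D c = (\<Sum>c'\<in>?I. M c c' *\<^sub>R (c - c'))" for c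
  let ?K = "e powr (1 - r) * 2 powr (r - 1)"
  have "bary_transport N r \<nu>1 \<nu>2 \<le> (\<integral>\<^sup>+x. ennreal (bary_cost N r x (p x)) \<partial>\<nu>2)"
    unfolding bary_transport_kernel[OF \<nu>2D(1,2)] using pm pb by (intro INF_lower) auto
  also have "\<dots> \<le> (\<integral>\<^sup>+x. ennreal ((1 - e) powr (1 - r)) * ennreal (N ((1 / w2 (\<phi> x)) *\<^sub>R D (\<phi> x)) powr r)
      + ennreal ?K * (ennreal (N (x - \<phi> x) powr r) + (\<integral>\<^sup>+y. ennreal (N (y - \<phi> y) powr r) \<partial>p x)) \<partial>\<nu>2)"
  proof (rule nn_integral_mono_AE)
    have "AE x in \<nu>2. integrable (p x) (\<lambda>z. z)"
      by (rule kernel_AE_integrable[OF pm]) (simp_all only: pb \<nu>1D(4) measurable_ident_sets)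
    then show "AE x in \<nu>2. ennreal (bary_cost N r x (p x)) \<le> ennreal ((1 - e) powr (1 - r)) * ennreal (N ((1 / w2 (\<phi> x)) *\<^sub>R D (\<phi> x)) powr r)
      + ennreal ?K * (ennreal (N (x - \<phi> x) powr r) + (\<integral>\<^sup>+y. ennreal (N (y - \<phi> y) powr r) \<partial>p x))"
      using pos2
    proof eventually_elim
      case (elim x)
      let ?c = "\<phi> x"
      have c: "?c \<in> ?I" by simp
      interpret px: prob_space "p x" unfolding p_def by (rule Kp)
      have \<phi>p: "\<phi> \<in> borel_measurable (p x)" using \<phi> by (simp add: p_def Ks cong: measurable_cong_sets)
      note fi = integral_finite_range[OF px.prob_space_axioms \<phi>p fin, of "\<lambda>c. c"]
      have meas_p: "measure (p x) (\<phi> -` {c'} \<inter> space (p x)) = M ?c c' / w2 ?c" if c': "c' \<in> ?I" for c'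
      proof -
        have bs: "\<phi> -` {c'} \<in> sets borel" using measurable_sets[OF \<phi>, of "{c'}"] by simp
        have "emeasure (p x) (\<phi> -` {c'} \<inter> space (p x)) = emeasure (K ?c) (\<phi> -` {c'})"
          using sets_eq_imp_space_eq[OF Ks[of ?c]] by (simp add: p_def)
        also have "\<dots> = (\<integral>\<^sup>+y. indicator (\<phi> -` {c'}) y \<partial>K ?c)" using bs Ks by simp
        also have "\<dots> = (\<integral>\<^sup>+y. ennreal (h ?c (\<phi> y)) * indicator (\<phi> -` {c'}) y \<partial>\<nu>1)" using bs by (intro nnK) simp
        also have "\<dots> = (\<integral>\<^sup>+y. ennreal (h ?c (\<phi> y)) * indicator {c'} (\<phi> y) \<partial>\<nu>1)" by (intro nn_integral_cong) (auto simp: indicator_def)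
        also have "\<dots> = (\<Sum>c''\<in>?I. ennreal (h ?c c'') * indicator {c'} c'' * ennreal (w1 c''))" by (rule fr1)
        also have "\<dots> = (\<Sum>c''\<in>?I. if c'' = c' then ennreal (h ?c c') * ennreal (w1 c') else 0)"
          by (intro sum.cong) (auto simp: indicator_def)
        also have "\<dots> = ennreal (h ?c c' * w1 c')" using fin c' h0[OF c'] w by (simp add: ennreal_mult)
        also have "h ?c c' * w1 c' = M ?c c' / w2 ?c" by (rule hw[OF c' elim(2)])
        finally show ?thesis using M(1)[OF c c'] w by (simp add: measure_def)
      qed
      have "(1 / w2 ?c) *\<^sub>R D ?c = (\<Sum>c'\<in>?I. (M ?c c' / w2 ?c) *\<^sub>R ?c) - (\<Sum>c'\<in>?I. (M ?c c' / w2 ?c) *\<^sub>R c')"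
        by (simp add: D_def scaleR_sum_right scaleR_right_diff_distrib sum_subtractf)
      also have "(\<Sum>c'\<in>?I. (M ?c c' / w2 ?c) *\<^sub>R ?c) = ?c"
      proof -
        have "(\<Sum>c'\<in>?I. M ?c c' / w2 ?c) = 1" using M(2)[OF c] elim(2) by (simp add: w2_def flip: sum_divide_distrib)
        then show ?thesis by (simp flip: scaleR_sum_left)
      qed
      also have "(\<Sum>c'\<in>?I. (M ?c c' / w2 ?c) *\<^sub>R c') = (\<integral>y. \<phi> y \<partial>p x)"
        unfolding fi(2) using meas_p by (intro sum.cong) auto
      finally have bar: "(1 / w2 ?c) *\<^sub>R D ?c = ?c - (\<integral>y. \<phi> y \<partial>p x)" .
      have "x - (\<integral>y. y \<partial>p x) = (1 / w2 ?c) *\<^sub>R D ?c + ((x - ?c) + (\<integral>y. \<phi> y - y \<partial>p x))"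
        unfolding bar using fi(1) elim(1) by simp
      from N_powr_add3_le[OF e, of "(1 / w2 ?c) *\<^sub>R D ?c" "x - ?c" "\<integral>y. \<phi> y - y \<partial>p x", folded this]
      have "ennreal (bary_cost N r x (p x)) \<le> ennreal ((1 - e) powr (1 - r)) * ennreal (N ((1 / w2 ?c) *\<^sub>R D ?c) powr r)
          + ennreal ?K * (ennreal (N (x - ?c) powr r) + ennreal (N (\<integral>y. \<phi> y - y \<partial>p x) powr r))"
        by (simp add: bary_cost_def ennreal_leI flip: ennreal_mult ennreal_plus)
      also have "ennreal (N (\<integral>y. \<phi> y - y \<partial>p x) powr r) \<le> (\<integral>\<^sup>+y. ennreal (N (\<phi> y - y) powr r) \<partial>p x)"
        using fi(1) elim(1) by (intro N_powr_expectation_le px.prob_space_axioms) auto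
      also have "(\<integral>\<^sup>+y. ennreal (N (\<phi> y - y) powr r) \<partial>p x) = (\<integral>\<^sup>+y. ennreal (N (y - \<phi> y) powr r) \<partial>p x)"
        by (simp add: N_minus_commute)
      finally show ?case by (simp add: add_left_mono mult_left_mono)
    qed
  qed
  also have "\<dots> = ennreal ((1 - e) powr (1 - r)) * (\<integral>\<^sup>+x. ennreal (N ((1 / w2 (\<phi> x)) *\<^sub>R D (\<phi> x)) powr r) \<partial>\<nu>2)
      + ennreal ?K * ((\<integral>\<^sup>+x. ennreal (N (x - \<phi> x) powr r) \<partial>\<nu>2) + (\<integral>\<^sup>+x. \<integral>\<^sup>+y. ennreal (N (y - \<phi> y) powr r) \<partial>p x \<partial>\<nu>2))"
  proof -
    have sm: "(\<lambda>x. F (\<phi> x)) \<in> borel_measurable \<nu>2" for F :: "real^'m \<Rightarrow> ennreal"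
      by (rule measurable_compose[OF cs(2)]) simp
    have pmm: "(\<lambda>x. \<integral>\<^sup>+y. ennreal (N (y - \<phi> y) powr r) \<partial>p x) \<in> borel_measurable \<nu>2"
      using sm[of "\<lambda>c. \<integral>\<^sup>+y. ennreal (N (y - \<phi> y) powr r) \<partial>K c"] by (simp add: p_def)
    have m2: "(\<lambda>x. ennreal (N (x - \<phi> x) powr r)) \<in> borel_measurable \<nu>2" by measurable
    note m1 = sm[of "\<lambda>c. ennreal (N ((1 / w2 c) *\<^sub>R D c) powr r)"]
    show ?thesis using m1 m2 pmm by (simp add: nn_integral_add nn_integral_cmult)
  qed
  finally have main: "bary_transport N r \<nu>1 \<nu>2 \<le> ennreal ((1 - e) powr (1 - r)) * (\<integral>\<^sup>+x. ennreal (N ((1 / w2 (\<phi> x)) *\<^sub>R D (\<phi> x)) powr r) \<partial>\<nu>2)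
      + ennreal ?K * ((\<integral>\<^sup>+x. ennreal (N (x - \<phi> x) powr r) \<partial>\<nu>2) + (\<integral>\<^sup>+x. \<integral>\<^sup>+y. ennreal (N (y - \<phi> y) powr r) \<partial>p x \<partial>\<nu>2))" .
  \<comment> \<open>The targets are distributed according to \<open>\<nu>1\<close>, hence their
    rounding error is the one measured under \<open>\<nu>1\<close>.\<close>
  have t1: "(\<integral>\<^sup>+x. \<integral>\<^sup>+y. ennreal (N (y - \<phi> y) powr r) \<partial>p x \<partial>\<nu>2) \<le> ennreal \<theta>"
  proof -
    have "(\<integral>\<^sup>+y. ennreal (N (y - \<phi> y) powr r) \<partial>(\<nu>2 \<bind> p)) = (\<integral>\<^sup>+x. \<integral>\<^sup>+y. ennreal (N (y - \<phi> y) powr r) \<partial>p x \<partial>\<nu>2)"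
      by (rule kernel_nn_integral[OF pm]) measurable
    then show ?thesis using \<theta>(2) by (simp add: pb)
  qed
  have t2: "(\<integral>\<^sup>+x. ennreal (N ((1 / w2 (\<phi> x)) *\<^sub>R D (\<phi> x)) powr r) \<partial>\<nu>2) \<le> ennreal B"
  proof -
    have "(\<integral>\<^sup>+x. ennreal (N ((1 / w2 (\<phi> x)) *\<^sub>R D (\<phi> x)) powr r) \<partial>\<nu>2)
        = (\<Sum>c\<in>?I. ennreal (N ((1 / w2 c) *\<^sub>R D c) powr r) * ennreal (w2 c))" by (rule fr2)
    also have "\<dots> = (\<Sum>c\<in>?I. ennreal (row_cost (w2 c) (D c)))"
      using w by (intro sum.cong refl) (simp add: row_cost_def ennreal_mult mult.commute)
    also have "\<dots> = ennreal (\<Sum>c\<in>?I. row_cost (w2 c) (D c))"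
      using w by (intro sum_ennreal) (simp add: row_cost_def)
    also have "\<dots> \<le> ennreal B" using B by (intro ennreal_leI) (simp add: w2_def D_def)
    finally show ?thesis .
  qed
  have "0 \<le> (\<Sum>c\<in>?I. row_cost (w2 c) (D c))" using w by (intro sum_nonneg) (simp add: row_cost_def)
  then have B0: "B \<ge> 0" using B by (simp add: w2_def D_def)
  have "bary_transport N r \<nu>1 \<nu>2 \<le> ennreal ((1 - e) powr (1 - r)) * ennreal B + ennreal ?K * (ennreal \<theta> + ennreal \<theta>)"
    using t1 t2 \<theta>(3) by (intro order_trans[OF main] add_mono mult_left_mono) auto
  also have "ennreal \<theta> + ennreal \<theta> = ennreal (2 * \<theta>)" using \<theta>(1) by (subst ennreal_plus[symmetric]) auto
  also have "ennreal ((1 - e) powr (1 - r)) * ennreal B + ennreal ?K * ennreal (2 * \<theta>)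
      = ennreal ((1 - e) powr (1 - r) * B + ?K * (2 * \<theta>))"
    using B0 \<theta>(1) by (subst ennreal_plus) (simp_all only: ennreal_mult mult_nonneg_nonneg powr_ge_zero zero_le_numeral)
  finally show ?thesis .
qed

end

section \<open>From concentration to transport inequalities\<close>

text \<open>Summation over the unit intervals of values of \<open>W\<close>. The factor
  \<open>2\<close> in the exponent leaves half of the decay rate, so that the levels form a
  geometric series with ratio \<open>exp (- 1 / (2 * a))\<close>.\<close>

lemma exp_moment_of_tail:
  assumes "prob_space \<mu>" and W[measurable]: "W \<in> borel_measurable \<mu>" and a: "a > 0"
    and tail: "\<And>u. u \<ge> 0 \<Longrightarrow> measure \<mu> {y \<in> space \<mu>. u < W y} \<le> b * exp (- u / a)"
  shows "(\<integral>\<^sup>+y. ennreal (exp (W y / (2 * a))) \<partial>\<mu>) < \<infinity>"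
proof -
  interpret prob_space \<mu> by fact
  define c where "c = 1 / (2 * a)"
  have c: "c > 0" using a by (simp add: c_def)
  have b: "b \<ge> 0" using order_trans[OF measure_nonneg tail[of 0]] by simp
  let ?S = "\<lambda>k::nat. {y \<in> space \<mu>. real k + 1 < W y}"
  have le_suminf: "F k \<le> (\<Sum>k. F k)" for F :: "nat \<Rightarrow> ennreal" and k
    using sum_le_suminf[of F "{k}"] by simp
  have pw: "ennreal (exp (c * W y)) \<le> ennreal (exp c) + (\<Sum>k. ennreal (exp (c * (real k + 2))) * indicator (?S k) y)"
    if y: "y \<in> space \<mu>" for y
  proof (cases "W y \<le> 1")
    case True
    then have "ennreal (exp (c * W y)) \<le> ennreal (exp c)" using c by (intro ennreal_leI) simp
    then show ?thesis by (rule order_trans) simp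
  next
    case False
    \<comment> \<open>\<open>k\<close> is the index with \<open>k + 1 < W y \<le> k + 2\<close>;
      values up to \<open>1\<close> are covered by the constant term.\<close>
    define k where "k = nat (\<lceil>W y\<rceil> - 2)"
    have k: "real k + 1 < W y" "W y \<le> real k + 2" using False unfolding k_def by linarith+
    have "ennreal (exp (c * W y)) \<le> ennreal (exp (c * (real k + 2))) * indicator (?S k) y"
      using k c y by (auto intro!: ennreal_leI)
    also have "\<dots> \<le> (\<Sum>k. ennreal (exp (c * (real k + 2))) * indicator (?S k) y)"
      by (rule le_suminf)
    finally show ?thesis by (rule order_trans) simp
  qed
  have level: "ennreal (exp (c * (real k + 2))) * emeasure \<mu> (?S k) \<le> ennreal (b * exp (- c) ^ k)" for k
  proof -
    have "exp (c * (real k + 2)) * measure \<mu> (?S k) \<le> exp (c * (real k + 2)) * (b * exp (- (real k + 1) / a))"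
      by (intro mult_left_mono tail) auto
    also have "\<dots> = b * exp (c * (real k + 2) + - (real k + 1) / a)" by (simp only: exp_add mult_ac)
    also have "c * (real k + 2) + - (real k + 1) / a = - c * real k" using a by (simp add: c_def field_simps)
    also have "exp (- c * real k) = exp (- c) ^ k" by (rule exp_of_nat2_mult)
    finally show ?thesis unfolding emeasure_eq_measure by (simp add: ennreal_leI flip: ennreal_mult)
  qed
  have "(\<integral>\<^sup>+y. ennreal (exp (c * W y)) \<partial>\<mu>) \<le> (\<integral>\<^sup>+y. ennreal (exp c) + (\<Sum>k. ennreal (exp (c * (real k + 2))) * indicator (?S k) y) \<partial>\<mu>)"
    by (intro nn_integral_mono pw)
  also have "\<dots> = ennreal (exp c) + (\<Sum>k. ennreal (exp (c * (real k + 2))) * emeasure \<mu> (?S k))"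
    by (subst nn_integral_add) (auto simp: nn_integral_suminf nn_integral_cmult_indicator emeasure_space_1)
  also have "\<dots> \<le> ennreal (exp c) + (\<Sum>k. ennreal (b * exp (- c) ^ k))"
    by (intro add_left_mono suminf_le level) auto
  also have "\<dots> < \<infinity>"
  proof -
    have "summable (\<lambda>k. b * exp (- c) ^ k)" using c by (intro summable_mult summable_geometric) simp
    then have "(\<Sum>k. ennreal (b * exp (- c) ^ k)) = ennreal (\<Sum>k. b * exp (- c) ^ k)"
      using b by (intro suminf_ennreal2) auto
    then show ?thesis by simp
  qed
  finally show ?thesis by (simp add: c_def)
qed

text \<open>The variational inequality bounds the mean of each truncation of \<open>W\<close> under
  \<nu> by the entropy plus the logarithm of the exponential moment, independently of the truncation
  level; monotone convergence concludes.\<close>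

lemma integrable_of_exp_moment:
  assumes \<mu>: "prob_space \<mu>" and \<nu>: "prob_space \<nu>" "sets \<nu> = sets \<mu>" "rel_entropy \<nu> \<mu> < \<infinity>"
    and W[measurable]: "W \<in> borel_measurable \<mu>" "\<And>y. 0 \<le> W y"
    and fin: "(\<integral>\<^sup>+y. ennreal (exp (W y)) \<partial>\<mu>) < \<infinity>"
  shows "integrable \<nu> W"
proof -
  interpret prob_space \<mu> by fact
  interpret \<nu>: prob_space \<nu> by fact
  note [measurable_cong] = \<nu>(2)
  have int: "integrable \<mu> (\<lambda>y. exp (W y))" using fin by (intro integrableI_bounded) auto
  define B where "B = enn2real (rel_entropy \<nu> \<mu>) + ln (\<integral>y. exp (W y) \<partial>\<mu>)"
  have "(\<integral>\<^sup>+y. ennreal (min (W y) (real k)) \<partial>\<nu>) \<le> ennreal B" for k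
  proof -
    let ?f = "\<lambda>y. min (W y) (real k)"
    have fb: "\<bar>?f y\<bar> \<le> real k" for y using W(2)[of y] by simp
    have intf: "integrable \<nu> ?f" using fb by (intro \<nu>.integrable_const_bound[of _ "real k"]) auto
    have inte: "integrable \<mu> (\<lambda>y. exp (?f y))" by (intro integrable_const_bound[of _ "exp (real k)"]) auto
    have "(\<integral>y. 1 \<partial>\<mu>) \<le> (\<integral>y. exp (?f y) \<partial>\<mu>)" using inte W(2) by (intro integral_mono) auto
    moreover have "(\<integral>y. exp (?f y) \<partial>\<mu>) \<le> (\<integral>y. exp (W y) \<partial>\<mu>)" using inte int by (intro integral_mono) auto
    ultimately have "ln (\<integral>y. exp (?f y) \<partial>\<mu>) \<le> ln (\<integral>y. exp (W y) \<partial>\<mu>)" by (intro ln_mono) (auto simp: prob_space)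
    moreover have "(\<integral>y. ?f y \<partial>\<nu>) \<le> enn2real (rel_entropy \<nu> \<mu>) + ln (\<integral>y. exp (?f y) \<partial>\<mu>)"
      using fb by (intro Donsker_Varadhan[OF \<mu> \<nu>]) auto
    ultimately have "(\<integral>y. ?f y \<partial>\<nu>) \<le> B" by (simp add: B_def)
    then show ?thesis using intf W(2) by (subst nn_integral_eq_integral) (auto intro: ennreal_leI)
  qed
  then have "(SUP k. \<integral>\<^sup>+y. ennreal (min (W y) (real k)) \<partial>\<nu>) \<le> ennreal B" by (intro SUP_least)
  also have "(SUP k. \<integral>\<^sup>+y. ennreal (min (W y) (real k)) \<partial>\<nu>) = (\<integral>\<^sup>+y. (SUP k. ennreal (min (W y) (real k))) \<partial>\<nu>)"
    by (rule nn_integral_monotone_convergence_SUP[symmetric]) (auto simp: incseq_def le_fun_def intro!: ennreal_leI)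
  finally have le: "(\<integral>\<^sup>+y. (SUP k. ennreal (min (W y) (real k))) \<partial>\<nu>) \<le> ennreal B" .
  have "ennreal (W y) \<le> (SUP k. ennreal (min (W y) (real k)))" for y
  proof -
    obtain k where "W y \<le> real k" using real_arch_simple by blast
    then show ?thesis by (intro SUP_upper2[of k]) auto
  qed
  then have "(\<integral>\<^sup>+y. ennreal (W y) \<partial>\<nu>) \<le> ennreal B" by (intro order_trans[OF nn_integral_mono le])
  then show ?thesis using W(2) by (intro integrableI_nonneg) (auto simp: top_unique less_top[symmetric])
qed

lemma le_ennreal_limit:
  assumes "\<forall>\<^sub>F x in at_right 0. X \<le> ennreal (f x)" "(f \<longlongrightarrow> L) (at_right (0::real))"
  shows "X \<le> ennreal L"
  by (rule tendsto_lowerbound[OF tendsto_ennrealI[OF assms(2)] assms(1)]) simp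

section \<open>Moments under finite entropy and the limit of many coordinates\<close>

context norm_power_prob
begin

text \<open>(2) for a single coordinate and the function \<open>N\<close>; \<open>R\<close> is a
  median of it.\<close>

lemma lipschitz_imp_tail:
  assumes lc: "lipschitz_concentration N r \<mu> a b"
  shows "\<exists>R. \<forall>t\<ge>0. measure \<mu> {y. R + t < N y} \<le> b * exp (- (t powr r) / a)"
proof -
  interpret \<mu>: prob_space \<mu> by (rule prob)
  interpret P1: prob_space "P 1" by (rule prob_P)
  let ?f = "\<lambda>x. N (x 0)"
  have fm: "?f \<in> borel_measurable (P 1)" by (rule measurable_compose[OF measurable_coord]) auto
  have pr: "measure (P 1) {x \<in> tuples 1. Q (x 0)} = measure \<mu> {y. Q y}" if Q: "{y. Q y} \<in> sets borel" for Q
  proof -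
    have "measure \<mu> {y. Q y} = measure (distr (P 1) \<mu> (\<lambda>x. x 0)) {y. Q y}"
      using prob by (subst distr_PiM_component) auto
    also have "\<dots> = measure (P 1) ((\<lambda>x. x 0) -` {y. Q y} \<inter> space (P 1))"
      using Q sets_borel by (intro measure_distr measurable_component_singleton) auto
    also have "(\<lambda>x. x 0) -` {y. Q y} \<inter> space (P 1) = {x \<in> tuples 1. Q (x 0)}" by auto
    finally show ?thesis by simp
  qed
  have "(\<lambda>k. measure \<mu> {y. N y \<le> real k}) \<longlonglongrightarrow> measure \<mu> (\<Union>k. {y. N y \<le> real k})"
    by (intro \<mu>.finite_Lim_measure_incseq) (auto simp: incseq_def sets_borel)
  also have "(\<Union>k. {y. N y \<le> real k}) = space \<mu>" using real_arch_simple by auto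
  finally have "\<forall>\<^sub>F k in sequentially. 1 / 2 < measure \<mu> {y. N y \<le> real k}"
    by (intro order_tendstoD) (auto simp: \<mu>.prob_space simp del: space_\<mu>)
  then obtain k where k: "1 / 2 < measure \<mu> {y. N y \<le> real k}"
    using eventually_happens'[OF sequentially_bot] by blast
  have "P1.prob {x \<in> space (P 1). ?f x \<le> real k} \<ge> 1 / 2"
    unfolding space_P using k by (subst pr) auto
  then obtain R where R: "is_median (P 1) ?f R" using P1.exists_median_le[OF fm] by blast
  have conv: "convex_on (tuples 1) ?f"
    using convex_on_N by (auto simp: convex_on_def)
  have "measure (P 1) {x \<in> tuples 1. R + t < ?f x} \<le> b * exp (- (t powr r) / a)" if "t \<ge> 0" for t
  proof (rule lipschitz_concentrationD[OF lc _ that _ _ R])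
    fix x y :: "nat \<Rightarrow> real^'m"
    show "\<bar>?f x - ?f y\<bar> \<le> tuple_norm N r 1 (x - y)"
      using N_triangle_abs[of "x 0" "y 0"] N_le_tuple_norm[of 0 1 "x - y"] by simp
  qed (use conv in auto)
  moreover have "measure (P 1) {x \<in> tuples 1. R + t < N (x 0)} = measure \<mu> {y. R + t < N y}" for t
    by (rule pr) measurable
  ultimately show ?thesis by (intro exI[of _ R] allI impI) simp
qed

text \<open>Supplies the moments of order \<open>r\<close> that \<open>simple_approximation\<close>
  requires. By the tail of \<open>N\<close> under \<mu>, the power \<open>r\<close> of the excess of
  \<open>N\<close> over a median has an exponential moment, and finite entropy carries integrability
  over to \<nu>; adding the median back costs a constant.\<close>

lemma integrable_N_powr:
  assumes lc: "lipschitz_concentration N r \<mu> a b" and a: "a > 0"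
    and \<nu>: "prob_space \<nu>" "sets \<nu> = sets borel" "rel_entropy \<nu> \<mu> < \<infinity>"
  shows "integrable \<nu> (\<lambda>y. N y powr r)"
proof -
  note [measurable_cong] = \<nu>(2)
  obtain R where R: "\<And>t. t \<ge> 0 \<Longrightarrow> measure \<mu> {y. R + t < N y} \<le> b * exp (- (t powr r) / a)"
    using lipschitz_imp_tail[OF lc] by blast
  let ?W = "\<lambda>y. max 0 (N y - R) powr r"
  have "(\<integral>\<^sup>+y. ennreal (exp (?W y / (2 * a))) \<partial>\<mu>) < \<infinity>"
  proof (rule exp_moment_of_tail[OF prob _ a])
    fix u :: real assume u: "u \<ge> 0"
    have "{y \<in> space \<mu>. u < ?W y} \<subseteq> {y. R + u powr (1 / r) < N y}"
    proof safe
      fix y assume y: "u < ?W y"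
      have "u powr (1 / r) < ?W y powr (1 / r)" using u y r by (intro powr_less_mono2) auto
      also have "\<dots> = max 0 (N y - R)" using r by (simp add: powr_powr)
      finally show "R + u powr (1 / r) < N y" using powr_ge_zero[of u "1 / r"] by linarith
    qed
    then have "measure \<mu> {y \<in> space \<mu>. u < ?W y} \<le> measure \<mu> {y. R + u powr (1 / r) < N y}"
      by (intro finite_measure.finite_measure_mono prob_space.finite_measure prob) (auto simp: sets_borel)
    also have "\<dots> \<le> b * exp (- u / a)" using R[of "u powr (1 / r)"] u r by (simp add: powr_powr)
    finally show "measure \<mu> {y \<in> space \<mu>. u < ?W y} \<le> b * exp (- u / a)" .
  qed measurable
  then have "integrable \<nu> (\<lambda>y. ?W y / (2 * a))"
    using a \<nu> sets_borel by (intro integrable_of_exp_moment[OF prob]) auto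
  from integrable_mult_right[OF this, of "2 * a"] have int: "integrable \<nu> ?W" using a by simp
  interpret \<nu>: prob_space \<nu> by fact
  have bd: "N y powr r \<le> (1 / 2) powr (1 - r) * (?W y + \<bar>R\<bar> powr r)" for y
  proof -
    have "N y powr r \<le> (max 0 (N y - R) + \<bar>R\<bar>) powr r" using r by (intro powr_mono2) auto
    also have "\<dots> \<le> (1 / 2) powr (1 - r) * (?W y + \<bar>R\<bar> powr r)"
      using powr_add_le_weighted[OF r, of "max 0 (N y - R)" "\<bar>R\<bar>" "1 / 2"] by (simp add: algebra_simps)
    finally show ?thesis .
  qed
  show ?thesis
  proof (rule Bochner_Integration.integrable_bound)
    show "integrable \<nu> (\<lambda>y. (1 / 2) powr (1 - r) * (?W y + \<bar>R\<bar> powr r))" using int by simp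
    show "AE y in \<nu>. norm (N y powr r) \<le> norm ((1 / 2) powr (1 - r) * (?W y + \<bar>R\<bar> powr r))"
      using bd by (auto intro!: AE_I2 order_trans[OF bd])
  qed measurable
qed

text \<open>If no typical tuple for \<open>\<nu>2\<close> lay in the enlargement of the typical set
  for \<open>\<nu>1\<close> with parameter \<open>n * \<tau>\<close>, (3) would make a product of
  powers of their measures smaller than \<open>b * exp (- n * \<tau> / a)\<close>. The entropy
  bounds keep both measures from being that small: the hypothesis on \<tau> leaves a gap
  \<open>g\<close> per coordinate, against which the remaining constants, \<open>ln b\<close> among
  them, lose for large \<open>n\<close>.\<close>

lemma typical_points_close:
  assumes ts: "two_set_at a b s" and a: "a > 0" and b: "b > 0" and s: "0 < s" "s < 1"
    and \<nu>1: "prob_space \<nu>1" "sets \<nu>1 = sets borel" "rel_entropy \<nu>1 \<mu> < \<infinity>"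
    and \<nu>2: "prob_space \<nu>2" "sets \<nu>2 = sets borel" "rel_entropy \<nu>2 \<mu> < \<infinity>"
    and \<phi>: "\<phi> \<in> borel_measurable borel" "finite (range \<phi>)"
    and \<theta>: "0 < \<theta>" "\<theta> < 1 / 4"
      "(\<integral>\<^sup>+y. ennreal (N (y - \<phi> y) powr r) \<partial>\<nu>1) \<le> ennreal (\<theta>\<^sup>2)" "(\<integral>\<^sup>+y. ennreal (N (y - \<phi> y) powr r) \<partial>\<nu>2) \<le> ennreal (\<theta>\<^sup>2)"
    and d: "d > 0"
    and \<tau>: "(enn2real (rel_entropy \<nu>2 \<mu>) / (1 - s) powr (r - 1) + enn2real (rel_entropy \<nu>1 \<mu>) / s powr (r - 1)) / (1 - 2 * \<theta>) < \<tau> / a"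
  shows "\<exists>n x p. n \<ge> 1 \<and> x \<in> typical \<phi> \<nu>2 d \<theta> n \<and> p \<in> P1_tuples n \<and> emeasure p (typical \<phi> \<nu>1 d \<theta> n) = 1 \<and>
    (\<Sum>i<n. N (x i - (\<integral>y. y i \<partial>p)) powr r) \<le> real n * (\<tau> + \<theta>)"
proof -
  define \<alpha> \<beta> where "\<alpha> = 1 / (1 - s) powr (r - 1)" and "\<beta> = 1 / s powr (r - 1)"
  define h1 h2 where "h1 = enn2real (rel_entropy \<nu>1 \<mu>)" and "h2 = enn2real (rel_entropy \<nu>2 \<mu>)"
  have pos: "\<alpha> > 0" "\<beta> > 0" "h1 \<ge> 0" "h2 \<ge> 0" using s by (auto simp: \<alpha>_def \<beta>_def h1_def h2_def)
  define g where "g = \<tau> / a - (\<alpha> * h2 + \<beta> * h1) / (1 - 2 * \<theta>)"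
  have g: "g > 0" using \<tau> by (simp add: g_def \<alpha>_def \<beta>_def h1_def h2_def)
  have "0 \<le> (\<alpha> * h2 + \<beta> * h1) / (1 - 2 * \<theta>)" using pos \<theta> by simp
  then have "\<tau> / a > 0" using g by (simp add: g_def)
  then have \<tau>0: "\<tau> > 0" using a by (simp add: zero_less_divide_iff)
  \<comment> \<open>Everything in the comparison that does not grow with \<open>n\<close>: the
    factor \<open>b\<close> and the terms \<open>ln 2\<close> of the two entropy bounds.\<close>
  let ?K = "\<bar>ln b\<bar> + (\<alpha> + \<beta>) * ln 2 / (1 - 2 * \<theta>)"
  obtain n1 where n1: "\<And>n. n \<ge> n1 \<Longrightarrow> 1 - 2 * \<theta> \<le> measure (power_measure \<nu>1 n) (typical \<phi> \<nu>1 d \<theta> n)"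
    using typical_probability[OF \<nu>1(1,2) \<phi> \<theta>(1,3) d] by blast
  obtain n2 where n2: "\<And>n. n \<ge> n2 \<Longrightarrow> 1 - 2 * \<theta> \<le> measure (power_measure \<nu>2 n) (typical \<phi> \<nu>2 d \<theta> n)"
    using typical_probability[OF \<nu>2(1,2) \<phi> \<theta>(1,4) d] by blast
  obtain n3 :: nat where n3: "?K / g < real n3" using reals_Archimedean2 by blast
  define n where "n = max 1 (max n1 (max n2 n3))"
  have n: "n \<ge> 1" "n \<ge> n1" "n \<ge> n2" "real n \<ge> real n3" by (auto simp: n_def)
  interpret Pn: prob_space "P n" by (rule prob_P)
  let ?T1 = "typical \<phi> \<nu>1 d \<theta> n" and ?T2 = "typical \<phi> \<nu>2 d \<theta> n"
  have m: "?T1 \<in> sets (tuple_borel n)" "?T2 \<in> sets (tuple_borel n)" by (intro typical_measurable \<phi>)+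
  have lb: "Pn.prob T > 0 \<and> (1 - 2 * \<theta>) * ln (1 / Pn.prob T) \<le> real n * enn2real (rel_entropy \<nu> \<mu>) + ln 2"
    if "prob_space \<nu>" "sets \<nu> = sets borel" "rel_entropy \<nu> \<mu> < \<infinity>" "T \<in> sets (tuple_borel n)"
      "1 - 2 * \<theta> \<le> measure (power_measure \<nu> n) T" for \<nu> T
  proof -
    have p: "measure (power_measure \<nu> n) T > 0" using that(5) \<theta> by linarith
    note lb = entropy_lower_bound[OF that(1-4) p]
    have "ln (1 / Pn.prob T) \<ge> 0" using lb(1) by simp
    then have "(1 - 2 * \<theta>) * ln (1 / Pn.prob T) \<le> measure (power_measure \<nu> n) T * ln (1 / Pn.prob T)"
      using that(5) by (intro mult_right_mono)
    then show ?thesis using lb by linarith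
  qed
  define q1 q2 where "q1 = Pn.prob ?T1" and "q2 = Pn.prob ?T2"
  have q: "q1 > 0" "(1 - 2 * \<theta>) * ln (1 / q1) \<le> real n * h1 + ln 2" "q2 > 0" "(1 - 2 * \<theta>) * ln (1 / q2) \<le> real n * h2 + ln 2"
    using lb[OF \<nu>1 m(1) n1[OF n(2)]] lb[OF \<nu>2 m(2) n2[OF n(3)]] by (simp_all add: q1_def q2_def h1_def h2_def)
  have ne: "?T1 \<noteq> {}" using q(1) by (auto simp: q1_def)
  have nt: "real n * \<tau> \<ge> 0" using \<tau>0 by simp
  have "\<not> ?T2 \<subseteq> tuples n - cost_enlarge N r n ?T1 (real n * \<tau>)"
  proof
    assume sub: "?T2 \<subseteq> tuples n - cost_enlarge N r n ?T1 (real n * \<tau>)"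
    have "tuples n - cost_enlarge N r n ?T1 (real n * \<tau>) \<in> sets (P n)"
      unfolding compl_cost_enlarge[OF m(1) ne nt] by (rule sets_tdist) (rule hull_closure(4)[OF m(1) ne])
    from Pn.finite_measure_mono[OF sub this]
    have "q2 powr \<alpha> * q1 powr \<beta> \<le> Pn.prob (tuples n - cost_enlarge N r n ?T1 (real n * \<tau>)) powr \<alpha> * q1 powr \<beta>"
      using pos by (intro mult_right_mono powr_mono2) (auto simp: q2_def)
    also have "\<dots> \<le> b * exp (- (real n * \<tau>) / a)"
      using two_set_atD[OF ts n(1) m(1) nt] by (simp add: q1_def \<alpha>_def \<beta>_def)
    finally have "ln (q2 powr \<alpha> * q1 powr \<beta>) \<le> ln (b * exp (- (real n * \<tau>) / a))"
      using q b by (subst ln_le_cancel_iff) auto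
    then have 1: "\<alpha> * ln q2 + \<beta> * ln q1 \<le> ln b - real n * \<tau> / a"
      using q b by (simp add: ln_mult ln_powr)
    have "ln (1 / q2) \<le> (real n * h2 + ln 2) / (1 - 2 * \<theta>)" "ln (1 / q1) \<le> (real n * h1 + ln 2) / (1 - 2 * \<theta>)"
      using q \<theta> by (simp_all add: pos_le_divide_eq mult.commute)
    then have "\<alpha> * ln (1 / q2) + \<beta> * ln (1 / q1) \<le> \<alpha> * ((real n * h2 + ln 2) / (1 - 2 * \<theta>)) + \<beta> * ((real n * h1 + ln 2) / (1 - 2 * \<theta>))"
      using pos by (intro add_mono mult_left_mono) auto
    also have "\<dots> = real n * ((\<alpha> * h2 + \<beta> * h1) / (1 - 2 * \<theta>)) + (\<alpha> + \<beta>) * ln 2 / (1 - 2 * \<theta>)"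
      by (simp add: field_simps flip: add_divide_distrib)
    finally have "real n * g \<le> ?K" using 1 q by (simp add: g_def ln_div algebra_simps)
    moreover have "?K < real n * g" using n3 n(4) g by (simp add: pos_divide_less_eq) (metis mult_right_mono order.strict_trans2 less_imp_le of_nat_le_iff)
    ultimately show False by simp
  qed
  then obtain x where x: "x \<in> ?T2" "x \<in> cost_enlarge N r n ?T1 (real n * \<tau>)"
    using sets.sets_into_space[OF m(2)] by auto
  have "set_cost N r n ?T1 x \<le> ennreal (real n * \<tau>)" using x(2) by (simp add: cost_enlarge_def)
  also have "\<dots> < ennreal (real n * (\<tau> + \<theta>))"
    using n(1) \<theta> \<tau>0 by (intro ennreal_lessI mult_pos_pos mult_strict_left_mono add_pos_pos) auto
  finally obtain p where p: "p \<in> P1_tuples n" "emeasure p ?T1 = 1"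
    "ennreal (\<Sum>i<n. bary_cost N r (x i) (distr p borel (\<lambda>y. y i))) < ennreal (real n * (\<tau> + \<theta>))"
    unfolding set_cost_def INF_less_iff by blast
  have "(\<Sum>i<n. bary_cost N r (x i) (distr p borel (\<lambda>y. y i))) \<le> real n * (\<tau> + \<theta>)"
    using p(3) by (subst (asm) ennreal_less_iff) (auto simp: bary_cost_def intro!: sum_nonneg)
  then have "(\<Sum>i<n. N (x i - (\<integral>y. y i \<partial>p)) powr r) \<le> real n * (\<tau> + \<theta>)"
    using bary_cost_marginal[OF p(1)] by simp
  then show ?thesis using n(1) x(1) p(1,2) by blast
qed

text \<open>The order of the limits matters. The discretization \<phi> depends on \<theta> and stays
  fixed while \<open>d\<close> tends to \<open>0\<close>, which is where \<open>n\<close> grows.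
  Then \<theta> tends to \<open>0\<close> with \<open>e\<close> fixed, which removes the rounding
  errors despite their large factor in \<open>e\<close>; then \<open>e\<close> tends to
  \<open>0\<close>, which restores the coefficient \<open>1\<close>; finally \<tau> decreases to
  \<open>a * h\<close>.\<close>

lemma two_set_at_imp_bary_transport_le:
  assumes ts: "two_set_at a b s" and a: "a > 0" and b: "b > 0" and s: "0 < s" "s < 1"
    and \<nu>: "\<nu>1 \<in> P1" "\<nu>2 \<in> P1" and H: "rel_entropy \<nu>1 \<mu> < \<infinity>" "rel_entropy \<nu>2 \<mu> < \<infinity>"
    and int: "integrable \<nu>1 (\<lambda>y. N y powr r)" "integrable \<nu>2 (\<lambda>y. N y powr r)"
  shows "bary_transport N r \<nu>1 \<nu>2 \<le>
    ennreal (a * (enn2real (rel_entropy \<nu>2 \<mu>) / (1 - s) powr (r - 1) + enn2real (rel_entropy \<nu>1 \<mu>) / s powr (r - 1)))"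
proof -
  note \<nu>1D = P1D[OF \<nu>(1)] and \<nu>2D = P1D[OF \<nu>(2)]
  define h where "h = enn2real (rel_entropy \<nu>2 \<mu>) / (1 - s) powr (r - 1) + enn2real (rel_entropy \<nu>1 \<mu>) / s powr (r - 1)"
  let ?L = "\<lambda>e. e powr (1 - r) * 2 powr (r - 1)" and ?U = "\<lambda>e. (1 - e) powr (1 - r)"
  have step: "bary_transport N r \<nu>1 \<nu>2 \<le>
      ennreal (?U e * (?U e * (\<tau> + \<theta>) + ?L e * (2 * \<theta>)) + ?L e * (2 * \<theta>))"
    if e: "0 < e" "e < 1" and \<theta>: "0 < \<theta>" "\<theta> < 1 / 4" and \<tau>: "h / (1 - 2 * \<theta>) < \<tau> / a" for e \<theta> \<tau>
  proof -
    have "\<theta>\<^sup>2 > 0" using \<theta> by simp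
    from simple_approximation[OF \<nu>1D(1,2) \<nu>2D(1,2) int this]
    obtain \<phi> where \<phi>: "\<phi> \<in> borel_measurable borel" "finite (range \<phi>)"
      "(\<integral>\<^sup>+y. ennreal (N (y - \<phi> y) powr r) \<partial>\<nu>1) \<le> ennreal (\<theta>\<^sup>2)" "(\<integral>\<^sup>+y. ennreal (N (y - \<phi> y) powr r) \<partial>\<nu>2) \<le> ennreal (\<theta>\<^sup>2)"
      by blast
    have "\<theta>\<^sup>2 \<le> \<theta>" using \<theta> by (simp add: power2_eq_square mult_le_cancel_left1)
    then have le: "ennreal (\<theta>\<^sup>2) \<le> ennreal \<theta>" by (rule ennreal_leI)
    let ?B = "?U e * (\<tau> + \<theta>) + ?L e * (2 * \<theta>)"
    have "\<exists>M. coupling_matrix (range \<phi>) (\<lambda>c. measure \<nu>2 (\<phi> -` {c})) (\<lambda>c. measure \<nu>1 (\<phi> -` {c})) d ?B M"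
      if d: "d > 0" for d
    proof -
      obtain n x p where *: "n \<ge> 1" "x \<in> typical \<phi> \<nu>2 d \<theta> n" "p \<in> P1_tuples n" "emeasure p (typical \<phi> \<nu>1 d \<theta> n) = 1"
        "(\<Sum>i<n. N (x i - (\<integral>y. y i \<partial>p)) powr r) \<le> real n * (\<tau> + \<theta>)"
        using typical_points_close[OF ts a b s \<nu>1D(1,2) H(1) \<nu>2D(1,2) H(2) \<phi>(1,2) \<theta> \<phi>(3,4) d] \<tau> unfolding h_def by blast
      show ?thesis by (rule coupling_matrix_of_typical[OF \<phi>(1,2) *(1) e *(2-5)])
    qed
    then have "\<exists>M. (\<forall>c\<in>range \<phi>. \<forall>c'\<in>range \<phi>. 0 \<le> M c c') \<and>
      (\<forall>c\<in>range \<phi>. (\<Sum>c'\<in>range \<phi>. M c c') = measure \<nu>2 (\<phi> -` {c})) \<and>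
      (\<forall>c'\<in>range \<phi>. (\<Sum>c\<in>range \<phi>. M c c') = measure \<nu>1 (\<phi> -` {c'})) \<and>
      (\<Sum>c\<in>range \<phi>. row_cost (measure \<nu>2 (\<phi> -` {c})) (\<Sum>c'\<in>range \<phi>. M c c' *\<^sub>R (c - c'))) \<le> ?B"
      by (intro coupling_matrix_limit[OF \<phi>(2)]) auto
    then obtain M where M: "\<forall>c\<in>range \<phi>. \<forall>c'\<in>range \<phi>. 0 \<le> M c c'"
      "\<forall>c\<in>range \<phi>. (\<Sum>c'\<in>range \<phi>. M c c') = measure \<nu>2 (\<phi> -` {c})"
      "\<forall>c'\<in>range \<phi>. (\<Sum>c\<in>range \<phi>. M c c') = measure \<nu>1 (\<phi> -` {c'})"
      "(\<Sum>c\<in>range \<phi>. row_cost (measure \<nu>2 (\<phi> -` {c})) (\<Sum>c'\<in>range \<phi>. M c c' *\<^sub>R (c - c'))) \<le> ?B"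
      by blast
    show ?thesis
      using M(1-3) \<theta> \<phi>(3,4) le
      by (intro bary_transport_le_matrix[OF \<nu> \<phi>(1,2) e _ _ _ _ _ _ M(4)]) (auto intro: order_trans)
  qed
  have s1: "bary_transport N r \<nu>1 \<nu>2 \<le> ennreal (?U e * (?U e * \<tau>))"
    if e: "0 < e" "e < 1" and \<tau>: "h < \<tau> / a" for e \<tau>
  proof (rule le_ennreal_limit)
    have "((\<lambda>\<theta>. h / (1 - 2 * \<theta>)) \<longlongrightarrow> h / (1 - 2 * 0)) (at_right 0)" by (intro tendsto_intros) auto
    then have "\<forall>\<^sub>F \<theta> in at_right 0. h / (1 - 2 * \<theta>) < \<tau> / a" using \<tau> by (intro order_tendstoD(2)) auto
    moreover have "\<forall>\<^sub>F \<theta> in at_right 0. \<theta> \<in> {0<..<1/4::real}" by (rule eventually_at_right_real) simp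
    ultimately show "\<forall>\<^sub>F \<theta> in at_right 0. bary_transport N r \<nu>1 \<nu>2 \<le>
        ennreal (?U e * (?U e * (\<tau> + \<theta>) + ?L e * (2 * \<theta>)) + ?L e * (2 * \<theta>))"
      by eventually_elim (use step[OF e] in auto)
    have "((\<lambda>\<theta>. ?U e * (?U e * (\<tau> + \<theta>) + ?L e * (2 * \<theta>)) + ?L e * (2 * \<theta>)) \<longlongrightarrow>
        ?U e * (?U e * (\<tau> + 0) + ?L e * (2 * 0)) + ?L e * (2 * 0)) (at_right 0)" by (intro tendsto_intros)
    then show "((\<lambda>\<theta>. ?U e * (?U e * (\<tau> + \<theta>) + ?L e * (2 * \<theta>)) + ?L e * (2 * \<theta>)) \<longlongrightarrow> ?U e * (?U e * \<tau>)) (at_right 0)"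
      by simp
  qed
  have s2: "bary_transport N r \<nu>1 \<nu>2 \<le> ennreal \<tau>" if \<tau>: "h < \<tau> / a" for \<tau>
  proof (rule le_ennreal_limit)
    have "\<forall>\<^sub>F e in at_right 0. e \<in> {0<..<1::real}" by (rule eventually_at_right_real) simp
    then show "\<forall>\<^sub>F e in at_right 0. bary_transport N r \<nu>1 \<nu>2 \<le> ennreal (?U e * (?U e * \<tau>))"
      by eventually_elim (use s1[OF _ _ \<tau>] in auto)
    have "((\<lambda>e. ?U e * (?U e * \<tau>)) \<longlongrightarrow> ?U 0 * (?U 0 * \<tau>)) (at_right 0)" by (intro tendsto_intros) auto
    then show "((\<lambda>e. ?U e * (?U e * \<tau>)) \<longlongrightarrow> \<tau>) (at_right 0)" by simp
  qed
  have "bary_transport N r \<nu>1 \<nu>2 \<le> ennreal (a * h)"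
  proof (rule le_ennreal_limit)
    have "\<forall>\<^sub>F e in at_right 0. e \<in> {0<..<1::real}" by (rule eventually_at_right_real) simp
    then show "\<forall>\<^sub>F e in at_right 0. bary_transport N r \<nu>1 \<nu>2 \<le> ennreal (a * (h + e))"
      by eventually_elim (use s2 a in auto)
    have "((\<lambda>e. a * (h + e)) \<longlongrightarrow> a * (h + 0)) (at_right 0)" by (intro tendsto_intros)
    then show "((\<lambda>e. a * (h + e)) \<longlongrightarrow> a * h) (at_right 0)" by simp
  qed
  then show ?thesis by (simp add: h_def)
qed

text \<open>The concentration with the constants \<open>a'\<close> and \<open>b'\<close> provides
  the moments of order \<open>r\<close>; these constants do not enter the conclusion. An infinite
  entropy makes the right-hand side infinite.\<close>

lemma two_set_at_imp_T_ineq: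
  assumes ts: "two_set_at a b s" and a: "a > 0" and b: "b > 0" and s: "0 < s" "s < 1"
    and lc: "lipschitz_concentration N r \<mu> a' b'" and a': "a' > 0"
  shows "T_ineq N r \<mu> (a / s powr (r - 1)) (a / (1 - s) powr (r - 1))"
  unfolding T_ineq_def
proof (intro ballI)
  fix \<nu>1 \<nu>2 :: "(real^'m) measure" assume \<nu>: "\<nu>1 \<in> P1" "\<nu>2 \<in> P1"
  let ?c1 = "a / s powr (r - 1)" and ?c2 = "a / (1 - s) powr (r - 1)"
  have c: "?c1 > 0" "?c2 > 0" using a s by auto
  show "bary_transport N r \<nu>1 \<nu>2 \<le> ennreal ?c1 * rel_entropy \<nu>1 \<mu> + ennreal ?c2 * rel_entropy \<nu>2 \<mu>"
  proof (cases "rel_entropy \<nu>1 \<mu> < \<infinity> \<and> rel_entropy \<nu>2 \<mu> < \<infinity>")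
    case True
    then have H: "rel_entropy \<nu>1 \<mu> < \<infinity>" "rel_entropy \<nu>2 \<mu> < \<infinity>" by auto
    let ?h1 = "enn2real (rel_entropy \<nu>1 \<mu>)" and ?h2 = "enn2real (rel_entropy \<nu>2 \<mu>)"
    have "bary_transport N r \<nu>1 \<nu>2 \<le> ennreal (a * (?h2 / (1 - s) powr (r - 1) + ?h1 / s powr (r - 1)))"
      using P1D[OF \<nu>(1)] P1D[OF \<nu>(2)] H
      by (intro two_set_at_imp_bary_transport_le[OF ts a b s \<nu> H] integrable_N_powr[OF lc a']) auto
    also have "a * (?h2 / (1 - s) powr (r - 1) + ?h1 / s powr (r - 1)) = ?c1 * ?h1 + ?c2 * ?h2"
      by (simp add: algebra_simps)
    also have "ennreal \<dots> = ennreal ?c1 * ennreal ?h1 + ennreal ?c2 * ennreal ?h2"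
      using c[THEN less_imp_le] by (simp only: ennreal_plus ennreal_mult mult_nonneg_nonneg enn2real_nonneg)
    finally show ?thesis using H by simp
  next
    case False
    then have inf: "ennreal ?c1 * rel_entropy \<nu>1 \<mu> + ennreal ?c2 * rel_entropy \<nu>2 \<mu> = \<infinity>"
      using c by (auto simp: not_less top_unique ennreal_mult_top ennreal_mult_eq_top_iff)
    show ?thesis unfolding inf by simp
  qed
qed


lemma set_imp_two_set:
  assumes sc: "set_concentration N r \<mu> a b" and a: "a > 0" and b: "b > 0" and \<mu>: "\<mu> \<in> P1"
  shows "two_set_concentration N r \<mu> a b"
  unfolding two_set_iff
proof
  fix s :: real assume "s \<in> {0<..<1}"
  then have s: "0 < s" "s < 1" by auto
  let ?b = "max b (b powr (1 / (1 - s) powr (r - 1) + 1 / s powr (r - 1)))"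
  have ts: "two_set_at a ?b s" by (rule set_imp_two_set_at[OF sc a b s])
  show "two_set_at a b s"
  proof (cases "b \<le> 1")
    case True
    have "1 \<le> 1 / (1 - s) powr (r - 1) + 1 / s powr (r - 1)"
      using exponent_ge_1[of s] s by (simp add: add_increasing)
    \<comment> \<open>The exponents add up to at least \<open>1\<close>, so for
      \<open>b \<le> 1\<close> the power of \<open>b\<close> is absorbed by
      \<open>b\<close>.\<close>
    then have "?b = b" using powr_le_self[of b] b True by (intro max_absorb1) simp
    then show ?thesis using ts by simp
  next
    case False
    have "T_ineq N r \<mu> (a / s powr (r - 1)) (a / (1 - s) powr (r - 1))"
      using b by (intro two_set_at_imp_T_ineq[OF ts a _ s set_imp_lipschitz[OF sc] a]) simp
    then have "two_set_at a 1 s" by (rule T_ineq_imp_two_set_at[OF _ \<mu> a s])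
    moreover have "1 * exp (- t / a) \<le> b * exp (- t / a)" for t
      using False by (intro mult_right_mono) auto
    ultimately show ?thesis unfolding two_set_at_def by (blast intro: order_trans)
  qed
qed

lemma two_set_imp_T_family:
  assumes ts: "two_set_concentration N r \<mu> a b" and a: "a > 0" and b: "b > 0"
  shows "T_family N r \<mu> a"
  unfolding T_family_def
proof
  fix s :: real assume s: "s \<in> {0<..<1}"
  \<comment> \<open>The value \<open>1 / 2\<close> is arbitrary: the concentration it yields is used
    only to ensure finite moments of order \<open>r\<close>, so its constants do not matter.\<close>
  have "set_concentration N r \<mu> (a / (1 - 1 / 2) powr (r - 1))
      (b powr ((1 - 1 / 2) powr (r - 1)) * 2 powr ((1 - 1 / 2) powr (r - 1) / (1 / 2) powr (r - 1)))"
    by (rule two_set_imp_set[OF ts a b]) auto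
  note lc = set_imp_lipschitz[OF this]
  show "T_ineq N r \<mu> (a / s powr (r - 1)) (a / (1 - s) powr (r - 1))"
    by (rule two_set_at_imp_T_ineq[OF _ a b _ _ lc]) (use ts s a in \<open>auto simp: two_set_iff\<close>)
qed

lemma T_family_imp_two_set:
  assumes "T_family N r \<mu> a" "a > 0" "\<mu> \<in> P1"
  shows "two_set_concentration N r \<mu> a 1"
  unfolding two_set_iff
proof
  fix s :: real assume s: "s \<in> {0<..<1}"
  then have "T_ineq N r \<mu> (a / s powr (r - 1)) (a / (1 - s) powr (r - 1))"
    using assms(1) by (simp add: T_family_def)
  then show "two_set_at a 1 s" by (rule T_ineq_imp_two_set_at[OF _ assms(3,2)]) (use s in auto)
qed

end

theorem corollary5p11:
  fixes N :: "real ^ 'm \<Rightarrow> real" and r :: real and \<mu> :: "(real ^ 'm) measure"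
  assumes r: "r \<ge> 2" and N: "is_norm N" and \<mu>: "\<mu> \<in> P1"
  shows
    "(\<forall>n\<ge>1. \<forall>A\<in>sets (tuple_borel n). \<forall>t\<ge>0.
        cost_enlarge N r n A t = enlarge N r n (closure (convex hull A)) t) \<and>
     ((\<exists>a>0. \<exists>b>0. set_concentration N r \<mu> a b) \<longleftrightarrow> (\<exists>a>0. \<exists>b>0. lipschitz_concentration N r \<mu> a b)) \<and>
     ((\<exists>a>0. \<exists>b>0. lipschitz_concentration N r \<mu> a b) \<longleftrightarrow> (\<exists>a>0. \<exists>b>0. two_set_concentration N r \<mu> a b)) \<and>
     ((\<exists>a>0. \<exists>b>0. two_set_concentration N r \<mu> a b) \<longleftrightarrow> (\<exists>a>0. T_family N r \<mu> a)) \<and>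
     ((\<exists>a>0. T_family N r \<mu> a) \<longleftrightarrow> (\<exists>a>0. T_plus_minus N r \<mu> a)) \<and>
     (\<forall>a>0. \<forall>b>0. set_concentration N r \<mu> a b \<longleftrightarrow> lipschitz_concentration N r \<mu> a b) \<and>
     (\<forall>a>0. \<forall>b>0. two_set_concentration N r \<mu> a b \<longrightarrow> T_family N r \<mu> a) \<and>
     (\<forall>a>0. T_family N r \<mu> a \<longrightarrow> two_set_concentration N r \<mu> a 1) \<and>
     (\<forall>a>0. T_family N r \<mu> a \<longleftrightarrow> T_plus_minus N r \<mu> a) \<and>
     (\<forall>a>0. \<forall>b>0. set_concentration N r \<mu> a b \<longrightarrow> two_set_concentration N r \<mu> a b) \<and>
     (\<forall>a>0. \<forall>b>0. two_set_concentration N r \<mu> a b \<longrightarrow>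
        (\<forall>s\<in>{0<..<1}. set_concentration N r \<mu> (a / (1 - s) powr (r - 1))
           (b powr ((1 - s) powr (r - 1)) * 2 powr ((1 - s) powr (r - 1) / s powr (r - 1)))))"
proof -
  interpret norm_power_prob N r \<mu>
    using N r P1D(1,2)[OF \<mu>] by (intro norm_power_prob.intro norm_power.intro power_prob.intro) simp_all
  have sl: "set_concentration N r \<mu> a b \<longleftrightarrow> lipschitz_concentration N r \<mu> a b" if "a > 0" "b > 0" for a b
    by (rule iffI[OF set_imp_lipschitz lipschitz_imp_set[OF _ that]])
  have st: "two_set_concentration N r \<mu> a b" if "set_concentration N r \<mu> a b" "a > 0" "b > 0" for a b
    by (rule set_imp_two_set[OF that \<mu>])
  have tT: "T_family N r \<mu> a" if "two_set_concentration N r \<mu> a b" "a > 0" "b > 0" for a b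
    by (rule two_set_imp_T_family[OF that])
  have Tt: "two_set_concentration N r \<mu> a 1" if "T_family N r \<mu> a" "a > 0" for a
    by (rule T_family_imp_two_set[OF that \<mu>])
  have TT: "T_family N r \<mu> a \<longleftrightarrow> T_plus_minus N r \<mu> a" if "a > 0" for a
    by (rule T_family_iff[OF \<mu> that])
  have ts: "set_concentration N r \<mu> (a / (1 - s) powr (r - 1))
      (b powr ((1 - s) powr (r - 1)) * 2 powr ((1 - s) powr (r - 1) / s powr (r - 1)))"
    if "two_set_concentration N r \<mu> a b" "a > 0" "b > 0" "s \<in> {0<..<1}" for a b s
    using that by (intro two_set_imp_set) auto
  have exl: "\<exists>a>0. \<exists>b>0. lipschitz_concentration N r \<mu> a b" if "two_set_concentration N r \<mu> a b" "a > 0" "b > 0" for a b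
  proof (intro exI conjI)
    show "lipschitz_concentration N r \<mu> (a / (1 - 1 / 2) powr (r - 1))
        (b powr ((1 - 1 / 2) powr (r - 1)) * 2 powr ((1 - 1 / 2) powr (r - 1) / (1 / 2) powr (r - 1)))"
      by (rule set_imp_lipschitz[OF ts[OF that]]) simp
  qed (use that in auto)
  show ?thesis
  proof (intro conjI)
    show "\<forall>n\<ge>1. \<forall>A\<in>sets (tuple_borel n). \<forall>t\<ge>0.
        cost_enlarge N r n A t = enlarge N r n (closure (convex hull A)) t"
      using cost_enlarge_eq by blast
    show "(\<exists>a>0. \<exists>b>0. set_concentration N r \<mu> a b) \<longleftrightarrow> (\<exists>a>0. \<exists>b>0. lipschitz_concentration N r \<mu> a b)"
      using sl by blast
    show "(\<exists>a>0. \<exists>b>0. lipschitz_concentration N r \<mu> a b) \<longleftrightarrow> (\<exists>a>0. \<exists>b>0. two_set_concentration N r \<mu> a b)"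
      using sl st exl by blast
    show "(\<exists>a>0. \<exists>b>0. two_set_concentration N r \<mu> a b) \<longleftrightarrow> (\<exists>a>0. T_family N r \<mu> a)"
      using tT Tt zero_less_one by blast
    show "(\<exists>a>0. T_family N r \<mu> a) \<longleftrightarrow> (\<exists>a>0. T_plus_minus N r \<mu> a)"
      using TT by blast
    show "\<forall>a>0. \<forall>b>0. set_concentration N r \<mu> a b \<longleftrightarrow> lipschitz_concentration N r \<mu> a b"
      using sl by blast
    show "\<forall>a>0. \<forall>b>0. two_set_concentration N r \<mu> a b \<longrightarrow> T_family N r \<mu> a"
      using tT by blast
    show "\<forall>a>0. T_family N r \<mu> a \<longrightarrow> two_set_concentration N r \<mu> a 1"
      using Tt by blast
    show "\<forall>a>0. T_family N r \<mu> a \<longleftrightarrow> T_plus_minus N r \<mu> a"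
      using TT by blast
    show "\<forall>a>0. \<forall>b>0. set_concentration N r \<mu> a b \<longrightarrow> two_set_concentration N r \<mu> a b"
      using st by blast
    show "\<forall>a>0. \<forall>b>0. two_set_concentration N r \<mu> a b \<longrightarrow>
        (\<forall>s\<in>{0<..<1}. set_concentration N r \<mu> (a / (1 - s) powr (r - 1))
           (b powr ((1 - s) powr (r - 1)) * 2 powr ((1 - s) powr (r - 1) / s powr (r - 1))))"
      using ts by blast
  qed
qed

end
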